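(* Let $\mathrm F_1=\frac{\tanh(\sqrt\mu|D|)}{\sqrt\mu|D|}$. The water waves equations are consistent at order $O(\mu\epsilon)$ in the shallow water regime $\mathcal A$ with the system $$\begin{cases}\partial_t\zeta+\mathrm F_1\Delta\psi+\epsilon\,\mathrm F_1\nabla\cdot(\zeta\,\mathrm F_1\nabla\psi)=0,\\ \partial_t\psi+\zeta+\frac\epsilon2|\mathrm F_1\nabla\psi|^2=0.\end{cases}$$
   Context: Setting. $d\in\{1,2\}$; $\nabla,\Delta$ are the gradient and Laplacian in $X\in\mathbb{R}^d$. $\mu_{\max}>0$ is fixed. $H^s(\mathbb{R}^d)$ has norm $|f|_{H^s}=|\Lambda^sf|_2$, $\Lambda^s=(1-\Delta)^{s/2}$, $|\cdot|_2$ the $L^2(\mathbb{R}^d)$ norm; for $s\ge1$, $\dot H^s(\mathbb{R}^d)=\{f\in L^2_{\rm loc}:\nabla f\in H^{s-1}\}$. Fix $t_0$ with $d/2<t_0\le2$. Write $h=1+\epsilon\zeta$. Dirichlet-to-Neumann operator. Given $\zeta$ with $h\ge h_{\min}>0$ on $\mathbb{R}^d$, and $\psi$, let $\phi$ solve in $\mathcal S=\mathbb{R}^d\times(-1,0)$ $$\nabla^\mu\cdot P(\Sigma_t)\nabla^\mu\phi=0,\quad\phi|_{z=0}=\psi,\quad\partial_z\phi|_{z=-1}=0,$$ with $\nabla^\mu=(\sqrt\mu\nabla^T,\partial_z)^T$ and $P(\Sigma_t)=\begin{pmatrix}(1+\epsilon\zeta)I_d&-\sqrt\mu\,\epsilon(z+1)\nabla\zeta\\-\sqrt\mu\,\epsilon(z+1)\nabla\zeta^T&\frac{1+\mu\epsilon^2(z+1)^2|\nabla\zeta|^2}{1+\epsilon\zeta}\end{pmatrix}$.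 Set $\overline V=\frac1h\int_{-1}^0[h\nabla\phi-\epsilon(z+1)\nabla\zeta\,\partial_z\phi]\,dz$ and $\mathcal G^\mu\psi=-\mu\nabla\cdot(h\overline V)$. Water waves equations: $$\begin{cases}\partial_t\zeta-\frac1\mu\mathcal G^\mu\psi=0,\\ \partial_t\psi+\zeta+\frac\epsilon2|\nabla\psi|^2-\frac\epsilon\mu\frac{(\mathcal G^\mu\psi+\epsilon\mu\nabla\zeta\cdot\nabla\psi)^2}{2(1+\epsilon^2\mu|\nabla\zeta|^2)}=0.\end{cases}$$ Standing assumption (non-cavitation): there is $h_{\min}>0$ with $h(t,X)\ge h_{\min}$ for all $X$ (and all times considered). Fourier multipliers: $\widehat{\mathrm F(D)u}(\xi)=F(\xi)\widehat u(\xi)$, $|D|$ having symbol $|\xi|$; symbols are extended continuously at $\xi=0$. Constants. $C(\circ)$ denotes a positive finite constant depending only on $\circ$ (and on $s,d,t_0$), so on $\epsilon,\mu,\zeta,\psi$ only through $\circ$. $M_0=C(\tfrac1{h_{\min}},\mu_{\max},|\zeta|_{H^{t_0}})$, $M(s)=C(M_0,|\zeta|_{H^{\max(t_0+1,s)}})$, $N(s)=C(M(s),|\nabla\psi|_{H^s})$. Consistency. $\mathcal A\subset\{(\epsilon,\mu):0\le\epsilon\le1,\ 0<\mu\le\mu_{\max}\}$ is the shallow water regime. For a model of the form $\partial_t\zeta+\mathcal N^1(\zeta,\psi)=0$, $\partial_t\psi+\mathcal N^2(\zeta,\psi)=0$, the water waves equations are said to be consistent at order $O(\mu^k\epsilon^l)$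 with it in the regime $\mathcal A$ if there exist $n\in\mathbb N$ and $T>0$ such that for all $s\ge0$, all $(\epsilon,\mu)\in\mathcal A$ and every solution $(\zeta,\psi)\in C([0,\frac T\epsilon];H^{s+n}\times\dot H^{s+n+1})$ of the water waves equations one has $$\partial_t\zeta+\mathcal N^1(\zeta,\psi)=\mu^k\epsilon^lR_1,\qquad\partial_t\psi+\mathcal N^2(\zeta,\psi)=\mu^k\epsilon^lR_2,$$ with $|R_1|_{H^s},|R_2|_{H^s}\le N(s+n)$ on $[0,\frac T\epsilon]$ (read as $[0,\infty)$ if $\epsilon=0$). *)

theory Defs
  imports "HOL-Analysis.Analysis"
begin

text \<open>
  Functions on \<open>\<real>\<^sup>d\<close> are Borel functions on a Euclidean space; elements of \<open>L\<^sup>2\<close> and of the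
  Sobolev spaces are representatives, so that equations between them are stated almost everywhere.
  Operators that are only determined up to null sets (weak gradient, weak divergence, Fourier
  multipliers) return a representative chosen by \<open>SOME\<close>.
\<close>

subsection \<open>Square integrable functions and weak derivatives\<close>

definition in_L2 :: "('a::euclidean_space \<Rightarrow> 'b::euclidean_space) \<Rightarrow> bool" where
  "in_L2 f \<longleftrightarrow> f \<in> borel_measurable lborel \<and> integrable lborel (\<lambda>x. (norm (f x))\<^sup>2)"

definition L2_norm :: "('a::euclidean_space \<Rightarrow> 'b::euclidean_space) \<Rightarrow> real" where
  "L2_norm f = sqrt (LINT x|lborel. (norm (f x))\<^sup>2)"

definition in_L2loc :: "('a::euclidean_space \<Rightarrow> 'b::euclidean_space) \<Rightarrow> bool" where
  "in_L2loc f \<longleftrightarrow> f \<in> borel_measurable lborel \<and>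
     (\<forall>r. set_integrable lborel (cball 0 r) (\<lambda>x. (norm (f x))\<^sup>2))"

text \<open>
  Test functions are \<open>C\<^sup>1\<close> with compact support, \<open>g\<close> being the gradient of \<open>\<eta>\<close>. By mollification,
  they yield the same weak derivatives and the same closure in \<open>H\<^sup>1\<close> as smooth ones.
\<close>

definition test_fun :: "('a::euclidean_space \<Rightarrow> real) \<Rightarrow> ('a \<Rightarrow> 'a) \<Rightarrow> bool" where
  "test_fun \<eta> g \<longleftrightarrow> (\<forall>x. GDERIV \<eta> x :> g x) \<and> continuous_on UNIV g \<and>
     compact (closure {x. \<eta> x \<noteq> 0})"

definition has_weak_grad :: "('a::euclidean_space \<Rightarrow> real) \<Rightarrow> ('a \<Rightarrow> 'a) \<Rightarrow> bool" where
  "has_weak_grad f G \<longleftrightarrow> in_L2loc f \<and> in_L2loc G \<and>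
     (\<forall>\<eta> g. test_fun \<eta> g \<longrightarrow>
        (LINT x|lborel. f x *\<^sub>R g x) = - (LINT x|lborel. \<eta> x *\<^sub>R G x))"

definition weak_grad :: "('a::euclidean_space \<Rightarrow> real) \<Rightarrow> 'a \<Rightarrow> 'a" where
  "weak_grad f = (SOME G. has_weak_grad f G)"

definition has_weak_div :: "('a::euclidean_space \<Rightarrow> 'a) \<Rightarrow> ('a \<Rightarrow> real) \<Rightarrow> bool" where
  "has_weak_div W D \<longleftrightarrow> in_L2loc W \<and> in_L2loc D \<and>
     (\<forall>\<eta> g. test_fun \<eta> g \<longrightarrow>
        (LINT x|lborel. W x \<bullet> g x) = - (LINT x|lborel. D x * \<eta> x))"

definition weak_div :: "('a::euclidean_space \<Rightarrow> 'a) \<Rightarrow> 'a \<Rightarrow> real" where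
  "weak_div W = (SOME D. has_weak_div W D)"

definition weak_laplacian :: "('a::euclidean_space \<Rightarrow> real) \<Rightarrow> 'a \<Rightarrow> real" where
  "weak_laplacian f = weak_div (weak_grad f)"

subsection \<open>Fourier multipliers and Sobolev spaces\<close>

text \<open>
  The Fourier--Plancherel transform: \<open>U\<close> is the \<open>L\<^sup>2\<close> limit, as \<open>R\<close> tends to infinity, of
  \<open>\<xi> \<mapsto> \<integral>\<^bsub>|x| \<le> R\<^esub> e\<^bsup>-i x \<bullet> \<xi>\<^esup> u(x) dx\<close>.
\<close>

definition has_fourier :: "('a::euclidean_space \<Rightarrow> complex) \<Rightarrow> ('a \<Rightarrow> complex) \<Rightarrow> bool" where
  "has_fourier u U \<longleftrightarrow> in_L2 u \<and> in_L2 U \<and>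
     ((\<lambda>R. \<integral>\<^sup>+\<xi>. ennreal ((norm (U \<xi> - (LINT x:cball 0 R|lborel. cis (- (x \<bullet> \<xi>)) * u x)))\<^sup>2)
        \<partial>lborel) \<longlongrightarrow> 0) at_top"

text \<open>
  \<open>F(D)u\<close> for real-valued \<open>u\<close>. All symbols used below are real and even, hence \<open>F(D)u\<close> is
  real-valued.
\<close>

definition fourier_mult ::
    "('a::euclidean_space \<Rightarrow> real) \<Rightarrow> ('a \<Rightarrow> real) \<Rightarrow> 'a \<Rightarrow> real" where
  "fourier_mult F u = (SOME v. \<exists>U V.
     has_fourier (\<lambda>x. complex_of_real (u x)) U \<and> has_fourier (\<lambda>x. complex_of_real (v x)) V \<and>
     (AE \<xi> in lborel. V \<xi> = complex_of_real (F \<xi>) * U \<xi>))"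

definition fourier_mult_vec ::
    "('a::euclidean_space \<Rightarrow> real) \<Rightarrow> ('a \<Rightarrow> 'a) \<Rightarrow> 'a \<Rightarrow> 'a" where
  "fourier_mult_vec F W = (\<lambda>x. \<Sum>b\<in>Basis. fourier_mult F (\<lambda>y. W y \<bullet> b) x *\<^sub>R b)"

definition Lambda_symbol :: "real \<Rightarrow> 'a::euclidean_space \<Rightarrow> real" where
  "Lambda_symbol s \<xi> = (1 + (norm \<xi>)\<^sup>2) powr (s / 2)"

text \<open>The space \<open>H\<^sup>s\<close> and its norm; only \<open>s \<ge> 0\<close> is used, so that \<open>H\<^sup>s \<subseteq> L\<^sup>2\<close>.\<close>

definition sobolev :: "real \<Rightarrow> ('a::euclidean_space \<Rightarrow> real) set" where
  "sobolev s = {f. \<exists>U. has_fourier (\<lambda>x. complex_of_real (f x)) U \<and>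
     in_L2 (\<lambda>\<xi>. complex_of_real (Lambda_symbol s \<xi>) * U \<xi>)}"

definition sobolev_norm :: "real \<Rightarrow> ('a::euclidean_space \<Rightarrow> real) \<Rightarrow> real" where
  "sobolev_norm s f = L2_norm (fourier_mult (Lambda_symbol s) f)"

definition sobolev_vec_norm :: "real \<Rightarrow> ('a::euclidean_space \<Rightarrow> 'a) \<Rightarrow> real" where
  "sobolev_vec_norm s W = L2_norm (fourier_mult_vec (Lambda_symbol s) W)"

text \<open>The space \<open>\<dot>H\<^sup>s\<close> of functions in \<open>L\<^sup>2\<^sub>l\<^sub>o\<^sub>c\<close> with gradient in \<open>H\<^bsup>s-1\<^esup>\<close>, for \<open>s \<ge> 1\<close>.\<close>

definition sobolev_dot :: "real \<Rightarrow> ('a::euclidean_space \<Rightarrow> real) set" where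
  "sobolev_dot s = {f. in_L2loc f \<and>
     (\<exists>G. has_weak_grad f G \<and> (\<forall>b\<in>Basis. (\<lambda>x. G x \<bullet> b) \<in> sobolev (s - 1)))}"

definition cont_sobolev ::
    "real \<Rightarrow> real set \<Rightarrow> (real \<Rightarrow> 'a::euclidean_space \<Rightarrow> real) \<Rightarrow> bool" where
  "cont_sobolev s I f \<longleftrightarrow> (\<forall>t\<in>I. f t \<in> sobolev s \<and>
     ((\<lambda>\<tau>. sobolev_norm s (\<lambda>x. f \<tau> x - f t x)) \<longlongrightarrow> 0) (at t within I))"

definition cont_sobolev_dot ::
    "real \<Rightarrow> real set \<Rightarrow> (real \<Rightarrow> 'a::euclidean_space \<Rightarrow> real) \<Rightarrow> bool" where
  "cont_sobolev_dot s I f \<longleftrightarrow> (\<forall>t\<in>I. f t \<in> sobolev_dot s \<and>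
     ((\<lambda>\<tau>. sobolev_vec_norm (s - 1) (weak_grad (\<lambda>x. f \<tau> x - f t x))) \<longlongrightarrow> 0) (at t within I))"

subsection \<open>The Dirichlet-to-Neumann operator\<close>

text \<open>Points and vectors of \<open>\<real>\<^sup>d \<times> \<real>\<close> are pairs of a horizontal and a vertical component.\<close>

definition strip :: "('a::euclidean_space \<times> real) set" where
  "strip = UNIV \<times> {-1<..<0}"

definition water_height :: "real \<Rightarrow> ('a \<Rightarrow> real) \<Rightarrow> 'a \<Rightarrow> real" where
  "water_height \<epsilon> \<zeta> X = 1 + \<epsilon> * \<zeta> X"

text \<open>
  \<open>scale_mu \<mu>\<close> turns the gradient in \<open>(X, z)\<close> into \<open>\<nabla>\<^sup>\<mu>\<close>; \<open>P_matrix \<epsilon> \<mu> \<zeta> p\<close> is the linear map given by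
  the matrix \<open>P(\<Sigma>\<^sub>t)\<close> at the point \<open>p\<close>.
\<close>

definition scale_mu :: "real \<Rightarrow> 'a::euclidean_space \<times> real \<Rightarrow> 'a \<times> real" where
  "scale_mu \<mu> v = (sqrt \<mu> *\<^sub>R fst v, snd v)"

definition P_matrix ::
    "real \<Rightarrow> real \<Rightarrow> ('a::euclidean_space \<Rightarrow> real) \<Rightarrow> 'a \<times> real \<Rightarrow> 'a \<times> real \<Rightarrow> 'a \<times> real" where
  "P_matrix \<epsilon> \<mu> \<zeta> p v =
     (let X = fst p; z = snd p; h = water_height \<epsilon> \<zeta> X; D = weak_grad \<zeta> X in
      (h *\<^sub>R fst v - (sqrt \<mu> * \<epsilon> * (z + 1) * snd v) *\<^sub>R D,
       - (sqrt \<mu> * \<epsilon> * (z + 1) * (D \<bullet> fst v))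
         + (1 + \<mu> * \<epsilon>\<^sup>2 * (z + 1)\<^sup>2 * (norm D)\<^sup>2) / h * snd v))"

text \<open>
  Test functions on \<open>\<real>\<^sup>d \<times> [-1,0)\<close>: they vanish near the surface \<open>z = 0\<close>, but not necessarily near
  the bottom \<open>z = -1\<close>.
\<close>

definition strip_test_fun ::
    "('a::euclidean_space \<times> real \<Rightarrow> real) \<Rightarrow> ('a \<times> real \<Rightarrow> 'a \<times> real) \<Rightarrow> bool" where
  "strip_test_fun v g \<longleftrightarrow> test_fun v g \<and> closure {p. v p \<noteq> 0} \<subseteq> UNIV \<times> {..<0}"

text \<open>
  \<open>u\<close> belongs to the closure of these test functions in \<open>H\<^sup>1\<close> of the strip, i.e. to the space of
  \<open>H\<^sup>1\<close> functions with zero trace at \<open>z = 0\<close>, and \<open>G\<close> is its gradient.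
\<close>

definition H1_surf0 ::
    "('a::euclidean_space \<times> real \<Rightarrow> real) \<Rightarrow> ('a \<times> real \<Rightarrow> 'a \<times> real) \<Rightarrow> bool" where
  "H1_surf0 u G \<longleftrightarrow> u \<in> borel_measurable lborel \<and> G \<in> borel_measurable lborel \<and>
     (\<exists>v g. (\<forall>k::nat. strip_test_fun (v k) (g k)) \<and>
        (\<lambda>k. \<integral>\<^sup>+p\<in>strip. ennreal ((u p - v k p)\<^sup>2) \<partial>lborel) \<longlonglongrightarrow> 0 \<and>
        (\<lambda>k. \<integral>\<^sup>+p\<in>strip. ennreal ((norm (G p - g k p))\<^sup>2) \<partial>lborel) \<longlonglongrightarrow> 0)"

text \<open>
  \<open>\<phi>\<close>, with gradient \<open>\<Phi>\<close>, is the variational (finite energy) solution of the elliptic boundary value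
  problem. The condition \<open>\<phi> = \<psi>\<close> at \<open>z = 0\<close> says that \<open>\<phi> - \<psi>\<close> has zero trace there. The conormal
  derivative at \<open>z = -1\<close> is \<open>\<partial>\<^sub>z\<phi> / h\<close>, so that \<open>\<partial>\<^sub>z\<phi> = 0\<close> is the natural boundary condition of the
  weak formulation with the test functions above.
\<close>

definition potential_solution ::
    "real \<Rightarrow> real \<Rightarrow> ('a::euclidean_space \<Rightarrow> real) \<Rightarrow> ('a \<Rightarrow> real) \<Rightarrow>
     ('a \<times> real \<Rightarrow> real) \<Rightarrow> ('a \<times> real \<Rightarrow> 'a \<times> real) \<Rightarrow> bool" where
  "potential_solution \<epsilon> \<mu> \<zeta> \<psi> \<phi> \<Phi> \<longleftrightarrow>
     H1_surf0 (\<lambda>p. \<phi> p - \<psi> (fst p)) (\<lambda>p. \<Phi> p - (weak_grad \<psi> (fst p), 0)) \<and>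
     (\<forall>v g. strip_test_fun v g \<longrightarrow>
        (LINT p:strip|lborel. P_matrix \<epsilon> \<mu> \<zeta> p (scale_mu \<mu> (\<Phi> p)) \<bullet> scale_mu \<mu> (g p)) = 0)"

definition V_bar ::
    "real \<Rightarrow> ('a::euclidean_space \<Rightarrow> real) \<Rightarrow> ('a \<times> real \<Rightarrow> 'a \<times> real) \<Rightarrow> 'a \<Rightarrow> 'a" where
  "V_bar \<epsilon> \<zeta> \<Phi> X = (1 / water_height \<epsilon> \<zeta> X) *\<^sub>R
     (LINT z:{-1<..<0}|lborel. water_height \<epsilon> \<zeta> X *\<^sub>R fst (\<Phi> (X, z))
        - (\<epsilon> * (z + 1) * snd (\<Phi> (X, z))) *\<^sub>R weak_grad \<zeta> X)"

text \<open>\<open>G\<close> is (a representative of) \<open>\<G>\<^sup>\<mu>\<psi> = - \<mu> \<nabla>\<cdot>(h V)\<close>, with \<open>V\<close> the averaged velocity \<open>V_bar\<close>.\<close>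

definition is_DN ::
    "real \<Rightarrow> real \<Rightarrow> ('a::euclidean_space \<Rightarrow> real) \<Rightarrow> ('a \<Rightarrow> real) \<Rightarrow> ('a \<Rightarrow> real) \<Rightarrow> bool" where
  "is_DN \<epsilon> \<mu> \<zeta> \<psi> G \<longleftrightarrow> (\<exists>\<phi> \<Phi> D. potential_solution \<epsilon> \<mu> \<zeta> \<psi> \<phi> \<Phi> \<and>
     has_weak_div (\<lambda>X. water_height \<epsilon> \<zeta> X *\<^sub>R V_bar \<epsilon> \<zeta> \<Phi> X) D \<and> G = (\<lambda>X. - \<mu> * D X))"

subsection \<open>The water waves equations\<close>

text \<open>Time derivative (one-sided at end points): convergence of difference quotients in \<open>L\<^sup>2\<^sub>l\<^sub>o\<^sub>c\<close>.\<close>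

definition has_time_deriv ::
    "(real \<Rightarrow> 'a::euclidean_space \<Rightarrow> real) \<Rightarrow> ('a \<Rightarrow> real) \<Rightarrow> real \<Rightarrow> real set \<Rightarrow> bool" where
  "has_time_deriv f f' t I \<longleftrightarrow> in_L2loc f' \<and>
     (\<forall>r. ((\<lambda>\<tau>. \<integral>\<^sup>+X\<in>cball 0 r. ennreal (((f \<tau> X - f t X) / (\<tau> - t) - f' X)\<^sup>2) \<partial>lborel)
        \<longlongrightarrow> 0) (at t within I))"

text \<open>\<open>\<zeta>'\<close> and \<open>\<psi>'\<close> are the time derivatives of \<open>\<zeta>\<close> and \<open>\<psi>\<close>.\<close>

definition water_waves ::
    "real \<Rightarrow> real \<Rightarrow> real set \<Rightarrow> (real \<Rightarrow> 'a::euclidean_space \<Rightarrow> real) \<Rightarrow> (real \<Rightarrow> 'a \<Rightarrow> real) \<Rightarrow>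
     (real \<Rightarrow> 'a \<Rightarrow> real) \<Rightarrow> (real \<Rightarrow> 'a \<Rightarrow> real) \<Rightarrow> bool" where
  "water_waves \<epsilon> \<mu> I \<zeta> \<psi> \<zeta>' \<psi>' \<longleftrightarrow> (\<forall>t\<in>I.
     has_time_deriv \<zeta> (\<zeta>' t) t I \<and> has_time_deriv \<psi> (\<psi>' t) t I \<and>
     (\<exists>G. is_DN \<epsilon> \<mu> (\<zeta> t) (\<psi> t) G \<and>
       (AE X in lborel. \<zeta>' t X - 1 / \<mu> * G X = 0) \<and>
       (AE X in lborel. \<psi>' t X + \<zeta> t X + \<epsilon> / 2 * (norm (weak_grad (\<psi> t) X))\<^sup>2
          - \<epsilon> / \<mu> * ((G X + \<epsilon> * \<mu> * (weak_grad (\<zeta> t) X \<bullet> weak_grad (\<psi> t) X))\<^sup>2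
              / (2 * (1 + \<epsilon>\<^sup>2 * \<mu> * (norm (weak_grad (\<zeta> t) X))\<^sup>2))) = 0)))"

definition non_cavitation ::
    "real \<Rightarrow> real set \<Rightarrow> real \<Rightarrow> (real \<Rightarrow> 'a::euclidean_space \<Rightarrow> real) \<Rightarrow> bool" where
  "non_cavitation h_min I \<epsilon> \<zeta> \<longleftrightarrow> h_min > 0 \<and>
     (\<forall>t\<in>I. AE X in lborel. water_height \<epsilon> (\<zeta> t) X \<ge> h_min)"

subsection \<open>Consistency\<close>

definition shallow_water :: "real \<Rightarrow> (real \<times> real) set" where
  "shallow_water \<mu>_max = {(\<epsilon>, \<mu>). 0 \<le> \<epsilon> \<and> \<epsilon> \<le> 1 \<and> 0 < \<mu> \<and> \<mu> \<le> \<mu>_max}"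

definition time_interval :: "real \<Rightarrow> real \<Rightarrow> real set" where
  "time_interval T \<epsilon> = (if \<epsilon> = 0 then {0..} else {0..T / \<epsilon>})"

text \<open>The constants \<open>M\<^sub>0\<close>, \<open>M(s)\<close>, \<open>N(s)\<close> built from dependence functions \<open>C\<^sub>0\<close>, \<open>C\<^sub>1\<close>, \<open>C\<^sub>2\<close>.\<close>

definition M0_const ::
    "(real \<Rightarrow> real \<Rightarrow> real \<Rightarrow> real) \<Rightarrow> real \<Rightarrow> real \<Rightarrow> real \<Rightarrow> ('a::euclidean_space \<Rightarrow> real) \<Rightarrow> real" where
  "M0_const C0 t0 h_min \<mu>_max \<zeta> = C0 (1 / h_min) \<mu>_max (sobolev_norm t0 \<zeta>)"

definition M_const ::
    "(real \<Rightarrow> real \<Rightarrow> real \<Rightarrow> real) \<Rightarrow> (real \<Rightarrow> real \<Rightarrow> real) \<Rightarrow> real \<Rightarrow> real \<Rightarrow> real \<Rightarrow> real \<Rightarrow>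
     ('a::euclidean_space \<Rightarrow> real) \<Rightarrow> real" where
  "M_const C0 C1 t0 h_min \<mu>_max s \<zeta> =
     C1 (M0_const C0 t0 h_min \<mu>_max \<zeta>) (sobolev_norm (max (t0 + 1) s) \<zeta>)"

definition N_const ::
    "(real \<Rightarrow> real \<Rightarrow> real \<Rightarrow> real) \<Rightarrow> (real \<Rightarrow> real \<Rightarrow> real) \<Rightarrow> (real \<Rightarrow> real \<Rightarrow> real) \<Rightarrow>
     real \<Rightarrow> real \<Rightarrow> real \<Rightarrow> real \<Rightarrow> ('a::euclidean_space \<Rightarrow> real) \<Rightarrow> ('a \<Rightarrow> real) \<Rightarrow> real" where
  "N_const C0 C1 C2 t0 h_min \<mu>_max s \<zeta> \<psi> =
     C2 (M_const C0 C1 t0 h_min \<mu>_max s \<zeta>) (sobolev_vec_norm s (weak_grad \<psi>))"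

text \<open>
  Consistency at order \<open>O(\<mu>\<^sup>k \<epsilon>\<^sup>l)\<close> of the water waves equations with the model
  \<open>\<partial>\<^sub>t\<zeta> + N1 \<epsilon> \<mu> \<zeta> \<psi> = 0\<close>, \<open>\<partial>\<^sub>t\<psi> + N2 \<epsilon> \<mu> \<zeta> \<psi> = 0\<close>. The dependence functions are chosen after \<open>s\<close>, but
  before \<open>\<epsilon>\<close>, \<open>\<mu>\<close>, \<open>h_min\<close> and the solution.
\<close>

definition ww_consistent ::
    "real \<Rightarrow> real \<Rightarrow> (real \<times> real) set \<Rightarrow> nat \<Rightarrow> nat \<Rightarrow>
     (real \<Rightarrow> real \<Rightarrow> ('a::euclidean_space \<Rightarrow> real) \<Rightarrow> ('a \<Rightarrow> real) \<Rightarrow> 'a \<Rightarrow> real) \<Rightarrow>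
     (real \<Rightarrow> real \<Rightarrow> ('a \<Rightarrow> real) \<Rightarrow> ('a \<Rightarrow> real) \<Rightarrow> 'a \<Rightarrow> real) \<Rightarrow> bool" where
  "ww_consistent t0 \<mu>_max A k l N1 N2 \<longleftrightarrow>
     (\<exists>(n::nat) T. T > 0 \<and> (\<forall>s\<ge>0. \<exists>C0 C1 C2.
        (\<forall>x y z. C0 x y z > 0) \<and> (\<forall>x y. C1 x y > 0) \<and> (\<forall>x y. C2 x y > 0) \<and>
        (\<forall>(\<epsilon>, \<mu>)\<in>A. \<forall>h_min \<zeta> \<psi> \<zeta>' \<psi>'.
           cont_sobolev (s + n) (time_interval T \<epsilon>) \<zeta> \<and>
           cont_sobolev_dot (s + n + 1) (time_interval T \<epsilon>) \<psi> \<and>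
           non_cavitation h_min (time_interval T \<epsilon>) \<epsilon> \<zeta> \<and>
           water_waves \<epsilon> \<mu> (time_interval T \<epsilon>) \<zeta> \<psi> \<zeta>' \<psi>' \<longrightarrow>
           (\<exists>R1 R2. \<forall>t\<in>time_interval T \<epsilon>.
              (AE X in lborel. \<zeta>' t X + N1 \<epsilon> \<mu> (\<zeta> t) (\<psi> t) X = \<mu> ^ k * \<epsilon> ^ l * R1 t X) \<and>
              (AE X in lborel. \<psi>' t X + N2 \<epsilon> \<mu> (\<zeta> t) (\<psi> t) X = \<mu> ^ k * \<epsilon> ^ l * R2 t X) \<and>
              R1 t \<in> sobolev s \<and> R2 t \<in> sobolev s \<and>
              sobolev_norm s (R1 t) \<le> N_const C0 C1 C2 t0 h_min \<mu>_max (s + n) (\<zeta> t) (\<psi> t) \<and>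
              sobolev_norm s (R2 t) \<le> N_const C0 C1 C2 t0 h_min \<mu>_max (s + n) (\<zeta> t) (\<psi> t)))))"

subsection \<open>The full dispersion model\<close>

definition F1_symbol :: "real \<Rightarrow> 'a::euclidean_space \<Rightarrow> real" where
  "F1_symbol \<mu> \<xi> = (if \<xi> = 0 then 1 else tanh (sqrt \<mu> * norm \<xi>) / (sqrt \<mu> * norm \<xi>))"

text \<open>
  As \<open>\<psi>\<close> is only controlled through its gradient, \<open>F\<^sub>1\<Delta>\<psi>\<close> is obtained by applying \<open>F\<^sub>1\<close> to the
  function \<open>\<Delta>\<psi>\<close>.
\<close>

definition model_N1 ::
    "real \<Rightarrow> real \<Rightarrow> ('a::euclidean_space \<Rightarrow> real) \<Rightarrow> ('a \<Rightarrow> real) \<Rightarrow> 'a \<Rightarrow> real" where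
  "model_N1 \<epsilon> \<mu> \<zeta> \<psi> X =
     fourier_mult (F1_symbol \<mu>) (weak_laplacian \<psi>) X
     + \<epsilon> * fourier_mult (F1_symbol \<mu>)
         (weak_div (\<lambda>Y. \<zeta> Y *\<^sub>R fourier_mult_vec (F1_symbol \<mu>) (weak_grad \<psi>) Y)) X"

definition model_N2 ::
    "real \<Rightarrow> real \<Rightarrow> ('a::euclidean_space \<Rightarrow> real) \<Rightarrow> ('a \<Rightarrow> real) \<Rightarrow> 'a \<Rightarrow> real" where
  "model_N2 \<epsilon> \<mu> \<zeta> \<psi> X =
     \<zeta> X + \<epsilon> / 2 * (norm (fourier_mult_vec (F1_symbol \<mu>) (weak_grad \<psi>) X))\<^sup>2"

end

theory Submission
  imports Defs "HOL-Probability.Probability"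
begin

text \<open>
  For \<open>Y = \<nabla>\<^sup>\<mu>(\<phi> - \<psi>)\<close> the straightened elliptic problem becomes a problem with homogeneous data on the strip, and
  applying difference quotients to it bounds the horizontal derivatives of \<open>Y\<close> by \<open>\<mu>\<close> times a constant depending on
  Sobolev norms of \<open>\<zeta>\<close> and \<open>\<nabla>\<psi>\<close> only. Hence the averaged velocity is \<open>\<nabla>\<psi> + O(\<mu>)\<close>,
  which settles the second equation, since \<open>F\<^sub>1 - 1 = O(\<mu> |D|\<^sup>2)\<close>, and the terms carrying a factor \<open>\<epsilon>\<close> of the first.
  The flat problem \<open>\<epsilon> = 0\<close> has to be solved exactly: expanding in the vertical modes \<open>cos ((j + 1/2) \<pi> (z + 1))\<close> turns it
  into Fourier multipliers that sum up to \<open>F\<^sub>1\<close>, and the difference of the two problems contributes \<open>O(\<mu>\<epsilon>)\<close>.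
\<close>

text \<open>The remainder must carry both factors \<epsilon> and \<mu>, so the model has to be exact
  at \<epsilon> = 0. What makes this tractable is the depth integral w of \<phi> - \<psi>: since h V
  = h \<nabla>\<psi> + \<nabla>(h w), only this scalar has to be expanded in the modes. The elliptic
  problem is posed for fields, by orthogonality, instead of functions and traces; facts about \<phi>
  - \<psi> come from pairing with explicit fields. The source \<surd>\<mu> \<nabla>\<psi> has order
  \<surd>\<mu> only; an integration by parts in z exchanges it for a vertical source of order \<mu>.
  The dependence functions precede the solution in the quantifiers, so estimates are stated for the
  family of all data under a common bound, and the final constant is a function of that bound
  obtained by choice. Of the 2 d + 4 derivatives lost, 2 d pay for two embeddings into bounded
  functions, three for differentiations and one for rounding s up to an integer.\<close>

section \<open>Square integrable functions over an arbitrary measure\<close>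

definition sqint :: "'x measure => ('x => 'b::euclidean_space) => bool" where
  "sqint N f \<longleftrightarrow> f \<in> borel_measurable N & integrable N (%x. (norm (f x))\<^sup>2)"

definition l2 :: "'x measure => ('x => 'b::euclidean_space) => real" where
  "l2 N f = sqrt (LINT x|N. (norm (f x))\<^sup>2)"

lemma in_L2_sqint: "in_L2 f \<longleftrightarrow> sqint lborel f"
  by (simp add: in_L2_def sqint_def)

lemma L2_norm_l2: "L2_norm f = l2 lborel f"
  by (simp add: L2_norm_def l2_def)

lemma l2_nonneg [simp]: "0 <= l2 N f"
  by (simp add: l2_def)

lemma l2_sq: "(l2 N f)\<^sup>2 = (LINT x|N. (norm (f x))\<^sup>2)"
  by (simp add: l2_def)

lemma nn_sq_l2:
  assumes "sqint N f"
  shows "(\<integral>\<^sup>+x. ennreal ((norm (f x))\<^sup>2) \<partial>N) = ennreal ((l2 N f)\<^sup>2)"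
  using assms unfolding l2_sq sqint_def by (intro nn_integral_eq_integral) auto

lemma sqint_iff_nn:
  "sqint N f \<longleftrightarrow> f \<in> borel_measurable N & (\<integral>\<^sup>+x. ennreal ((norm (f x))\<^sup>2) \<partial>N) < \<infinity>"
  unfolding sqint_def by (auto simp: integrable_iff_bounded)

lemma sqint_l2_leI:
  assumes "f \<in> borel_measurable N" "(\<integral>\<^sup>+x. ennreal ((norm (f x))\<^sup>2) \<partial>N) <= ennreal (M\<^sup>2)" "0 <= M"
  shows "sqint N f" "l2 N f <= M"
proof -
  show 1: "sqint N f"
    unfolding sqint_iff_nn using assms by (auto intro: le_less_trans)
  have "(l2 N f)\<^sup>2 <= M\<^sup>2"
    using assms(2) nn_sq_l2[OF 1] by simp
  then show "l2 N f <= M" using assms(3) by (rule power2_le_imp_le)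
qed

lemma sqint_bound:
  assumes "sqint N g" "f \<in> borel_measurable N" "AE x in N. norm (f x) <= C * norm (g x)" "0 <= C"
  shows "sqint N f" "l2 N f <= C * l2 N g"
proof -
  have "(\<integral>\<^sup>+x. ennreal ((norm (f x))\<^sup>2) \<partial>N) <= (\<integral>\<^sup>+x. ennreal (C\<^sup>2) * ennreal ((norm (g x))\<^sup>2) \<partial>N)"
  proof (rule nn_integral_mono_AE)
    show "AE x in N. ennreal ((norm (f x))\<^sup>2) <= ennreal (C\<^sup>2) * ennreal ((norm (g x))\<^sup>2)"
      using assms(3)
    proof eventually_elim
      case (elim x)
      then have "(norm (f x))\<^sup>2 <= (C * norm (g x))\<^sup>2" by (intro power_mono) auto
      then show ?case by (simp add: power_mult_distrib flip: ennreal_mult)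
    qed
  qed
  also have "\<dots> = ennreal (C\<^sup>2) * (\<integral>\<^sup>+x. ennreal ((norm (g x))\<^sup>2) \<partial>N)"
    using assms(1) by (intro nn_integral_cmult) (auto simp: sqint_def)
  also have "\<dots> = ennreal ((C * l2 N g)\<^sup>2)"
    by (simp add: nn_sq_l2[OF assms(1)] power_mult_distrib flip: ennreal_mult)
  finally show "sqint N f" "l2 N f <= C * l2 N g"
    using assms by (auto intro!: sqint_l2_leI)
qed

lemma l2_cong_AE:
  assumes "f \<in> borel_measurable N" "g \<in> borel_measurable N" "AE x in N. f x = g x"
  shows "l2 N f = l2 N g"
proof -
  have "(LINT x|N. (norm (f x))\<^sup>2) = (LINT x|N. (norm (g x))\<^sup>2)"
    using assms by (intro integral_cong_AE) auto
  then show ?thesis by (simp add: l2_def)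
qed

lemma sqint_cong_AE:
  assumes "sqint N f" "g \<in> borel_measurable N" "AE x in N. f x = g x"
  shows "sqint N g"
  using assms by (intro sqint_bound(1)[of N f g 1]) auto

lemma integrable_norm_prod:
  assumes "sqint N f" "sqint N g"
  shows "integrable N (%x. norm (f x) * norm (g x))"
proof -
  have [measurable]: "f \<in> borel_measurable N" "g \<in> borel_measurable N"
    using assms by (auto simp: sqint_def)
  show ?thesis
  proof (rule Bochner_Integration.integrable_bound)
    show "integrable N (%x. (norm (f x))\<^sup>2 + (norm (g x))\<^sup>2)"
      using assms by (auto simp: sqint_def)
    show "AE x in N. norm (norm (f x) * norm (g x)) <= norm ((norm (f x))\<^sup>2 + (norm (g x))\<^sup>2)"
    proof (rule AE_I2)
      fix x
      have "2 * (norm (f x) * norm (g x)) <= (norm (f x))\<^sup>2 + (norm (g x))\<^sup>2"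
        using sum_squares_bound[of "norm (f x)" "norm (g x)"] by (simp add: mult.assoc)
      moreover have "0 <= norm (f x) * norm (g x)" by simp
      ultimately have "norm (f x) * norm (g x) <= (norm (f x))\<^sup>2 + (norm (g x))\<^sup>2" by linarith
      then show "norm (norm (f x) * norm (g x)) <= norm ((norm (f x))\<^sup>2 + (norm (g x))\<^sup>2)"
        by simp
    qed
  qed measurable
qed

lemma l2_Cauchy_Schwarz:
  assumes "sqint N f" "sqint N g"
  shows "(LINT x|N. norm (f x) * norm (g x)) <= l2 N f * l2 N g"
proof -
  have [measurable]: "f \<in> borel_measurable N" "g \<in> borel_measurable N"
    using assms by (auto simp: sqint_def)
  have "(\<integral>\<^sup>+x. ennreal (norm (f x)) * ennreal (norm (g x)) \<partial>N)\<^sup>2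
      <= (\<integral>\<^sup>+x. ennreal (norm (f x)) ^ 2 \<partial>N) * (\<integral>\<^sup>+x. ennreal (norm (g x)) ^ 2 \<partial>N)"
    by (rule Cauchy_Schwarz_nn_integral) measurable
  also have "\<dots> = ennreal ((l2 N f * l2 N g)\<^sup>2)"
    using assms by (simp add: ennreal_power nn_sq_l2 power_mult_distrib ennreal_mult)
  also have "(\<integral>\<^sup>+x. ennreal (norm (f x)) * ennreal (norm (g x)) \<partial>N)
      = ennreal (LINT x|N. norm (f x) * norm (g x))"
    using integrable_norm_prod[OF assms]
    by (subst nn_integral_eq_integral[symmetric]) (auto simp: ennreal_mult)
  finally have "(LINT x|N. norm (f x) * norm (g x))\<^sup>2 <= (l2 N f * l2 N g)\<^sup>2"
    by (simp add: ennreal_power)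
  then show ?thesis by (rule power2_le_imp_le) simp
qed

lemma sqint_add:
  assumes "sqint N f" "sqint N g"
  shows "sqint N (%x. f x + g x)" "l2 N (%x. f x + g x) <= l2 N f + l2 N g"
proof -
  have [measurable]: "f \<in> borel_measurable N" "g \<in> borel_measurable N"
    using assms by (auto simp: sqint_def)
  have int: "integrable N (%x. (norm (f x))\<^sup>2 + 2 * (norm (f x) * norm (g x)) + (norm (g x))\<^sup>2)"
    using assms integrable_norm_prod[OF assms] by (auto simp: sqint_def)
  have le: "(norm (f x + g x))\<^sup>2 <= (norm (f x))\<^sup>2 + 2 * (norm (f x) * norm (g x)) + (norm (g x))\<^sup>2" for x
  proof -
    have "(norm (f x + g x))\<^sup>2 <= (norm (f x) + norm (g x))\<^sup>2"
      by (intro power_mono norm_triangle_ineq) auto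
    then show ?thesis by (simp add: power2_sum)
  qed
  show s: "sqint N (%x. f x + g x)"
    unfolding sqint_def
  proof
    show "integrable N (%x. (norm (f x + g x))\<^sup>2)"
      using le by (intro Bochner_Integration.integrable_bound[OF int]) (auto intro: order_trans[OF _ abs_ge_self])
  qed measurable
  have "(l2 N (%x. f x + g x))\<^sup>2
      <= (LINT x|N. (norm (f x))\<^sup>2 + 2 * (norm (f x) * norm (g x)) + (norm (g x))\<^sup>2)"
    unfolding l2_sq using s int le by (intro integral_mono) (auto simp: sqint_def)
  also have "\<dots> = (l2 N f)\<^sup>2 + 2 * (LINT x|N. norm (f x) * norm (g x)) + (l2 N g)\<^sup>2"
    unfolding l2_sq using assms integrable_norm_prod[OF assms]
    by (simp add: sqint_def)
  also have "\<dots> <= (l2 N f)\<^sup>2 + 2 * (l2 N f * l2 N g) + (l2 N g)\<^sup>2"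
    using l2_Cauchy_Schwarz[OF assms] by simp
  also have "\<dots> = (l2 N f + l2 N g)\<^sup>2" by (simp add: power2_sum)
  finally show "l2 N (%x. f x + g x) <= l2 N f + l2 N g"
    by (rule power2_le_imp_le) simp
qed

lemma sqint_scaleR:
  assumes "sqint N f"
  shows "sqint N (%x. c *\<^sub>R f x)" "l2 N (%x. c *\<^sub>R f x) = \<bar>c\<bar> * l2 N f"
  using assms by (auto simp: sqint_def l2_def power_mult_distrib real_sqrt_mult)

lemma sqint_minus:
  "sqint N f ==> sqint N (%x. - f x)" "l2 N (%x. - f x) = l2 N f"
  by (auto simp: sqint_def l2_def)

lemma sqint_diff:
  assumes "sqint N f" "sqint N g"
  shows "sqint N (%x. f x - g x)" "l2 N (%x. f x - g x) <= l2 N f + l2 N g"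
  using sqint_add[OF assms(1) sqint_minus(1)[OF assms(2)]] by (auto simp: sqint_minus(2))

lemma l2_triangle:
  assumes "sqint N f" "sqint N g" "sqint N h"
  shows "l2 N (%x. f x - h x) <= l2 N (%x. f x - g x) + l2 N (%x. g x - h x)"
  using sqint_add[OF sqint_diff(1)[OF assms(1,2)] sqint_diff(1)[OF assms(2,3)]] by simp

lemma sqint_zero [simp]: "sqint N (%x. 0)" "l2 N (%x. 0) = 0"
  by (auto simp: sqint_def l2_def)

lemma sqint_sum:
  assumes "finite A" "!!i. i \<in> A ==> sqint N (f i)"
  shows "sqint N (%x. \<Sum>i\<in>A. f i x) & l2 N (%x. \<Sum>i\<in>A. f i x) <= (\<Sum>i\<in>A. l2 N (f i))"
  using assms
proof (induction A rule: finite_induct)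
  case (insert a A)
  then have "sqint N (f a)" "sqint N (%x. \<Sum>i\<in>A. f i x)"
    "l2 N (%x. \<Sum>i\<in>A. f i x) <= (\<Sum>i\<in>A. l2 N (f i))" by auto
  with sqint_add[of N "f a" "%x. \<Sum>i\<in>A. f i x"] insert.hyps show ?case by simp
qed simp

lemma l2_diff_commute: "l2 N (%x. f x - g x) = l2 N (%x. g x - f x)"
  by (simp add: l2_def norm_minus_commute)

lemma l2_eq_0_AE:
  assumes "sqint N f" "l2 N f = 0"
  shows "AE x in N. f x = 0"
proof -
  have "(LINT x|N. (norm (f x))\<^sup>2) = 0" using assms(2) l2_sq[of N f] by simp
  then have "AE x in N. (norm (f x))\<^sup>2 = 0"
    using assms(1) by (subst (asm) integral_nonneg_eq_0_iff_AE) (auto simp: sqint_def)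
  then show ?thesis by auto
qed

lemma l2_tendsto_unique:
  assumes "F \<noteq> bot" "!!i. sqint N (f i)" "sqint N g" "sqint N h"
    "((%i. l2 N (%x. f i x - g x)) \<longlongrightarrow> 0) F" "((%i. l2 N (%x. f i x - h x)) \<longlongrightarrow> 0) F"
  shows "AE x in N. g x = h x"
proof -
  have "l2 N (%x. g x - h x) <= 0"
  proof (rule tendsto_le[OF assms(1) _ tendsto_const])
    show "((%i. l2 N (%x. f i x - g x) + l2 N (%x. f i x - h x)) \<longlongrightarrow> 0) F"
      using tendsto_add[OF assms(5,6)] by simp
    show "\<forall>\<^sub>F i in F. l2 N (%x. g x - h x) <= l2 N (%x. f i x - g x) + l2 N (%x. f i x - h x)"
      using l2_triangle[OF assms(3) assms(2) assms(4)]
      by (auto intro!: always_eventually simp: l2_diff_commute[of N g])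
  qed
  then have "l2 N (%x. g x - h x) = 0" by (simp add: order_antisym)
  then have "AE x in N. g x - h x = 0"
    using assms by (intro l2_eq_0_AE sqint_diff)
  then show ?thesis by simp
qed

text \<open>One statement for products, inner products, scalings and the matrix action
  \<open>pmat\<close>. The bound K of B is explicit because later constants have to be uniform over
  families.\<close>

lemma sqint_pairing:
  fixes f :: "'x => 'b::euclidean_space" and g :: "'x => 'c::euclidean_space"
    and B :: "'b => 'c => 'e::euclidean_space"
  assumes "sqint N f" "sqint N g" "bounded_bilinear B" and K: "!!a b. norm (B a b) <= norm a * norm b * K"
    and "0 <= K"
  shows "integrable N (%x. B (f x) (g x))" "norm (LINT x|N. B (f x) (g x)) <= K * (l2 N f * l2 N g)"
proof -
  interpret bounded_bilinear B by fact
  have [measurable]: "f \<in> borel_measurable N" "g \<in> borel_measurable N"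
    using assms by (auto simp: sqint_def)
  have int: "integrable N (%x. norm (f x) * norm (g x) * K)"
    using integrable_norm_prod[OF assms(1,2)] by simp
  have "continuous_on UNIV (%p. B (fst p) (snd p))"
    by (intro continuous_on continuous_intros)
  then have [measurable]: "(%x. B (f x) (g x)) \<in> borel_measurable N"
    by (rule borel_measurable_continuous_Pair[rotated 2]) measurable
  show 1: "integrable N (%x. B (f x) (g x))"
    using K by (intro Bochner_Integration.integrable_bound[OF int]) (auto intro: order_trans[OF _ abs_ge_self])
  have "norm (LINT x|N. B (f x) (g x)) <= (LINT x|N. norm (B (f x) (g x)))"
    by (rule integral_norm_bound)
  also have "\<dots> <= (LINT x|N. norm (f x) * norm (g x) * K)"
    using 1 int K by (intro integral_mono) auto
  also have "\<dots> <= K * (l2 N f * l2 N g)"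
    using mult_left_mono[OF l2_Cauchy_Schwarz[OF assms(1,2)] assms(5)] by (simp add: mult.commute)
  finally show "norm (LINT x|N. B (f x) (g x)) <= K * (l2 N f * l2 N g)" .
qed

lemma sqint_pairing_tendsto:
  fixes f :: "'i => 'x => 'b::euclidean_space" and g :: "'i => 'x => 'c::euclidean_space"
    and B :: "'b => 'c => 'e::euclidean_space"
  assumes f: "!!i. sqint N (f i)" "sqint N f0" "((%i. l2 N (%x. f i x - f0 x)) \<longlongrightarrow> 0) F"
    and g: "!!i. sqint N (g i)" "sqint N g0" "((%i. l2 N (%x. g i x - g0 x)) \<longlongrightarrow> 0) F"
    and B: "bounded_bilinear B"
  shows "((%i. LINT x|N. B (f i x) (g i x)) \<longlongrightarrow> (LINT x|N. B (f0 x) (g0 x))) F"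
proof -
  interpret bounded_bilinear B by fact
  obtain K where K: "0 <= K" "!!a b. norm (B a b) <= norm a * norm b * K"
    using nonneg_bounded by blast
  note P = sqint_pairing[OF _ _ B K(2) K(1)]
  have fd: "sqint N (%x. f i x - f0 x)" and gd: "sqint N (%x. g i x - g0 x)" for i
    using f g by (auto intro: sqint_diff)
  \<comment> \<open>Expansion around the limits: each of the three terms contains a difference that
    tends to 0.\<close>
  have eq: "(LINT x|N. B (f i x) (g i x)) - (LINT x|N. B (f0 x) (g0 x))
     = (LINT x|N. B (f i x - f0 x) (g i x - g0 x)) + (LINT x|N. B (f i x - f0 x) (g0 x))
       + (LINT x|N. B (f0 x) (g i x - g0 x))" for i
  proof -
    have "(LINT x|N. B (f i x - f0 x) (g i x - g0 x)) + (LINT x|N. B (f i x - f0 x) (g0 x))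
        + (LINT x|N. B (f0 x) (g i x - g0 x))
       = (LINT x|N. B (f i x - f0 x) (g i x - g0 x) + B (f i x - f0 x) (g0 x) + B (f0 x) (g i x - g0 x))"
      using P(1)[OF fd gd] P(1)[OF fd g(2)] P(1)[OF f(2) gd]
      by (simp add: Bochner_Integration.integral_add)
    also have "\<dots> = (LINT x|N. B (f i x) (g i x) - B (f0 x) (g0 x))"
      by (intro Bochner_Integration.integral_cong) (auto simp: diff_left diff_right)
    also have "\<dots> = (LINT x|N. B (f i x) (g i x)) - (LINT x|N. B (f0 x) (g0 x))"
      using P(1)[OF f(1) g(1)] P(1)[OF f(2) g(2)] by (simp add: Bochner_Integration.integral_diff)
    finally show ?thesis ..
  qed
  let ?df = "%i. l2 N (%x. f i x - f0 x)" and ?dg = "%i. l2 N (%x. g i x - g0 x)"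
  have "((%i. (LINT x|N. B (f i x) (g i x)) - (LINT x|N. B (f0 x) (g0 x))) \<longlongrightarrow> 0) F"
  proof (rule Lim_null_comparison)
    show "\<forall>\<^sub>F i in F. norm ((LINT x|N. B (f i x) (g i x)) - (LINT x|N. B (f0 x) (g0 x)))
      <= K * (?df i * ?dg i) + K * (?df i * l2 N g0) + K * (l2 N f0 * ?dg i)"
      unfolding eq using P(2)[OF fd gd] P(2)[OF fd g(2)] P(2)[OF f(2) gd]
      by (intro always_eventually allI) (intro norm_triangle_le add_mono, auto)
    have "((%i. K * (?df i * ?dg i) + K * (?df i * l2 N g0) + K * (l2 N f0 * ?dg i)) \<longlongrightarrow>
      K * (0 * 0) + K * (0 * l2 N g0) + K * (l2 N f0 * 0)) F"
      by (intro tendsto_intros f g)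
    then show "((%i. K * (?df i * ?dg i) + K * (?df i * l2 N g0) + K * (l2 N f0 * ?dg i)) \<longlongrightarrow> 0) F"
      by simp
  qed
  then show ?thesis by (rule LIM_zero_cancel)
qed

lemma l2_tendsto:
  assumes "!!i. sqint N (f i)" "sqint N g" "((%i. l2 N (%x. f i x - g x)) \<longlongrightarrow> 0) F"
  shows "((%i. l2 N (f i)) \<longlongrightarrow> l2 N g) F"
proof -
  have "((%i. LINT x|N. inner (f i x) (f i x)) \<longlongrightarrow> (LINT x|N. inner (g x) (g x))) F"
    by (intro sqint_pairing_tendsto assms bounded_bilinear_inner)
  then show ?thesis unfolding l2_def power2_norm_eq_inner by (rule tendsto_real_sqrt)
qed


text \<open>Pointwise limits inherit norm bounds without convergence in norm. This serves
  completeness, and later the passage from bounded difference quotients to weights on the Fourier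
  side.\<close>

lemma l2_fatou:
  fixes f :: "nat => 'x => 'b::euclidean_space"
  assumes f: "!!n. sqint N (f n)" and [measurable]: "g \<in> borel_measurable N"
    and lim: "AE x in N. (%n. f n x) \<longlonglongrightarrow> g x" and M: "\<forall>\<^sub>F n in sequentially. l2 N (f n) <= M"
  shows "sqint N g" "l2 N g <= M"
proof -
  have [measurable]: "f n \<in> borel_measurable N" for n using f by (auto simp: sqint_def)
  obtain n where "l2 N (f n) <= M" using M by (auto simp: eventually_sequentially)
  then have "0 <= M" using l2_nonneg order_trans by blast
  have "(\<integral>\<^sup>+x. ennreal ((norm (g x))\<^sup>2) \<partial>N)
      = (\<integral>\<^sup>+x. liminf (%k. ennreal ((norm (f k x))\<^sup>2)) \<partial>N)"
  proof (rule nn_integral_cong_AE)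
    show "AE x in N. ennreal ((norm (g x))\<^sup>2) = liminf (%k. ennreal ((norm (f k x))\<^sup>2))"
      using lim
    proof eventually_elim
      case (elim x)
      then have "(%k. ennreal ((norm (f k x))\<^sup>2)) \<longlonglongrightarrow> ennreal ((norm (g x))\<^sup>2)"
        by (intro tendsto_intros)
      from lim_imp_Liminf[OF _ this] show ?case by simp
    qed
  qed
  also have "\<dots> <= liminf (%k. \<integral>\<^sup>+x. ennreal ((norm (f k x))\<^sup>2) \<partial>N)"
    by (rule nn_integral_liminf) measurable
  also have "\<dots> <= ennreal (M\<^sup>2)"
  proof (rule Liminf_le)
    show "\<forall>\<^sub>F k in sequentially. (\<integral>\<^sup>+x. ennreal ((norm (f k x))\<^sup>2) \<partial>N) <= ennreal (M\<^sup>2)"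
      using M
    proof eventually_elim
      case (elim k)
      then have "(l2 N (f k))\<^sup>2 <= M\<^sup>2" by (intro power_mono) auto
      then show ?case using f by (simp add: nn_sq_l2)
    qed
  qed simp
  finally show "sqint N g" "l2 N g <= M"
    using sqint_l2_leI[of g N M] \<open>0 <= M\<close> by auto
qed

lemma l2_dominated_convergence:
  fixes f :: "nat => 'x => 'b::euclidean_space" and w :: "'x => 'c::euclidean_space"
  assumes [measurable]: "!!n. f n \<in> borel_measurable N" "g \<in> borel_measurable N"
    and w: "sqint N w"
    and lim: "AE x in N. (%n. f n x) \<longlonglongrightarrow> g x"
    and dom: "!!n. AE x in N. norm (f n x) <= C * norm (w x)"
  shows "!!n. sqint N (f n)" "sqint N g" "(%n. l2 N (%x. f n x - g x)) \<longlonglongrightarrow> 0"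
proof -
  have dom': "AE x in N. norm (f n x) <= \<bar>C\<bar> * norm (w x)" for n
    using dom[of n]
  proof eventually_elim
    case (elim x)
    have "C * norm (w x) <= \<bar>C\<bar> * norm (w x)" by (intro mult_right_mono) auto
    with elim show ?case by simp
  qed
  show f: "sqint N (f n)" for n
    using w dom' by (intro sqint_bound(1)[of N w "f n" "\<bar>C\<bar>"]) auto
  have domall: "AE x in N. \<forall>n. norm (f n x) <= \<bar>C\<bar> * norm (w x)"
    using dom' by (simp add: AE_all_countable)
  have domg: "AE x in N. norm (g x) <= \<bar>C\<bar> * norm (w x)"
    using lim domall
  proof eventually_elim
    case (elim x)
    show ?case by (rule tendsto_le[OF _ tendsto_const tendsto_norm[OF elim(1)]]) (use elim in auto)
  qed
  show g: "sqint N g"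
    using w domg by (intro sqint_bound(1)[of N w g "\<bar>C\<bar>"]) auto
  have "(%n. LINT x|N. (norm (f n x - g x))\<^sup>2) \<longlonglongrightarrow> (LINT x|N. 0)"
  proof (rule integral_dominated_convergence[where w = "%x. (2 * \<bar>C\<bar>)\<^sup>2 * (norm (w x))\<^sup>2"])
    show "integrable N (%x. (2 * \<bar>C\<bar>)\<^sup>2 * (norm (w x))\<^sup>2)"
      using w by (simp add: sqint_def)
    show "AE x in N. (%n. (norm (f n x - g x))\<^sup>2) \<longlonglongrightarrow> 0"
      using lim
    proof eventually_elim
      case (elim x)
      have "(%n. (norm (f n x - g x))\<^sup>2) \<longlonglongrightarrow> (norm (g x - g x))\<^sup>2"
        using elim by (intro tendsto_intros)
      then show ?case by simp
    qed
    show "AE x in N. norm ((norm (f n x - g x))\<^sup>2) <= (2 * \<bar>C\<bar>)\<^sup>2 * (norm (w x))\<^sup>2" for n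
      using dom'[of n] domg
    proof eventually_elim
      case (elim x)
      have "norm (f n x - g x) <= 2 * \<bar>C\<bar> * norm (w x)"
        using norm_triangle_ineq4[of "f n x" "g x"] elim by simp
      then have "(norm (f n x - g x))\<^sup>2 <= (2 * \<bar>C\<bar> * norm (w x))\<^sup>2" by (intro power_mono) auto
      then show ?case by (simp add: power_mult_distrib)
    qed
  qed measurable
  then have "(%n. sqrt (LINT x|N. (norm (f n x - g x))\<^sup>2)) \<longlonglongrightarrow> sqrt 0"
    by (intro tendsto_real_sqrt) simp
  then show "(%n. l2 N (%x. f n x - g x)) \<longlonglongrightarrow> 0"
    by (simp add: l2_def)
qed

subsection \<open>Plancherel's theorem\<close>

text \<open>The Riesz-Fischer argument: a subsequence with geometrically small increments converges
  almost everywhere, and Fatou's lemma turns the Cauchy bounds into bounds for the distance to the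
  limit.\<close>

lemma l2_complete:
  fixes f :: "nat => 'x => 'b::euclidean_space"
  assumes f: "!!n. sqint N (f n)"
    and Cauchy: "!!e. 0 < e ==> \<exists>M. \<forall>m\<ge>M. \<forall>n\<ge>M. l2 N (%x. f m x - f n x) < e"
  shows "\<exists>g. sqint N g & (%n. l2 N (%x. f n x - g x)) \<longlonglongrightarrow> 0"
proof -
  have [measurable]: "f n \<in> borel_measurable N" for n
    using f by (auto simp: sqint_def)
  have "\<exists>M. \<forall>k. \<forall>m\<ge>M k. \<forall>n\<ge>M k. l2 N (%x. f m x - f n x) < (1/4)^k"
    using Cauchy by (intro choice) auto
  then obtain M where M: "!!k m n. M k <= m ==> M k <= n ==> l2 N (%x. f m x - f n x) < (1/4)^k"
    by blast
  \<comment> \<open>Summing the thresholds makes \<open>r k\<close> exceed every \<open>M j\<close>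
    with j at most k.\<close>
  define r where "r k = (\<Sum>j\<le>k. M j)" for k :: nat
  have rM: "M j <= r k" if "j <= k" for j k
    unfolding r_def using that by (intro member_le_sum) auto
  define D where "D k x = f (r (Suc k)) x - f (r k) x" for k x
  have [measurable]: "D k \<in> borel_measurable N" for k
    unfolding D_def by measurable
  have D: "sqint N (D k)" "l2 N (D k) < (1/4)^k" for k
    unfolding D_def using M[of k "r (Suc k)" "r k"] rM[of k k] rM[of k "Suc k"] f by (auto intro: sqint_diff)
  have "(\<integral>\<^sup>+x. (\<Sum>k. ennreal (2^k * (norm (D k x))\<^sup>2)) \<partial>N)
     = (\<Sum>k. \<integral>\<^sup>+x. ennreal (2^k) * ennreal ((norm (D k x))\<^sup>2) \<partial>N)"
    by (subst nn_integral_suminf) (auto simp: ennreal_mult)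
  also have "\<dots> = (\<Sum>k. ennreal (2^k * (l2 N (D k))\<^sup>2))"
    by (subst nn_integral_cmult) (auto simp: nn_sq_l2[OF D(1)] ennreal_mult)
  also have "\<dots> <= (\<Sum>k. ennreal ((1/8)^k))"
  proof (intro suminf_le ennreal_leI)
    fix k
    have "(l2 N (D k))\<^sup>2 <= ((1/4)^k)\<^sup>2" using D(2)[of k] by (intro power_mono) auto
    then have "2^k * (l2 N (D k))\<^sup>2 <= 2^k * ((1/4)^k)\<^sup>2" by simp
    also have "\<dots> = (1/8::real)^k"
      by (simp add: power2_eq_square flip: power_mult_distrib)
    finally show "2^k * (l2 N (D k))\<^sup>2 <= (1/8)^k" .
  qed auto
  also have "\<dots> = ennreal (\<Sum>k. (1/8)^k)"
    by (intro suminf_ennreal2) (auto intro!: summable_geometric)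
  finally have "(\<integral>\<^sup>+x. (\<Sum>k. ennreal (2^k * (norm (D k x))\<^sup>2)) \<partial>N) \<noteq> \<infinity>"
    by (auto simp: top_unique)
  then have AEfin: "AE x in N. (\<Sum>k. ennreal (2^k * (norm (D k x))\<^sup>2)) \<noteq> \<infinity>"
    by (intro nn_integral_PInf_AE) auto
  define g where "g x = lim (%k. f (r k) x)" for x
  have [measurable]: "g \<in> borel_measurable N"
    unfolding g_def by measurable
  have conv: "AE x in N. (%k. f (r k) x) \<longlonglongrightarrow> g x"
    using AEfin
  proof eventually_elim
    case (elim x)
    then have "summable (%k. 2^k * (norm (D k x))\<^sup>2)"
      by (intro summable_suminf_not_top) auto
    then have "summable (%k. (1/2)^k + 2^k * (norm (D k x))\<^sup>2)" by (intro summable_add summable_geometric) simp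
    \<comment> \<open>The weight 2^k in the series above exists for this inequality: it makes the
      increments themselves summable once their weighted squares are.\<close>
    moreover have "norm (D k x) <= (1/2)^k + 2^k * (norm (D k x))\<^sup>2" for k
    proof -
      have "0 <= ((1/2)^k - norm (D k x))\<^sup>2 * 2^k" by simp
      also have "\<dots> = (1/2)^k - 2 * norm (D k x) + 2^k * (norm (D k x))\<^sup>2"
        by (simp add: power2_eq_square algebra_simps power_one_over)
      finally show ?thesis using norm_ge_zero[of "D k x"] by linarith
    qed
    ultimately have "summable (%k. D k x)" by (rule summable_comparison_test'[of _ 0])
    then have "(%n. \<Sum>k<n. D k x) \<longlonglongrightarrow> (\<Sum>k. D k x)"
      by (rule summable_LIMSEQ)
    then have "(%n. f (r 0) x + (\<Sum>k<n. D k x)) \<longlonglongrightarrow> f (r 0) x + (\<Sum>k. D k x)"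
      by (intro tendsto_intros)
    moreover have "f (r 0) x + (\<Sum>k<n. D k x) = f (r n) x" for n
      unfolding D_def by (subst sum_lessThan_telescope) simp
    ultimately have "(%k. f (r k) x) \<longlonglongrightarrow> f (r 0) x + (\<Sum>k. D k x)" by simp
    then show ?case unfolding g_def by (metis limI)
  qed
  have bound: "sqint N (%x. g x - f n x) & l2 N (%x. g x - f n x) <= (1/4)^j" if n: "M j <= n" for n j
  proof -
    have "AE x in N. (%k. f (r k) x - f n x) \<longlonglongrightarrow> g x - f n x"
      using conv by eventually_elim (intro tendsto_intros)
    moreover have "\<forall>\<^sub>F k in sequentially. l2 N (%x. f (r k) x - f n x) <= (1/4)^j"
      using eventually_ge_at_top[of j] by eventually_elim (use M[of j _ n] n rM[of j] in \<open>force intro: less_imp_le order_trans\<close>)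
    ultimately show ?thesis using l2_fatou[of N "%k x. f (r k) x - f n x" "%x. g x - f n x"] f by (simp add: sqint_diff)
  qed
  have "sqint N (%x. (g x - f (M 0) x) + f (M 0) x)"
    using bound[of 0 "M 0"] f by (intro sqint_add) auto
  then have "sqint N g" by simp
  moreover have "(%n. l2 N (%x. f n x - g x)) \<longlonglongrightarrow> 0"
  proof (rule LIMSEQ_I)
    fix e :: real assume "0 < e"
    obtain j where j: "(1/4::real)^j < e"
      using real_arch_pow_inv[OF \<open>0 < e\<close>, of "1/4"] by auto
    have "norm (l2 N (%x. f n x - g x) - 0) < e" if "M j <= n" for n
      using bound[OF that] j l2_diff_commute[of N "f n" g] by auto
    then show "\<exists>n0. \<forall>n\<ge>n0. norm (l2 N (%x. f n x - g x) - 0) < e" by blast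
  qed
  ultimately show ?thesis by blast
qed

section \<open>Translations and reflections in L2\<close>

lemma integral_lborel_shift:
  fixes f :: "'a::euclidean_space => 'b::{banach, second_countable_topology}"
  assumes [measurable]: "f \<in> borel_measurable borel"
  shows "(LINT x|lborel. f (x + t)) = (LINT x|lborel. f x)"
proof -
  have "(LINT x|lborel. f x) = (LINT x|distr lborel borel ((+) t). f x)"
    by (simp add: lborel_distr_plus)
  also have "\<dots> = (LINT x|lborel. f (t + x))" by (rule integral_distr) auto
  finally show ?thesis by (simp add: add.commute)
qed

lemma integrable_lborel_shift:
  fixes f :: "'a::euclidean_space => 'b::{banach, second_countable_topology}"
  assumes "integrable lborel f"
  shows "integrable lborel (%x. f (x + t))"
proof -
  have [measurable]: "f \<in> borel_measurable borel" using assms by auto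
  have "integrable (distr lborel borel ((+) t)) f"
    using assms by (simp add: lborel_distr_plus)
  then have "integrable lborel (%x. f (t + x))" by (subst (asm) integrable_distr_eq) auto
  then show ?thesis by (simp add: add.commute)
qed

lemma nn_integral_lborel_shift:
  fixes f :: "'a::euclidean_space => ennreal"
  assumes [measurable]: "f \<in> borel_measurable borel"
  shows "(\<integral>\<^sup>+x. f (x + t) \<partial>lborel) = (\<integral>\<^sup>+x. f x \<partial>lborel)"
proof -
  have "(\<integral>\<^sup>+x. f x \<partial>lborel) = (\<integral>\<^sup>+x. f x \<partial>distr lborel borel ((+) t))"
    by (simp add: lborel_distr_plus)
  also have "\<dots> = (\<integral>\<^sup>+x. f (t + x) \<partial>lborel)" by (rule nn_integral_distr) auto
  finally show ?thesis by (simp add: add.commute)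
qed

lemma lborel_uminus: "distr lborel borel uminus = (lborel :: 'a::euclidean_space measure)"
  using lborel_affine[of "-1::real" "0::'a"] by (simp add: density_1)

lemma integral_lborel_uminus:
  fixes f :: "'a::euclidean_space => 'b::{banach, second_countable_topology}"
  assumes [measurable]: "f \<in> borel_measurable borel"
  shows "(LINT x|lborel. f (- x)) = (LINT x|lborel. f x)"
proof -
  have "(LINT x|lborel. f x) = (LINT x|distr lborel borel uminus. f x)"
    by (simp add: lborel_uminus)
  also have "\<dots> = (LINT x|lborel. f (- x))" by (rule integral_distr) auto
  finally show ?thesis by simp
qed

lemma integrable_lborel_uminus:
  fixes f :: "'a::euclidean_space => 'b::{banach, second_countable_topology}"
  assumes "integrable lborel f"
  shows "integrable lborel (%x. f (- x))"
proof -
  have [measurable]: "f \<in> borel_measurable borel" using assms by auto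
  have "integrable (distr lborel borel uminus) f"
    using assms by (simp add: lborel_uminus)
  then show ?thesis by (subst (asm) integrable_distr_eq) auto
qed

lemma sqint_shift:
  fixes u :: "'a::euclidean_space => 'b::euclidean_space"
  assumes "sqint lborel u"
  shows "sqint lborel (%x. u (x + h))" "l2 lborel (%x. u (x + h)) = l2 lborel u"
proof -
  have [measurable]: "u \<in> borel_measurable borel" using assms by (auto simp: sqint_def)
  show "sqint lborel (%x. u (x + h))"
    using assms integrable_lborel_shift[of "%x. (norm (u x))\<^sup>2" h] by (auto simp: sqint_def)
  show "l2 lborel (%x. u (x + h)) = l2 lborel u"
    unfolding l2_def using integral_lborel_shift[of "%x. (norm (u x))\<^sup>2" h] by simp
qed

lemma ind_cball_sqint: "sqint lborel (indicator (cball (0::'a::euclidean_space) R) :: 'a => real)"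
proof -
  have "integrable lborel (indicator (cball (0::'a) R) :: 'a => real)"
    by (intro integrable_real_indicator emeasure_lborel_cball_finite) auto
  moreover have "(norm (indicator (cball (0::'a) R) x :: real))\<^sup>2 = indicator (cball 0 R) x" for x
    by (simp add: indicator_def)
  ultimately show ?thesis unfolding sqint_def by (simp add: borel_measurable_indicator)
qed

text \<open>The property passes to limits in L2, since translations are isometries. It holds for
  bounded continuous functions with bounded support by dominated convergence, these approximate
  bounded functions supported in balls, and those approximate u.\<close>

lemma l2_translation_tendsto:
  fixes u :: "'a::euclidean_space => 'b::euclidean_space"
  assumes u: "sqint lborel u" and t: "t \<longlonglongrightarrow> 0"
  shows "(%n. l2 lborel (%x. u (x + t n) - u x)) \<longlonglongrightarrow> 0"
proof -
  define P where "P u \<longleftrightarrow> sqint lborel u & (%n. l2 lborel (%x. u (x + t n) - u x)) \<longlonglongrightarrow> 0" for u :: "'a => 'b"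
  have approx: "P u" if u: "sqint lborel u" and v: "!!m::nat. P (v m)" and lim: "(%m. l2 lborel (%x. v m x - u x)) \<longlonglongrightarrow> 0" for u v
    unfolding P_def
  proof (intro conjI u LIMSEQ_I)
    fix e :: real assume "0 < e"
    then obtain m where m: "l2 lborel (%x. v m x - u x) < e / 3"
      using LIMSEQ_D[OF lim, of "e / 3"] by auto
    have vm: "sqint lborel (v m)" using v by (simp add: P_def)
    obtain n0 where n0: "!!n. n0 <= n ==> l2 lborel (%x. v m (x + t n) - v m x) < e / 3"
      using v[of m] LIMSEQ_D[of "%n. l2 lborel (%x. v m (x + t n) - v m x)" 0 "e / 3"] \<open>0 < e\<close> by (auto simp: P_def)
    have "l2 lborel (%x. u (x + t n) - u x) < e" if "n0 <= n" for n
    proof -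
      note s = sqint_shift(1)[OF u, of "t n"] sqint_shift(1)[OF vm, of "t n"]
      have "l2 lborel (%x. u (x + t n) - u x) <= l2 lborel (%x. u (x + t n) - v m (x + t n)) + l2 lborel (%x. v m (x + t n) - u x)"
        by (rule l2_triangle[OF s u])
      also have "l2 lborel (%x. v m (x + t n) - u x) <= l2 lborel (%x. v m (x + t n) - v m x) + l2 lborel (%x. v m x - u x)"
        by (rule l2_triangle[OF s(2) vm u])
      also have "l2 lborel (%x. u (x + t n) - v m (x + t n)) = l2 lborel (%x. v m x - u x)"
        unfolding l2_diff_commute[of lborel "v m" u] by (rule sqint_shift(2)[OF sqint_diff(1)[OF u vm]])
      finally show ?thesis using m n0[OF that] by simp
    qed
    then show "\<exists>n0. \<forall>n\<ge>n0. norm (l2 lborel (%x. u (x + t n) - u x) - 0) < e" by auto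
  qed
  obtain T where T: "!!n. norm (t n) <= T" using convergent_imp_bounded[OF t] by (auto simp: bounded_iff)
  note ind = ind_cball_sqint
  have cont: "P v" if c: "continuous_on UNIV v" and B: "!!x. norm (v x) <= B * indicator (cball 0 R) x" "0 <= B" for v :: "'a => 'b" and B R
  proof -
    have [measurable]: "v \<in> borel_measurable borel" by (rule borel_measurable_continuous_onI[OF c])
    have "sqint lborel v" by (rule sqint_bound(1)[OF ind _ _ B(2)]) (use B in auto)
    moreover have "(%n. l2 lborel (%x. v (x + t n) - v x)) \<longlonglongrightarrow> 0"
    proof (rule l2_dominated_convergence(3)[OF _ _ ind[of "R + T"]])
      show "AE x in lborel. (%n. v (x + t n)) \<longlonglongrightarrow> v x"
        by (intro AE_I2 continuous_on_tendsto_compose[OF c]) (auto intro!: tendsto_eq_intros t)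
      have "indicator (cball 0 R) (x + t n) <= (indicator (cball 0 (R + T)) x :: real)" for x n
        using norm_triangle_ineq4[of "x + t n" "t n"] T[of n] by (auto simp: indicator_def)
      from order_trans[OF B(1) mult_left_mono[OF this B(2)]]
      show "AE x in lborel. norm (v (x + t n)) <= B * norm (indicator (cball 0 (R + T)) x :: real)" for n by simp
    qed measurable
    ultimately show ?thesis by (simp add: P_def)
  qed
  define w where "w m x = (if norm x <= real m & norm (u x) <= real m then u x else 0)" for m x
  have [measurable]: "u \<in> borel_measurable borel" using u by (simp add: sqint_def)
  have [measurable]: "w m \<in> borel_measurable borel" for m unfolding w_def[abs_def] by measurable
  have "AE x in lborel. (%m. w m x) \<longlonglongrightarrow> u x"
  proof (intro AE_I2 tendsto_eventually)
    fix x
    obtain n0 :: nat where "max (norm x) (norm (u x)) <= real n0" using real_arch_simple by blast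
    then show "\<forall>\<^sub>F m in sequentially. w m x = u x"
      by (auto simp: w_def eventually_sequentially intro!: exI[of _ n0])
  qed
  then have w: "!!m. sqint lborel (w m)" "(%m. l2 lborel (%x. w m x - u x)) \<longlonglongrightarrow> 0"
    using l2_dominated_convergence[of w lborel u u 1] u by (auto simp: w_def)
  have "P (w m)" for m
  proof -
    \<comment> \<open>A measurable function is an almost everywhere limit of continuous functions;
      this replaces a density theorem.\<close>
    have "w m measurable_on UNIV" by (rule lebesgue_measurable_imp_measurable_on) (auto intro: measurable_completion)
    then obtain Z g where Z: "negligible Z" "!!n. continuous_on UNIV (g n)" "!!x. x \<notin> Z ==> (%n::nat. g n x) \<longlonglongrightarrow> w m x"
      by (auto simp: measurable_on_def)
    define c where "c x = max 0 (min 1 (real m + 1 - norm x))" for x :: 'a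
    \<comment> \<open>The factor c cuts off in space and the quotient clips the norm at m + 1.
      Neither changes \<open>w m\<close>, which is supported in the ball of radius m and bounded by
      m.\<close>
    define v where "v n x = (c x * (real m + 1) / max (real m + 1) (norm (g n x))) *\<^sub>R g n x" for n x
    have vc: "continuous_on UNIV (v n)" for n
      unfolding v_def[abs_def] c_def by (intro continuous_intros Z(2)) auto
    have vB: "norm (v n x) <= (real m + 1) * indicator (cball 0 (real m + 1)) x" for n x
    proof (cases "norm x <= real m + 1")
      case True
      have "c x * (real m + 1) * norm (g n x) <= 1 * (real m + 1) * max (real m + 1) (norm (g n x))"
        by (intro mult_mono) (auto simp: c_def)
      then have "norm (v n x) <= real m + 1" by (simp add: v_def c_def divide_le_eq abs_mult)
      then show ?thesis using True by simp
    qed (simp add: v_def c_def)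
    have "AE x in lborel. x \<notin> Z"
      using Z(1) by (auto simp: negligible_iff_null_sets AE_completion_iff dest!: AE_not_in)
    then have "AE x in lborel. (%n. v n x) \<longlonglongrightarrow> w m x"
    proof eventually_elim
      case (elim x)
      have "(%n. v n x) \<longlonglongrightarrow> (c x * (real m + 1) / max (real m + 1) (norm (w m x))) *\<^sub>R w m x"
        unfolding v_def by (intro tendsto_intros Z(3)[OF elim]) auto
      moreover have "(c x * (real m + 1) / max (real m + 1) (norm (w m x))) *\<^sub>R w m x = w m x"
        by (auto simp: w_def c_def max_def)
      ultimately show ?case by simp
    qed
    then have "(%n. l2 lborel (%x. v n x - w m x)) \<longlonglongrightarrow> 0"
      by (rule l2_dominated_convergence(3)[OF _ _ ind[of "real m + 1"], rotated -2])
        (use vB borel_measurable_continuous_onI[OF vc] in auto)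
    from approx[OF w(1) cont[OF vc vB] this] show ?thesis by simp
  qed
  from approx[OF u this w(2)] show ?thesis by (simp add: P_def)
qed

section \<open>The absolutely convergent Fourier integral\<close>

definition fint :: "('a::euclidean_space => complex) => 'a => complex" where
  "fint u \<xi> = (LINT x|lborel. cis (- (x \<bullet> \<xi>)) * u x)"

lemma borel_measurable_cis [measurable]: "cis \<in> borel_measurable borel"
  by (intro borel_measurable_continuous_onI continuous_intros)

lemma fint_measurable [measurable]:
  assumes [measurable]: "u \<in> borel_measurable borel"
  shows "fint u \<in> borel_measurable borel"
  unfolding fint_def by measurable

lemma fint_integrand_integrable:
  assumes "integrable lborel u"
  shows "integrable lborel (%x. cis (- (x \<bullet> \<xi>)) * u x)"
proof (rule Bochner_Integration.integrable_bound[OF assms])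
  have [measurable]: "u \<in> borel_measurable borel" using assms by auto
  show "(%x. cis (- (x \<bullet> \<xi>)) * u x) \<in> borel_measurable lborel" by measurable
qed (simp add: norm_mult)

lemma fint_bound:
  assumes "integrable lborel u"
  shows "norm (fint u \<xi>) <= (LINT x|lborel. norm (u x))"
proof -
  have "norm (fint u \<xi>) <= (LINT x|lborel. norm (cis (- (x \<bullet> \<xi>)) * u x))"
    unfolding fint_def by (rule integral_norm_bound)
  then show ?thesis by (simp add: norm_mult)
qed

lemma fint_add:
  assumes "integrable lborel u" "integrable lborel v"
  shows "fint (%x. u x + v x) = (%\<xi>. fint u \<xi> + fint v \<xi>)"
  unfolding fint_def using fint_integrand_integrable[OF assms(1)] fint_integrand_integrable[OF assms(2)]
  by (simp add: distrib_left)

lemma fint_diff: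
  assumes "integrable lborel u" "integrable lborel v"
  shows "fint (%x. u x - v x) = (%\<xi>. fint u \<xi> - fint v \<xi>)"
  unfolding fint_def using fint_integrand_integrable[OF assms(1)] fint_integrand_integrable[OF assms(2)]
  by (simp add: right_diff_distrib)

lemma fint_cmult: "fint (%x. c * u x) = (%\<xi>. c * fint u \<xi>)"
proof
  fix \<xi>
  have "fint (%x. c * u x) \<xi> = (LINT x|lborel. c * (cis (- (x \<bullet> \<xi>)) * u x))"
    unfolding fint_def by (intro Bochner_Integration.integral_cong) auto
  then show "fint (%x. c * u x) \<xi> = c * fint u \<xi>"
    unfolding fint_def by simp
qed

lemma fint_cnj: "fint (%x. cnj (u x)) \<xi> = cnj (fint u (- \<xi>))"
  unfolding fint_def by (subst Bochner_Integration.integral_cnj[symmetric]) (simp add: cis_cnj)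

text \<open>Fubini's theorem for a kernel symmetric in x and y. It is used to move the transform
  onto Gaussians, where it is explicit.\<close>

lemma fint_multiplication:
  fixes f g :: "'a::euclidean_space => complex"
  assumes "integrable lborel f" "integrable lborel g"
  shows "(LINT x|lborel. fint f x * g x) = (LINT x|lborel. f x * fint g x)"
proof -
  have [measurable]: "f \<in> borel_measurable borel" "g \<in> borel_measurable borel"
    using assms by auto
  have int: "integrable (lborel \<Otimes>\<^sub>M lborel) (%(x, y). cis (- (x \<bullet> y)) * f x * g y)"
  proof (rule lborel_pair.Fubini_integrable)
    show "integrable lborel (%x. LINT y|lborel. norm (case (x, y) of (x, y) => cis (- (x \<bullet> y)) * f x * g y))"
      using assms by (simp add: norm_mult)
    show "AE x in lborel. integrable lborel (%y. case (x, y) of (x, y) => cis (- (x \<bullet> y)) * f x * g y)"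
    proof (rule AE_I2)
      fix x
      show "integrable lborel (%y. case (x, y) of (x, y) => cis (- (x \<bullet> y)) * f x * g y)"
        by (rule Bochner_Integration.integrable_bound[of _ "%y. f x * g y"])
           (use assms in \<open>auto simp: norm_mult\<close>)
    qed
  qed measurable
  have "(LINT y|lborel. fint f y * g y) = (LINT y|lborel. LINT x|lborel. cis (- (x \<bullet> y)) * f x * g y)"
    unfolding fint_def by (subst integral_mult_left_zero[symmetric]) (rule refl)
  also have "\<dots> = (LINT x|lborel. LINT y|lborel. cis (- (x \<bullet> y)) * f x * g y)"
    using lborel_pair.Fubini_integral[OF int] by simp
  also have "\<dots> = (LINT x|lborel. f x * fint g x)"
  proof (intro Bochner_Integration.integral_cong refl)
    fix x
    have "f x * fint g x = (LINT y|lborel. f x * (cis (- (y \<bullet> x)) * g y))"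
      unfolding fint_def by (rule integral_mult_right_zero[symmetric])
    also have "\<dots> = (LINT y|lborel. cis (- (x \<bullet> y)) * f x * g y)"
      by (intro Bochner_Integration.integral_cong refl) (simp add: inner_commute[of x] mult_ac)
    finally show "(LINT y|lborel. cis (- (x \<bullet> y)) * f x * g y) = f x * fint g x" ..
  qed
  finally show ?thesis .
qed

subsection \<open>Gaussians\<close>

text \<open>The characteristic function of the standard normal distribution is the case e = 1; the
  substitution of e t for t gives the others.\<close>

lemma gauss_fourier_1d:
  assumes "0 < e"
  shows "integrable lborel (%t::real. complex_of_real (exp (- (e * t)\<^sup>2 / 2)) * cis (- (t * x)))"
    and "(LINT t|lborel. complex_of_real (exp (- (e * t)\<^sup>2 / 2)) * cis (- (t * x)))
       = complex_of_real (sqrt (2 * pi) / e * exp (- (x / e)\<^sup>2 / 2))"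
proof -
  let ?g = "%t::real. complex_of_real (exp (- t\<^sup>2 / 2)) * cis (- (t * (x / e)))"
  have int: "integrable lborel (%t::real. exp (- t\<^sup>2 / 2))"
  proof -
    have "integrable lborel (%t. sqrt (2 * pi) * std_normal_density t)"
      using integrable_normal_moment[of 1 0 0] by simp
    then show ?thesis by (simp add: std_normal_density_def)
  qed
  have intg: "integrable lborel ?g"
    by (rule Bochner_Integration.integrable_bound[OF int]) (auto simp: norm_mult)
  have "char std_normal_distribution (- (x / e)) = complex_of_real (exp (- (x / e)\<^sup>2 / 2))"
    by (simp add: char_std_normal_distribution)
  moreover have "char std_normal_distribution (- (x / e)) = (LINT t|lborel. std_normal_density t *\<^sub>R cis (- (t * (x / e))))"
    unfolding char_def by (subst integral_density) (auto simp: normal_density_nonneg cis_conv_exp mult.commute)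
  moreover have "\<dots> = (LINT t|lborel. complex_of_real (1 / sqrt (2 * pi)) * ?g t)"
    by (intro Bochner_Integration.integral_cong) (auto simp: std_normal_density_def scaleR_conv_of_real)
  moreover have "\<dots> = complex_of_real (1 / sqrt (2 * pi)) * (LINT t|lborel. ?g t)"
    by (rule integral_mult_right_zero)
  ultimately have 1: "(LINT t|lborel. ?g t) = complex_of_real (sqrt (2 * pi) * exp (- (x / e)\<^sup>2 / 2))"
    by (simp add: field_simps)
  have eq: "?g (0 + e * t) = complex_of_real (exp (- (e * t)\<^sup>2 / 2)) * cis (- (t * x))" for t
    using assms by simp
  show "integrable lborel (%t::real. complex_of_real (exp (- (e * t)\<^sup>2 / 2)) * cis (- (t * x)))"
    using lborel_integrable_real_affine[OF intg, of e 0] assms unfolding eq by simp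
  have "(LINT t|lborel. ?g t) = \<bar>e\<bar> *\<^sub>R (LINT t|lborel. ?g (0 + e * t))"
    using assms by (intro lborel_integral_real_affine) simp
  then show "(LINT t|lborel. complex_of_real (exp (- (e * t)\<^sup>2 / 2)) * cis (- (t * x)))
       = complex_of_real (sqrt (2 * pi) / e * exp (- (x / e)\<^sup>2 / 2))"
    using 1 assms unfolding eq by (simp add: field_simps scaleR_conv_of_real)
qed

lemma lborel_integral_prod:
  fixes f :: "'a::euclidean_space => real => complex"
  assumes "!!b. b \<in> Basis ==> integrable lborel (f b)"
  shows "integrable lborel (%x. \<Prod>b\<in>Basis. f b (x \<bullet> b))"
    and "(LINT x|lborel. (\<Prod>b\<in>Basis. f b (x \<bullet> b))) = (\<Prod>b\<in>Basis. LINT t|lborel. f b t)"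
proof -
  interpret product_sigma_finite "%_::'a. lborel :: real measure" ..
  have [measurable]: "b \<in> Basis ==> f b \<in> borel_measurable borel" for b
    using assms by auto
  have m: "(%x. \<Prod>b\<in>Basis. f b (x \<bullet> b)) \<in> borel_measurable borel"
    by measurable
  have T: "(%y. \<Sum>b\<in>Basis. y b *\<^sub>R b) \<in> measurable (\<Pi>\<^sub>M b\<in>(Basis::'a set). lborel) borel"
    by measurable
  have eq: "(\<Prod>b\<in>Basis. f b ((\<Sum>c\<in>Basis. y c *\<^sub>R c) \<bullet> b)) = (\<Prod>b\<in>Basis. f b (y b))" for y
    by (intro prod.cong) (auto simp: inner_sum_left_Basis)
  show "integrable lborel (%x. \<Prod>b\<in>Basis. f b (x \<bullet> b))"
    by (subst lborel_eq, subst integrable_distr_eq[OF T m]) (simp add: eq product_integrable_prod assms)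
  show "(LINT x|lborel. (\<Prod>b\<in>Basis. f b (x \<bullet> b))) = (\<Prod>b\<in>Basis. LINT t|lborel. f b t)"
    by (subst lborel_eq, subst integral_distr[OF T m]) (simp add: eq product_integral_prod assms)
qed

definition gauss :: "real => 'a::euclidean_space => real" where
  "gauss e \<xi> = exp (- (norm (e *\<^sub>R \<xi>))\<^sup>2 / 2)"

lemma gauss_prod: "gauss e \<xi> = (\<Prod>b\<in>Basis. exp (- (e * (\<xi> \<bullet> b))\<^sup>2 / 2))"
proof -
  have "(norm (e *\<^sub>R \<xi>))\<^sup>2 = (\<Sum>b\<in>Basis. (e * (\<xi> \<bullet> b))\<^sup>2)"
    unfolding power2_norm_eq_inner by (subst euclidean_inner) (simp add: power2_eq_square)
  then have "- (norm (e *\<^sub>R \<xi>))\<^sup>2 / 2 = (\<Sum>b\<in>Basis. - (e * (\<xi> \<bullet> b))\<^sup>2 / 2)"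
    by (simp add: sum_negf sum_divide_distrib)
  then show ?thesis unfolding gauss_def by (simp add: exp_sum)
qed

lemma cis_sum: "finite A ==> cis (\<Sum>i\<in>A. f i) = (\<Prod>i\<in>A. cis (f i))"
  by (induction A rule: finite_induct) (auto simp: cis_mult[symmetric])

lemma gauss_fourier:
  fixes x :: "'a::euclidean_space"
  assumes "0 < e"
  shows "integrable lborel (%\<xi>::'a. complex_of_real (gauss e \<xi>))"
    and "fint (%\<xi>. complex_of_real (gauss e \<xi>)) x
      = complex_of_real ((sqrt (2 * pi) / e) ^ DIM('a) * gauss (1 / e) x)"
proof -
  have eq: "complex_of_real (gauss e \<xi>) * cis (- (\<xi> \<bullet> x))
     = (\<Prod>b\<in>Basis. complex_of_real (exp (- (e * (\<xi> \<bullet> b))\<^sup>2 / 2)) * cis (- ((\<xi> \<bullet> b) * (x \<bullet> b))))" for x \<xi> :: 'a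
    by (subst euclidean_inner[of \<xi> x]) (simp add: gauss_prod prod.distrib cis_sum flip: sum_negf)
  note I = lborel_integral_prod[of "%b t. complex_of_real (exp (- (e * t)\<^sup>2 / 2)) * cis (- (t * (x \<bullet> b)))" for x :: 'a]
  have "integrable lborel (%\<xi>::'a. complex_of_real (gauss e \<xi>) * cis (- (\<xi> \<bullet> 0)))"
    unfolding eq by (rule I) (rule gauss_fourier_1d[OF assms])
  then show "integrable lborel (%\<xi>::'a. complex_of_real (gauss e \<xi>))" by simp
  have "fint (%\<xi>. complex_of_real (gauss e \<xi>)) x = (LINT \<xi>|lborel. complex_of_real (gauss e \<xi>) * cis (- (\<xi> \<bullet> x)))"
    unfolding fint_def by (simp add: mult.commute)
  also have "\<dots> = (\<Prod>b\<in>Basis. LINT t|lborel. complex_of_real (exp (- (e * t)\<^sup>2 / 2)) * cis (- (t * (x \<bullet> b))))"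
    unfolding eq by (rule I(2)) (rule gauss_fourier_1d[OF assms])
  also have "\<dots> = (\<Prod>b\<in>Basis. complex_of_real (sqrt (2 * pi) / e * exp (- (1 / e * (x \<bullet> b))\<^sup>2 / 2)))"
    by (intro prod.cong refl) (subst gauss_fourier_1d(2)[OF assms], simp)
  also have "\<dots> = complex_of_real ((sqrt (2 * pi) / e) ^ DIM('a) * gauss (1 / e) x)"
    unfolding gauss_prod by (simp add: prod.distrib prod_constant prod_dividef power_divide)
  finally show "fint (%\<xi>. complex_of_real (gauss e \<xi>)) x
      = complex_of_real ((sqrt (2 * pi) / e) ^ DIM('a) * gauss (1 / e) x)" .
qed

lemma gauss_integrable: "0 < e ==> integrable lborel (gauss e :: 'a::euclidean_space => real)"
  using gauss_fourier(1)[of e] unfolding complex_of_real_integrable_eq by blast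

lemma gauss_measurable [measurable]: "gauss e \<in> borel_measurable borel"
  unfolding gauss_def by measurable

lemma gauss_integral:
  "(LINT x|lborel. gauss 1 (x::'a::euclidean_space)) = sqrt (2 * pi) ^ DIM('a)"
proof -
  have "fint (%\<xi>::'a. complex_of_real (gauss 1 \<xi>)) 0 = complex_of_real (LINT x|lborel. gauss 1 (x::'a))"
    unfolding fint_def by simp
  moreover have "fint (%\<xi>::'a. complex_of_real (gauss 1 \<xi>)) 0 = complex_of_real (sqrt (2 * pi) ^ DIM('a))"
    using gauss_fourier(2)[of 1 "0::'a"] by (simp add: gauss_def)
  ultimately show ?thesis by (metis of_real_eq_iff)
qed

lemma gauss_bounds [simp]: "0 < gauss e x" "0 <= gauss e x" "gauss e x <= 1" "\<bar>gauss e x\<bar> = gauss e x"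
  by (auto simp: gauss_def)


subsection \<open>Limits in L2\<close>

lemma cnj_measurable [measurable]: "cnj \<in> borel_measurable borel"
  by (intro borel_measurable_continuous_onI continuous_intros)

lemma integral_lborel_scale:
  fixes f :: "'a::euclidean_space => complex"
  assumes [measurable]: "f \<in> borel_measurable borel" and "0 < e"
  shows "(LINT x|lborel. f x) = complex_of_real (e ^ DIM('a)) * (LINT x|lborel. f (e *\<^sub>R x))"
proof -
  have "(LINT x|lborel. f x) = (LINT x|density (distr lborel borel (%x. 0 + e *\<^sub>R x)) (%_. ennreal (\<bar>e\<bar> ^ DIM('a))). f x)"
    using lborel_affine[of e "0::'a"] assms(2) by (simp add: ennreal_power)
  also have "\<dots> = complex_of_real (e ^ DIM('a)) * (LINT x|lborel. f (e *\<^sub>R x))"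
    using assms(2) by (subst integral_density) (auto simp: integral_distr scaleR_conv_of_real)
  finally show ?thesis .
qed

lemma fint_shift:
  fixes u :: "'a::euclidean_space => complex"
  assumes "u \<in> borel_measurable borel"
  shows "fint (%x. u (x + h)) \<xi> = cis (h \<bullet> \<xi>) * fint u \<xi>"
proof -
  note assms[measurable]
  have "fint (%x. u (x + h)) \<xi> = (LINT x|lborel. (%y. cis (h \<bullet> \<xi>) * (cis (- (y \<bullet> \<xi>)) * u y)) (x + h))"
    unfolding fint_def
  proof (intro Bochner_Integration.integral_cong refl)
    fix x
    have "cis (h \<bullet> \<xi>) * cis (- ((x + h) \<bullet> \<xi>)) = cis (- (x \<bullet> \<xi>))"
      unfolding cis_mult by (simp add: inner_add_left)
    then show "cis (- (x \<bullet> \<xi>)) * u (x + h) = (%y. cis (h \<bullet> \<xi>) * (cis (- (y \<bullet> \<xi>)) * u y)) (x + h)"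
      by (simp only: mult.assoc[symmetric])
  qed
  also have "\<dots> = (LINT y|lborel. cis (h \<bullet> \<xi>) * (cis (- (y \<bullet> \<xi>)) * u y))"
    by (rule integral_lborel_shift) measurable
  finally show ?thesis by (simp add: fint_def)
qed

section \<open>Plancherel's identity for functions in L1 and L2\<close>

text \<open>By Fubini the integral over h comes first; it is the transform of a translate of u, and
  the remaining integral over x is the conjugate of the transform of u.\<close>

lemma autocorrelation:
  fixes u :: "'a::euclidean_space => complex"
  defines "c \<equiv> %h. LINT x|lborel. u (x + h) * cnj (u x)"
  assumes u: "integrable lborel u"
  shows "integrable lborel c" "fint c \<xi> = complex_of_real ((norm (fint u \<xi>))\<^sup>2)"
proof -
  have [measurable]: "u \<in> borel_measurable borel" using u by auto
  define f where "f \<xi> x h = cis (- (h \<bullet> \<xi>)) * (u (x + h) * cnj (u x))" for \<xi> x h :: 'a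
  have uh: "integrable lborel (%h. u (x + h))" for x using integrable_lborel_shift[OF u, of x] by (simp add: add.commute)
  have fi: "integrable (lborel \<Otimes>\<^sub>M lborel) (case_prod (f \<xi>))" for \<xi>
  proof (rule lborel_pair.Fubini_integrable)
    show "case_prod (f \<xi>) \<in> borel_measurable (lborel \<Otimes>\<^sub>M lborel)" unfolding f_def[abs_def] by measurable
    have "(LINT h|lborel. norm (u (x + h))) = (LINT h|lborel. norm (u h))" for x
      using integral_lborel_shift[of "%h. norm (u h)" x] by (simp add: add.commute)
    then show "integrable lborel (%x. LINT h|lborel. norm (case (x, h) of (x, h) => f \<xi> x h))"
      using u by (simp add: f_def norm_mult)
    show "AE x in lborel. integrable lborel (%h. case (x, h) of (x, h) => f \<xi> x h)"
      using uh fint_integrand_integrable[OF integrable_mult_left[OF uh]] by (auto simp: f_def)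
  qed
  from lborel_pair.integrable_snd[OF fi[of 0]] show "integrable lborel c" by (simp add: f_def c_def)
  have "fint c \<xi> = (LINT h|lborel. LINT x|lborel. f \<xi> x h)" by (simp add: fint_def c_def f_def)
  also have "\<dots> = (LINT x|lborel. LINT h|lborel. f \<xi> x h)" by (rule lborel_pair.Fubini_integral[OF fi])
  also have "\<dots> = (LINT x|lborel. fint (%h. u (h + x)) \<xi> * cnj (u x))"
    by (simp add: f_def fint_def add.commute flip: mult.assoc)
  also have "\<dots> = (LINT x|lborel. fint u \<xi> * cnj (cis (- (x \<bullet> \<xi>)) * u x))"
    by (simp add: fint_shift cis_cnj mult_ac)
  also have "\<dots> = fint u \<xi> * cnj (fint u \<xi>)" by (simp only: fint_def integral_mult_right_zero Bochner_Integration.integral_cnj)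
  finally show "fint c \<xi> = complex_of_real ((norm (fint u \<xi>))\<^sup>2)" unfolding complex_norm_square .
qed

text \<open>
  Let \<open>c\<close> be the autocorrelation of \<open>u\<close>. The integral of its transform, which is the square of \<open>norm (fint u)\<close>,
  against a wide Gaussian is the integral of \<open>c\<close> against a narrow one, and \<open>c\<close> is continuous at \<open>0\<close>.
\<close>

lemma plancherel:
  fixes u :: "'a::euclidean_space => complex"
  assumes u: "integrable lborel u" "sqint lborel u"
  shows "sqint lborel (fint u)" "l2 lborel (fint u) = sqrt ((2 * pi) ^ DIM('a)) * l2 lborel u"
proof -
  have [measurable]: "u \<in> borel_measurable borel" using u by auto
  define c where "c h = (LINT x|lborel. u (x + h) * cnj (u x))" for h
  note c = autocorrelation[OF u(1), folded c_def[abs_def]]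
  have [measurable]: "c \<in> borel_measurable borel" using c(1) by auto
  \<comment> \<open>As e decreases to 0, \<open>gauss e\<close> increases to 1, so that monotone
    convergence applies.\<close>
  define e where "e n = 1 / real (Suc n)" for n
  have e: "0 < e n" "e \<longlonglongrightarrow> 0" for n using LIMSEQ_inverse_real_of_nat by (simp_all add: e_def[abs_def] inverse_eq_divide)
  define C where "C = sqrt (2 * pi) ^ DIM('a)"
  have C: "0 < C" "C * C = (2 * pi) ^ DIM('a)" unfolding C_def power_mult_distrib[symmetric] by simp_all
  have cu: "sqint lborel (%x. cnj (u x))" and cl: "l2 lborel (%x. cnj (u x)) = l2 lborel u"
    using u(2) by (simp_all add: sqint_def l2_def)
  have cn: "norm (c h) <= (l2 lborel u)\<^sup>2" for h
    using sqint_pairing(2)[OF sqint_shift(1)[OF u(2), of h] cu bounded_bilinear_mult, of 1]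
    by (simp add: c_def norm_mult sqint_shift(2)[OF u(2)] cl power2_eq_square)
  have c0: "(%n. c (e n *\<^sub>R s)) \<longlonglongrightarrow> complex_of_real ((l2 lborel u)\<^sup>2)" for s
  proof -
    have "(%n. e n *\<^sub>R s) \<longlonglongrightarrow> 0" by (rule tendsto_eq_intros e refl)+ simp
    from sqint_pairing_tendsto[OF sqint_shift(1)[OF u(2)] u(2) l2_translation_tendsto[OF u(2) this] cu cu _ bounded_bilinear_mult]
    have "(%n. c (e n *\<^sub>R s)) \<longlonglongrightarrow> (LINT x|lborel. u x * cnj (u x))" unfolding c_def by simp
    then show ?thesis unfolding l2_sq integral_complex_of_real[symmetric] by (simp flip: complex_norm_square)
  qed
  have nn: "(\<integral>\<^sup>+\<xi>. ennreal (gauss (e n) \<xi> * (norm (fint u \<xi>))\<^sup>2) \<partial>lborel) = ennreal (LINT \<xi>|lborel. gauss (e n) \<xi> * (norm (fint u \<xi>))\<^sup>2)" for n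
  proof (rule nn_integral_eq_integral)
    have "integrable lborel (%\<xi>. complex_of_real (gauss (e n) \<xi>) * fint c \<xi>)"
      by (rule Bochner_Integration.integrable_bound[OF integrable_mult_left[OF gauss_fourier(1)[OF e(1)[of n]], of "complex_of_real (LINT x|lborel. norm (c x))"]])
        (use fint_bound[OF c(1)] in \<open>auto simp: norm_mult intro!: mult_left_mono AE_I2 order_trans[OF _ abs_ge_self]\<close>)
    then show "integrable lborel (%\<xi>. gauss (e n) \<xi> * (norm (fint u \<xi>))\<^sup>2)"
      unfolding c(2) by (simp only: flip: of_real_mult) (simp only: complex_of_real_integrable_eq)
  qed simp
  have L: "(%n. LINT \<xi>|lborel. gauss (e n) \<xi> * (norm (fint u \<xi>))\<^sup>2) \<longlonglongrightarrow> C * C * (l2 lborel u)\<^sup>2"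
  proof -
    \<comment> \<open>After the substitution h = e s the narrow Gaussian becomes the fixed one
      \<open>gauss 1\<close>, and e remains only in the argument of c.\<close>
    have 1: "complex_of_real (LINT \<xi>|lborel. gauss (e n) \<xi> * (norm (fint u \<xi>))\<^sup>2) = (LINT s|lborel. C * (gauss 1 s * c (e n *\<^sub>R s)))" for n
    proof -
      have "complex_of_real (LINT \<xi>|lborel. gauss (e n) \<xi> * (norm (fint u \<xi>))\<^sup>2) = (LINT \<xi>|lborel. fint c \<xi> * complex_of_real (gauss (e n) \<xi>))"
        unfolding integral_complex_of_real[symmetric] c(2) by (simp add: mult.commute)
      also have "\<dots> = (LINT h|lborel. c h * fint (%\<xi>. complex_of_real (gauss (e n) \<xi>)) h)"
        by (rule fint_multiplication[OF c(1) gauss_fourier(1)[OF e(1)]])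
      also have "\<dots> = complex_of_real (e n ^ DIM('a)) * (LINT s|lborel. c (e n *\<^sub>R s) * fint (%\<xi>. complex_of_real (gauss (e n) \<xi>)) (e n *\<^sub>R s))"
        by (rule integral_lborel_scale[OF _ e(1)]) measurable
      also have "\<dots> = (LINT s|lborel. C * (gauss 1 s * c (e n *\<^sub>R s)))"
        unfolding integral_mult_right_zero[symmetric] gauss_fourier(2)[OF e(1)] using e(1)[of n]
        by (intro Bochner_Integration.integral_cong refl) (simp add: gauss_def C_def power_divide)
      finally show ?thesis .
    qed
    have 2: "(%n. LINT s|lborel. C * (gauss 1 s * c (e n *\<^sub>R s))) \<longlonglongrightarrow> (LINT s|(lborel::'a measure). C * (gauss 1 s * complex_of_real ((l2 lborel u)\<^sup>2)))"
    proof (rule integral_dominated_convergence[where w = "%s. C * (l2 lborel u)\<^sup>2 * gauss 1 s"])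
      show "AE s in lborel. norm (C * (gauss 1 s * c (e n *\<^sub>R s))) <= C * (l2 lborel u)\<^sup>2 * gauss 1 s" for n
        using C(1) cn by (intro AE_I2) (simp add: norm_mult mult.commute[of "gauss 1 _"] mult_right_mono)
    qed (auto intro!: AE_I2 tendsto_intros c0[unfolded of_real_power] gauss_integrable)
    have "(LINT s|(lborel::'a measure). C * (gauss 1 s * complex_of_real ((l2 lborel u)\<^sup>2))) = complex_of_real (C * C * (l2 lborel u)\<^sup>2)"
      by (simp add: gauss_integral integral_complex_of_real C_def flip: of_real_mult of_real_power)
    from 2[folded 1, unfolded this] show ?thesis by (simp only: tendsto_of_real_iff)
  qed
  \<comment> \<open>Monotone convergence of nonnegative integrals, as it is not yet known that the
    limit is finite.\<close>
  have "(%n. \<integral>\<^sup>+\<xi>. ennreal (gauss (e n) \<xi> * (norm (fint u \<xi>))\<^sup>2) \<partial>lborel) \<longlonglongrightarrow> (\<integral>\<^sup>+\<xi>. ennreal ((norm (fint u \<xi>))\<^sup>2) \<partial>lborel)"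
  proof (rule nn_integral_LIMSEQ)
    show "incseq (%n \<xi>. ennreal (gauss (e n) \<xi> * (norm (fint u \<xi>))\<^sup>2))"
    proof (intro incseq_SucI le_funI ennreal_leI mult_right_mono)
      fix n and \<xi> :: 'a
      have "(norm (e (Suc n) *\<^sub>R \<xi>))\<^sup>2 <= (norm (e n *\<^sub>R \<xi>))\<^sup>2"
        by (intro power_mono) (auto simp: e_def frac_le divide_right_mono intro!: mult_right_mono frac_le)
      then show "gauss (e n) \<xi> <= gauss (e (Suc n)) \<xi>" by (simp add: gauss_def)
    qed simp
    show "(%n. ennreal (gauss (e n) \<xi> * (norm (fint u \<xi>))\<^sup>2)) \<longlonglongrightarrow> ennreal ((norm (fint u \<xi>))\<^sup>2)" for \<xi>
      unfolding gauss_def by (intro tendsto_ennrealI) (auto intro!: tendsto_eq_intros e)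
  qed measurable
  from LIMSEQ_unique[OF this[unfolded nn] tendsto_ennrealI[OF L]]
  have eq: "(\<integral>\<^sup>+\<xi>. ennreal ((norm (fint u \<xi>))\<^sup>2) \<partial>lborel) = ennreal (C * C * (l2 lborel u)\<^sup>2)" .
  show sf: "sqint lborel (fint u)" unfolding sqint_iff_nn eq by simp
  have "(l2 lborel (fint u))\<^sup>2 = C * C * (l2 lborel u)\<^sup>2" using eq C by (simp add: nn_sq_l2[OF sf])
  then show "l2 lborel (fint u) = sqrt ((2 * pi) ^ DIM('a)) * l2 lborel u"
    unfolding C(2) using real_sqrt_unique[of "l2 lborel (fint u)"] by (simp add: real_sqrt_mult)
qed

section \<open>The Fourier transform on L2\<close>

definition trunc :: "real => ('a::euclidean_space => complex) => 'a => complex" where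
  "trunc R u x = indicator (cball 0 R) x *\<^sub>R u x"

lemma fint_trunc: "(LINT x:cball 0 R|lborel. cis (- (x \<bullet> \<xi>)) * u x) = fint (trunc R u) \<xi>"
  unfolding set_lebesgue_integral_def fint_def trunc_def by simp

lemma trunc_L12:
  assumes "sqint lborel u"
  shows "integrable lborel (trunc R u)" "sqint lborel (trunc R u)"
proof -
  have [measurable]: "u \<in> borel_measurable borel" using assms by (auto simp: sqint_def)
  have ind: "sqint lborel (indicator (cball 0 R) :: 'a => real)"
  proof -
    have "integrable lborel (indicator (cball (0::'a) R) :: 'a => real)"
      by (intro integrable_real_indicator emeasure_lborel_cball_finite) auto
    moreover have "(norm (indicator (cball (0::'a) R) x :: real))\<^sup>2 = indicator (cball 0 R) x" for x
      by (simp add: indicator_def)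
    ultimately show ?thesis unfolding sqint_def by simp
  qed
  have "trunc R u \<in> borel_measurable borel"
    unfolding trunc_def[abs_def] by (intro borel_measurable_scaleR borel_measurable_indicator) auto
  then have tm: "trunc R u \<in> borel_measurable lborel" by simp
  show "integrable lborel (trunc R u)"
    using integrable_norm_prod[OF ind assms] tm
    by (rule Bochner_Integration.integrable_bound) (auto simp: trunc_def)
  show "sqint lborel (trunc R u)"
    using assms tm by (rule sqint_bound(1)[of _ _ _ 1]) (auto simp: trunc_def indicator_def)
qed

lemma trunc_tendsto:
  assumes "sqint lborel u"
  shows "((%R. l2 lborel (%x. trunc R u x - u x)) \<longlongrightarrow> 0) at_top"
proof (rule tendsto_at_topI_sequentially)
  fix X :: "nat => real" assume X: "filterlim X at_top sequentially"
  show "(%n. l2 lborel (%x. trunc (X n) u x - u x)) \<longlonglongrightarrow> 0"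
  proof (rule l2_dominated_convergence(3)[where C = 1])
    show "AE x in lborel. (%n. trunc (X n) u x) \<longlonglongrightarrow> u x"
    proof (intro AE_I2 tendsto_eventually)
      fix x :: 'a
      have "\<forall>\<^sub>F n in sequentially. norm x <= X n" using X by (simp add: filterlim_at_top)
      then show "\<forall>\<^sub>F n in sequentially. trunc (X n) u x = u x"
        by eventually_elim (simp add: trunc_def)
    qed
    show "AE x in lborel. norm (trunc (X n) u x) <= 1 * norm (u x)" for n
      by (auto simp: trunc_def indicator_def)
  qed (use assms trunc_L12[OF assms] in \<open>auto simp: sqint_def\<close>)
qed

lemma nn_l2_tendsto_iff:
  assumes "!!i. sqint N (f i)"
  shows "((%i. \<integral>\<^sup>+x. ennreal ((norm (f i x))\<^sup>2) \<partial>N) \<longlongrightarrow> 0) F \<longleftrightarrow> ((%i. l2 N (f i)) \<longlongrightarrow> 0) F"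
proof -
  have "((%i. ennreal ((l2 N (f i))\<^sup>2)) \<longlongrightarrow> ennreal 0) F \<longleftrightarrow> ((%i. (l2 N (f i))\<^sup>2) \<longlongrightarrow> 0) F"
    by (rule tendsto_ennreal_iff) auto
  also have "\<dots> \<longleftrightarrow> ((%i. l2 N (f i)) \<longlongrightarrow> 0) F"
  proof
    assume "((%i. (l2 N (f i))\<^sup>2) \<longlongrightarrow> 0) F"
    then have "((%i. sqrt ((l2 N (f i))\<^sup>2)) \<longlongrightarrow> sqrt 0) F" by (rule tendsto_real_sqrt)
    then show "((%i. l2 N (f i)) \<longlongrightarrow> 0) F" by simp
  next
    assume "((%i. l2 N (f i)) \<longlongrightarrow> 0) F"
    then have "((%i. (l2 N (f i))\<^sup>2) \<longlongrightarrow> 0\<^sup>2) F" by (intro tendsto_intros)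
    then show "((%i. (l2 N (f i))\<^sup>2) \<longlongrightarrow> 0) F" by simp
  qed
  finally show ?thesis using assms by (simp add: nn_sq_l2)
qed

text \<open>The definition measures distances by integrals that may be infinite. Plancherel's
  identity for the truncations makes them finite, so that convergence can be stated with
  \<open>l2\<close>.\<close>

lemma has_fourier_iff:
  fixes u :: "'a::euclidean_space => complex"
  shows "has_fourier u U \<longleftrightarrow> sqint lborel u & sqint lborel U &
    ((%R. l2 lborel (%\<xi>. fint (trunc R u) \<xi> - U \<xi>)) \<longlongrightarrow> 0) at_top"
proof (cases "sqint lborel u & sqint lborel U")
  case True
  have s: "sqint lborel (%\<xi>. U \<xi> - fint (trunc R u) \<xi>)" for R
    using True plancherel(1)[OF trunc_L12[of u]] by (intro sqint_diff) auto
  show ?thesis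
    unfolding has_fourier_def in_L2_sqint fint_trunc nn_l2_tendsto_iff[OF s]
    by (simp add: l2_diff_commute[of _ U])
qed (auto simp: has_fourier_def in_L2_sqint)

lemma has_fourierD:
  assumes "has_fourier u U"
  shows "sqint lborel u" "sqint lborel U"
  using assms by (auto simp: has_fourier_iff)

text \<open>Any approximation in L1 and L2 may replace the truncations, because transforms are as
  far apart as the functions, up to a constant. This is what admits translates of truncations, which
  are not themselves truncations about 0.\<close>

lemma has_fourier_limit:
  fixes u :: "'a::euclidean_space => complex"
  assumes F: "F \<noteq> bot" and u: "sqint lborel u" and U: "sqint lborel U"
    and f: "!!i. integrable lborel (f i)" "!!i. sqint lborel (f i)"
    and lim: "((%i. l2 lborel (%x. f i x - u x)) \<longlongrightarrow> 0) F"
      "((%i. l2 lborel (%\<xi>. fint (f i) \<xi> - U \<xi>)) \<longlongrightarrow> 0) F"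
  shows "has_fourier u U"
proof -
  let ?C = "sqrt ((2 * pi) ^ DIM('a))"
  have C: "0 <= ?C" by simp
  have ff: "sqint lborel (fint (f i))" for i using plancherel(1) f by blast
  have t: "sqint lborel (trunc R u)" "integrable lborel (trunc R u)" "sqint lborel (fint (trunc R u))" for R
    using trunc_L12[OF u] plancherel(1) by auto
  have b: "l2 lborel (%\<xi>. fint (trunc R u) \<xi> - U \<xi>) <= ?C * l2 lborel (%x. trunc R u x - u x)" for R
  proof (rule tendsto_lowerbound[OF _ _ F])
    show "((%i. ?C * (l2 lborel (%x. trunc R u x - u x) + l2 lborel (%x. f i x - u x)) + l2 lborel (%\<xi>. fint (f i) \<xi> - U \<xi>))
       \<longlongrightarrow> ?C * l2 lborel (%x. trunc R u x - u x)) F"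
    proof -
      have "((%i. ?C * (l2 lborel (%x. trunc R u x - u x) + l2 lborel (%x. f i x - u x)) + l2 lborel (%\<xi>. fint (f i) \<xi> - U \<xi>))
       \<longlongrightarrow> ?C * (l2 lborel (%x. trunc R u x - u x) + 0) + 0) F"
        by (intro tendsto_add tendsto_mult tendsto_const lim)
      then show ?thesis by simp
    qed
    show "\<forall>\<^sub>F i in F. l2 lborel (%\<xi>. fint (trunc R u) \<xi> - U \<xi>)
      <= ?C * (l2 lborel (%x. trunc R u x - u x) + l2 lborel (%x. f i x - u x)) + l2 lborel (%\<xi>. fint (f i) \<xi> - U \<xi>)"
    proof (rule always_eventually, rule allI)
      fix i
      have "l2 lborel (%\<xi>. fint (trunc R u) \<xi> - U \<xi>)
        <= l2 lborel (%\<xi>. fint (trunc R u) \<xi> - fint (f i) \<xi>) + l2 lborel (%\<xi>. fint (f i) \<xi> - U \<xi>)"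
        by (rule l2_triangle[OF t(3) ff U])
      also have "l2 lborel (%\<xi>. fint (trunc R u) \<xi> - fint (f i) \<xi>) = ?C * l2 lborel (%x. trunc R u x - f i x)"
        using plancherel(2)[of "%x. trunc R u x - f i x"] t f fint_diff[OF t(2)[of R] f(1)[of i]] sqint_diff(1)[OF t(1) f(2)]
        by auto
      also have "\<dots> <= ?C * (l2 lborel (%x. trunc R u x - u x) + l2 lborel (%x. f i x - u x))"
        using l2_triangle[OF t(1)[of R] u f(2)[of i]] by (intro mult_left_mono C) (simp add: l2_diff_commute[of _ u])
      finally show "l2 lborel (%\<xi>. fint (trunc R u) \<xi> - U \<xi>)
        <= ?C * (l2 lborel (%x. trunc R u x - u x) + l2 lborel (%x. f i x - u x)) + l2 lborel (%\<xi>. fint (f i) \<xi> - U \<xi>)"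
        by simp
    qed
  qed
  have "((%R. l2 lborel (%\<xi>. fint (trunc R u) \<xi> - U \<xi>)) \<longlongrightarrow> 0) at_top"
  proof (rule Lim_null_comparison)
    show "\<forall>\<^sub>F R in at_top. norm (l2 lborel (%\<xi>. fint (trunc R u) \<xi> - U \<xi>)) <= ?C * l2 lborel (%x. trunc R u x - u x)"
      using b by (intro always_eventually) auto
    show "((%R. ?C * l2 lborel (%x. trunc R u x - u x)) \<longlongrightarrow> 0) at_top"
      using tendsto_mult_left[OF trunc_tendsto[OF u]] by simp
  qed
  with u U show ?thesis by (simp add: has_fourier_iff)
qed

lemma has_fourier_fint:
  assumes "integrable lborel u" "sqint lborel u"
  shows "has_fourier u (fint u)"
  using assms plancherel(1)[OF assms] by (intro has_fourier_limit[where F = sequentially and f = "%_. u"]) auto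

lemma has_fourier_ex:
  fixes u :: "'a::euclidean_space => complex"
  assumes u: "sqint lborel u"
  shows "\<exists>U. has_fourier u U"
proof -
  define f where "f n = trunc (real n) u" for n
  have f: "integrable lborel (f n)" "sqint lborel (f n)" "sqint lborel (fint (f n))" for n
    using trunc_L12[OF u] plancherel(1) by (auto simp: f_def)
  have "filterlim real at_top sequentially" by (rule filterlim_real_sequentially)
  from filterlim_compose[OF trunc_tendsto[OF u] this]
  have fu: "(%n. l2 lborel (%x. f n x - u x)) \<longlonglongrightarrow> 0" by (simp add: f_def)
  have "\<exists>U. sqint lborel U & (%n. l2 lborel (%\<xi>. fint (f n) \<xi> - U \<xi>)) \<longlonglongrightarrow> 0"
  proof (rule l2_complete[OF f(3)])
    let ?C = "sqrt ((2 * pi) ^ DIM('a))"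
    fix e :: real assume "0 < e"
    have C: "0 < ?C" by simp
    then have "0 < e / (2 * ?C)" using \<open>0 < e\<close> by simp
    then obtain M where M: "!!n. n \<ge> M ==> norm (l2 lborel (%x. f n x - u x) - 0) < e / (2 * ?C)"
      using LIMSEQ_D[OF fu] by blast
    have "l2 lborel (%\<xi>. fint (f m) \<xi> - fint (f n) \<xi>) < e" if "m \<ge> M" "n \<ge> M" for m n
    proof -
      have "l2 lborel (%\<xi>. fint (f m) \<xi> - fint (f n) \<xi>) = ?C * l2 lborel (%x. f m x - f n x)"
        using plancherel(2)[of "%x. f m x - f n x"] f fint_diff[OF f(1) f(1)] sqint_diff(1)[OF f(2) f(2)] by auto
      also have "\<dots> <= ?C * (l2 lborel (%x. f m x - u x) + l2 lborel (%x. f n x - u x))"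
        using l2_triangle[OF f(2)[of m] u f(2)[of n]] C by (intro mult_left_mono) (auto simp: l2_diff_commute[of _ u])
      also have "\<dots> < ?C * (e / (2 * ?C) + e / (2 * ?C))"
        using M[OF that(1)] M[OF that(2)] C by (intro mult_strict_left_mono add_strict_mono) auto
      also have "\<dots> = e" using C by (simp add: field_simps)
      finally show ?thesis .
    qed
    then show "\<exists>M. \<forall>m\<ge>M. \<forall>n\<ge>M. l2 lborel (%\<xi>. fint (f m) \<xi> - fint (f n) \<xi>) < e" by blast
  qed
  then obtain U where U: "sqint lborel U" "(%n. l2 lborel (%\<xi>. fint (f n) \<xi> - U \<xi>)) \<longlonglongrightarrow> 0" by blast
  from has_fourier_limit[OF _ u U(1) f(1,2) fu U(2)] show ?thesis by auto
qed

lemma has_fourier_l2: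
  fixes u :: "'a::euclidean_space => complex"
  assumes "has_fourier u U"
  shows "l2 lborel U = sqrt ((2 * pi) ^ DIM('a)) * l2 lborel u"
proof -
  note u = has_fourierD[OF assms]
  have t: "sqint lborel (trunc R u)" "integrable lborel (trunc R u)" "sqint lborel (fint (trunc R u))" for R
    using trunc_L12[OF u(1)] plancherel(1) by auto
  have "((%R. l2 lborel (fint (trunc R u))) \<longlongrightarrow> l2 lborel U) at_top"
    using assms by (intro l2_tendsto t u) (auto simp: has_fourier_iff)
  moreover have "((%R. l2 lborel (fint (trunc R u))) \<longlongrightarrow> sqrt ((2 * pi) ^ DIM('a)) * l2 lborel u) at_top"
    unfolding plancherel(2)[OF t(2,1)] by (intro tendsto_intros l2_tendsto t u trunc_tendsto)
  ultimately show ?thesis by (rule tendsto_unique[rotated]) simp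
qed

lemma has_fourier_add:
  assumes "has_fourier u U" "has_fourier v V"
  shows "has_fourier (%x. u x + v x) (%\<xi>. U \<xi> + V \<xi>)"
proof -
  note u = has_fourierD[OF assms(1)] and v = has_fourierD[OF assms(2)]
  note tu = trunc_L12[OF u(1)] and tv = trunc_L12[OF v(1)]
  have 1: "((%R. l2 lborel (%x. (trunc R u x + trunc R v x) - (u x + v x))) \<longlongrightarrow> 0) at_top"
  proof (rule Lim_null_comparison)
    show "\<forall>\<^sub>F R in at_top. norm (l2 lborel (%x. (trunc R u x + trunc R v x) - (u x + v x)))
      <= l2 lborel (%x. trunc R u x - u x) + l2 lborel (%x. trunc R v x - v x)"
      using sqint_add(2)[OF sqint_diff(1)[OF tu(2) u(1)] sqint_diff(1)[OF tv(2) v(1)]]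
      by (intro always_eventually) (simp add: algebra_simps)
    show "((%R. l2 lborel (%x. trunc R u x - u x) + l2 lborel (%x. trunc R v x - v x)) \<longlongrightarrow> 0) at_top"
      using tendsto_add[OF trunc_tendsto[OF u(1)] trunc_tendsto[OF v(1)]] by simp
  qed
  have f: "sqint lborel (fint (trunc R u))" "sqint lborel (fint (trunc R v))" for R
    using plancherel(1)[OF tu] plancherel(1)[OF tv] by auto
  have 2: "((%R. l2 lborel (%\<xi>. fint (%x. trunc R u x + trunc R v x) \<xi> - (U \<xi> + V \<xi>))) \<longlongrightarrow> 0) at_top"
  proof (rule Lim_null_comparison)
    show "\<forall>\<^sub>F R in at_top. norm (l2 lborel (%\<xi>. fint (%x. trunc R u x + trunc R v x) \<xi> - (U \<xi> + V \<xi>)))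
      <= l2 lborel (%\<xi>. fint (trunc R u) \<xi> - U \<xi>) + l2 lborel (%\<xi>. fint (trunc R v) \<xi> - V \<xi>)"
      using sqint_add(2)[OF sqint_diff(1)[OF f(1) u(2)] sqint_diff(1)[OF f(2) v(2)]]
      by (intro always_eventually) (simp add: fint_add[OF tu(1) tv(1)] algebra_simps)
    show "((%R. l2 lborel (%\<xi>. fint (trunc R u) \<xi> - U \<xi>) + l2 lborel (%\<xi>. fint (trunc R v) \<xi> - V \<xi>)) \<longlongrightarrow> 0) at_top"
      using assms by (intro tendsto_add_zero) (auto simp: has_fourier_iff)
  qed
  show ?thesis
    using u v tu tv 1 2
    by (intro has_fourier_limit[where F = at_top and f = "%R x. trunc R u x + trunc R v x"]) (auto intro: sqint_add)
qed

lemma sqint_cmult: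
  fixes u :: "'a => complex"
  assumes "sqint N u"
  shows "sqint N (%x. c * u x)" "l2 N (%x. c * u x) = norm c * l2 N u"
  using assms by (auto simp: sqint_def l2_def norm_mult power_mult_distrib real_sqrt_mult)

lemma has_fourier_cmult:
  assumes "has_fourier u U"
  shows "has_fourier (%x. c * u x) (%\<xi>. c * U \<xi>)"
proof -
  note u = has_fourierD[OF assms]
  note tu = trunc_L12[OF u(1)]
  have f: "sqint lborel (fint (trunc R u))" for R using plancherel(1) tu by auto
  have 1: "((%R. l2 lborel (%x. c * trunc R u x - c * u x)) \<longlongrightarrow> 0) at_top"
    using tendsto_mult_left[OF trunc_tendsto[OF u(1)], of "norm c"] sqint_cmult(2)[OF sqint_diff(1)[OF tu(2) u(1)]]
    by (simp add: right_diff_distrib)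
  have "((%R. norm c * l2 lborel (%\<xi>. fint (trunc R u) \<xi> - U \<xi>)) \<longlongrightarrow> norm c * 0) at_top"
    using assms by (intro tendsto_mult_left) (auto simp: has_fourier_iff)
  then have 2: "((%R. l2 lborel (%\<xi>. fint (%x. c * trunc R u x) \<xi> - c * U \<xi>)) \<longlongrightarrow> 0) at_top"
    using sqint_cmult(2)[OF sqint_diff(1)[OF f u(2)]] by (simp add: right_diff_distrib fint_cmult)
  show ?thesis
    using u tu 1 2 by (intro has_fourier_limit[where F = at_top and f = "%R x. c * trunc R u x"]) (auto intro: sqint_cmult)
qed

lemma has_fourier_diff:
  assumes "has_fourier u U" "has_fourier v V"
  shows "has_fourier (%x. u x - v x) (%\<xi>. U \<xi> - V \<xi>)"
  using has_fourier_add[OF assms(1) has_fourier_cmult[OF assms(2), of "-1"]] by simp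

lemma has_fourier_0: "has_fourier (%x. 0) (%x. 0)"
  using has_fourier_fint[of "%x. 0"] by (simp add: fint_def[abs_def])

lemma has_fourier_sum:
  assumes "finite A" "!!i. i \<in> A ==> has_fourier (u i) (U i)"
  shows "has_fourier (%x. \<Sum>i\<in>A. u i x) (%\<xi>. \<Sum>i\<in>A. U i \<xi>)"
  using assms by (induction A rule: finite_induct) (auto intro: has_fourier_add simp: has_fourier_0)

lemma has_fourier_unique:
  assumes "has_fourier u U" "has_fourier v V" "AE x in lborel. u x = v x"
  shows "AE \<xi> in lborel. U \<xi> = V \<xi>"
proof -
  have d: "has_fourier (%x. u x - v x) (%\<xi>. U \<xi> - V \<xi>)" by (rule has_fourier_diff[OF assms(1,2)])
  have "l2 lborel (%x. u x - v x) = l2 lborel (%x::'a. 0 :: complex)"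
    using has_fourierD(1)[OF d] assms(3) by (intro l2_cong_AE) (auto simp: sqint_def)
  then have "l2 lborel (%\<xi>. U \<xi> - V \<xi>) = 0" using has_fourier_l2[OF d] by simp
  then have "AE \<xi> in lborel. U \<xi> - V \<xi> = 0" using has_fourierD(2)[OF d] by (rule l2_eq_0_AE[rotated])
  then show ?thesis by simp
qed

lemma has_fourier_inj:
  assumes "has_fourier u U" "has_fourier v V" "AE \<xi> in lborel. U \<xi> = V \<xi>"
  shows "AE x in lborel. u x = v x"
proof -
  have d: "has_fourier (%x. u x - v x) (%\<xi>. U \<xi> - V \<xi>)" by (rule has_fourier_diff[OF assms(1,2)])
  have "l2 lborel (%\<xi>. U \<xi> - V \<xi>) = l2 lborel (%x::'a. 0 :: complex)"
    using has_fourierD(2)[OF d] assms(3) by (intro l2_cong_AE) (auto simp: sqint_def)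
  then have "l2 lborel (%x. u x - v x) = 0" using has_fourier_l2[OF d] by simp
  then have "AE x in lborel. u x - v x = 0" using has_fourierD(1)[OF d] by (rule l2_eq_0_AE[rotated])
  then show ?thesis by simp
qed

lemma has_fourier_cong:
  assumes "has_fourier u U" "AE x in lborel. u x = v x" "v \<in> borel_measurable borel"
    "AE \<xi> in lborel. U \<xi> = V \<xi>" "V \<in> borel_measurable borel"
  shows "has_fourier v V"
proof -
  have v: "sqint lborel v" and V: "sqint lborel V"
    using has_fourierD[OF assms(1)] assms by (auto intro: sqint_cong_AE)
  obtain V' where V': "has_fourier v V'" using has_fourier_ex[OF v] by blast
  have eq: "AE \<xi> in lborel. V' \<xi> = V \<xi>"
    using has_fourier_unique[OF assms(1) V' assms(2)] assms(4) by eventually_elim simp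
  have "l2 lborel (%\<xi>. fint (trunc R v) \<xi> - V' \<xi>) = l2 lborel (%\<xi>. fint (trunc R v) \<xi> - V \<xi>)" for R
  proof (rule l2_cong_AE)
    have [measurable]: "fint (trunc R v) \<in> borel_measurable borel"
      using trunc_L12[OF v, of R] by (intro fint_measurable) auto
    have [measurable]: "V' \<in> borel_measurable borel" using has_fourierD[OF V'] by (auto simp: sqint_def)
    note assms(5)[measurable]
    show "(%\<xi>. fint (trunc R v) \<xi> - V' \<xi>) \<in> borel_measurable lborel" by measurable
    show "(%\<xi>. fint (trunc R v) \<xi> - V \<xi>) \<in> borel_measurable lborel" by measurable
    show "AE \<xi> in lborel. fint (trunc R v) \<xi> - V' \<xi> = fint (trunc R v) \<xi> - V \<xi>"
      using eq by eventually_elim simp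
  qed
  with V' V show ?thesis by (simp add: has_fourier_iff)
qed


subsection \<open>Inversion, translation and reality\<close>

lemma sqint_cis_mult:
  fixes U :: "'a::euclidean_space => complex"
  assumes "sqint lborel U"
  shows "sqint lborel (%\<xi>. cis (h \<bullet> \<xi>) * U \<xi>)" "l2 lborel (%\<xi>. cis (h \<bullet> \<xi>) * U \<xi>) = l2 lborel U"
proof -
  have [measurable]: "U \<in> borel_measurable borel" using assms by (auto simp: sqint_def)
  show "sqint lborel (%\<xi>. cis (h \<bullet> \<xi>) * U \<xi>)"
    by (rule sqint_bound(1)[OF assms, of _ 1]) (auto simp: norm_mult)
  show "l2 lborel (%\<xi>. cis (h \<bullet> \<xi>) * U \<xi>) = l2 lborel U"
    by (simp add: l2_def norm_mult)
qed

lemma has_fourier_shift: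
  fixes u :: "'a::euclidean_space => complex"
  assumes "has_fourier u U"
  shows "has_fourier (%x. u (x + h)) (%\<xi>. cis (h \<bullet> \<xi>) * U \<xi>)"
proof -
  note u = has_fourierD[OF assms]
  note tu = trunc_L12[OF u(1)]
  have f: "sqint lborel (fint (trunc R u))" for R using plancherel(1)[OF tu] .
  have m: "trunc R u \<in> borel_measurable borel" for R using tu by (auto simp: sqint_def)
  have 1: "((%R. l2 lborel (%x. trunc R u (x + h) - u (x + h))) \<longlongrightarrow> 0) at_top"
    using trunc_tendsto[OF u(1)] sqint_shift(2)[OF sqint_diff(1)[OF tu(2) u(1)], where h = h] by simp
  have "l2 lborel (%\<xi>. cis (h \<bullet> \<xi>) * fint (trunc R u) \<xi> - cis (h \<bullet> \<xi>) * U \<xi>)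
      = l2 lborel (%\<xi>. fint (trunc R u) \<xi> - U \<xi>)" for R
    using sqint_cis_mult(2)[OF sqint_diff(1)[OF f u(2)], where h = h] by (simp add: right_diff_distrib)
  then have 2: "((%R. l2 lborel (%\<xi>. fint (%x. trunc R u (x + h)) \<xi> - cis (h \<bullet> \<xi>) * U \<xi>)) \<longlongrightarrow> 0) at_top"
    using assms by (simp add: fint_shift[OF m] has_fourier_iff)
  show ?thesis
    using tu integrable_lborel_shift[OF tu(1)] sqint_shift(1)[OF tu(2)] sqint_shift(1)[OF u(1)] sqint_cis_mult(1)[OF u(2)] 1 2
    by (intro has_fourier_limit[where F = at_top and f = "%R x. trunc R u (x + h)"]) auto
qed

lemma sqint_uminus:
  fixes u :: "'a::euclidean_space => 'b::euclidean_space"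
  assumes "sqint lborel u"
  shows "sqint lborel (%x. u (- x))" "l2 lborel (%x. u (- x)) = l2 lborel u"
proof -
  have [measurable]: "u \<in> borel_measurable borel" using assms by (auto simp: sqint_def)
  show "sqint lborel (%x. u (- x))"
    using assms integrable_lborel_uminus[of "%x. (norm (u x))\<^sup>2"] by (auto simp: sqint_def)
  show "l2 lborel (%x. u (- x)) = l2 lborel u"
    unfolding l2_def using integral_lborel_uminus[of "%x. (norm (u x))\<^sup>2"] by simp
qed

lemma sqint_cnj:
  assumes "sqint N u"
  shows "sqint N (%x. cnj (u x))" "l2 N (%x. cnj (u x)) = l2 N u"
  using assms by (auto simp: sqint_def l2_def)

lemma has_fourier_cnj:
  fixes u :: "'a::euclidean_space => complex"
  assumes "has_fourier u U"
  shows "has_fourier (%x. cnj (u x)) (%\<xi>. cnj (U (- \<xi>)))"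
proof -
  note u = has_fourierD[OF assms]
  note tu = trunc_L12[OF u(1)]
  have f: "sqint lborel (fint (trunc R u))" for R using plancherel(1)[OF tu] .
  have 1: "((%R. l2 lborel (%x. cnj (trunc R u x) - cnj (u x))) \<longlongrightarrow> 0) at_top"
    using trunc_tendsto[OF u(1)] sqint_cnj(2)[OF sqint_diff(1)[OF tu(2) u(1)]] by simp
  have "l2 lborel (%\<xi>. cnj (fint (trunc R u) (- \<xi>)) - cnj (U (- \<xi>)))
      = l2 lborel (%\<xi>. fint (trunc R u) \<xi> - U \<xi>)" for R
    using sqint_cnj(2)[OF sqint_uminus(1)[OF sqint_diff(1)[OF f u(2)]]] sqint_uminus(2)[OF sqint_diff(1)[OF f u(2)]]
    by simp
  then have 2: "((%R. l2 lborel (%\<xi>. fint (%x. cnj (trunc R u x)) \<xi> - cnj (U (- \<xi>)))) \<longlongrightarrow> 0) at_top"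
    using assms by (simp add: fint_cnj has_fourier_iff)
  show ?thesis
    using tu sqint_cnj(1)[OF tu(2)] sqint_cnj(1)[OF u(1)] sqint_cnj(1)[OF sqint_uminus(1)[OF u(2)]] 1 2
    by (intro has_fourier_limit[where F = at_top and f = "%R x. cnj (trunc R u x)"]) auto
qed

lemma has_fourier_multiplication:
  fixes u v :: "'a::euclidean_space => complex"
  assumes "has_fourier u U" "has_fourier v V"
  shows "(LINT x|lborel. U x * v x) = (LINT x|lborel. u x * V x)"
proof -
  note u = has_fourierD[OF assms(1)] and v = has_fourierD[OF assms(2)]
  note tu = trunc_L12[OF u(1)] and tv = trunc_L12[OF v(1)]
  have f: "sqint lborel (fint (trunc R u))" "sqint lborel (fint (trunc R v))" for R
    using plancherel(1)[OF tu] plancherel(1)[OF tv] by auto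
  have "((%R. LINT x|lborel. fint (trunc R u) x * trunc R v x) \<longlongrightarrow> (LINT x|lborel. U x * v x)) at_top"
    using assms by (intro sqint_pairing_tendsto f u v tu tv trunc_tendsto bounded_bilinear_mult) (auto simp: has_fourier_iff)
  moreover have "((%R. LINT x|lborel. trunc R u x * fint (trunc R v) x) \<longlongrightarrow> (LINT x|lborel. u x * V x)) at_top"
    using assms by (intro sqint_pairing_tendsto f u v tu tv trunc_tendsto bounded_bilinear_mult) (auto simp: has_fourier_iff)
  moreover have "(LINT x|lborel. fint (trunc R u) x * trunc R v x) = (LINT x|lborel. trunc R u x * fint (trunc R v) x)" for R
    by (rule fint_multiplication[OF tu(1) tv(1)])
  ultimately show ?thesis using tendsto_unique[OF trivial_limit_at_top_linorder] by fastforce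
qed

text \<open>
  Surjectivity: for \<open>w\<close> the transform of the conjugate of \<open>U\<close>, the function
  \<open>u = (2\<pi>)\<^bsup>-d\<^esup> cnj w\<close> has transform \<open>U\<close>, since the squared distance of its transform to \<open>U\<close>
  expands to \<open>(2\<pi>)\<^sup>d |u|\<^sup>2 (1 - 2 + 1) = 0\<close>.
\<close>

lemma has_fourier_inverse:
  fixes U :: "'a::euclidean_space => complex"
  assumes w: "has_fourier (%\<xi>. cnj (U \<xi>)) w" and [measurable]: "U \<in> borel_measurable borel"
  shows "has_fourier (%x. cnj (w x) / complex_of_real ((2 * pi) ^ DIM('a))) U"
proof -
  define c where "c = (2 * pi) ^ DIM('a)"
  have c: "0 < c" by (simp add: c_def)
  define u where "u x = cnj (w x) / complex_of_real c" for x
  have U: "sqint lborel U" using sqint_cnj(1)[OF has_fourierD(1)[OF w]] by simp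
  have ws: "sqint lborel w" using has_fourierD(2)[OF w] .
  have [measurable]: "w \<in> borel_measurable borel" using ws by (auto simp: sqint_def)
  have us: "sqint lborel u"
    using sqint_cmult(1)[OF sqint_cnj(1)[OF ws], of "1 / complex_of_real c"] by (simp add: u_def[abs_def])
  obtain V where V: "has_fourier u V" using has_fourier_ex[OF us] by blast
  note Vs = has_fourierD(2)[OF V]
  have u2: "(l2 lborel u)\<^sup>2 * c\<^sup>2 = (l2 lborel w)\<^sup>2"
  proof -
    have "l2 lborel u = norm (complex_of_real (1 / c)) * l2 lborel w"
      using sqint_cmult(2)[OF sqint_cnj(1)[OF ws], of "complex_of_real (1 / c)"] sqint_cnj(2)[OF ws]
      by (simp add: u_def[abs_def])
    then show ?thesis using c by (simp add: power_mult_distrib norm_divide power_divide)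
  qed
  have V2: "(l2 lborel V)\<^sup>2 = c * (l2 lborel u)\<^sup>2"
    using has_fourier_l2[OF V] c by (simp add: power_mult_distrib c_def)
  have "(l2 lborel w)\<^sup>2 = c * (l2 lborel U)\<^sup>2"
    using has_fourier_l2[OF w] sqint_cnj(2)[OF U] c by (simp add: power_mult_distrib c_def)
  then have w2: "c * (l2 lborel U)\<^sup>2 = (l2 lborel w)\<^sup>2" by (rule sym)
  have U2: "(l2 lborel U)\<^sup>2 = c * (l2 lborel u)\<^sup>2"
  proof -
    have "c * (l2 lborel U)\<^sup>2 = c * (c * (l2 lborel u)\<^sup>2)"
    proof -
      have "c * (l2 lborel U)\<^sup>2 = (l2 lborel w)\<^sup>2" by fact
      also have "\<dots> = (l2 lborel u)\<^sup>2 * c\<^sup>2" by (rule u2[symmetric])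
      finally show ?thesis by (simp only: power2_eq_square mult_ac)
    qed
    then show ?thesis using c by simp
  qed
  have i1: "integrable lborel (%x. V x * cnj (U x))"
    by (rule sqint_pairing(1)[OF Vs sqint_cnj(1)[OF U] bounded_bilinear_mult, where K = 1]) (simp_all add: norm_mult)
  \<comment> \<open>The cross term in the expansion of the squared distance. The multiplication
    formula moves the transform to the other factor, where w is a multiple of the conjugate of
    u.\<close>
  have "(LINT x|lborel. V x * cnj (U x)) = (LINT x|lborel. u x * w x)"
    by (rule has_fourier_multiplication[OF V w])
  also have "\<dots> = (LINT x|lborel. complex_of_real (c * (norm (u x))\<^sup>2))"
  proof (intro Bochner_Integration.integral_cong refl)
    fix x
    have "w x = complex_of_real c * cnj (u x)" using c by (simp add: u_def)
    then show "u x * w x = complex_of_real (c * (norm (u x))\<^sup>2)"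
      by (simp add: mult_ac flip: complex_norm_square)
  qed
  also have "\<dots> = complex_of_real (c * (l2 lborel u)\<^sup>2)"
    unfolding l2_sq integral_complex_of_real by simp
  finally have "Re (LINT x|lborel. V x * cnj (U x)) = c * (l2 lborel u)\<^sup>2" by simp
  then have VU: "(LINT x|lborel. Re (V x * cnj (U x))) = c * (l2 lborel u)\<^sup>2"
    by (simp only: integral_Re[OF i1])
  have iV: "integrable lborel (%x. (norm (V x))\<^sup>2)" and iU: "integrable lborel (%x. (norm (U x))\<^sup>2)"
    using Vs U by (auto simp: sqint_def)
  have iR: "integrable lborel (%x. Re (V x * cnj (U x)))"
    using i1 by (rule integrable_Re)
  have iR2: "integrable lborel (%x. 2 * Re (V x * cnj (U x)))"
    using iR by (intro integrable_mult_right)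
  have "(l2 lborel (%x. V x - U x))\<^sup>2 = (LINT x|lborel. (norm (V x))\<^sup>2 - 2 * Re (V x * cnj (U x)) + (norm (U x))\<^sup>2)"
    unfolding l2_sq
  proof (intro Bochner_Integration.integral_cong refl)
    fix x
    show "(norm (V x - U x))\<^sup>2 = (norm (V x))\<^sup>2 - 2 * Re (V x * cnj (U x)) + (norm (U x))\<^sup>2"
      by (simp add: cmod_power2 power2_diff)
  qed
  also have "\<dots> = (LINT x|lborel. (norm (V x))\<^sup>2) - 2 * (LINT x|lborel. Re (V x * cnj (U x))) + (LINT x|lborel. (norm (U x))\<^sup>2)"
    by (simp only: Bochner_Integration.integral_add[OF Bochner_Integration.integrable_diff[OF iV iR2] iU]
      Bochner_Integration.integral_diff[OF iV iR2] integral_mult_right_zero)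
  also have "\<dots> = (l2 lborel V)\<^sup>2 - 2 * (c * (l2 lborel u)\<^sup>2) + (l2 lborel U)\<^sup>2"
    unfolding VU l2_sq ..
  also have "\<dots> = 0" unfolding V2 U2 by simp
  finally have "l2 lborel (%x. V x - U x) = 0" by simp
  then have "AE x in lborel. V x - U x = 0"
    by (rule l2_eq_0_AE[rotated]) (intro sqint_diff Vs U)
  then have ae: "AE x in lborel. V x = U x" by simp
  have um: "u \<in> borel_measurable borel" using us by (simp add: sqint_def)
  have "has_fourier u U"
    by (rule has_fourier_cong[OF V AE_I2[OF refl] um ae assms(2)])
  then show ?thesis unfolding u_def[abs_def] c_def .
qed

lemma has_fourier_surj:
  fixes U :: "'a::euclidean_space => complex"
  assumes "sqint lborel U"
  shows "\<exists>u. has_fourier u U"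
proof -
  obtain w where "has_fourier (%\<xi>. cnj (U \<xi>)) w"
    using has_fourier_ex[OF sqint_cnj(1)[OF assms]] by blast
  then show ?thesis using has_fourier_inverse assms by (auto simp: sqint_def)
qed

lemma has_fourier_inverse_integral:
  fixes U :: "'a::euclidean_space => complex"
  assumes U: "integrable lborel U" "sqint lborel U"
  shows "has_fourier (%x. fint U (- x) / complex_of_real ((2 * pi) ^ DIM('a))) U"
proof -
  have "has_fourier (%\<xi>. cnj (U \<xi>)) (fint (%\<xi>. cnj (U \<xi>)))"
    using U sqint_cnj(1)[OF U(2)] by (intro has_fourier_fint) auto
  from has_fourier_inverse[OF this] U(2) show ?thesis by (simp add: fint_cnj sqint_def)
qed

section \<open>Transforms of real functions\<close>

definition rft :: "('a::euclidean_space => real) => ('a => complex) => bool" where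
  "rft u U \<longleftrightarrow> has_fourier (%x. complex_of_real (u x)) U"

lemma rft_hermitian:
  assumes "rft u U"
  shows "AE \<xi> in lborel. U (- \<xi>) = cnj (U \<xi>)"
proof -
  have "has_fourier (%x. complex_of_real (u x)) (%\<xi>. cnj (U (- \<xi>)))"
    using has_fourier_cnj[OF assms[unfolded rft_def]] by simp
  from has_fourier_unique[OF this assms[unfolded rft_def]]
  have "AE \<xi> in lborel. cnj (U (- \<xi>)) = U \<xi>" by simp
  then show ?thesis by eventually_elim (metis complex_cnj_cnj)
qed

text \<open>By the symmetry the inverse transform and its conjugate have the same transform, hence
  agree almost everywhere.\<close>

lemma rft_ex_hermitian:
  fixes U :: "'a::euclidean_space => complex"
  assumes U: "sqint lborel U" and h: "AE \<xi> in lborel. U (- \<xi>) = cnj (U \<xi>)"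
  shows "\<exists>u. rft u U"
proof -
  obtain v where v: "has_fourier v U" using has_fourier_surj[OF U] by blast
  have [measurable]: "v \<in> borel_measurable borel" "U \<in> borel_measurable borel"
    using has_fourierD[OF v] by (auto simp: sqint_def)
  have "has_fourier (%x. cnj (v x)) (%\<xi>. cnj (U (- \<xi>)))" by (rule has_fourier_cnj[OF v])
  then have "AE x in lborel. v x = cnj (v x)"
    by (rule has_fourier_inj[OF v]) (use h in eventually_elim, simp)
  then have "AE x in lborel. v x = complex_of_real (Re (v x))"
    by eventually_elim (auto simp: complex_eq_iff)
  from has_fourier_cong[OF v this, of U] have "has_fourier (%x. complex_of_real (Re (v x))) U" by simp
  then show ?thesis unfolding rft_def by (rule exI[of _ "%x. Re (v x)"])
qed

lemma rft_sqint:
  assumes "rft u U"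
  shows "sqint lborel u" "sqint lborel U" "u \<in> borel_measurable borel" "U \<in> borel_measurable borel"
proof -
  note r = has_fourierD[OF assms[unfolded rft_def]]
  have [measurable]: "(%x. complex_of_real (u x)) \<in> borel_measurable borel"
    using r(1) by (simp add: sqint_def)
  have "(%x. Re (complex_of_real (u x))) \<in> borel_measurable borel" by measurable
  then show m: "u \<in> borel_measurable borel" by simp
  then show "sqint lborel u" using r(1) by (simp add: sqint_def)
  show "sqint lborel U" by fact
  then show "U \<in> borel_measurable borel" by (simp add: sqint_def)
qed

lemma rft_ex:
  assumes "sqint lborel (u :: 'a::euclidean_space => real)"
  shows "\<exists>U. rft u U"
proof -
  have "sqint lborel (%x. complex_of_real (u x))" using assms by (auto simp: sqint_def)
  then show ?thesis unfolding rft_def by (rule has_fourier_ex)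
qed

lemma rft_l2: "rft (u :: 'a::euclidean_space => real) U ==> l2 lborel U = sqrt ((2 * pi) ^ DIM('a)) * l2 lborel u"
  using has_fourier_l2[of "%x. complex_of_real (u x)" U] by (simp add: rft_def l2_def)

lemma rft_cong:
  assumes "rft u U" "AE x in lborel. u x = v x" "v \<in> borel_measurable borel"
    "AE \<xi> in lborel. U \<xi> = V \<xi>" "V \<in> borel_measurable borel"
  shows "rft v V"
proof -
  have "AE x in lborel. complex_of_real (u x) = complex_of_real (v x)"
    using assms(2) by eventually_elim simp
  from has_fourier_cong[OF assms(1)[unfolded rft_def] this _ assms(4,5)] assms(3)
  show ?thesis unfolding rft_def by simp
qed

lemma rft_unique: "rft u U ==> rft v V ==> AE x in lborel. u x = v x ==> AE \<xi> in lborel. U \<xi> = V \<xi>"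
  unfolding rft_def by (erule has_fourier_unique) auto

lemma rft_inj:
  assumes "rft u U" "rft v V" "AE \<xi> in lborel. U \<xi> = V \<xi>"
  shows "AE x in lborel. u x = v x"
  using has_fourier_inj[OF assms(1,2)[unfolded rft_def] assms(3)] by simp

lemma rft_add: "rft u U ==> rft v V ==> rft (%x. u x + v x) (%\<xi>. U \<xi> + V \<xi>)"
  using has_fourier_add[of "%x. complex_of_real (u x)" U "%x. complex_of_real (v x)" V] by (simp add: rft_def)

lemma rft_diff: "rft u U ==> rft v V ==> rft (%x. u x - v x) (%\<xi>. U \<xi> - V \<xi>)"
  using has_fourier_diff[of "%x. complex_of_real (u x)" U "%x. complex_of_real (v x)" V] by (simp add: rft_def)

lemma rft_cmult: "rft u U ==> rft (%x. c * u x) (%\<xi>. complex_of_real c * U \<xi>)"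
  using has_fourier_cmult[of "%x. complex_of_real (u x)" U "complex_of_real c"] by (simp add: rft_def)

lemma rft_shift: "rft u U ==> rft (%x. u (x + h)) (%\<xi>. cis (h \<bullet> \<xi>) * U \<xi>)"
  using has_fourier_shift[of "%x. complex_of_real (u x)" U h] by (simp add: rft_def)

lemma rft_sum:
  assumes "finite A" "!!i. i \<in> A ==> rft (u i) (U i)"
  shows "rft (%x. \<Sum>i\<in>A. u i x) (%\<xi>. \<Sum>i\<in>A. U i \<xi>)"
  using has_fourier_sum[of A "%i x. complex_of_real (u i x)" U] assms by (simp add: rft_def)

text \<open>Taking the real part makes the inverse transform real everywhere instead of almost everywhere.\<close>

lemma rft_inverse_integral:
  fixes U :: "'a::euclidean_space => complex"
  assumes U: "integrable lborel U" "sqint lborel U" and h: "AE \<xi> in lborel. U (- \<xi>) = cnj (U \<xi>)"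
  shows "rft (%x. Re (fint U (- x)) / (2 * pi) ^ DIM('a)) U"
proof -
  note v = has_fourier_inverse_integral[OF U]
  obtain u where u: "rft u U" using rft_ex_hermitian[OF U(2) h] by blast
  note [measurable] = rft_sqint(4)[OF u]
  have "AE x in lborel. complex_of_real (u x) = fint U (- x) / complex_of_real ((2 * pi) ^ DIM('a))"
    by (rule has_fourier_inj[OF u[unfolded rft_def] v]) simp
  then have "AE x in lborel. u x = Re (fint U (- x)) / (2 * pi) ^ DIM('a)"
  proof eventually_elim
    case (elim x)
    from arg_cong[OF this, of Re] show ?case by (simp only: Re_divide_of_real Re_complex_of_real)
  qed
  from rft_cong[OF u this] show ?thesis by simp
qed

lemma rft_bound:
  assumes "rft u U" "integrable lborel U"
  shows "AE x in lborel. \<bar>u (x::'a::euclidean_space)\<bar> <= (LINT \<xi>|lborel. norm (U \<xi>))"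
proof -
  have "AE x in lborel. u x = Re (fint U (- x)) / (2 * pi) ^ DIM('a)"
    using rft_inverse_integral[OF assms(2) rft_sqint(2)[OF assms(1)] rft_hermitian[OF assms(1)]]
    by (rule rft_inj[OF assms(1)]) simp
  then show ?thesis
  proof eventually_elim
    case (elim x)
    have "\<bar>Re (fint U (- x))\<bar> <= (LINT \<xi>|lborel. norm (U \<xi>))"
      using fint_bound[OF assms(2)] abs_Re_le_cmod order_trans by blast
    \<comment> \<open>The normalising factor of the inverse transform is at least 1 and is dropped
      from the bound.\<close>
    moreover have "1 <= (2 * pi) ^ DIM('a)" using pi_ge_two by (intro one_le_power) auto
    ultimately have "\<bar>Re (fint U (- x))\<bar> / (2 * pi) ^ DIM('a) <= (LINT \<xi>|lborel. norm (U \<xi>)) / 1"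
      by (intro frac_le) auto
    then show ?case unfolding elim by (simp add: abs_divide)
  qed
qed

text \<open>This makes the \<open>SOME\<close> in \<open>fourier_mult\<close> usable. A witness
  exists because an even real symbol preserves Hermitian symmetry, and whichever witness is chosen
  has the stated transform because the transform of u is unique almost everywhere.\<close>

lemma fourier_mult_rft:
  fixes u :: "'a::euclidean_space => real"
  assumes u: "rft u U" and F: "!!\<xi>. F (- \<xi>) = F \<xi>" and s: "sqint lborel (%\<xi>. complex_of_real (F \<xi>) * U \<xi>)"
  shows "rft (fourier_mult F u) (%\<xi>. complex_of_real (F \<xi>) * U \<xi>)"
proof -
  let ?P = "%v. \<exists>U V. rft u U & rft v V & (AE \<xi> in lborel. V \<xi> = complex_of_real (F \<xi>) * U \<xi>)"
  have "AE \<xi> in lborel. complex_of_real (F (- \<xi>)) * U (- \<xi>) = cnj (complex_of_real (F \<xi>) * U \<xi>)"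
    using rft_hermitian[OF u] by eventually_elim (simp add: F)
  from rft_ex_hermitian[OF s this] obtain v where "rft v (%\<xi>. complex_of_real (F \<xi>) * U \<xi>)" by blast
  then have Pv: "?P v" using u by (intro exI[of _ U] exI[of _ "%\<xi>. complex_of_real (F \<xi>) * U \<xi>"]) auto
  from someI[of ?P, OF Pv] have "?P (SOME v. ?P v)" .
  moreover have "(SOME v. ?P v) = fourier_mult F u" by (simp add: fourier_mult_def rft_def)
  ultimately have "?P (fourier_mult F u)" by simp
  then obtain U' V where UV: "rft u U'" "rft (fourier_mult F u) V" "AE \<xi> in lborel. V \<xi> = complex_of_real (F \<xi>) * U' \<xi>"
    by blast
  have "AE \<xi> in lborel. V \<xi> = complex_of_real (F \<xi>) * U \<xi>"
    using UV(3) rft_unique[OF UV(1) u] by auto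
  from rft_cong[OF UV(2) _ _ this] show ?thesis using rft_sqint[OF UV(2)] s by (auto simp: sqint_def)
qed

subsection \<open>Bounded difference quotients\<close>

text \<open>L2 is for unknowns and remainders, Linf for coefficients. As a parameter, the exponent
  allows the calculus of difference quotients to be developed once for both.\<close>

datatype exponent = L2 | Linf

text \<open>The conjunct \<open>0 <= M\<close> is explicit for \<open>Linf\<close> and implied by
  nonnegativity of the norm for \<open>L2\<close>, so that a bound can always be multiplied into
  inequalities.\<close>

fun lpb :: "exponent => 'x measure => real => ('x => 'b::euclidean_space) => bool" where
  "lpb L2 N M f \<longleftrightarrow> sqint N f & l2 N f <= M"
| "lpb Linf N M f \<longleftrightarrow> f \<in> borel_measurable N & 0 <= M & (AE x in N. norm (f x) <= M)"

lemma lpbD: "lpb p N M f ==> f \<in> borel_measurable N" "lpb p N M f ==> 0 <= M"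
  by (cases p; auto simp: sqint_def intro: order_trans[OF l2_nonneg])+

lemma lpb_mono: "lpb p N M f ==> M <= M' ==> lpb p N M' f"
  by (cases p) (auto elim: eventually_mono)

lemma lpb_dominated:
  assumes "lpb p N M g" "f \<in> borel_measurable N" "AE x in N. norm (f x) <= C * norm (g x)" "0 <= C"
  shows "lpb p N (C * M) f"
proof (cases p)
  case L2
  with assms(1) sqint_bound[OF _ assms(2-4)] mult_left_mono[OF _ assms(4), of "l2 N g" M] show ?thesis by force
next
  case Linf
  then have "AE x in N. norm (g x) <= M" using assms(1) by simp
  with assms(3) have "AE x in N. norm (f x) <= C * M"
    by eventually_elim (use assms(4) in \<open>auto intro: order_trans mult_left_mono\<close>)
  then show ?thesis using Linf assms by simp
qed

lemma lpb_add:
  assumes "lpb p N A f" "lpb p N B g"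
  shows "lpb p N (A + B) (%x. f x + g x)"
proof (cases p)
  case L2
  then show ?thesis using assms sqint_add[of N f g] by auto
next
  case Linf
  then have "AE x in N. norm (f x) <= A" "AE x in N. norm (g x) <= B" using assms by auto
  then have "AE x in N. norm (f x + g x) <= A + B" by eventually_elim (rule norm_triangle_mono)
  then show ?thesis using Linf assms by (simp add: borel_measurable_add)
qed

text \<open>Division by the length of h makes a bound uniform in h equivalent to control of a
  derivative.\<close>

definition dq :: "'p::euclidean_space => ('p => 'b::euclidean_space) => 'p => 'b" where
  "dq h f x = (f (x + h) - f x) /\<^sub>R norm h"

text \<open>
  \<open>cls p N H k M f\<close> bounds by \<open>M\<close> the \<open>L\<^sup>p(N)\<close> norms of all iterated difference quotients of \<open>f\<close> of order at most
  \<open>k\<close> with steps in \<open>H\<close>.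
\<close>

primrec cls :: "exponent => 'p::euclidean_space measure => 'p set => nat => real => ('p => 'b::euclidean_space) => bool" where
  "cls p N H 0 M f \<longleftrightarrow> lpb p N M f"
| "cls p N H (Suc k) M f \<longleftrightarrow> lpb p N M f & (\<forall>h\<in>H. h \<noteq> 0 --> cls p N H k M (dq h f))"

lemma cls_lpb: "cls p N H k M f ==> lpb p N M f"
  by (cases k; simp)

lemmas cls_base = cls_lpb[where p = L2, simplified, THEN conjunct1] cls_lpb[where p = L2, simplified, THEN conjunct2]

lemmas cls_nonneg = lpbD(2)[OF cls_lpb]

lemma cls_mono: "cls p N H k M f ==> M <= M' ==> cls p N H k M' f"
  by (induction k arbitrary: f) (auto intro: lpb_mono)

lemma cls_Suc: "cls p N H (Suc k) M f ==> cls p N H k M f"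
  by (induction k arbitrary: f) auto

lemma cls_le: "cls p N H k M f ==> j <= k ==> cls p N H j M f"
  by (induction k) (auto simp: le_Suc_eq simp del: cls.simps dest: cls_Suc)

lemma dq_measurable [measurable]:
  assumes [measurable]: "f \<in> borel_measurable borel"
  shows "dq h f \<in> borel_measurable borel"
  unfolding dq_def[abs_def] by measurable

text \<open>Two instances are intended: the whole space with all shifts, and the strip with the
  horizontal ones, under which it is invariant.\<close>

locale shift_invariant =
  fixes N :: "'p::euclidean_space measure" and H :: "'p set"
  assumes sets_N [measurable_cong, simp]: "sets N = sets borel"
    and distr_N: "h \<in> H ==> distr N borel (%x. x + h) = N"
begin

lemma measurable_N [simp]: "borel_measurable N = borel_measurable borel"
  by (rule measurable_cong_sets) simp_all

lemma space_N [simp]: "space N = UNIV"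
  using sets_eq_imp_space_eq[OF sets_N] by simp

lemma AE_shift:
  assumes "AE x in N. P x" "h \<in> H"
  shows "AE x in N. P (x + h)"
proof -
  have "AE x in distr N borel (%x. x + h). P x" using assms(1) unfolding distr_N[OF assms(2)] .
  then show ?thesis by (rule AE_distrD[rotated]) (simp add: measurable_cong_sets[OF sets_N refl])
qed

lemma integral_N_shift:
  fixes f :: "'p => 'b::{banach, second_countable_topology}"
  assumes [measurable]: "f \<in> borel_measurable borel" and "h \<in> H"
  shows "(LINT x|N. f (x + h)) = (LINT x|N. f x)"
proof -
  have "(LINT x|N. f x) = (LINT x|distr N borel (%x. x + h). f x)" unfolding distr_N[OF assms(2)] ..
  also have "\<dots> = (LINT x|N. f (x + h))" by (rule integral_distr) (simp_all add: measurable_cong_sets[OF sets_N refl])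
  finally show ?thesis ..
qed

lemma integrable_N_shift:
  fixes f :: "'p => 'b::{banach, second_countable_topology}"
  assumes f: "integrable N f" and "h \<in> H"
  shows "integrable N (%x. f (x + h))"
proof -
  have fm: "f \<in> borel_measurable borel" using borel_measurable_integrable[OF f] by simp
  have "integrable (distr N borel (%x. x + h)) f" using f unfolding distr_N[OF assms(2)] .
  then show ?thesis
    by (subst (asm) integrable_distr_eq) (simp_all add: fm measurable_cong_sets[OF sets_N refl])
qed

lemma sqint_N_shift:
  fixes f :: "'p => 'b::euclidean_space"
  assumes "sqint N f" "h \<in> H"
  shows "sqint N (%x. f (x + h))" "l2 N (%x. f (x + h)) = l2 N f"
proof -
  have [measurable]: "f \<in> borel_measurable borel" using assms by (simp add: sqint_def)
  show "sqint N (%x. f (x + h))"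
    using assms integrable_N_shift[of "%x. (norm (f x))\<^sup>2" h] by (simp add: sqint_def)
  show "l2 N (%x. f (x + h)) = l2 N f"
    unfolding l2_def using integral_N_shift[of "%x. (norm (f x))\<^sup>2" h] assms by simp
qed

lemma cls_shift:
  fixes f :: "'p => 'b::euclidean_space"
  shows "cls p N H k M f ==> y \<in> H ==> cls p N H k M (%x. f (x + y))"
proof (induction k arbitrary: f)
  have lpb: "lpb p N M (%x. f (x + y))" if "lpb p N M f" "y \<in> H" for f :: "'p => 'b"
    using that sqint_N_shift[of f y] AE_shift[of "%x. norm (f x) <= M" y] by (cases p) auto
  have dq: "dq h (%x. f (x + y)) = (%x. dq h f (x + y))" for h and f :: "'p => 'b"
    by (simp add: dq_def[abs_def] add_ac)
  {
    case 0
    then show ?case using lpb by simp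
  next
    case (Suc k)
    then show ?case using lpb by (simp add: dq)
  }
qed

lemma cls_cong:
  fixes f :: "'p => 'b::euclidean_space"
  assumes "cls p N H k M f" "AE x in N. f x = g x" "g \<in> borel_measurable borel"
  shows "cls p N H k M g"
  using assms
proof (induction k arbitrary: f g)
  have lpb: "lpb p N M g" if "lpb p N M f" "AE x in N. f x = g x" "g \<in> borel_measurable borel" for f g :: "'p => 'b"
    proof -
    have "AE x in N. norm (g x) <= 1 * norm (f x)" using that(2) by eventually_elim simp
    then show ?thesis using lpb_dominated[OF that(1), of g 1] that(3) by simp
  qed
  {
    case 0
    then show ?case using lpb by simp
  next
    case (Suc k)
    have "cls p N H k M (dq h g)" if h: "h \<in> H" "h \<noteq> 0" for h
    proof (rule Suc.IH)
      show "AE x in N. dq h f x = dq h g x"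
        using Suc.prems(2) AE_shift[OF Suc.prems(2) h(1)] by eventually_elim (simp add: dq_def)
    qed (use Suc.prems h in auto)
    then show ?case using Suc.prems lpb by auto
  }
qed

lemma dq_add: "dq h (%x. f x + g x) = (%x. dq h f x + dq h g x)"
  by (simp add: dq_def[abs_def] algebra_simps)

lemma cls_add: "cls p N H k A f ==> cls p N H k B g ==> cls p N H k (A + B) (%x. f x + g x)"
  by (induction k arbitrary: f g) (auto simp: dq_add lpb_add)

lemma dq_prod:
  assumes "bounded_bilinear B"
  shows "dq h (%x. B (f x) (g x)) = (%x. B (dq h f x) (g (x + h)) + B (f x) (dq h g x))"
proof -
  interpret bounded_bilinear B by fact
  show ?thesis by (simp add: dq_def[abs_def] scaleR_left scaleR_right diff_left diff_right algebra_simps)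
qed

lemma measurable_bilinear:
  fixes f :: "'p => 'b::euclidean_space" and g :: "'p => 'c::euclidean_space"
    and B :: "'b => 'c => 'e::euclidean_space"
  assumes "bounded_bilinear B" and [measurable]: "f \<in> borel_measurable borel" "g \<in> borel_measurable borel"
  shows "(%x. B (f x) (g x)) \<in> borel_measurable borel"
proof -
  interpret bounded_bilinear B by fact
  have "continuous_on UNIV (%p. B (fst p) (snd p))" by (intro continuous_on continuous_intros)
  then show ?thesis by (rule borel_measurable_continuous_Pair[rotated 2]) measurable
qed

text \<open>The discrete Leibniz rule produces two terms per order, whence 2^k; invariance of the
  measure absorbs the shift in one of the factors.\<close>

lemma cls_prod:
  fixes f :: "'p => 'b::euclidean_space" and g :: "'p => 'c::euclidean_space"
    and B :: "'b => 'c => 'e::euclidean_space"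
  assumes B: "bounded_bilinear B" and K: "!!a b. norm (B a b) <= norm a * norm b * K" "0 <= K"
  shows "cls Linf N H k A f ==> cls p N H k M g ==> cls p N H k (2 ^ k * K * A * M) (%x. B (f x) (g x))"
proof (induction k arbitrary: f g)
  have base: "lpb p N (K * A * M) (%x. B (f x) (g x))"
    if f: "lpb Linf N A f" and g: "lpb p N M g" for f :: "'p => 'b" and g :: "'p => 'c"
  proof (rule lpb_dominated[OF g])
    have "AE x in N. norm (f x) <= A" using f by simp
    then show "AE x in N. norm (B (f x) (g x)) <= (K * A) * norm (g x)"
    proof eventually_elim
      case (elim x)
      have "norm (f x) * norm (g x) * K <= A * norm (g x) * K" using elim K by (intro mult_right_mono) auto
      with K(1)[of "f x" "g x"] show ?case by (simp add: mult_ac)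
    qed
    show "(%x. B (f x) (g x)) \<in> borel_measurable N"
      using measurable_bilinear[OF B] lpbD(1)[OF f] lpbD(1)[OF g] by simp
  qed (use K f in simp)
  {
    case 0
    then show ?case using base[of f g] by simp
  next
    case (Suc k)
    have nn: "0 <= A" "0 <= M" using Suc.prems cls_nonneg by blast+
    have "1 * (K * A * M) <= 2 ^ Suc k * (K * A * M)"
      using K(2) nn by (intro mult_right_mono one_le_power) auto
    then have "lpb p N (2 ^ Suc k * K * A * M) (%x. B (f x) (g x))"
      using Suc.prems by (intro lpb_mono[OF base[of f g]]) (auto simp: mult.assoc)
    moreover have "cls p N H k (2 ^ Suc k * K * A * M) (dq h (%x. B (f x) (g x)))" if h: "h \<in> H" "h \<noteq> 0" for h
    proof -
      have "cls p N H k (2 ^ k * K * A * M) (%x. B (dq h f x) (g (x + h)))"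
        using Suc.prems(1) h by (intro Suc.IH[OF _ cls_shift[OF cls_Suc[OF Suc.prems(2)] h(1)]]) simp
      moreover have "cls p N H k (2 ^ k * K * A * M) (%x. B (f x) (dq h g x))"
        using Suc.prems(2) h by (intro Suc.IH[OF cls_Suc[OF Suc.prems(1)]]) simp
      ultimately show ?thesis
        unfolding dq_prod[OF B] by (rule cls_mono[OF cls_add]) (simp add: mult_ac)
    qed
    ultimately show ?case by simp
  }
qed

lemma dq_const: "dq h (%x. c) = (%x. 0)"
  by (simp add: dq_def[abs_def])

lemma cls_const: "norm c <= M ==> cls Linf N H k M (%x. c)"
proof (induction k arbitrary: c)
  case (Suc k)
  have "0 <= M" using Suc.prems norm_ge_zero order_trans by blast
  with Suc show ?case by (simp add: dq_const)
qed (auto intro: order_trans[OF norm_ge_zero])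

lemma cls_linear:
  fixes f :: "'p => 'b::euclidean_space" and L :: "'b => 'c::euclidean_space"
  assumes L: "bounded_linear L" and K: "!!x. norm (L x) <= norm x * K" "0 <= K"
  shows "cls p N H k M f ==> cls p N H k (K * M) (%x. L (f x))"
proof (induction k arbitrary: f)
  interpret L: bounded_linear L by fact
  have Lm: "L \<in> borel_measurable borel"
    using L by (intro borel_measurable_continuous_onI linear_continuous_on)
  have lpb: "lpb p N (K * M) (%x. L (f x))" if "lpb p N M f" for f :: "'p => 'b"
    by (rule lpb_dominated[OF that measurable_compose[OF lpbD(1)[OF that] Lm] _ K(2)])
      (use K(1) in \<open>simp add: mult.commute\<close>)
  have "dq h (%x. L (f x)) = (%x. L (dq h f x))" for h and f :: "'p => 'b"
    by (simp add: dq_def[abs_def] L.scaleR L.diff)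
  note lpb = lpb and dq = this
  {
    case 0
    then show ?case using lpb by simp
  next
    case (Suc k)
    then show ?case using lpb by (simp add: dq)
  }
qed

lemma cls_scaleR: "cls p N H k M f ==> cls p N H k (\<bar>c\<bar> * M) (%x. c *\<^sub>R f x)"
  by (rule cls_linear[OF bounded_linear_scaleR_right]) auto

lemma cls_diff: "cls p N H k A f ==> cls p N H k B g ==> cls p N H k (A + B) (%x. f x - g x)"
  using cls_add[OF _ cls_scaleR[of p k B g "-1"], of A f] by simp

lemma cls_0: "0 <= M ==> cls p N H k M (%x. 0)"
  by (induction k; cases p) (auto simp: dq_const)

text \<open>The quotient rule dq (1 / f) = - dq f / (f f(. + h)) reduces one order to two product
  estimates of lower order. The constant is quantified before f, as uniformity over families
  demands.\<close>

lemma cls_inverse_ex: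
  assumes c: "0 < c"
  shows "\<exists>C. \<forall>f :: 'p => real. cls Linf N H k A f --> (AE x in N. c <= f x) --> cls Linf N H k C (%x. inverse (f x))"
proof (induction k)
  have base: "lpb Linf N (inverse c) (%x. inverse (f x))" if "lpb Linf N A f" "AE x in N. c <= f x" for f :: "'p => real"
  proof -
    have "AE x in N. norm (inverse (f x)) <= inverse c"
      using that(2) by eventually_elim (use c in \<open>auto intro: le_imp_inverse_le\<close>)
    then show ?thesis using that(1) c by (simp add: borel_measurable_inverse)
  qed
  {
    case 0
    then show ?case using base c by (intro exI[of _ "inverse c"]) simp
  next
    case (Suc k)
    then obtain C where C: "!!f :: 'p => real. cls Linf N H k A f ==> AE x in N. c <= f x ==> cls Linf N H k C (%x. inverse (f x))"
      by blast
    \<comment> \<open>The constant of two applications of \<open>cls_prod\<close>: first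
      \<open>dq h f\<close> (bound A) with 1 / f (bound C), then the result with the shifted
      reciprocal (bound C).\<close>
    define D where "D = 2 ^ k * 1 * (2 ^ k * 1 * A * C) * C"
    have "cls Linf N H (Suc k) (max (inverse c) D) (%x. inverse (f x))" if f: "cls Linf N H (Suc k) A f" "AE x in N. c <= f x" for f
    proof -
      have [measurable]: "f \<in> borel_measurable borel" using f by simp
      have i: "cls Linf N H k C (%x. inverse (f x))" using C[OF cls_Suc[OF f(1)] f(2)] .
      have "cls Linf N H k (max (inverse c) D) (dq h (%x. inverse (f x)))" if h: "h \<in> H" "h \<noteq> 0" for h
      proof (rule cls_cong)
        have df: "cls Linf N H k A (%x. - dq h f x)"
          using cls_scaleR[of Linf k A "dq h f" "-1"] f(1) h by simp
        have "cls Linf N H k D (%x. (- dq h f x * inverse (f x)) * inverse (f (x + h)))"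
          unfolding D_def
          by (intro cls_prod bounded_bilinear_mult df i cls_shift[OF i h(1)]) (simp_all add: abs_mult)
        then show "cls Linf N H k (max (inverse c) D) (%x. (- dq h f x * inverse (f x)) * inverse (f (x + h)))"
          by (rule cls_mono) simp
        show "AE x in N. (- dq h f x * inverse (f x)) * inverse (f (x + h)) = dq h (%x. inverse (f x)) x"
          using f(2) AE_shift[OF f(2) h(1)]
        proof eventually_elim
          case (elim x)
          then have "f x \<noteq> 0" "f (x + h) \<noteq> 0" using c by auto
          then have eq: "inverse (f (x + h)) - inverse (f x) = - (f (x + h) - f x) * inverse (f x) * inverse (f (x + h))"
            by (simp add: field_simps)
          show ?case unfolding dq_def eq by (simp add: algebra_simps)
        qed
      qed measurable
      moreover have "lpb Linf N (max (inverse c) D) (%x. inverse (f x))"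
        by (rule lpb_mono[OF base]) (use f in auto)
      ultimately show ?thesis by simp
    qed
    then show ?case by blast
  }
qed

end

interpretation leb: shift_invariant "lborel :: 'a::euclidean_space measure" UNIV
proof
  fix h :: 'a
  have "(%x. x + h) = (+) h" by (auto simp: add.commute)
  then show "distr lborel borel (%x. x + h) = lborel" by (simp add: lborel_distr_plus)
qed simp

subsection \<open>Difference quotients and the Fourier transform\<close>

lemma cis_minus_1_bound: "norm (cis x - 1) <= \<bar>x\<bar>"
  using iexp_approx1[of x 0] by (simp add: cis_conv_exp)

lemma cis_approx_2: "norm (cis x - 1 - \<i> * x) <= x\<^sup>2 / 2"
proof -
  have "norm (iexp x - (1 + \<i> * x)) <= x\<^sup>2 / 2"
    using iexp_approx1[of x 1] by (simp add: power2_eq_square)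
  then show ?thesis by (simp add: cis_conv_exp algebra_simps)
qed

text \<open>The Fourier symbol of \<open>dq h\<close>.\<close>

definition dqs :: "'a::euclidean_space => 'a => complex" where
  "dqs h \<xi> = (cis (h \<bullet> \<xi>) - 1) / complex_of_real (norm h)"

lemma dqs_measurable [measurable]: "dqs h \<in> borel_measurable borel"
  unfolding dqs_def[abs_def] by measurable

lemma dqs_bound: "h \<noteq> 0 ==> norm (dqs h \<xi>) <= norm \<xi>"
proof -
  assume h: "h \<noteq> 0"
  have "norm (cis (h \<bullet> \<xi>) - 1) <= norm h * norm \<xi>"
    using cis_minus_1_bound[of "h \<bullet> \<xi>"] Cauchy_Schwarz_ineq2[of h \<xi>] by linarith
  then show ?thesis using h by (simp add: dqs_def norm_divide divide_le_eq mult.commute)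
qed

lemma rft_dq:
  assumes "rft f U"
  shows "rft (dq h f) (%\<xi>. dqs h \<xi> * U \<xi>)"
proof -
  have "rft (%x. (1 / norm h) * (f (x + h) - f x)) (%\<xi>. complex_of_real (1 / norm h) * (cis (h \<bullet> \<xi>) * U \<xi> - U \<xi>))"
    by (intro rft_cmult rft_diff rft_shift assms)
  moreover have "(%x. (1 / norm h) * (f (x + h) - f x)) = dq h f"
    by (simp add: dq_def[abs_def] inverse_eq_divide)
  moreover have "(%\<xi>. complex_of_real (1 / norm h) * (cis (h \<bullet> \<xi>) * U \<xi> - U \<xi>)) = (%\<xi>. dqs h \<xi> * U \<xi>)"
    by (simp add: dqs_def left_diff_distrib)
  ultimately show ?thesis by simp
qed

text \<open>Integer powers multiply exactly, which matches one factor 1 + |\<xi>| per difference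
  quotient. The comparison with \<open>Lambda_symbol\<close> is left to the interface with Sobolev
  norms.\<close>

definition wt :: "nat => 'a::euclidean_space => real" where
  "wt k \<xi> = (1 + norm \<xi>) ^ k"

lemma wt_measurable [measurable]: "wt k \<in> borel_measurable borel"
  unfolding wt_def[abs_def] by measurable

lemma wt_pos [simp]: "0 < wt k \<xi>" "0 <= wt k \<xi>" "1 <= wt k \<xi>" "\<bar>wt k \<xi>\<bar> = wt k \<xi>" "wt k \<xi> \<noteq> 0"
proof -
  show 1: "1 <= wt k \<xi>" unfolding wt_def by (intro one_le_power) auto
  then show "0 < wt k \<xi>" by linarith
  then show "0 <= wt k \<xi>" "\<bar>wt k \<xi>\<bar> = wt k \<xi>" "wt k \<xi> \<noteq> 0" by auto
qed

lemma wt_add: "wt (j + k) \<xi> = wt j \<xi> * wt k \<xi>"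
  by (simp add: wt_def power_add)

lemma wt_Suc: "wt (Suc k) \<xi> = wt k \<xi> * (1 + norm \<xi>)"
  by (simp add: wt_def)

lemma wt_mono: "j <= k ==> wt j \<xi> <= wt k \<xi>"
  unfolding wt_def by (intro power_increasing) auto

lemma norm_wt_mult [simp]: "norm (complex_of_real (wt k \<xi>) * z) = wt k \<xi> * norm z"
  by (simp add: norm_mult)

lemma norm_pow_le_wt: "norm \<xi> ^ k <= wt k \<xi>"
  unfolding wt_def by (intro power_mono) auto

abbreviation wU :: "nat => ('a::euclidean_space => complex) => 'a => complex" where
  "wU k U \<equiv> (%\<xi>. complex_of_real (wt k \<xi>) * U \<xi>)"

lemma sqint_wU_le:
  assumes "sqint lborel (wU k U)" "U \<in> borel_measurable borel" "j <= k"
  shows "sqint lborel (wU j U)" "l2 lborel (wU j U) <= l2 lborel (wU k U)"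
proof -
  note assms(2)[measurable]
  have "AE \<xi> in lborel. norm (wU j U \<xi>) <= 1 * norm (wU k U \<xi>)"
  proof (rule AE_I2)
    fix \<xi> :: 'a
    show "norm (wU j U \<xi>) <= 1 * norm (wU k U \<xi>)"
      using mult_right_mono[OF wt_mono[OF assms(3), of \<xi>] norm_ge_zero[of "U \<xi>"]] by simp
  qed
  from sqint_bound[OF assms(1) _ this] show "sqint lborel (wU j U)" "l2 lborel (wU j U) <= l2 lborel (wU k U)"
    by auto
qed

lemma l2_le_rft:
  assumes "rft (u :: 'a::euclidean_space => real) U"
  shows "l2 lborel u <= l2 lborel U"
proof -
  have "1 <= (2 * pi) ^ DIM('a)" using pi_ge_two by (intro one_le_power) auto
  then have "1 <= sqrt ((2 * pi) ^ DIM('a))" by simp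
  then have "1 * l2 lborel u <= sqrt ((2 * pi) ^ DIM('a)) * l2 lborel u" by (intro mult_right_mono) auto
  then show ?thesis by (simp add: rft_l2[OF assms])
qed

lemma wU_dqs_le: "h \<noteq> 0 ==> norm (wU k (%\<xi>. dqs h \<xi> * U \<xi>) \<xi>) <= norm (wU (Suc k) U \<xi>)"
proof -
  assume "h \<noteq> 0"
  then have "norm (dqs h \<xi>) * norm (U \<xi>) <= (1 + norm \<xi>) * norm (U \<xi>)"
    using dqs_bound[of h \<xi>] by (intro mult_right_mono) auto
  then have "wt k \<xi> * (norm (dqs h \<xi>) * norm (U \<xi>)) <= wt k \<xi> * ((1 + norm \<xi>) * norm (U \<xi>))"
    by (intro mult_left_mono) auto
  then show ?thesis unfolding norm_wt_mult unfolding wt_Suc by (simp add: norm_mult mult_ac)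
qed

text \<open>The symbol of a difference quotient is bounded by |\<xi>| uniformly in the step, so each
  quotient consumes one weight.\<close>

lemma cls_of_rft:
  assumes "rft (f :: 'a::euclidean_space => real) U" "sqint lborel (wU k U)" "l2 lborel (wU k U) <= M"
  shows "cls L2 lborel UNIV k M f"
  using assms
proof (induction k arbitrary: f U)
  case 0
  then show ?case using l2_le_rft[OF 0(1)] rft_sqint[OF 0(1)] by (simp add: wt_def)
next
  case (Suc k)
  note [measurable] = rft_sqint(4)[OF Suc.prems(1)]
  note s0 = sqint_wU_le[OF Suc.prems(2) rft_sqint(4)[OF Suc.prems(1)], of 0]
  have "l2 lborel f <= M" using l2_le_rft[OF Suc.prems(1)] s0(2) Suc.prems(3) by (simp add: wt_def)
  moreover have "cls L2 lborel UNIV k M (dq h f)" if "h \<noteq> 0" for h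
    using sqint_bound[OF Suc.prems(2), of "wU k (%\<xi>. dqs h \<xi> * U \<xi>)" 1] Suc.prems(3) wU_dqs_le[OF that, where k = k and U = U]
    by (intro Suc.IH[OF rft_dq[OF Suc.prems(1)]]) auto
  ultimately show ?case using rft_sqint[OF Suc.prems(1)] by simp
qed

text \<open>The same count of weights, with the sup norm controlled by the L1 norm of the
  transform.\<close>

lemma cls_Linf_of_rft:
  assumes "rft (f :: 'a::euclidean_space => real) U" "integrable lborel (wU k U)" "(LINT \<xi>|lborel. norm (wU k U \<xi>)) <= M"
  shows "cls Linf lborel UNIV k M f"
  using assms
proof (induction k arbitrary: f U)
  have M: "0 <= M" using order_trans[OF Bochner_Integration.integral_nonneg_AE assms(3)] by simp
  {
    case 0
    then show ?case using rft_bound[OF 0(1)] rft_sqint[OF 0(1)] M by (auto simp: wt_def elim!: eventually_mono)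
  next
    case (Suc k)
    note Um = rft_sqint(4)[OF Suc.prems(1)]
    note Um[measurable]
    have iU: "integrable lborel U"
      by (rule Bochner_Integration.integrable_bound[OF Suc.prems(2)])
        (auto simp: mult_le_cancel_right1 simp del: of_real_mult intro!: AE_I2)
    have "(LINT \<xi>|lborel. norm (U \<xi>)) <= (LINT \<xi>|lborel. norm (wU (Suc k) U \<xi>))"
      using iU Suc.prems(2) by (intro integral_mono integrable_norm) (auto simp: mult_le_cancel_right1)
    then have "AE x in lborel. norm (f x) <= M" using rft_bound[OF Suc.prems(1) iU] Suc.prems(3) by (auto elim!: eventually_mono)
    moreover have "cls Linf lborel UNIV k M (dq h f)" if "h \<noteq> 0" for h
    proof (rule Suc.IH[OF rft_dq[OF Suc.prems(1)]])
      note le = wU_dqs_le[OF that, where k = k and U = U]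
      show i: "integrable lborel (wU k (%\<xi>. dqs h \<xi> * U \<xi>))"
        by (rule Bochner_Integration.integrable_bound[OF Suc.prems(2)]) (use le in auto)
      have "(LINT \<xi>|lborel. norm (wU k (%\<xi>. dqs h \<xi> * U \<xi>) \<xi>)) <= (LINT \<xi>|lborel. norm (wU (Suc k) U \<xi>))"
        using i Suc.prems(2) le by (intro integral_mono integrable_norm) auto
      then show "(LINT \<xi>|lborel. norm (wU k (%\<xi>. dqs h \<xi> * U \<xi>) \<xi>)) <= M" using Suc.prems(3) by linarith
    qed
    ultimately show ?case using rft_sqint[OF Suc.prems(1)] M by simp
  }
qed

lemma cls_funpow:
  assumes "cls p N H k M f" "h \<in> H" "h \<noteq> 0" "j <= k"
  shows "cls p N H (k - j) M ((dq h ^^ j) f)"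
  using assms(4)
proof (induction j)
  case (Suc j)
  then have "cls p N H (Suc (k - Suc j)) M ((dq h ^^ j) f)" by (simp add: Suc_diff_Suc)
  then show ?case using assms(2,3) by simp
qed (use assms in simp)

lemma rft_dq_funpow: "rft f U ==> rft ((dq h ^^ j) f) (%\<xi>. dqs h \<xi> ^ j * U \<xi>)"
proof (induction j)
  case (Suc j)
  from rft_dq[OF Suc.IH[OF Suc.prems], of h] show ?case by (simp add: mult.assoc)
qed simp

lemma dqs_tendsto:
  fixes b :: "'a::euclidean_space"
  assumes "b \<in> Basis"
  shows "(%n. dqs ((1 / Suc n) *\<^sub>R b) \<xi>) \<longlonglongrightarrow> \<i> * (\<xi> \<bullet> b)"
proof (rule LIM_zero_cancel, rule Lim_null_comparison)
  let ?y = "\<xi> \<bullet> b"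
  have t: "(%n. 1 / real (Suc n)) \<longlonglongrightarrow> 0"
    using LIMSEQ_inverse_real_of_nat by (simp add: inverse_eq_divide)
  show "(%n. 1 / real (Suc n) * (?y\<^sup>2 / 2)) \<longlonglongrightarrow> 0"
    using tendsto_mult_right[OF t, of "?y\<^sup>2 / 2"] by (simp only: mult_zero_left)
  show "\<forall>\<^sub>F n in sequentially. norm (dqs ((1 / Suc n) *\<^sub>R b) \<xi> - \<i> * ?y) <= 1 / real (Suc n) * (?y\<^sup>2 / 2)"
  proof (rule always_eventually, rule allI)
    fix n
    define t where "t = 1 / real (Suc n)"
    have t: "0 < t" by (simp add: t_def)
    have "dqs (t *\<^sub>R b) \<xi> - \<i> * ?y = (cis (t * ?y) - 1 - \<i> * (t * ?y)) / complex_of_real t"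
      using t assms by (simp add: dqs_def inner_commute[of b] field_simps)
    then have "norm (dqs (t *\<^sub>R b) \<xi> - \<i> * ?y) = norm (cis (t * ?y) - 1 - \<i> * (t * ?y)) / t"
      using t by (simp add: norm_divide)
    also have "\<dots> <= ((t * ?y)\<^sup>2 / 2) / t"
      using cis_approx_2[of "t * ?y"] t by (intro divide_right_mono) auto
    also have "\<dots> = t * (?y\<^sup>2 / 2)" using t by (simp add: power2_eq_square)
    finally show "norm (dqs ((1 / Suc n) *\<^sub>R b) \<xi> - \<i> * ?y) <= 1 / real (Suc n) * (?y\<^sup>2 / 2)"
      by (simp only: t_def)
  qed
qed

text \<open>Pure powers of single coordinates dominate the weight, so that difference quotients
  iterated in one coordinate direction at a time are enough.\<close>

lemma wt_le_sum:
  fixes \<xi> :: "'a::euclidean_space"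
  shows "wt k \<xi> <= real (DIM('a) + 1) ^ k * (1 + (\<Sum>b\<in>Basis. \<bar>\<xi> \<bullet> b\<bar> ^ k))"
proof -
  define m where "m = Max (insert 1 ((%b. \<bar>\<xi> \<bullet> b\<bar>) ` Basis))"
  have m1: "1 <= m" unfolding m_def by (rule Max_ge) auto
  have mb: "\<bar>\<xi> \<bullet> b\<bar> <= m" if "b \<in> Basis" for b unfolding m_def by (rule Max_ge) (use that in auto)
  have "norm \<xi> <= (\<Sum>b\<in>Basis. \<bar>\<xi> \<bullet> b\<bar>)" by (rule norm_le_l1)
  also have "\<dots> <= (\<Sum>b\<in>(Basis::'a set). m)" by (intro sum_mono mb)
  finally have "1 + norm \<xi> <= real (DIM('a) + 1) * m" using m1 by (simp add: algebra_simps)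
  then have "wt k \<xi> <= (real (DIM('a) + 1) * m) ^ k" unfolding wt_def by (intro power_mono) auto
  also have "\<dots> = real (DIM('a) + 1) ^ k * m ^ k" by (simp add: power_mult_distrib)
  also have "m ^ k <= 1 + (\<Sum>b\<in>Basis. \<bar>\<xi> \<bullet> b\<bar> ^ k)"
  proof -
    have "m \<in> insert 1 ((%b. \<bar>\<xi> \<bullet> b\<bar>) ` Basis)" unfolding m_def by (rule Max_in) auto
    then consider "m = 1" | b where "b \<in> Basis" "m = \<bar>\<xi> \<bullet> b\<bar>" by auto
    then show ?thesis
    proof cases
      case 1 then show ?thesis by (simp add: sum_nonneg)
    next
      case 2
      then have "m ^ k <= (\<Sum>b\<in>Basis. \<bar>\<xi> \<bullet> b\<bar> ^ k)" using member_le_sum[of b Basis "%b. \<bar>\<xi> \<bullet> b\<bar> ^ k"] by simp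
      then show ?thesis by simp
    qed
  qed
  finally show ?thesis by (simp add: mult_left_mono)
qed

text \<open>The converse of \<open>cls_of_rft\<close>. The k-fold quotient in direction b with step
  tending to 0 has symbol tending to the k-th power of i (\<xi> \<bullet> b), and Fatou's lemma
  preserves the bound. One factor d + 1 counts the summands U and its d pure derivatives, the other
  k come from \<open>wt_le_sum\<close>.\<close>

lemma rft_of_cls:
  fixes f :: "'a::euclidean_space => real"
  assumes c: "cls L2 lborel UNIV k M f" and f: "rft f U"
  shows "sqint lborel (wU k U)"
    "l2 lborel (wU k U) <= real (DIM('a) + 1) ^ Suc k * sqrt ((2 * pi) ^ DIM('a)) * M"
proof -
  let ?C = "sqrt ((2 * pi) ^ DIM('a))"
  note [measurable] = rft_sqint(4)[OF f]
  have b: "sqint lborel (%\<xi>. (\<i> * (\<xi> \<bullet> b)) ^ k * U \<xi>) & l2 lborel (%\<xi>. (\<i> * (\<xi> \<bullet> b)) ^ k * U \<xi>) <= ?C * M"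
    if b: "b \<in> Basis" for b
  proof -
    define h where "h n = (1 / real (Suc n)) *\<^sub>R b" for n
    have h0: "h n \<noteq> 0" for n using b by (auto simp: h_def)
    note r = rft_dq_funpow[OF f, where h = "h n" and j = k for n]
    have l: "l2 lborel (%\<xi>. dqs (h n) \<xi> ^ k * U \<xi>) <= ?C * M" for n
      unfolding rft_l2[OF r] using cls_base(2)[OF cls_funpow[OF c UNIV_I h0, of k n]]
      by (intro mult_left_mono) auto
    have lim: "AE \<xi> in lborel. (%n. dqs (h n) \<xi> ^ k * U \<xi>) \<longlonglongrightarrow> (\<i> * (\<xi> \<bullet> b)) ^ k * U \<xi>"
      unfolding h_def by (intro AE_I2 tendsto_intros dqs_tendsto b)
    from l2_fatou[OF rft_sqint(2)[OF r] _ lim, of "?C * M"] l show ?thesis by auto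
  qed
  have U: "sqint lborel U" "l2 lborel U <= ?C * M"
    using rft_sqint[OF f] rft_l2[OF f] cls_base(2)[OF c] by (auto intro: mult_left_mono)
  define V where "V \<xi> = norm (U \<xi>) + (\<Sum>b\<in>Basis. norm ((\<i> * (\<xi> \<bullet> b)) ^ k * U \<xi>))" for \<xi>
  have sn: "sqint N g ==> sqint N (%x. norm (g x)) & l2 N (%x. norm (g x)) = l2 N g" for N :: "'a measure" and g :: "'a => complex"
    by (auto simp: sqint_def l2_def)
  have sm: "sqint lborel (%\<xi>. \<Sum>b\<in>(Basis::'a set). norm ((\<i> * (\<xi> \<bullet> b)) ^ k * U \<xi>)) &
     l2 lborel (%\<xi>. \<Sum>b\<in>(Basis::'a set). norm ((\<i> * (\<xi> \<bullet> b)) ^ k * U \<xi>))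
       <= (\<Sum>b\<in>(Basis::'a set). l2 lborel (%\<xi>. norm ((\<i> * (\<xi> \<bullet> b)) ^ k * U \<xi>)))"
    using b by (intro sqint_sum) (auto dest!: sn)
  have "(\<Sum>b\<in>(Basis::'a set). l2 lborel (%\<xi>. norm ((\<i> * (\<xi> \<bullet> b)) ^ k * U \<xi>))) <= (\<Sum>b\<in>(Basis::'a set). ?C * M)"
  proof (rule sum_mono)
    fix b :: 'a assume "b \<in> Basis"
    then show "l2 lborel (%\<xi>. norm ((\<i> * (\<xi> \<bullet> b)) ^ k * U \<xi>)) <= ?C * M"
      using b[of b] sn[of lborel "%\<xi>. (\<i> * (\<xi> \<bullet> b)) ^ k * U \<xi>"] by simp
  qed
  then have V: "sqint lborel V" "l2 lborel V <= real (DIM('a) + 1) * (?C * M)"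
    unfolding V_def using sm sqint_add[of lborel "%\<xi>. norm (U \<xi>)" "%\<xi>. \<Sum>b\<in>(Basis::'a set). norm ((\<i> * (\<xi> \<bullet> b)) ^ k * U \<xi>)"] sn[OF U(1)] U(2)
    by (auto simp: algebra_simps)
  have ae: "AE \<xi> in lborel. norm (wU k U \<xi>) <= real (DIM('a) + 1) ^ k * norm (V \<xi>)"
  proof (rule AE_I2)
    fix \<xi> :: 'a
    have "V \<xi> = (1 + (\<Sum>b\<in>Basis. \<bar>\<xi> \<bullet> b\<bar> ^ k)) * norm (U \<xi>)"
      by (simp add: V_def norm_mult norm_power distrib_right sum_distrib_right)
    moreover have "0 <= V \<xi>" unfolding V_def by (intro add_nonneg_nonneg sum_nonneg) auto
    ultimately show "norm (wU k U \<xi>) <= real (DIM('a) + 1) ^ k * norm (V \<xi>)"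
      using mult_right_mono[OF wt_le_sum[of k \<xi>] norm_ge_zero[of "U \<xi>"]] by (simp add: mult.assoc)
  qed
  from sqint_bound[OF V(1) _ ae] have s: "sqint lborel (wU k U)" "l2 lborel (wU k U) <= real (DIM('a) + 1) ^ k * l2 lborel V"
    by auto
  show "sqint lborel (wU k U)" by fact
  have "real (DIM('a) + 1) ^ k * l2 lborel V <= real (DIM('a) + 1) ^ k * (real (DIM('a) + 1) * (?C * M))"
    using V(2) by (intro mult_left_mono) auto
  also have "\<dots> = real (DIM('a) + 1) ^ Suc k * ?C * M" by (simp only: power_Suc mult_ac)
  finally show "l2 lborel (wU k U) <= real (DIM('a) + 1) ^ Suc k * ?C * M"
    using s(2) by linarith
qed

text \<open>The square of the weight dominates the product of 1 + (\<xi> \<bullet> b)^2 over the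
  coordinates, whose reciprocal is a product of integrable functions of one variable. This fixes d
  derivatives as the price of an embedding.\<close>

lemma decay_sqint: "sqint lborel (%\<xi>::'a::euclidean_space. inverse (wt (DIM('a)) \<xi>))"
proof -
  have "set_integrable lborel (einterval (-\<infinity>) \<infinity>) (%x. inverse (1 + x\<^sup>2))"
    by (rule integrable_inverse_1_plus_square)
  then have "integrable lborel (%x::real. inverse (1 + x\<^sup>2))"
    by (simp add: set_integrable_def)
  then have "integrable lborel (%x::real. complex_of_real (inverse (1 + x\<^sup>2)))"
    unfolding complex_of_real_integrable_eq .
  from lborel_integral_prod(1)[of "%b::'a. %x. complex_of_real (inverse (1 + x\<^sup>2))", OF this]
  have i: "integrable lborel (%\<xi>::'a. \<Prod>b\<in>Basis. complex_of_real (inverse (1 + (\<xi> \<bullet> b)\<^sup>2)))" .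
  have le: "(norm (inverse (wt (DIM('a)) \<xi>)))\<^sup>2 <= norm (\<Prod>b\<in>Basis. complex_of_real (inverse (1 + (\<xi> \<bullet> b)\<^sup>2)))" for \<xi> :: 'a
  proof -
    have "(\<Prod>b\<in>(Basis::'a set). 1 + (\<xi> \<bullet> b)\<^sup>2) <= (\<Prod>b\<in>(Basis::'a set). (1 + norm \<xi>)\<^sup>2)"
    proof (intro prod_mono conjI)
      fix b :: 'a assume b: "b \<in> Basis"
      have "(\<xi> \<bullet> b)\<^sup>2 <= (norm \<xi>)\<^sup>2" using Basis_le_norm[OF b, of \<xi>] by (simp add: power2_le_iff_abs_le)
      then show "1 + (\<xi> \<bullet> b)\<^sup>2 <= (1 + norm \<xi>)\<^sup>2" by (simp add: power2_sum add_increasing2)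
    qed auto
    also have "\<dots> = (wt (DIM('a)) \<xi>)\<^sup>2"
      by (simp add: wt_def flip: power_mult) (simp add: mult.commute)
    finally have "inverse ((wt (DIM('a)) \<xi>)\<^sup>2) <= inverse (\<Prod>b\<in>(Basis::'a set). 1 + (\<xi> \<bullet> b)\<^sup>2)"
      by (intro le_imp_inverse_le prod_pos) (auto simp: add_pos_nonneg)
    also have "\<dots> = norm (\<Prod>b\<in>Basis. complex_of_real (inverse (1 + (\<xi> \<bullet> b)\<^sup>2)))"
      by (simp add: prod_norm[symmetric] norm_inverse prod_inversef[symmetric] del: of_real_inverse of_real_add of_real_power)
    finally show ?thesis by (simp add: power_inverse)
  qed
  have "(%\<xi>::'a. inverse (wt (DIM('a)) \<xi>)) \<in> borel_measurable borel"
    by (intro borel_measurable_inverse wt_measurable)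
  then show ?thesis unfolding sqint_def
  proof (intro conjI)
    show "integrable lborel (%\<xi>::'a. (norm (inverse (wt (DIM('a)) \<xi>)))\<^sup>2)"
      by (rule Bochner_Integration.integrable_bound[OF i]) (use le in auto)
  qed simp
qed

text \<open>The Cauchy-Schwarz inequality against \<open>decay_sqint\<close>.\<close>

lemma wU_integrable:
  fixes U :: "'a::euclidean_space => complex"
  assumes s: "sqint lborel (wU (k + DIM('a)) U)" and [measurable]: "U \<in> borel_measurable borel"
  shows "integrable lborel (wU k U)"
    "(LINT \<xi>|lborel. norm (wU k U \<xi>)) <= l2 lborel (%\<xi>::'a. inverse (wt (DIM('a)) \<xi>)) * l2 lborel (wU (k + DIM('a)) U)"
proof -
  have eq: "norm (wU k U \<xi>) = norm (inverse (wt (DIM('a)) \<xi>)) * norm (wU (k + DIM('a)) U \<xi>)" for \<xi>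
    by (simp add: wt_add norm_mult field_simps)
  have i: "integrable lborel (%\<xi>. norm (wU k U \<xi>))"
    unfolding eq by (rule integrable_norm_prod[OF decay_sqint s])
  show "integrable lborel (wU k U)"
    by (rule Bochner_Integration.integrable_bound[OF i]) auto
  show "(LINT \<xi>|lborel. norm (wU k U \<xi>)) <= l2 lborel (%\<xi>::'a. inverse (wt (DIM('a)) \<xi>)) * l2 lborel (wU (k + DIM('a)) U)"
    unfolding eq by (rule l2_Cauchy_Schwarz[OF decay_sqint s])
qed

subsection \<open>Test functions\<close>

lemma sqint_of_real:
  "sqint N f ==> sqint N (%x. complex_of_real (f x))" "l2 N (%x. complex_of_real (f x)) = l2 N f"
  by (auto simp: sqint_def l2_def)

lemma test_fun_cont: "test_fun \<eta> g ==> continuous_on UNIV \<eta>" "test_fun \<eta> g ==> continuous_on UNIV g"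
  unfolding test_fun_def gderiv_def
  by (auto intro!: continuous_at_imp_continuous_on has_derivative_continuous)

lemma test_fun_measurable:
  "test_fun \<eta> g ==> \<eta> \<in> borel_measurable borel" "test_fun \<eta> g ==> g \<in> borel_measurable borel"
  by (rule borel_measurable_continuous_onI, erule test_fun_cont)+

text \<open>The support condition concerns \<eta> alone; that g vanishes outside the ball follows
  from uniqueness of the derivative on an open set.\<close>

lemma test_fun_support:
  assumes "test_fun \<eta> g"
  shows "\<exists>R>0. \<forall>x. R < norm x --> \<eta> x = 0 & g x = 0"
proof -
  have "bounded (closure {x. \<eta> x \<noteq> 0})" using assms by (auto simp: test_fun_def compact_imp_bounded)
  then obtain R where R: "0 < R" "!!x. x \<in> closure {x. \<eta> x \<noteq> 0} ==> norm x <= R"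
    by (meson bounded_pos)
  have 0: "\<eta> x = 0" if "R < norm x" for x
    using R(2)[of x] closure_subset[of "{x. \<eta> x \<noteq> 0}"] that by force
  have "g x = 0" if x: "R < norm x" for x
  proof -
    have "open {y. R < norm y}" by (intro open_Collect_less continuous_intros)
    have "FDERIV (%_. 0) x :> (%h. inner h 0)" by simp
    then have "FDERIV \<eta> x :> (%h. inner h 0)"
      by (rule has_derivative_transform_within_open[OF _ \<open>open {y. R < norm y}\<close>]) (use x 0 in auto)
    moreover have "FDERIV \<eta> x :> (%h. inner h (g x))" using assms by (auto simp: test_fun_def gderiv_def)
    ultimately have "(%h. inner h 0) = (%h. inner h (g x))" by (rule has_derivative_unique)
    then have "inner (g x) 0 = inner (g x) (g x)" by metis
    then show "g x = 0" by simp
  qed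
  with R 0 show ?thesis by blast
qed

lemma test_fun_bounded:
  assumes "test_fun \<eta> g"
  shows "\<exists>R>0. \<exists>B\<ge>0. \<forall>x. (R < norm x --> \<eta> x = 0 & g x = 0) & \<bar>\<eta> x\<bar> <= B & norm (g x) <= B"
proof -
  obtain R where R: "0 < R" "!!x. R < norm x ==> \<eta> x = 0 & g x = 0" using test_fun_support[OF assms] by blast
  have c: "continuous_on (cball 0 R) \<eta>" "continuous_on (cball 0 R) g"
    using test_fun_cont[OF assms] by (auto intro: continuous_on_subset)
  have "bounded (\<eta> ` cball 0 R)" "bounded (g ` cball 0 R)"
    using c by (auto intro!: compact_imp_bounded compact_continuous_image)
  then obtain B1 B2 where B: "0 < B1" "!!x. norm x <= R ==> norm (\<eta> x) <= B1" "0 < B2" "!!x. norm x <= R ==> norm (g x) <= B2"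
    unfolding bounded_pos by (auto simp: image_iff)
  have "\<bar>\<eta> x\<bar> <= max B1 B2 & norm (g x) <= max B1 B2" for x
  proof (cases "norm x <= R")
    case True
    then show ?thesis using B(2)[of x] B(4)[of x] by auto
  next
    case False
    then show ?thesis using R(2)[of x] B(1) by auto
  qed
  then show ?thesis using R B by (intro exI[of _ R] conjI exI[of _ "max B1 B2"]) auto
qed

lemma test_funI:
  fixes \<eta> :: "'a::euclidean_space => real"
  assumes "!!x. GDERIV \<eta> x :> g x" "continuous_on UNIV g" "!!x. R < norm x ==> \<eta> x = 0"
  shows "test_fun \<eta> g"
  unfolding test_fun_def
proof (intro conjI allI assms)
  have "closure {x. \<eta> x \<noteq> 0} \<subseteq> cball 0 R"
    by (rule closure_minimal) (use assms(3) in \<open>auto simp: not_less[symmetric]\<close>)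
  then show "compact (closure {x. \<eta> x \<noteq> 0})"
    by (metis closed_closure compact_cball compact_Int_closed inf.absorb_iff2)
qed

lemma test_fun_sqint:
  assumes "test_fun \<eta> g"
  shows "sqint lborel \<eta>" "sqint lborel g"
proof -
  obtain R B where RB: "!!x. R < norm x ==> \<eta> x = 0 & g x = 0" "0 <= B" "!!x. \<bar>\<eta> x\<bar> <= B" "!!x. norm (g x) <= B"
    using test_fun_bounded[OF assms] by blast
  show "sqint lborel \<eta>"
  proof (rule sqint_bound(1)[OF ind_cball_sqint[of R]])
    show "AE x in lborel. norm (\<eta> x) <= B * norm (indicator (cball 0 R) x :: real)"
      using RB(1,3) by (intro AE_I2) (force simp: indicator_def)
  qed (use test_fun_measurable[OF assms] RB in auto)
  show "sqint lborel g"
  proof (rule sqint_bound(1)[OF ind_cball_sqint[of R]])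
    show "AE x in lborel. norm (g x) <= B * norm (indicator (cball 0 R) x :: real)"
      using RB(1,4) by (intro AE_I2) (force simp: indicator_def)
  qed (use test_fun_measurable[OF assms] RB in auto)
qed

lemma test_fun_shift:
  assumes "test_fun \<eta> g"
  shows "test_fun (%x. \<eta> (x + h)) (%x. g (x + h))"
proof -
  obtain R where R: "!!x. R < norm x ==> \<eta> x = 0 & g x = 0" using test_fun_support[OF assms] by blast
  show ?thesis
  proof (rule test_funI[where R = "R + norm h"])
    fix x
    have "((%y. y + h) has_derivative (%y. y)) (at x)" by (auto intro!: derivative_eq_intros)
    moreover have "(\<eta> has_derivative (%y. inner y (g (x + h)))) (at (x + h))"
      using assms by (auto simp: test_fun_def gderiv_def)
    ultimately show "GDERIV (%x. \<eta> (x + h)) x :> g (x + h)"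
      unfolding gderiv_def by (rule has_derivative_compose)
    show "\<eta> (x + h) = 0" if "R + norm h < norm x"
      using R[of "x + h"] norm_triangle_ineq4[of "x + h" h] that by simp
  next
    show "continuous_on UNIV (%x. g (x + h))"
      using test_fun_cont(2)[OF assms] by (rule continuous_on_compose2) (auto intro!: continuous_intros)
  qed
qed

lemma test_fun_mult:
  assumes "test_fun \<eta> g" and f: "!!x. GDERIV f x :> k x" "continuous_on UNIV k"
  shows "test_fun (%x. \<eta> x * f x) (%x. \<eta> x *\<^sub>R k x + f x *\<^sub>R g x)"
proof -
  obtain R where R: "!!x. R < norm x ==> \<eta> x = 0 & g x = 0" using test_fun_support[OF assms(1)] by blast
  have cf: "continuous_on UNIV f"
    using f(1) unfolding gderiv_def by (auto intro!: continuous_at_imp_continuous_on has_derivative_continuous)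
  show ?thesis
  proof (rule test_funI[where R = R])
    show "GDERIV (%x. \<eta> x * f x) x :> \<eta> x *\<^sub>R k x + f x *\<^sub>R g x" for x
      using assms by (intro GDERIV_mult) (auto simp: test_fun_def)
    show "continuous_on UNIV (%x. \<eta> x *\<^sub>R k x + f x *\<^sub>R g x)"
      using test_fun_cont[OF assms(1)] cf f(2) by (intro continuous_intros)
  qed (use R in auto)
qed

lemma DERIV_max_sq: "DERIV (%t::real. (max 0 t)\<^sup>2) t :> 2 * max 0 t"
proof -
  consider "t < 0" | "t = 0" | "0 < t" by linarith
  then show ?thesis
  proof cases
    case 1
    have "DERIV (%t::real. 0) t :> 2 * max 0 t" using 1 by simp
    then show ?thesis
      by (rule DERIV_cong_ev[THEN iffD1, OF refl _ refl, rotated])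
        (use 1 in \<open>auto intro!: eventually_mono[OF eventually_nhds_in_open[of "{..<0}"]]\<close>)
  next
    case 2
    have "((%h. ((max 0 (0 + h))\<^sup>2 - (max 0 0)\<^sup>2) / h) \<longlongrightarrow> 0) (at (0::real))"
    proof (rule Lim_null_comparison)
      show "\<forall>\<^sub>F h in at (0::real). norm (((max 0 (0 + h))\<^sup>2 - (max 0 0)\<^sup>2) / h) <= \<bar>h\<bar>"
        by (auto simp: max_def power2_eq_square intro!: always_eventually)
      show "((%h. \<bar>h\<bar>) \<longlongrightarrow> 0) (at (0::real))" by (rule tendsto_rabs_zero) (rule tendsto_ident_at)
    qed
    then show ?thesis using 2 by (simp add: DERIV_def)
  next
    case 3
    have "DERIV (%t::real. t\<^sup>2) t :> 2 * max 0 t" using 3 by (auto intro!: derivative_eq_intros)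
    then show ?thesis
      by (rule DERIV_cong_ev[THEN iffD1, OF refl _ refl, rotated])
        (use 3 in \<open>auto intro!: eventually_mono[OF eventually_nhds_in_open[of "{0<..}"]]\<close>)
  qed
qed

text \<open>A bump positive inside the ball of radius R. The square of a positive part has a
  continuous derivative, which is the regularity that \<open>test_fun\<close> asks for.\<close>

definition chi :: "real => 'a::euclidean_space => real" where
  "chi R x = (max 0 (1 - (norm x)\<^sup>2 / R\<^sup>2))\<^sup>2"

definition gchi :: "real => 'a::euclidean_space => 'a" where
  "gchi R x = (2 * max 0 (1 - (norm x)\<^sup>2 / R\<^sup>2)) *\<^sub>R ((- 2 / R\<^sup>2) *\<^sub>R x)"

lemma chi_test_fun:
  assumes "0 < R"
  shows "test_fun (chi R) (gchi R :: 'a::euclidean_space => 'a)"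
proof (rule test_funI[where R = R])
  fix x :: 'a
  have "GDERIV (%x. 1 - (norm x)\<^sup>2 / R\<^sup>2) x :> (- 2 / R\<^sup>2) *\<^sub>R x"
  proof -
    have "((%x. 1 - (x \<bullet> x) * c) has_derivative (%h. - (2 * (h \<bullet> x)) * c)) (at x)" for c :: real
      by (auto intro!: derivative_eq_intros simp: inner_commute)
    from this[of "1 / R\<^sup>2"] show ?thesis unfolding gderiv_def power2_norm_eq_inner by simp
  qed
  from GDERIV_DERIV_compose[OF this DERIV_max_sq] show "GDERIV (chi R) x :> gchi R x"
    by (simp add: chi_def[abs_def] gchi_def)
  show "chi R x = 0" if "R < norm x"
  proof -
    have "R\<^sup>2 <= (norm x)\<^sup>2" using that assms by (intro power_mono) auto
    then show ?thesis using assms by (simp add: chi_def)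
  qed
next
  show "continuous_on UNIV (gchi R :: 'a => 'a)" unfolding gchi_def[abs_def] using assms by (intro continuous_intros) auto
qed

lemma chi_bounds:
  "0 <= chi R x" "chi R x <= 1" "0 < R ==> norm x < R ==> 0 < chi R x"
  "0 < R ==> norm (gchi R x) <= 4 / R"
proof -
  show "0 <= chi R x" by (simp add: chi_def)
  have m: "0 <= max 0 (1 - (norm x)\<^sup>2 / R\<^sup>2)" "max 0 (1 - (norm x)\<^sup>2 / R\<^sup>2) <= 1" by auto
  then show "chi R x <= 1" unfolding chi_def by (intro power_le_one)
  show "0 < chi R x" if "0 < R" "norm x < R"
  proof -
    have "(norm x)\<^sup>2 < R\<^sup>2" using that by (intro power_strict_mono) auto
    then show ?thesis using that by (simp add: chi_def)
  qed
  show "norm (gchi R x) <= 4 / R" if R: "0 < R"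
  proof (cases "norm x <= R")
    case True
    have "norm (gchi R x) = 2 * max 0 (1 - (norm x)\<^sup>2 / R\<^sup>2) * (2 / R\<^sup>2 * norm x)"
      using R by (simp add: gchi_def)
    also have "\<dots> <= 2 * 1 * (2 / R\<^sup>2 * R)"
      using m True R by (intro mult_mono) auto
    also have "\<dots> = 4 / R" using R by (simp add: power2_eq_square)
    finally show ?thesis .
  next
    case False
    then have "R\<^sup>2 <= (norm x)\<^sup>2" using R by (intro power_mono) auto
    then show ?thesis using R by (simp add: gchi_def)
  qed
qed

subsection \<open>The fundamental lemma of the calculus of variations\<close>

lemma in_L2loc_chi:
  fixes f :: "'a::euclidean_space => real"
  assumes "in_L2loc f" "test_fun \<eta> g"
  shows "sqint lborel (%x. f x * \<eta> x)" "integrable lborel (%x. f x * \<eta> x)"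
proof -
  obtain R B where RB: "!!x. R < norm x ==> \<eta> x = 0 & g x = 0" "0 <= B" "!!x. \<bar>\<eta> x\<bar> <= B"
    using test_fun_bounded[OF assms(2)] by blast
  have fm[measurable]: "f \<in> borel_measurable borel" using assms(1) by (simp add: in_L2loc_def)
  note [measurable] = test_fun_measurable(1)[OF assms(2)]
  have [measurable]: "cball (0::'a) R \<in> sets borel" by simp
  have "set_integrable lborel (cball 0 R) (%x. (norm (f x))\<^sup>2)"
    using assms(1) unfolding in_L2loc_def by blast
  then have "integrable lborel (%x. indicator (cball 0 R) x *\<^sub>R (norm (f x))\<^sup>2)"
    unfolding set_integrable_def .
  moreover have "(%x. indicator (cball 0 R) x *\<^sub>R (norm (f x))\<^sup>2) = (%x. (norm (indicator (cball 0 R) x * f x))\<^sup>2)"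
    by (auto simp: indicator_def)
  ultimately have s: "sqint lborel (%x. indicator (cball 0 R) x * f x)"
    unfolding sqint_def by simp
  show "sqint lborel (%x. f x * \<eta> x)"
  proof (rule sqint_bound(1)[OF s])
    show "AE x in lborel. norm (f x * \<eta> x) <= B * norm (indicator (cball 0 R) x * f x)"
    proof (rule AE_I2)
      fix x
      show "norm (f x * \<eta> x) <= B * norm (indicator (cball 0 R) x * f x)"
      proof (cases "norm x <= R")
        case True
        then show ?thesis using mult_right_mono[OF RB(3)[of x], of "\<bar>f x\<bar>"] by (simp add: abs_mult mult.commute)
      next
        case False
        then show ?thesis using RB(1)[of x] RB(2) by simp
      qed
    qed
  qed (use RB in auto)
  have "integrable lborel (%x. norm (indicator (cball 0 R) x * f x) * norm (\<eta> x))"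
    by (rule integrable_norm_prod[OF s test_fun_sqint(1)[OF assms(2)]])
  then show "integrable lborel (%x. f x * \<eta> x)"
  proof (rule Bochner_Integration.integrable_bound)
    show "AE x in lborel. norm (f x * \<eta> x) <= norm (norm (indicator (cball 0 R) x * f x) * norm (\<eta> x))"
      using RB(1) by (intro AE_I2) (auto simp: abs_mult indicator_def)
  qed measurable
qed

text \<open>
  Testing against \<open>\<chi> cos(x \<bullet> \<xi>)\<close> and \<open>\<chi> sin(x \<bullet> \<xi>)\<close> shows that the Fourier transform of \<open>f \<chi>\<close> vanishes.
\<close>

lemma test_fun_separating:
  fixes f :: "'a::euclidean_space => real"
  assumes f: "in_L2loc f" and 0: "!!\<eta> g. test_fun \<eta> g ==> (LINT x|lborel. f x * \<eta> x) = 0"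
  shows "AE x in lborel. f x = 0"
proof -
  have R: "AE x in lborel. norm x < R --> f x = 0" if R: "0 < R" for R
  proof -
    define u where "u x = complex_of_real (f x * chi R x)" for x
    note t = in_L2loc_chi[OF f chi_test_fun[OF R]]
    have u: "integrable lborel u" "sqint lborel u"
      unfolding u_def complex_of_real_integrable_eq using t(2) sqint_of_real(1)[OF t(1)] by blast+
    have "fint u \<xi> = 0" for \<xi>
    proof -
      have c: "GDERIV (%x. cos (x \<bullet> \<xi>)) x :> (- sin (x \<bullet> \<xi>)) *\<^sub>R \<xi>" for x
        unfolding gderiv_def by (auto intro!: derivative_eq_intros)
      have s: "GDERIV (%x. sin (x \<bullet> \<xi>)) x :> cos (x \<bullet> \<xi>) *\<^sub>R \<xi>" for x
        unfolding gderiv_def by (auto intro!: derivative_eq_intros)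
      have tc: "test_fun (%x. chi R x * cos (x \<bullet> \<xi>)) (%x. chi R x *\<^sub>R ((- sin (x \<bullet> \<xi>)) *\<^sub>R \<xi>) + cos (x \<bullet> \<xi>) *\<^sub>R gchi R x)"
        by (rule test_fun_mult[OF chi_test_fun[OF R] c]) (intro continuous_intros)
      have ts: "test_fun (%x. chi R x * sin (x \<bullet> \<xi>)) (%x. chi R x *\<^sub>R (cos (x \<bullet> \<xi>) *\<^sub>R \<xi>) + sin (x \<bullet> \<xi>) *\<^sub>R gchi R x)"
        by (rule test_fun_mult[OF chi_test_fun[OF R] s]) (intro continuous_intros)
      note ui = fint_integrand_integrable[OF u(1), of \<xi>]
      have "Re (fint u \<xi>) = (LINT x|lborel. Re (cis (- (x \<bullet> \<xi>)) * u x))"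
        unfolding fint_def by (rule integral_Re[OF ui, symmetric])
      also have "\<dots> = (LINT x|lborel. f x * (chi R x * cos (x \<bullet> \<xi>)))"
        by (intro Bochner_Integration.integral_cong) (auto simp: u_def)
      also have "\<dots> = 0" by (rule 0[OF tc])
      finally have re: "Re (fint u \<xi>) = 0" .
      have "Im (fint u \<xi>) = (LINT x|lborel. Im (cis (- (x \<bullet> \<xi>)) * u x))"
        unfolding fint_def by (rule integral_Im[OF ui, symmetric])
      also have "\<dots> = (LINT x|lborel. - (f x * (chi R x * sin (x \<bullet> \<xi>))))"
        by (intro Bochner_Integration.integral_cong) (auto simp: u_def)
      also have "\<dots> = - (LINT x|lborel. f x * (chi R x * sin (x \<bullet> \<xi>)))"
        by (rule Bochner_Integration.integral_minus)
      also have "\<dots> = 0" using 0[OF ts] by simp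
      finally show ?thesis using re by (simp add: complex_eq_iff)
    qed
    then have "fint u = (%_. 0)" by (rule ext)
    with has_fourier_fint[OF u] have "has_fourier u (%_. 0)" by simp
    from has_fourier_inj[OF this has_fourier_0] have "AE x in lborel. u x = 0" by simp
    then show ?thesis
    proof eventually_elim
      case (elim x)
      then show ?case using chi_bounds(3)[OF R, of x] by (auto simp: u_def)
    qed
  qed
  have "AE x in lborel. \<forall>n::nat. norm x < real (Suc n) --> f x = 0"
    unfolding AE_all_countable by (intro allI R) simp
  then show ?thesis
  proof eventually_elim
    case (elim x)
    obtain n :: nat where "norm x < real n" using reals_Archimedean2 by blast
    then have "norm x < real (Suc n)" by simp
    with elim show ?case by blast
  qed
qed

lemma in_L2loc_diff:
  fixes f g :: "'a::euclidean_space => 'b::euclidean_space"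
  assumes "in_L2loc f" "in_L2loc g"
  shows "in_L2loc (%x. f x - g x)"
  unfolding in_L2loc_def
proof (intro conjI allI)
  have [measurable]: "f \<in> borel_measurable borel" "g \<in> borel_measurable borel"
    using assms by (auto simp: in_L2loc_def)
  show "(%x. f x - g x) \<in> borel_measurable lborel" by measurable
  fix r
  have [measurable]: "cball (0::'a) r \<in> sets borel" by simp
  have eq: "(%x. indicator (cball 0 r) x *\<^sub>R (norm (h x))\<^sup>2) = (%x. (norm (indicator (cball 0 r) x *\<^sub>R h x))\<^sup>2)"
    for h :: "'a => 'b"
    by (auto simp: indicator_def)
  have i: "integrable lborel (%x. indicator (cball 0 r) x *\<^sub>R (norm (f x))\<^sup>2)"
    "integrable lborel (%x. indicator (cball 0 r) x *\<^sub>R (norm (g x))\<^sup>2)"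
    using assms by (auto simp: in_L2loc_def set_integrable_def)
  have "sqint lborel (%x. indicator (cball 0 r) x *\<^sub>R f x)" "sqint lborel (%x. indicator (cball 0 r) x *\<^sub>R g x)"
    using i unfolding sqint_def eq by simp_all
  from sqint_diff(1)[OF this] have "integrable lborel (%x. (norm (indicator (cball 0 r) x *\<^sub>R f x - indicator (cball 0 r) x *\<^sub>R g x))\<^sup>2)"
    by (simp add: sqint_def)
  then show "set_integrable lborel (cball 0 r) (%x. (norm (f x - g x))\<^sup>2)"
    unfolding set_integrable_def eq by (simp add: scaleR_right_diff_distrib)
qed

lemma in_L2loc_inner:
  fixes f :: "'a::euclidean_space => 'b::euclidean_space"
  assumes "in_L2loc f" "b \<in> Basis"
  shows "in_L2loc (%x. f x \<bullet> b)"
  unfolding in_L2loc_def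
proof (intro conjI allI)
  have [measurable]: "f \<in> borel_measurable borel" using assms by (auto simp: in_L2loc_def)
  show "(%x. f x \<bullet> b) \<in> borel_measurable lborel" by measurable
  fix r
  have [measurable]: "cball (0::'a) r \<in> sets borel" by simp
  have i: "integrable lborel (%x. indicator (cball 0 r) x *\<^sub>R (norm (f x))\<^sup>2)"
    using assms by (auto simp: in_L2loc_def set_integrable_def)
  show "set_integrable lborel (cball 0 r) (%x. (norm (f x \<bullet> b))\<^sup>2)"
    unfolding set_integrable_def
  proof (rule Bochner_Integration.integrable_bound[OF i])
    show "AE x in lborel. norm (indicator (cball 0 r) x *\<^sub>R (norm (f x \<bullet> b))\<^sup>2) <= norm (indicator (cball 0 r) x *\<^sub>R (norm (f x))\<^sup>2)"
      using Basis_le_norm[OF assms(2)] by (intro AE_I2) (auto simp: indicator_def power2_le_iff_abs_le intro: abs_le_square_iff[THEN iffD1])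
  qed measurable
qed

lemma sqint_in_L2loc:
  fixes f :: "'a::euclidean_space => 'b::euclidean_space"
  assumes "sqint lborel f"
  shows "in_L2loc f"
  unfolding in_L2loc_def set_integrable_def
proof (intro conjI allI)
  show "f \<in> borel_measurable lborel" using assms by (simp add: sqint_def)
  fix r
  have [measurable]: "cball (0::'a) r \<in> sets borel" by simp
  show "integrable lborel (%x. indicator (cball 0 r) x *\<^sub>R (norm (f x))\<^sup>2)"
    using assms by (intro integrable_mult_indicator) (auto simp: sqint_def)
qed

lemma has_weak_grad_unique:
  fixes f :: "'a::euclidean_space => real"
  assumes "has_weak_grad f G" "has_weak_grad f G'"
  shows "AE x in lborel. G x = G' x"
proof -
  have L: "in_L2loc G" "in_L2loc G'" using assms by (auto simp: has_weak_grad_def)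
  have b: "AE x in lborel. (G x - G' x) \<bullet> b = 0" if b: "b \<in> Basis" for b
  proof (rule test_fun_separating)
    show "in_L2loc (%x. (G x - G' x) \<bullet> b)" by (intro in_L2loc_inner in_L2loc_diff L b)
    fix \<eta> :: "'a => real" and g assume t: "test_fun \<eta> g"
    have i: "integrable lborel (%x. \<eta> x *\<^sub>R H x)" if H: "in_L2loc H" for H :: "'a => 'a"
    proof -
      have "!!c. c \<in> Basis ==> integrable lborel (%x. (H x \<bullet> c) * \<eta> x)"
        using in_L2loc_chi(2)[OF in_L2loc_inner[OF H] t] .
      then have "integrable lborel (%x. \<Sum>c\<in>Basis. ((H x \<bullet> c) * \<eta> x) *\<^sub>R c)"
        by (intro Bochner_Integration.integrable_sum integrable_scaleR_left) auto
      moreover have "(\<Sum>c\<in>Basis. ((H x \<bullet> c) * \<eta> x) *\<^sub>R c) = \<eta> x *\<^sub>R H x" for x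
      proof -
        have "(\<Sum>c\<in>Basis. ((H x \<bullet> c) * \<eta> x) *\<^sub>R c) = \<eta> x *\<^sub>R (\<Sum>c\<in>Basis. (H x \<bullet> c) *\<^sub>R c)"
          by (simp add: scaleR_sum_right mult.commute)
        then show ?thesis by (simp add: euclidean_representation)
      qed
      ultimately show ?thesis by simp
    qed
    have "(LINT x|lborel. \<eta> x *\<^sub>R G x) = (LINT x|lborel. \<eta> x *\<^sub>R G' x)"
    proof -
      have "(LINT x|lborel. f x *\<^sub>R g x) = - (LINT x|lborel. \<eta> x *\<^sub>R G x)"
        "(LINT x|lborel. f x *\<^sub>R g x) = - (LINT x|lborel. \<eta> x *\<^sub>R G' x)"
        using assms t unfolding has_weak_grad_def by blast+
      then show ?thesis by simp
    qed
    then have "(LINT x|lborel. \<eta> x *\<^sub>R G x - \<eta> x *\<^sub>R G' x) = 0"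
      using i[OF L(1)] i[OF L(2)] by simp
    then have "(LINT x|lborel. (\<eta> x *\<^sub>R G x - \<eta> x *\<^sub>R G' x) \<bullet> b) = 0"
      using i[OF L(1)] i[OF L(2)] by (subst integral_inner_left) auto
    then show "(LINT x|lborel. (G x - G' x) \<bullet> b * \<eta> x) = 0"
      by (simp add: inner_diff_left algebra_simps)
  qed
  have "AE x in lborel. \<forall>b\<in>Basis. (G x - G' x) \<bullet> b = 0"
    using b by (simp add: AE_ball_countable countable_finite)
  then show ?thesis by eventually_elim (metis euclidean_all_zero_iff eq_iff_diff_eq_0)
qed

lemma has_weak_div_unique:
  fixes W :: "'a::euclidean_space => 'a"
  assumes "has_weak_div W D" "has_weak_div W D'"
  shows "AE x in lborel. D x = D' x"
proof -
  have L: "in_L2loc D" "in_L2loc D'" using assms by (auto simp: has_weak_div_def)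
  have "AE x in lborel. D x - D' x = 0"
  proof (rule test_fun_separating)
    show "in_L2loc (%x. D x - D' x)" by (intro in_L2loc_diff L)
    fix \<eta> :: "'a => real" and g assume t: "test_fun \<eta> g"
    have "(LINT x|lborel. D x * \<eta> x) = (LINT x|lborel. D' x * \<eta> x)"
    proof -
      have "(LINT x|lborel. W x \<bullet> g x) = - (LINT x|lborel. D x * \<eta> x)"
        "(LINT x|lborel. W x \<bullet> g x) = - (LINT x|lborel. D' x * \<eta> x)"
        using assms t unfolding has_weak_div_def by blast+
      then show ?thesis by simp
    qed
    then show "(LINT x|lborel. (D x - D' x) * \<eta> x) = 0"
      using in_L2loc_chi(2)[OF L(1) t] in_L2loc_chi(2)[OF L(2) t] by (simp add: left_diff_distrib)
  qed
  then show ?thesis by simp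
qed

lemma weak_grad_eq:
  assumes "has_weak_grad f G"
  shows "has_weak_grad f (weak_grad f)" "AE x in lborel. weak_grad f x = G x"
proof -
  show "has_weak_grad f (weak_grad f)" unfolding weak_grad_def by (rule someI[of "has_weak_grad f", OF assms])
  then show "AE x in lborel. weak_grad f x = G x" using assms by (rule has_weak_grad_unique)
qed

lemma weak_div_eq:
  assumes "has_weak_div W D"
  shows "has_weak_div W (weak_div W)" "AE x in lborel. weak_div W x = D x"
proof -
  show "has_weak_div W (weak_div W)" unfolding weak_div_def by (rule someI[of "has_weak_div W", OF assms])
  then show "AE x in lborel. weak_div W x = D x" using assms by (rule has_weak_div_unique)
qed

subsection \<open>Derivatives in L2\<close>

lemma dqs_approx:
  assumes b: "b \<in> Basis" and t: "0 < t"
  shows "norm (dqs (t *\<^sub>R b) \<xi> - \<i> * (\<xi> \<bullet> b)) <= t * ((\<xi> \<bullet> b)\<^sup>2 / 2)"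
proof -
  let ?y = "\<xi> \<bullet> b"
  have "dqs (t *\<^sub>R b) \<xi> - \<i> * ?y = (cis (t * ?y) - 1 - \<i> * (t * ?y)) / complex_of_real t"
    using t b by (simp add: dqs_def inner_commute[of b] field_simps)
  then have "norm (dqs (t *\<^sub>R b) \<xi> - \<i> * ?y) = norm (cis (t * ?y) - 1 - \<i> * (t * ?y)) / t"
    using t by (simp add: norm_divide)
  also have "\<dots> <= ((t * ?y)\<^sup>2 / 2) / t"
    using cis_approx_2[of "t * ?y"] t by (intro divide_right_mono) auto
  also have "\<dots> = t * (?y\<^sup>2 / 2)" using t by (simp add: power2_eq_square)
  finally show ?thesis .
qed

lemma dqs_bound_component:
  assumes b: "b \<in> Basis" and t: "0 < t"
  shows "norm (dqs (t *\<^sub>R b) \<xi>) <= \<bar>\<xi> \<bullet> b\<bar>"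
proof -
  have "norm (dqs (t *\<^sub>R b) \<xi>) = norm (cis (t * (\<xi> \<bullet> b)) - 1) / t"
    using t b by (simp add: dqs_def inner_commute[of b] norm_divide)
  also have "\<dots> <= \<bar>t * (\<xi> \<bullet> b)\<bar> / t"
    using cis_minus_1_bound t by (intro divide_right_mono) auto
  also have "\<dots> = \<bar>\<xi> \<bullet> b\<bar>" using t by (simp add: abs_mult)
  finally show ?thesis .
qed

lemma rft_mult_ex:
  assumes u: "rft u U" and s: "sqint lborel (%\<xi>. m \<xi> * U \<xi>)" and h: "!!\<xi>. m (- \<xi>) = cnj (m \<xi>)"
  shows "\<exists>v. rft v (%\<xi>. m \<xi> * U \<xi>)"
proof (rule rft_ex_hermitian[OF s])
  show "AE \<xi> in lborel. m (- \<xi>) * U (- \<xi>) = cnj (m \<xi> * U \<xi>)"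
    using rft_hermitian[OF u] by eventually_elim (simp add: h)
qed

definition iD :: "'a::euclidean_space => ('a => complex) => 'a => complex" where
  "iD b U \<xi> = \<i> * complex_of_real (\<xi> \<bullet> b) * U \<xi>"

lemma iD_measurable [measurable]:
  assumes [measurable]: "U \<in> borel_measurable borel"
  shows "iD b U \<in> borel_measurable borel"
  unfolding iD_def[abs_def] by measurable

lemma norm_iD: "norm (iD b U \<xi>) = \<bar>\<xi> \<bullet> b\<bar> * norm (U \<xi>)"
  by (simp add: iD_def norm_mult)

text \<open>Dominated convergence on the Fourier side, with the transform of the derivative itself
  as majorant.\<close>

lemma dq_tendsto_rft:
  fixes u :: "'a::euclidean_space => real"
  assumes b: "b \<in> Basis" and u: "rft u U" and v: "rft v (iD b U)"
  shows "(%n. l2 lborel (%x. dq ((1 / Suc n) *\<^sub>R b) u x - v x)) \<longlonglongrightarrow> 0"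
proof -
  let ?h = "%n. (1 / real (Suc n)) *\<^sub>R b"
  note [measurable] = rft_sqint(4)[OF u]
  have r: "rft (%x. dq (?h n) u x - v x) (%\<xi>. dqs (?h n) \<xi> * U \<xi> - iD b U \<xi>)" for n
    by (intro rft_diff rft_dq u v)
  have lim: "(%n. l2 lborel (%\<xi>. dqs (?h n) \<xi> * U \<xi> - iD b U \<xi>)) \<longlonglongrightarrow> 0"
  proof (rule l2_dominated_convergence(3)[where w = "iD b U" and C = 1])
    show "sqint lborel (iD b U)" by (rule rft_sqint(2)[OF v])
    show "AE \<xi> in lborel. (%n. dqs (?h n) \<xi> * U \<xi>) \<longlonglongrightarrow> iD b U \<xi>"
      unfolding iD_def by (intro AE_I2 tendsto_mult tendsto_const dqs_tendsto b)
    show "AE \<xi> in lborel. norm (dqs (?h n) \<xi> * U \<xi>) <= 1 * norm (iD b U \<xi>)" for n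
    proof (rule AE_I2)
      fix \<xi> :: 'a
      show "norm (dqs (?h n) \<xi> * U \<xi>) <= 1 * norm (iD b U \<xi>)"
        unfolding norm_mult norm_iD using dqs_bound_component[OF b, of "1 / real (Suc n)" \<xi>]
        by (simp add: mult_right_mono)
    qed
  qed measurable
  show ?thesis
  proof (rule Lim_null_comparison[OF always_eventually lim], rule allI)
    fix n
    show "norm (l2 lborel (%x. dq (?h n) u x - v x)) <= l2 lborel (%\<xi>. dqs (?h n) \<xi> * U \<xi> - iD b U \<xi>)"
      using l2_le_rft[OF r] by simp
  qed
qed

lemma test_fun_lipschitz:
  assumes "test_fun \<eta> g" "!!x. norm (g x) <= B"
  shows "\<bar>\<eta> (x + h) - \<eta> x\<bar> <= B * norm h"
proof -
  have "norm (\<eta> (x + h) - \<eta> x) <= B * norm ((x + h) - x)"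
  proof (rule differentiable_bound[where S = UNIV and f' = "%x h. inner h (g x)"])
    show "(\<eta> has_derivative (%h. inner h (g y))) (at y within UNIV)" for y
      using assms(1) by (auto simp: test_fun_def gderiv_def)
    show "onorm (%h. inner h (g y)) <= B" for y
    proof (rule onorm_le)
      fix z
      have "norm (inner z (g y)) <= norm z * norm (g y)" by (simp add: Cauchy_Schwarz_ineq2)
      also have "\<dots> <= norm z * B" using assms(2) by (intro mult_left_mono) auto
      finally show "norm (inner z (g y)) <= B * norm z" by (simp add: mult.commute)
    qed
  qed auto
  then show ?thesis by simp
qed

lemma GDERIV_directional_tendsto:
  fixes \<eta> :: "'a::euclidean_space => real"
  assumes "GDERIV \<eta> x :> d"
  shows "(%n. (\<eta> (x + (1 / Suc n) *\<^sub>R c) - \<eta> x) / (1 / Suc n)) \<longlonglongrightarrow> c \<bullet> d"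
proof -
  have 1: "((%t::real. x + t *\<^sub>R c) has_derivative (%t. t *\<^sub>R c)) (at 0)"
    by (auto intro!: derivative_eq_intros)
  have "(\<eta> has_derivative (%h. inner h d)) (at (x + 0 *\<^sub>R c))" using assms by (simp add: gderiv_def)
  from has_derivative_compose[OF 1 this]
  have "((%t. \<eta> (x + t *\<^sub>R c)) has_derivative (%t. (t *\<^sub>R c) \<bullet> d)) (at 0)" .
  then have "DERIV (%t. \<eta> (x + t *\<^sub>R c)) 0 :> c \<bullet> d"
    by (simp add: has_field_derivative_def mult.commute[of _ "c \<bullet> d"] mult_commute_abs)
  then have "((%h. (\<eta> (x + h *\<^sub>R c) - \<eta> x) / h) \<longlongrightarrow> c \<bullet> d) (at 0)" by (simp add: DERIV_def)
  moreover have "filterlim (%n. 1 / real (Suc n)) (at 0) sequentially"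
  proof (rule filterlim_atI)
    show "(%n. 1 / real (Suc n)) \<longlonglongrightarrow> 0"
      using LIMSEQ_inverse_real_of_nat by (simp add: inverse_eq_divide)
  qed auto
  ultimately show ?thesis by (rule filterlim_compose)
qed

lemma test_dq_tendsto:
  fixes \<eta> :: "'a::euclidean_space => real"
  assumes t: "test_fun \<eta> g" and c: "norm c = 1"
  shows "(%n. l2 lborel (%x. dq ((1 / Suc n) *\<^sub>R c) \<eta> x - c \<bullet> g x)) \<longlonglongrightarrow> 0"
proof -
  obtain R B where RB: "!!x. R < norm x ==> \<eta> x = 0 & g x = 0" "0 <= B" "!!x. norm (g x) <= B"
    using test_fun_bounded[OF t] by blast
  note [measurable] = test_fun_measurable[OF t]
  have dqe: "dq ((1 / real (Suc n)) *\<^sub>R c) \<eta> x = (\<eta> (x + (1 / real (Suc n)) *\<^sub>R c) - \<eta> x) / (1 / real (Suc n))" for n x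
    using c by (simp add: dq_def)
  show ?thesis
  proof (rule l2_dominated_convergence(3)[where w = "indicator (cball 0 (R + 1)) :: 'a => real" and C = B])
    show "AE x in lborel. (%n. dq ((1 / real (Suc n)) *\<^sub>R c) \<eta> x) \<longlonglongrightarrow> c \<bullet> g x"
      unfolding dqe using t by (intro AE_I2 GDERIV_directional_tendsto) (auto simp: test_fun_def)
    show "AE x in lborel. norm (dq ((1 / real (Suc n)) *\<^sub>R c) \<eta> x) <= B * norm (indicator (cball 0 (R + 1)) x :: real)" for n
    proof (rule AE_I2)
      fix x
      let ?h = "(1 / real (Suc n)) *\<^sub>R c"
      have h: "norm ?h = 1 / real (Suc n)" "norm ?h <= 1" "norm ?h > 0" using c by auto
      show "norm (dq ?h \<eta> x) <= B * norm (indicator (cball 0 (R + 1)) x :: real)"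
      proof (cases "norm x <= R + 1")
        case True
        have "norm (dq ?h \<eta> x) = \<bar>\<eta> (x + ?h) - \<eta> x\<bar> / norm ?h"
          unfolding dq_def by (simp add: divide_inverse abs_mult)
        also have "\<dots> <= B * norm ?h / norm ?h"
          using h by (intro divide_right_mono test_fun_lipschitz[OF t RB(3)]) auto
        also have "\<dots> = B" using h by simp
        finally show ?thesis using True by simp
      next
        case False
        have "norm x <= norm (x + ?h) + norm ?h" using norm_triangle_ineq4[of "x + ?h" ?h] by simp
        then have "R < norm (x + ?h)" "R < norm x" using False h(2) by linarith+
        then have "dq ?h \<eta> x = 0" using RB(1) by (simp add: dq_def)
        then show ?thesis using RB(2) by simp
      qed
    qed
  qed (auto intro: ind_cball_sqint)
qed

lemma sqint_inner:
  fixes f g :: "'x => 'b::euclidean_space"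
  assumes "sqint N f" "sqint N g"
  shows "integrable N (%x. f x \<bullet> g x)"
  by (rule sqint_pairing(1)[OF assms bounded_bilinear_inner, of 1]) (simp_all add: Cauchy_Schwarz_ineq2)

lemmas sqint_mult_integrable = sqint_inner[where 'b = real, unfolded inner_real_def]

text \<open>For difference quotients integration by parts is exact by translation invariance, with
  step -h on the test function. Both sides converge in L2 as the step tends to 0.\<close>

lemma ibp_dq:
  fixes u v :: "'a::euclidean_space => real"
  assumes u: "sqint lborel u" "sqint lborel v" "(%n. l2 lborel (%x. dq ((1 / Suc n) *\<^sub>R c) u x - v x)) \<longlonglongrightarrow> 0"
    and c: "norm c = 1" and t: "test_fun \<eta> g"
  shows "(LINT x|lborel. u x * (c \<bullet> g x)) = - (LINT x|lborel. v x * \<eta> x)"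
proof -
  let ?h = "%n. (1 / real (Suc n)) *\<^sub>R c"
  note ts = test_fun_sqint[OF t]
  have dqs: "sqint lborel (dq h f)" if "sqint lborel f" for h and f :: "'a => real"
    unfolding dq_def[abs_def] by (intro sqint_scaleR sqint_diff sqint_shift that)
  have bg: "sqint lborel (%x. (- c) \<bullet> g x)"
    by (rule sqint_bound(1)[OF ts(2), of _ 1]) (use c Cauchy_Schwarz_ineq2[of c] test_fun_measurable[OF t] in auto)
  have 1: "(%n. LINT x|lborel. dq (?h n) u x * \<eta> x) \<longlonglongrightarrow> (LINT x|lborel. v x * \<eta> x)"
    by (intro sqint_pairing_tendsto dqs u ts bounded_bilinear_mult) simp_all
  have 2: "(%n. LINT x|lborel. u x * dq ((1 / real (Suc n)) *\<^sub>R (- c)) \<eta> x) \<longlonglongrightarrow> (LINT x|lborel. u x * ((- c) \<bullet> g x))"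
    using c by (intro sqint_pairing_tendsto u dqs ts bg test_dq_tendsto[OF t] bounded_bilinear_mult) simp_all
  have eq: "(LINT x|lborel. dq h u x * \<eta> x) = (LINT x|lborel. u x * dq (- h) \<eta> x)" for h
  proof -
    note p = sqint_mult_integrable
    note [measurable] = test_fun_measurable[OF t]
    have [measurable]: "u \<in> borel_measurable borel" using u(1) by (simp add: sqint_def)
    have sh: "(LINT x|lborel. u (x + h) * \<eta> x) = (LINT x|lborel. u x * \<eta> (x - h))"
      using integral_lborel_shift[of "%x. u x * \<eta> (x - h)" h] by simp
    show ?thesis
      using sh p[OF sqint_shift(1)[OF u(1), of h] ts(1)] p[OF u(1) ts(1)] p[OF u(1) sqint_shift(1)[OF ts(1), of "- h"]]
      by (simp add: dq_def left_diff_distrib right_diff_distrib mult.assoc mult.left_commute[of _ "inverse (norm h)"])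
  qed
  have "(%n. LINT x|lborel. dq (?h n) u x * \<eta> x) \<longlonglongrightarrow> (LINT x|lborel. u x * ((- c) \<bullet> g x))"
    unfolding eq using 2 by simp
  from LIMSEQ_unique[OF 1 this] show ?thesis by simp
qed

lemma ibp_rft:
  fixes u :: "'a::euclidean_space => real"
  assumes b: "b \<in> Basis" and u: "rft u U" and v: "rft v (iD b U)" and t: "test_fun \<eta> g"
  shows "(LINT x|lborel. u x * (g x \<bullet> b)) = - (LINT x|lborel. v x * \<eta> x)"
  using ibp_dq[OF rft_sqint(1)[OF u] rft_sqint(1)[OF v] dq_tendsto_rft[OF b u v] _ t] b by (simp add: inner_commute)

lemma sqint_component:
  fixes f :: "'x => 'b::euclidean_space"
  assumes "sqint N f" "b \<in> Basis"
  shows "sqint N (%x. f x \<bullet> b)"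
proof (rule sqint_bound(1)[OF assms(1), of _ 1])
  show "(%x. f x \<bullet> b) \<in> borel_measurable N" using assms(1) by (auto simp: sqint_def)
qed (use assms(2) in \<open>auto intro!: AE_I2 Basis_le_norm\<close>)

lemma sqint_from_components:
  fixes f :: "'x => 'b::euclidean_space"
  assumes "!!b. b \<in> Basis ==> sqint N (%x. f x \<bullet> b)"
  shows "sqint N f"
proof -
  have "sqint N (%x. (f x \<bullet> b) *\<^sub>R b)" if "b \<in> Basis" for b
  proof (rule sqint_bound(1)[OF assms[OF that], of _ 1])
    show "(%x. (f x \<bullet> b) *\<^sub>R b) \<in> borel_measurable N"
      using assms[OF that] by (intro borel_measurable_scaleR) (auto simp: sqint_def)
  qed (use that in auto)
  then have "sqint N (%x. \<Sum>b\<in>Basis. (f x \<bullet> b) *\<^sub>R b)" using sqint_sum[of Basis N "%b x. (f x \<bullet> b) *\<^sub>R b"] by auto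
  then show ?thesis by (simp add: euclidean_representation)
qed

lemma has_weak_gradI:
  fixes u :: "'a::euclidean_space => real"
  assumes u: "sqint lborel u" "sqint lborel G"
    and e: "!!\<eta> g b. test_fun \<eta> g ==> b \<in> Basis ==> (LINT x|lborel. u x * (g x \<bullet> b)) = - (LINT x|lborel. (G x \<bullet> b) * \<eta> x)"
  shows "has_weak_grad u G"
  unfolding has_weak_grad_def
proof (intro conjI allI impI sqint_in_L2loc u)
  fix \<eta> and g :: "'a => 'a" assume t: "test_fun \<eta> g"
  note ts = test_fun_sqint[OF t]
  note p = sqint_pairing(1)[OF _ _ bounded_bilinear_scaleR, of _ _ _ 1, simplified]
  show "(LINT x|lborel. u x *\<^sub>R g x) = - (LINT x|lborel. \<eta> x *\<^sub>R G x)"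
  proof (rule euclidean_eqI)
    fix b :: 'a assume "b \<in> Basis"
    from e[OF t this] show "(LINT x|lborel. u x *\<^sub>R g x) \<bullet> b = - (LINT x|lborel. \<eta> x *\<^sub>R G x) \<bullet> b"
      using p[OF u(1) ts(2)] p[OF ts(1) u(2)]
        integral_inner_left[of b lborel "%x. u x *\<^sub>R g x"] integral_inner_left[of b lborel "%x. \<eta> x *\<^sub>R G x"]
      by (simp add: mult.commute)
  qed
qed

lemma has_weak_grad_rft:
  fixes u :: "'a::euclidean_space => real"
  assumes u: "rft u U" and G: "!!b. b \<in> Basis ==> rft (%x. G x \<bullet> b) (iD b U)"
  shows "has_weak_grad u G"
  by (rule has_weak_gradI[OF rft_sqint(1)[OF u] sqint_from_components[OF rft_sqint(1)[OF G]] ibp_rft[OF _ u G]])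

lemma has_weak_div_rft:
  fixes W :: "'a::euclidean_space => 'a"
  assumes W: "!!b. b \<in> Basis ==> rft (%x. W x \<bullet> b) (V b)" and v: "!!b. b \<in> Basis ==> rft (v b) (iD b (V b))"
    and D: "rft D (%\<xi>. \<Sum>b\<in>Basis. iD b (V b) \<xi>)"
  shows "has_weak_div W D"
  unfolding has_weak_div_def
proof (intro conjI allI impI)
  have Ws: "sqint lborel W" by (rule sqint_from_components) (rule rft_sqint(1)[OF W])
  note Ds = rft_sqint(1)[OF D]
  show "in_L2loc W" "in_L2loc D" using Ws Ds by (auto intro: sqint_in_L2loc)
  fix \<eta> :: "'a => real" and g assume t: "test_fun \<eta> g"
  note ts = test_fun_sqint[OF t]
  have i1: "integrable lborel (%x. (W x \<bullet> b) * (g x \<bullet> b))" if "b \<in> Basis" for b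
    by (rule sqint_mult_integrable[OF sqint_component[OF Ws that] sqint_component[OF ts(2) that]])
  have i2: "integrable lborel (%x. v b x * \<eta> x)" if "b \<in> Basis" for b
    by (rule sqint_mult_integrable[OF rft_sqint(1)[OF v[OF that]] ts(1)])
  have "AE x in lborel. (\<Sum>b\<in>Basis. v b x) = D x"
    by (rule rft_inj[OF rft_sum[OF finite_Basis v] D]) auto
  then have ae: "AE x in lborel. (\<Sum>b\<in>Basis. v b x * \<eta> x) = D x * \<eta> x"
    by eventually_elim (simp add: sum_distrib_right[symmetric])
  have "(LINT x|lborel. W x \<bullet> g x) = (LINT x|lborel. (\<Sum>b\<in>Basis. (W x \<bullet> b) * (g x \<bullet> b)))"
    by (intro Bochner_Integration.integral_cong refl euclidean_inner)
  also have "\<dots> = (\<Sum>b\<in>Basis. (LINT x|lborel. (W x \<bullet> b) * (g x \<bullet> b)))"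
    by (rule Bochner_Integration.integral_sum) (rule i1)
  also have "\<dots> = (\<Sum>b\<in>Basis. - (LINT x|lborel. v b x * \<eta> x))"
    by (intro sum.cong refl ibp_rft[OF _ W v t])
  also have "\<dots> = - (LINT x|lborel. (\<Sum>b\<in>Basis. v b x * \<eta> x))"
    by (subst Bochner_Integration.integral_sum) (auto simp: sum_negf intro: i2)
  also have "(LINT x|lborel. (\<Sum>b\<in>Basis. v b x * \<eta> x)) = (LINT x|lborel. D x * \<eta> x)"
  proof (rule integral_cong_AE[OF _ _ ae])
    show "(%x. \<Sum>b\<in>Basis. v b x * \<eta> x) \<in> borel_measurable lborel"
      using i2 by (intro borel_measurable_sum) auto
    show "(%x. D x * \<eta> x) \<in> borel_measurable lborel"
      using sqint_mult_integrable[OF Ds ts(1)] by auto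
  qed
  finally show "(LINT x|lborel. W x \<bullet> g x) = - (LINT x|lborel. D x * \<eta> x)" .
qed

lemma rft_iD_ex:
  assumes u: "rft u U" and s: "sqint lborel (iD b U)"
  shows "\<exists>v. rft v (iD b U)"
  using rft_mult_ex[OF u, of "%\<xi>. \<i> * complex_of_real (\<xi> \<bullet> b)"] s by (simp add: iD_def[abs_def])

subsection \<open>Product rule\<close>

lemma sqint_mult_bounded:
  fixes f g :: "'x => real"
  assumes "f \<in> borel_measurable N" "sqint N g" "AE x in N. \<bar>f x\<bar> <= K" "0 <= K"
  shows "sqint N (%x. f x * g x)" "l2 N (%x. f x * g x) <= K * l2 N g"
proof -
  have m: "(%x. f x * g x) \<in> borel_measurable N"
    using assms by (intro borel_measurable_times) (auto simp: sqint_def)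
  have ae: "AE x in N. norm (f x * g x) <= K * norm (g x)"
    using assms(3)
  proof eventually_elim
    case (elim x)
    from mult_right_mono[OF elim, of "\<bar>g x\<bar>"] show ?case by (simp only: real_norm_def abs_mult)
  qed
  show "sqint N (%x. f x * g x)" "l2 N (%x. f x * g x) <= K * l2 N g"
    using sqint_bound[OF assms(2) m ae assms(4)] by auto
qed

text \<open>The weight 2 on the integrable transform of c makes the difference quotients of c
  converge uniformly, at the rate of the step; those of w converge in L2. So the quotient of the
  product tends to the Leibniz expression, and limits are unique.\<close>

lemma deriv_product_rft:
  fixes c w :: "'a::euclidean_space => real"
  assumes b: "b \<in> Basis" and c: "rft c Z" "rft c' (iD b Z)" and ci: "integrable lborel (wU 2 Z)"
    and w: "rft w U" "rft w' (iD b U)"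
    and y: "rft (%x. c x * w x) Y" "rft y' (iD b Y)"
  shows "AE x in lborel. y' x = c x * w' x + c' x * w x"
proof -
  note Zm = rft_sqint(4)[OF c(1)]
  note [measurable] = rft_sqint(3)[OF c(1)] rft_sqint(3)[OF c(2)] rft_sqint(3)[OF w(1)] rft_sqint(3)[OF w(2)] Zm
  let ?t = "%n. 1 / real (Suc n)"
  let ?h = "%n. ?t n *\<^sub>R b"
  define K where "K = (LINT \<xi>|lborel. norm (wU 2 Z \<xi>))"
  have K0: "0 <= K" by (simp add: K_def)
  have le: "integrable lborel V & (LINT \<xi>|lborel. norm (V \<xi>)) <= a * K"
    if "V \<in> borel_measurable borel" "!!\<xi>. norm (V \<xi>) <= a * norm (wU 2 Z \<xi>)" "0 <= a" for V :: "'a => complex" and a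
  proof
    show i: "integrable lborel V"
    proof (rule Bochner_Integration.integrable_bound)
      show ia: "integrable lborel (%\<xi>. a * norm (wU 2 Z \<xi>))"
        using integrable_norm[OF ci] by (intro integrable_mult_right)
      show "AE \<xi> in lborel. norm (V \<xi>) <= norm (a * norm (wU 2 Z \<xi>))"
      proof (rule AE_I2)
        fix \<xi> :: 'a
        have "a * norm (wU 2 Z \<xi>) <= norm (a * norm (wU 2 Z \<xi>))" unfolding real_norm_def by (rule abs_ge_self)
        then show "norm (V \<xi>) <= norm (a * norm (wU 2 Z \<xi>))" using that(2)[of \<xi>] by (rule order_trans[rotated])
      qed
    qed (use that in simp)
    have "(LINT \<xi>|lborel. norm (V \<xi>)) <= (LINT \<xi>|lborel. a * norm (wU 2 Z \<xi>))"
      using integrable_norm[OF i] integrable_mult_right[OF integrable_norm[OF ci], of a] that(2) by (intro integral_mono)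
    then show "(LINT \<xi>|lborel. norm (V \<xi>)) <= a * K" by (simp add: K_def)
  qed
  have w2: "1 <= wt 2 \<xi>" "\<bar>\<xi> \<bullet> b\<bar> <= wt 2 \<xi>" "(\<xi> \<bullet> b)\<^sup>2 <= wt 2 \<xi>" for \<xi> :: 'a
  proof -
    have B: "\<bar>\<xi> \<bullet> b\<bar> <= norm \<xi>" by (rule Basis_le_norm[OF b])
    show "1 <= wt 2 \<xi>" by simp
    have "(1 + norm \<xi>) * 1 <= (1 + norm \<xi>) * (1 + norm \<xi>)" by (intro mult_left_mono) auto
    then show "\<bar>\<xi> \<bullet> b\<bar> <= wt 2 \<xi>" using B by (simp add: wt_def power2_eq_square)
    have "\<bar>\<xi> \<bullet> b\<bar>\<^sup>2 <= (1 + norm \<xi>)\<^sup>2" using B by (intro power_mono) auto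
    then show "(\<xi> \<bullet> b)\<^sup>2 <= wt 2 \<xi>" by (simp add: wt_def)
  qed
  have "integrable lborel Z & (LINT \<xi>|lborel. norm (Z \<xi>)) <= 1 * K"
    using w2(1) by (intro le) (auto simp: mult_le_cancel_right1)
  then have cb: "AE x in lborel. \<bar>c x\<bar> <= K"
    using rft_bound[OF c(1)] by (auto elim!: eventually_mono)
  have "integrable lborel (iD b Z) & (LINT \<xi>|lborel. norm (iD b Z \<xi>)) <= 1 * K"
    using w2(2) by (intro le) (auto simp: norm_iD intro!: mult_right_mono)
  then have cb': "AE x in lborel. \<bar>c' x\<bar> <= K"
    using rft_bound[OF c(2)] by (auto elim!: eventually_mono)
  \<comment> \<open>One weight would bound the difference quotient; the second one buys the factor
    \<open>?t n\<close>.\<close>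
  have cd: "AE x in lborel. \<bar>dq (?h n) c x - c' x\<bar> <= ?t n * K" for n
  proof -
    have r: "rft (%x. dq (?h n) c x - c' x) (%\<xi>. dqs (?h n) \<xi> * Z \<xi> - iD b Z \<xi>)"
      by (intro rft_diff rft_dq c)
    have "integrable lborel (%\<xi>. dqs (?h n) \<xi> * Z \<xi> - iD b Z \<xi>) &
      (LINT \<xi>|lborel. norm (dqs (?h n) \<xi> * Z \<xi> - iD b Z \<xi>)) <= ?t n * K"
    proof (rule le)
      fix \<xi> :: 'a
      have "norm (dqs (?h n) \<xi> * Z \<xi> - iD b Z \<xi>) = norm (dqs (?h n) \<xi> - \<i> * (\<xi> \<bullet> b)) * norm (Z \<xi>)"
        by (simp add: iD_def norm_mult[symmetric] left_diff_distrib)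
      also have "\<dots> <= (?t n * wt 2 \<xi>) * norm (Z \<xi>)"
      proof (rule mult_right_mono)
        have "norm (dqs (?h n) \<xi> - \<i> * (\<xi> \<bullet> b)) <= ?t n * ((\<xi> \<bullet> b)\<^sup>2 / 2)"
          by (rule dqs_approx[OF b]) simp
        also have "\<dots> <= ?t n * wt 2 \<xi>"
        proof (rule mult_left_mono)
          have "0 <= (\<xi> \<bullet> b)\<^sup>2" by simp
          then show "(\<xi> \<bullet> b)\<^sup>2 / 2 <= wt 2 \<xi>" using w2(3)[of \<xi>] by linarith
        qed simp
        finally show "norm (dqs (?h n) \<xi> - \<i> * (\<xi> \<bullet> b)) <= ?t n * wt 2 \<xi>" .
      qed simp
      finally show "norm (dqs (?h n) \<xi> * Z \<xi> - iD b Z \<xi>) <= ?t n * norm (wU 2 Z \<xi>)" by (simp add: mult.assoc)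
    qed (simp_all add: borel_measurable_diff borel_measurable_times)
    then show ?thesis using rft_bound[OF r] by (auto elim!: eventually_mono)
  qed
  note ws = rft_sqint(1)[OF w(1)] rft_sqint(1)[OF w(2)]
  define E where "E x = c x * w' x + c' x * w x" for x
  have cm: "c \<in> borel_measurable lborel" "c' \<in> borel_measurable lborel" by measurable
  note Es1 = sqint_mult_bounded(1)[OF cm(1) ws(2) cb K0]
  note Es2 = sqint_mult_bounded(1)[OF cm(2) ws(1) cb' K0]
  have Es: "sqint lborel E" unfolding E_def[abs_def] by (intro sqint_add Es1 Es2)
  have t0: "?t \<longlonglongrightarrow> 0" using LIMSEQ_inverse_real_of_nat by (simp add: inverse_eq_divide)
  have dw: "sqint lborel (dq h w)" for h by (rule rft_sqint(1)[OF rft_dq[OF w(1)]])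
  have l2dw: "(%n. l2 lborel (dq (?h n) w)) \<longlonglongrightarrow> l2 lborel w'"
    by (rule l2_tendsto[OF dw ws(2) dq_tendsto_rft[OF b w]])
  have lim: "(%n. l2 lborel (%x. dq (?h n) (%x. c x * w x) x - E x)) \<longlonglongrightarrow> 0"
  proof (rule Lim_null_comparison)
    show "(%n. (K * l2 lborel (%x. dq (?h n) w x - w' x) + ?t n * K * l2 lborel w) + K * (?t n * l2 lborel (dq (?h n) w))) \<longlonglongrightarrow> 0"
    proof -
      have "(%n. (K * l2 lborel (%x. dq (?h n) w x - w' x) + ?t n * K * l2 lborel w) + K * (?t n * l2 lborel (dq (?h n) w)))
        \<longlonglongrightarrow> (K * 0 + 0 * K * l2 lborel w) + K * (0 * l2 lborel w')"
        by (intro tendsto_add tendsto_mult tendsto_const t0 l2dw dq_tendsto_rft[OF b w])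
      then show ?thesis by simp
    qed
    show "\<forall>\<^sub>F n in sequentially. norm (l2 lborel (%x. dq (?h n) (%x. c x * w x) x - E x))
       <= (K * l2 lborel (%x. dq (?h n) w x - w' x) + ?t n * K * l2 lborel w) + K * (?t n * l2 lborel (dq (?h n) w))"
    proof (rule always_eventually, rule allI)
      fix n
      define h where "h = ?h n"
      have nh: "norm h = ?t n" using b by (simp add: h_def)
      have h0: "norm h \<noteq> 0" using nh by simp
      have wsh: "sqint lborel (%x. w (x + h))" "l2 lborel (%x. w (x + h)) = l2 lborel w" by (rule sqint_shift[OF ws(1)])+
      note 1 = sqint_mult_bounded[OF cm(1) sqint_diff(1)[OF dw ws(2)] cb K0, of h]
      have "(%x. dq h c x - c' x) \<in> borel_measurable lborel" "0 <= ?t n * K" using K0 by (measurable, simp)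
      note 2 = sqint_mult_bounded[OF this(1) wsh(1) cd[of n, folded h_def] this(2)]
      note 3 = sqint_mult_bounded[OF cm(2) sqint_scaleR(1)[OF dw] cb' K0, of "norm h" h]
      have 12: "sqint lborel (%x. c x * (dq h w x - w' x) + (dq h c x - c' x) * w (x + h))"
        "l2 lborel (%x. c x * (dq h w x - w' x) + (dq h c x - c' x) * w (x + h))
          <= K * l2 lborel (%x. dq h w x - w' x) + ?t n * K * l2 lborel w"
        using sqint_add[OF 1(1) 2(1)] 1(2) 2(2) wsh(2) by auto
      \<comment> \<open>The shifted w in the Leibniz rule is replaced by w plus a step times its
        quotient, which leaves three terms that all tend to 0.\<close>
      have eq: "dq h (%x. c x * w x) x - E x = (c x * (dq h w x - w' x) + (dq h c x - c' x) * w (x + h)) + c' x * (norm h *\<^sub>R dq h w x)" for x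
      proof -
        have e1: "w (x + h) = w x + norm h * dq h w x" using h0 by (simp add: dq_def flip: mult.assoc)
        have e2: "dq h (%x. c x * w x) x = dq h c x * w (x + h) + c x * dq h w x"
          by (simp add: dq_def algebra_simps)
        show ?thesis unfolding E_def e2 e1 real_scaleR_def by (simp add: algebra_simps)
      qed
      have "l2 lborel (%x. dq h (%x. c x * w x) x - E x)
         <= (K * l2 lborel (%x. dq h w x - w' x) + ?t n * K * l2 lborel w) + K * (?t n * l2 lborel (dq h w))"
      proof -
        have s3: "l2 lborel (%x. norm h *\<^sub>R dq h w x) = ?t n * l2 lborel (dq h w)"
          unfolding sqint_scaleR(2)[OF dw] nh by simp
        show ?thesis
          unfolding eq s3[symmetric] by (rule order_trans[OF sqint_add(2)[OF 12(1) 3(1)] add_mono[OF 12(2) 3(2)]])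
      qed
      then show "norm (l2 lborel (%x. dq (?h n) (%x. c x * w x) x - E x))
       <= (K * l2 lborel (%x. dq (?h n) w x - w' x) + ?t n * K * l2 lborel w) + K * (?t n * l2 lborel (dq (?h n) w))"
        by (simp add: h_def)
    qed
  qed
  have "AE x in lborel. y' x = E x"
    by (rule l2_tendsto_unique[OF _ _ rft_sqint(1)[OF y(2)] Es dq_tendsto_rft[OF b y] lim])
      (auto intro: rft_sqint(1)[OF rft_dq[OF y(1)]])
  then show ?thesis by (simp add: E_def)
qed

subsection \<open>The strip\<close>

text \<open>A density rather than a restriction keeps the Borel sets of the line. Its total mass is
  1, so averaging over the depth does not increase L2 norms.\<close>

abbreviation ivl :: "real measure" where
  "ivl \<equiv> density lborel (indicator {-1<..<0})"

definition smeas :: "('a::euclidean_space \<times> real) measure" where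
  "smeas = density lborel (indicator strip)"

text \<open>The horizontal directions; shifts along them map the strip onto itself.\<close>

definition sdir :: "('a::euclidean_space \<times> real) set" where
  "sdir = {h. snd h = 0}"

lemma strip_sets [measurable]: "(strip :: ('a::euclidean_space \<times> real) set) \<in> sets borel"
  unfolding strip_def by (intro borel_open open_Times) auto

lemma sets_smeas [measurable_cong, simp]: "sets smeas = sets borel"
  by (simp add: smeas_def)

lemma finite_measure_ivl: "finite_measure ivl"
  by (rule finite_measureI) (simp add: emeasure_density)

interpretation ivl: finite_measure ivl
  by (rule finite_measure_ivl)

interpretation ivl_pair: pair_sigma_finite "lborel :: 'a::euclidean_space measure" ivl
  by standard

lemma smeas_pair: "(smeas :: ('a::euclidean_space \<times> real) measure) = lborel \<Otimes>\<^sub>M ivl"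
proof -
  have "lborel \<Otimes>\<^sub>M ivl = density (lborel :: 'a measure) (%_. 1) \<Otimes>\<^sub>M ivl"
    by (simp add: density_1)
  also have "\<dots> = density (lborel \<Otimes>\<^sub>M lborel) (%(x, y). 1 * indicator {-1<..<0} y)"
    by (rule pair_measure_density) (auto intro: sigma_finite_lborel ivl.sigma_finite_measure_axioms)
  also have "\<dots> = smeas"
  proof -
    have "(%(x, y). 1 * indicator {-1<..<0} y) = (indicator (strip :: ('a \<times> real) set) :: _ => ennreal)"
      by (auto simp: strip_def indicator_def fun_eq_iff)
    then show ?thesis unfolding smeas_def lborel_prod by simp
  qed
  finally show ?thesis ..
qed

lemma AE_smeas: "(AE p in smeas. P p) \<longleftrightarrow> (AE p in lborel. p \<in> strip --> P p)"
  unfolding smeas_def by (subst AE_density) (auto simp: indicator_def)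

lemma AE_smeasI: "(!!x z. -1 < z ==> z < 0 ==> P (x, z)) ==> AE p in smeas. P p"
  unfolding AE_smeas by (auto simp: strip_def)

lemma nn_integral_smeas:
  assumes [measurable]: "f \<in> borel_measurable borel"
  shows "(\<integral>\<^sup>+p. f p \<partial>smeas) = (\<integral>\<^sup>+p\<in>strip. f p \<partial>lborel)"
  unfolding smeas_def by (subst nn_integral_density) (auto simp: mult.commute)

lemma integral_smeas:
  fixes f :: "'a::euclidean_space \<times> real => 'b::{banach, second_countable_topology}"
  assumes [measurable]: "f \<in> borel_measurable borel"
  shows "(LINT p|smeas. f p) = (LINT p:strip|lborel. f p)"
  unfolding smeas_def set_lebesgue_integral_def
  by (subst integral_density[where g = "indicator strip :: _ => real", symmetric]) (auto simp: ennreal_indicator)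

interpretation str: shift_invariant "smeas :: ('a::euclidean_space \<times> real) measure" sdir
proof
  show "sets (smeas :: ('a \<times> real) measure) = sets borel" by simp
  fix h :: "'a \<times> real" assume "h \<in> sdir"
  then have h: "p + h \<in> strip \<longleftrightarrow> p \<in> strip" for p :: "'a \<times> real"
    by (cases p; cases h) (auto simp: strip_def sdir_def)
  show "distr smeas borel (%p. p + h) = smeas"
  proof (rule measure_eqI)
    fix A :: "('a \<times> real) set" assume "A \<in> sets (distr smeas borel (%p. p + h))"
    then have [measurable]: "A \<in> sets borel" by simp
    have "emeasure (distr smeas borel (%p. p + h)) A = emeasure smeas ((%p. p + h) -` A)"
      by (subst emeasure_distr) (auto simp: sets_eq_imp_space_eq[OF sets_smeas])
    also have "\<dots> = (\<integral>\<^sup>+p. indicator strip p * indicator ((%p. p + h) -` A) p \<partial>lborel)"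
      unfolding smeas_def by (rule emeasure_density) (auto intro: measurable_sets_borel[of "%p. p + h" borel A])
    also have "\<dots> = (\<integral>\<^sup>+p. (%q. indicator strip q * indicator A q) (p + h) \<partial>lborel)"
      by (intro nn_integral_cong) (auto simp: indicator_def h)
    also have "\<dots> = (\<integral>\<^sup>+p. indicator strip p * indicator A p \<partial>lborel)"
      by (rule nn_integral_lborel_shift) measurable
    also have "\<dots> = emeasure smeas A" unfolding smeas_def by (rule emeasure_density[symmetric]) auto
    finally show "emeasure (distr smeas borel (%p. p + h)) A = emeasure smeas A" .
  qed simp
qed

lemma smeas_real: "smeas = density lborel (%p. ennreal (indicator strip p))"
  by (simp add: smeas_def ennreal_indicator)

lemma integrable_smeas:
  fixes f :: "'a::euclidean_space \<times> real => 'b::{banach, second_countable_topology}"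
  assumes "f \<in> borel_measurable borel"
  shows "integrable smeas f \<longleftrightarrow> integrable lborel (%p. indicator strip p *\<^sub>R f p)"
  unfolding smeas_real using assms by (subst integrable_density) auto

lemma sqint_smeas:
  assumes "sqint lborel f"
  shows "sqint smeas f"
proof -
  have [measurable]: "f \<in> borel_measurable borel" using assms by (simp add: sqint_def)
  have "integrable smeas (%p. (norm (f p))\<^sup>2)"
  proof (subst integrable_smeas)
    show "integrable lborel (%p. indicator strip p *\<^sub>R (norm (f p))\<^sup>2)"
      using assms by (intro integrable_mult_indicator) (auto simp: sqint_def)
  qed measurable
  then show ?thesis by (simp add: sqint_def)
qed

subsection \<open>Test functions on the strip\<close>

lemma strip_test_funI:
  fixes v :: "'a::euclidean_space \<times> real => real"
  assumes "test_fun v g" "0 < d" "!!p. - d < snd p ==> v p = 0"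
  shows "strip_test_fun v g"
  unfolding strip_test_fun_def
proof (intro conjI assms)
  have "closed {p :: 'a \<times> real. snd p <= - d}" by (intro closed_Collect_le continuous_intros)
  then have "closure {p. v p \<noteq> 0} \<subseteq> {p. snd p <= - d}"
    by (rule closure_minimal[rotated]) (use assms(3) in \<open>force simp: not_le[symmetric]\<close>)
  then show "closure {p. v p \<noteq> 0} \<subseteq> UNIV \<times> {..<0}" using assms(2) by force
qed

text \<open>A compact support below the surface keeps a positive distance from it.\<close>

lemma strip_test_funD:
  assumes "strip_test_fun v g"
  shows "test_fun v g" "\<exists>d>0. \<forall>p. - d < snd p --> v p = 0"
proof -
  show "test_fun v g" using assms by (simp add: strip_test_fun_def)
  let ?S = "closure {p. v p \<noteq> 0}"
  have S: "compact ?S" "?S \<subseteq> UNIV \<times> {..<0}" using assms by (auto simp: strip_test_fun_def test_fun_def)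
  show "\<exists>d>0. \<forall>p. - d < snd p --> v p = 0"
  proof (cases "?S = {}")
    case True
    then have "v p = 0" for p by (auto simp only: closure_eq_empty Collect_empty_eq not_not)
    then show ?thesis by (intro exI[of _ 1]) simp
  next
    case False
    have "\<exists>p\<in>?S. \<forall>q\<in>?S. snd q <= snd p"
      by (rule continuous_attains_sup[OF S(1) False]) (intro continuous_intros)
    then obtain p where p: "p \<in> ?S" "!!q. q \<in> ?S ==> snd q <= snd p" by blast
    have "snd p < 0" using p(1) S(2) by auto
    moreover have "v q = 0" if "snd p < snd q" for q
      using p(2)[of q] closure_subset[of "{p. v p \<noteq> 0}"] that by force
    ultimately show ?thesis by (intro exI[of _ "- snd p"]) auto
  qed
qed

lemma strip_test_fun_shift:
  assumes "strip_test_fun v g" "h \<in> sdir"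
  shows "strip_test_fun (%p. v (p + h)) (%p. g (p + h))"
proof -
  obtain d where "0 < d" "!!p. - d < snd p ==> v p = 0" using strip_test_funD(2)[OF assms(1)] by blast
  then show ?thesis
    using assms(2) by (intro strip_test_funI[of _ _ d] test_fun_shift strip_test_funD(1)[OF assms(1)]) (auto simp: sdir_def)
qed

lemma bounded_linear_scale_mu: "bounded_linear (scale_mu \<mu>)"
  unfolding scale_mu_def[abs_def] by (intro bounded_linear_intros)

lemma scale_mu_lin:
  "scale_mu \<mu> (x - y) = scale_mu \<mu> x - scale_mu \<mu> y" "scale_mu \<mu> (x + y) = scale_mu \<mu> x + scale_mu \<mu> y"
  "scale_mu \<mu> (c *\<^sub>R x) = c *\<^sub>R scale_mu \<mu> x"
  by (auto simp: scale_mu_def algebra_simps)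

lemma scale_mu_norm:
  assumes "0 < \<mu>"
  shows "norm (scale_mu \<mu> x) <= max 1 (sqrt \<mu>) * norm x"
proof -
  have "(norm (scale_mu \<mu> x))\<^sup>2 = \<mu> * (norm (fst x))\<^sup>2 + (norm (snd x))\<^sup>2"
    using assms by (simp add: scale_mu_def norm_Pair power_mult_distrib)
  also have "\<dots> <= (max 1 (sqrt \<mu>))\<^sup>2 * (norm (fst x))\<^sup>2 + (max 1 (sqrt \<mu>))\<^sup>2 * (norm (snd x))\<^sup>2"
  proof (intro add_mono mult_right_mono)
    have "(sqrt \<mu>)\<^sup>2 <= (max 1 (sqrt \<mu>))\<^sup>2" using assms by (intro power_mono) auto
    then show "\<mu> <= (max 1 (sqrt \<mu>))\<^sup>2" using assms by simp
    have "1\<^sup>2 <= (max 1 (sqrt \<mu>))\<^sup>2" by (intro power_mono) auto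
    then have "1 * (norm (snd x))\<^sup>2 <= (max 1 (sqrt \<mu>))\<^sup>2 * (norm (snd x))\<^sup>2" by (intro mult_right_mono) auto
    then show "(norm (snd x))\<^sup>2 <= (max 1 (sqrt \<mu>))\<^sup>2 * (norm (snd x))\<^sup>2" by simp
  qed auto
  also have "\<dots> = (max 1 (sqrt \<mu>) * norm x)\<^sup>2"
    by (cases x) (simp add: norm_Pair power_mult_distrib algebra_simps)
  finally show ?thesis by (rule power2_le_imp_le) simp
qed

lemma scale_mu_measurable [measurable]: "scale_mu \<mu> \<in> borel_measurable borel"
  by (intro borel_measurable_continuous_onI linear_continuous_on bounded_linear_scale_mu)

lemma sqint_scale_mu:
  assumes "sqint N X" "0 < \<mu>"
  shows "sqint N (%p. scale_mu \<mu> (X p))" "l2 N (%p. scale_mu \<mu> (X p)) <= max 1 (sqrt \<mu>) * l2 N X"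
proof -
  have "(%p. scale_mu \<mu> (X p)) \<in> borel_measurable N"
    using assms(1) by (intro measurable_compose[OF _ scale_mu_measurable]) (simp add: sqint_def)
  from sqint_bound[OF assms(1) this AE_I2[OF scale_mu_norm[OF assms(2)]]]
  show "sqint N (%p. scale_mu \<mu> (X p))" "l2 N (%p. scale_mu \<mu> (X p)) <= max 1 (sqrt \<mu>) * l2 N X" by auto
qed

lemma sqint_test_field: "strip_test_fun v g ==> 0 < \<mu> ==> sqint smeas (%p. scale_mu \<mu> (g p))"
  by (intro sqint_scale_mu sqint_smeas test_fun_sqint strip_test_funD)

subsection \<open>The variational problem\<close>

text \<open>
  \<open>normal_field \<mu> X\<close>: \<open>X\<close> is orthogonal to the scaled gradients of the test functions. A field orthogonal to all
  such \<open>X\<close> belongs to the closure of these gradients, i.e. it is the scaled gradient \<open>\<nabla>\<^sup>\<mu>u\<close> of a function \<open>u\<close>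
  vanishing at the surface. The problem \<open>\<nabla>\<^sup>\<mu> \<bullet> P Y = \<nabla>\<^sup>\<mu> \<bullet> F\<close> says that \<open>P Y - F\<close> is a normal field; the
  matrix \<open>P\<close> with entries \<open>h\<close>, \<open>-a\<close>, \<open>r\<close> is represented by \<open>c = (h, a, r)\<close>.
\<close>

definition normal_field :: "real => ('a::euclidean_space \<times> real => 'a \<times> real) => bool" where
  "normal_field \<mu> X \<longleftrightarrow> sqint smeas X &
     (\<forall>v g. strip_test_fun v g --> (LINT p|smeas. X p \<bullet> scale_mu \<mu> (g p)) = 0)"

definition efield :: "real => ('a::euclidean_space \<times> real => 'a \<times> real) => bool" where
  "efield \<mu> Y \<longleftrightarrow> sqint smeas Y & (\<forall>X. normal_field \<mu> X --> (LINT p|smeas. X p \<bullet> Y p) = 0)"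

definition pmat :: "real \<times> 'a::euclidean_space \<times> real => 'a \<times> real => 'a \<times> real" where
  "pmat c X = (fst c *\<^sub>R fst X - snd X *\<^sub>R fst (snd c), snd (snd c) * snd X - fst (snd c) \<bullet> fst X)"

text \<open>The constant 4 counts the products of an entry of c with a component of X.\<close>

lemma pmat_norm: "norm (pmat c X) <= norm c * norm X * 4"
proof -
  obtain h a r where c: "c = (h, a, r)" by (cases c)
  obtain p q where X: "X = (p, q)" by (cases X)
  have n: "\<bar>h\<bar> <= norm c" "norm a <= norm c" "\<bar>r\<bar> <= norm c" "norm p <= norm X" "\<bar>q\<bar> <= norm X"
    unfolding c X using norm_fst_le[of h "(a, r)"] norm_snd_le[of "(a, r)" h] norm_fst_le[of a r] norm_snd_le[of r a]
      norm_fst_le[of p q] norm_snd_le[of q p] by auto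
  have "norm (pmat c X) <= norm (h *\<^sub>R p - q *\<^sub>R a) + norm (r * q - a \<bullet> p)"
    unfolding pmat_def c X using norm_Pair_le[of "h *\<^sub>R p - q *\<^sub>R a" "r * q - a \<bullet> p"] by simp
  also have "\<dots> <= (\<bar>h\<bar> * norm p + \<bar>q\<bar> * norm a) + (\<bar>r\<bar> * \<bar>q\<bar> + norm a * norm p)"
  proof (rule add_mono)
    show "norm (h *\<^sub>R p - q *\<^sub>R a) <= \<bar>h\<bar> * norm p + \<bar>q\<bar> * norm a"
      using norm_triangle_ineq4[of "h *\<^sub>R p" "q *\<^sub>R a"] by simp
    show "norm (r * q - a \<bullet> p) <= \<bar>r\<bar> * \<bar>q\<bar> + norm a * norm p"
      using Cauchy_Schwarz_ineq2[of a p] norm_triangle_ineq4[of "r * q" "a \<bullet> p"] by (simp add: abs_mult)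
  qed
  also have "\<dots> <= (norm c * norm X + norm X * norm c) + (norm c * norm X + norm c * norm X)"
    using n by (intro add_mono mult_mono) auto
  also have "\<dots> = norm c * norm X * 4" by simp
  finally show ?thesis .
qed

lemma bounded_bilinear_pmat: "bounded_bilinear pmat"
proof
  show "\<exists>K. \<forall>a b. norm (pmat a b) <= norm a * norm b * K" using pmat_norm by blast
qed (auto simp: pmat_def algebra_simps inner_add_left inner_add_right)

lemma normal_fieldD: "normal_field \<mu> X ==> sqint smeas X"
  "normal_field \<mu> X ==> strip_test_fun v g ==> (LINT p|smeas. X p \<bullet> scale_mu \<mu> (g p)) = 0"
  unfolding normal_field_def by blast+

lemma efield_sqint: "efield \<mu> Y ==> sqint smeas Y"
  and efieldD: "efield \<mu> Y ==> normal_field \<mu> X ==> (LINT p|smeas. X p \<bullet> Y p) = 0"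
  by (simp_all add: efield_def)

text \<open>The closure of the scaled test gradients lies in their double orthogonal complement;
  this is how concrete fields are recognised as an \<open>efield\<close>.\<close>

lemma efield_limit:
  assumes Y: "sqint smeas Y" and \<mu>: "0 < \<mu>" and g: "!!n::nat. strip_test_fun (v n) (g n)"
    "(%n. l2 smeas (%p. scale_mu \<mu> (g n p) - Y p)) \<longlonglongrightarrow> 0"
  shows "efield \<mu> Y"
  unfolding efield_def
proof (intro conjI allI impI Y)
  fix X :: "'a \<times> real => 'a \<times> real" assume X: "normal_field \<mu> X"
  note s = normal_fieldD(1)[OF X]
  have "(%n. LINT p|smeas. X p \<bullet> scale_mu \<mu> (g n p)) \<longlonglongrightarrow> (LINT p|smeas. X p \<bullet> Y p)"
    by (intro sqint_pairing_tendsto[where f = "%_. X"] s Y g(2) bounded_bilinear_inner sqint_test_field[OF g(1) \<mu>]) simp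
  then show "(LINT p|smeas. X p \<bullet> Y p) = 0" by (simp add: normal_fieldD(2)[OF X g(1)] LIMSEQ_const_iff)
qed

lemma normal_field_lin:
  assumes "normal_field \<mu> X" "normal_field \<mu> Z" "0 < \<mu>"
  shows "normal_field \<mu> (%p. a *\<^sub>R X p + b *\<^sub>R Z p)"
  unfolding normal_field_def
proof (intro conjI allI impI)
  note s = assms(1,2)[THEN normal_fieldD(1)]
  show "sqint smeas (%p. a *\<^sub>R X p + b *\<^sub>R Z p)" by (intro sqint_add sqint_scaleR s)
  fix v and g :: "'a \<times> real => 'a \<times> real" assume t: "strip_test_fun v g"
  note sqint_inner[OF s(1) sqint_test_field[OF t assms(3)]] sqint_inner[OF s(2) sqint_test_field[OF t assms(3)]]
  with normal_fieldD(2)[OF assms(1) t] normal_fieldD(2)[OF assms(2) t] show "(LINT p|smeas. (a *\<^sub>R X p + b *\<^sub>R Z p) \<bullet> scale_mu \<mu> (g p)) = 0"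
    by (simp add: inner_add_left)
qed

lemma efield_lin:
  assumes "efield \<mu> Y" "efield \<mu> Z"
  shows "efield \<mu> (%p. a *\<^sub>R Y p + b *\<^sub>R Z p)"
  using assms by (auto simp: efield_def normal_field_def inner_add_right sqint_inner intro!: sqint_add sqint_scaleR)

lemma pairing_shift:
  assumes "sqint smeas X" "sqint smeas Y" "h \<in> sdir"
  shows "(LINT p|smeas. X (p + h) \<bullet> Y p) = (LINT p|smeas. X p \<bullet> Y (p - h))"
proof -
  have [measurable]: "X \<in> borel_measurable borel" "Y \<in> borel_measurable borel" using assms by (simp_all add: sqint_def)
  show ?thesis using str.integral_N_shift[OF _ assms(3), of "%p. X p \<bullet> Y (p - h)"] by simp
qed

lemma normal_field_shift:
  assumes X: "normal_field \<mu> X" and h: "h \<in> sdir" and \<mu>: "0 < \<mu>"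
  shows "normal_field \<mu> (%p. X (p + h))"
  unfolding normal_field_def
proof (intro conjI allI impI)
  show "sqint smeas (%p. X (p + h))" using X h by (simp add: normal_field_def str.sqint_N_shift)
  fix v and g :: "'a \<times> real => 'a \<times> real" assume t: "strip_test_fun v g"
  show "(LINT p|smeas. X (p + h) \<bullet> scale_mu \<mu> (g p)) = 0"
    using X strip_test_fun_shift[OF t, of "- h"] h pairing_shift[of X "%p. scale_mu \<mu> (g p)" h] sqint_test_field[OF t \<mu>]
    by (simp add: normal_field_def sdir_def)
qed

lemma dq_diff: "dq h (%x. f x - g x) = (%x. dq h f x - dq h g x)"
  by (simp add: dq_def[abs_def] algebra_simps)

lemma normal_field_dq: "normal_field \<mu> X ==> h \<in> sdir ==> 0 < \<mu> ==> normal_field \<mu> (dq h X)"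
  using normal_field_lin[OF normal_field_shift[of \<mu> X h], of X "inverse (norm h)" "- inverse (norm h)"]
  by (simp add: dq_def[abs_def] algebra_simps)

text \<open>Defined by duality, an \<open>efield\<close> inherits invariance from normal fields: a
  shift by h is moved to the other factor as a shift by -h.\<close>

lemma efield_dq:
  assumes Y: "efield \<mu> Y" and h: "h \<in> sdir" and \<mu>: "0 < \<mu>"
  shows "efield \<mu> (dq h Y)"
proof -
  have "efield \<mu> (%p. Y (p + h))" unfolding efield_def
  proof (intro conjI allI impI)
    show "sqint smeas (%p. Y (p + h))" using Y h by (simp add: efield_def str.sqint_N_shift)
    have "- h \<in> sdir" using h by (simp add: sdir_def)
    moreover fix X :: "'a \<times> real => 'a \<times> real" assume X: "normal_field \<mu> X"
    ultimately show "(LINT p|smeas. X p \<bullet> Y (p + h)) = 0"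
      using Y normal_field_shift[OF X _ \<mu>, of "- h"] pairing_shift[of X Y "- h"] X
      by (simp add: efield_def normal_field_def)
  qed
  from efield_lin[OF this Y, of "inverse (norm h)" "- inverse (norm h)"] show ?thesis
    by (simp add: dq_def[abs_def] algebra_simps)
qed

lemma sqint_pmat:
  assumes "cls Linf smeas sdir 0 A c" "0 <= A" "sqint smeas Y"
  shows "sqint smeas (%p. pmat (c p) (Y p))"
  using cls_base(1)[OF str.cls_prod[OF bounded_bilinear_pmat pmat_norm _ assms(1), of L2 "l2 smeas Y" Y]] assms(3) by simp

text \<open>The equation is tested with Y itself. Being an \<open>efield\<close>, Y is orthogonal to
  the normal field P Y - F, so the energy equals the pairing of F with Y.\<close>

lemma energy_estimate:
  assumes c: "cls Linf smeas sdir 0 A c" "0 <= A" and \<kappa>: "0 < \<kappa>" "AE p in smeas. \<forall>X. \<kappa> * (norm X)\<^sup>2 <= pmat (c p) X \<bullet> X"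
    and Y: "efield \<mu> Y" and w: "normal_field \<mu> (%p. pmat (c p) (Y p) - F p)" and F: "sqint smeas F"
  shows "l2 smeas Y <= l2 smeas F / \<kappa>"
proof -
  note Ys = efield_sqint[OF Y]
  note i = sqint_inner[OF sqint_pmat[OF c Ys] Ys] sqint_inner[OF F Ys]
  have "\<kappa> * (l2 smeas Y)\<^sup>2 = (LINT p|smeas. \<kappa> * (norm (Y p))\<^sup>2)" by (simp add: l2_sq)
  also have "\<dots> <= (LINT p|smeas. pmat (c p) (Y p) \<bullet> Y p)"
    by (rule integral_mono_AE[OF _ i(1) eventually_mono[OF \<kappa>(2)]]) (use Ys in \<open>simp_all add: sqint_def del: split_paired_All\<close>)
  also have "\<dots> = (LINT p|smeas. F p \<bullet> Y p)" using efieldD[OF Y w] i by (simp add: inner_diff_left)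
  also have "\<dots> <= 1 * (l2 smeas F * l2 smeas Y)"
    using sqint_pairing(2)[OF F Ys bounded_bilinear_inner, of 1] by (simp add: Cauchy_Schwarz_ineq2)
  finally have le: "\<kappa> * l2 smeas Y * l2 smeas Y <= l2 smeas F * l2 smeas Y" by (simp add: power2_eq_square)
  show ?thesis
  proof (cases "l2 smeas Y = 0")
    case True
    then show ?thesis using \<kappa> by simp
  next
    case False
    then have "0 < l2 smeas Y" using l2_nonneg[of smeas Y] by linarith
    with le have "\<kappa> * l2 smeas Y <= l2 smeas F" by simp
    then show ?thesis using \<kappa> by (simp add: field_simps)
  qed
qed

text \<open>
  The horizontal difference quotient \<open>dq h Y\<close> solves the same problem with right-hand side
  \<open>dq h F - (dq h P) Y(\<cdot> + h)\<close>, so regularity follows by induction from the energy estimate.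
\<close>

lemma elliptic_regularity:
  assumes A: "0 <= A" and \<kappa>: "0 < \<kappa>"
  shows "\<exists>C\<ge>0. \<forall>\<mu> c (Y :: 'a::euclidean_space \<times> real => 'a \<times> real) F M. 0 < \<mu> --> cls Linf smeas sdir k A c -->
      (AE p in smeas. \<forall>X. \<kappa> * (norm X)\<^sup>2 <= pmat (c p) X \<bullet> X) --> efield \<mu> Y --> normal_field \<mu> (%p. pmat (c p) (Y p) - F p) -->
      cls L2 smeas sdir k M F --> cls L2 smeas sdir k (C * M) Y"
proof (induction k)
  case 0
  have "l2 smeas Y <= inverse \<kappa> * M"
    if "0 < \<mu>" "cls Linf smeas sdir 0 A c" "AE p in smeas. \<forall>X. \<kappa> * (norm X)\<^sup>2 <= pmat (c p) X \<bullet> X"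
      "efield \<mu> Y" "normal_field \<mu> (%p. pmat (c p) (Y p) - F p)" "cls L2 smeas sdir 0 M F"
    for \<mu> c and Y :: "'a \<times> real => 'a \<times> real" and F M
  proof -
    have "l2 smeas Y <= l2 smeas F / \<kappa>"
      using that by (intro energy_estimate[OF _ A \<kappa>]) auto
    also have "\<dots> <= M / \<kappa>" using that(6) \<kappa> by (intro divide_right_mono) auto
    finally show ?thesis by (simp add: divide_inverse mult.commute)
  qed
  then show ?case using \<kappa> by (intro exI[of _ "inverse \<kappa>"]) (auto simp: efield_sqint)
next
  case (Suc k)
  then obtain C where C: "0 <= C" "!!\<mu> c (Y :: 'a \<times> real => 'a \<times> real) F M. 0 < \<mu> ==> cls Linf smeas sdir k A c ==>
      AE p in smeas. \<forall>X. \<kappa> * (norm X)\<^sup>2 <= pmat (c p) X \<bullet> X ==> efield \<mu> Y ==> normal_field \<mu> (%p. pmat (c p) (Y p) - F p) ==>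
      cls L2 smeas sdir k M F ==> cls L2 smeas sdir k (C * M) Y" by blast
  \<comment> \<open>The first summand bounds Y, the second its difference quotients: the induction
    constant C is applied to a right-hand side bounded by M plus the commutator, a product of
    \<open>dq h c\<close> (bound A) with the shifted Y (bound C M).\<close>
  define C' where "C' = C + C * (1 + 2 ^ k * 4 * A * C)"
  have C'0: "0 <= C'" using A C(1) by (simp add: C'_def)
  have "cls L2 smeas sdir (Suc k) (C' * M) Y"
    if \<mu>: "0 < \<mu>" and c: "cls Linf smeas sdir (Suc k) A c" and co: "AE p in smeas. \<forall>X. \<kappa> * (norm X)\<^sup>2 <= pmat (c p) X \<bullet> X"
      and Y: "efield \<mu> Y" and w: "normal_field \<mu> (%p. pmat (c p) (Y p) - F p)" and F: "cls L2 smeas sdir (Suc k) M F"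
    for \<mu> c and Y :: "'a \<times> real => 'a \<times> real" and F M
  proof -
    have M: "0 <= M" using cls_nonneg[OF F] .
    have Yk: "cls L2 smeas sdir k (C * M) Y" by (rule C(2)[OF \<mu> cls_Suc[OF c] co Y w cls_Suc[OF F]])
    have c0: "cls Linf smeas sdir 0 A c" using cls_le[OF c, of 0] by simp
    have step: "cls L2 smeas sdir k (C * (M + 2 ^ k * 4 * A * (C * M))) (dq h Y)" if h: "h \<in> sdir" "h \<noteq> 0" for h
    proof (rule C(2)[OF \<mu> cls_Suc[OF c] co efield_dq[OF Y h(1) \<mu>]])
      have dc: "cls Linf smeas sdir k A (dq h c)" using c h by simp
      have P: "cls L2 smeas sdir k (2 ^ k * 4 * A * (C * M)) (%p. pmat (dq h c p) (Y (p + h)))"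
        by (rule str.cls_prod[OF bounded_bilinear_pmat pmat_norm _ dc str.cls_shift[OF Yk h(1)]]) simp
      show "normal_field \<mu> (%p. pmat (c p) (dq h Y p) - (dq h F p - pmat (dq h c p) (Y (p + h))))"
        using normal_field_dq[OF w h(1) \<mu>] unfolding dq_diff str.dq_prod[OF bounded_bilinear_pmat] by (simp add: algebra_simps)
      show "cls L2 smeas sdir k (M + 2 ^ k * 4 * A * (C * M)) (%p. dq h F p - pmat (dq h c p) (Y (p + h)))"
        using F h by (intro str.cls_diff P) simp
    qed
    have eq: "C * (M + 2 ^ k * 4 * A * (C * M)) = (C' - C) * M" by (simp add: C'_def algebra_simps)
    have le1: "C * M <= C' * M" using M A C(1) by (intro mult_right_mono) (auto simp: C'_def)
    have "(C' - C) * M <= C' * M" using M C(1) by (intro mult_right_mono) auto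
    then have "cls L2 smeas sdir k (C' * M) (dq h Y)" if "h \<in> sdir" "h \<noteq> 0" for h
      using step[OF that] unfolding eq by (rule cls_mono[rotated])
    moreover have "l2 smeas Y <= C' * M" using cls_base(2)[OF Yk] le1 by linarith
    ultimately show ?thesis using efield_sqint[OF Y] by simp
  qed
  then show ?case using C'0 by blast
qed

lemma fst_snd_measurable [measurable]:
  "(%p. fst p) \<in> measurable (borel :: ('a::euclidean_space \<times> real) measure) borel"
  "(%p. snd p) \<in> measurable (borel :: ('a::euclidean_space \<times> real) measure) borel"
  unfolding borel_prod[symmetric] by measurable

subsection \<open>Integration over the depth\<close>

lemma AE_ivl: "AE z in ivl. -1 < z & z < 0"
  by (subst AE_density) (auto simp: indicator_def)

lemma emeasure_ivl: "emeasure ivl UNIV = 1"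
  by (simp add: emeasure_density)

lemma integrable_ivl:
  fixes f :: "real => real"
  assumes "continuous_on UNIV f"
  shows "integrable ivl f"
proof -
  have "compact (f ` {-1..0})" by (intro compact_continuous_image continuous_on_subset[OF assms]) auto
  then obtain B where "!!z. z \<in> {-1..0} ==> norm (f z) <= B" by (meson compact_imp_bounded bounded_iff imageI)
  then show ?thesis
    by (intro ivl.integrable_const_bound[where B = B])
      (auto simp: borel_measurable_continuous_onI[OF assms] intro: AE_mp[OF AE_ivl AE_I2])
qed

lemma ivl_FTC:
  fixes f :: "real => real"
  assumes F: "!!z. DERIV F z :> f z" and c: "continuous_on UNIV f" and z: "-1 <= z" "z <= 0"
  shows "(LINT t|ivl. indicator {..z} t * f t) = F z - F (-1)"
proof -
  have "has_bochner_integral lborel (%t. indicator {-1..z} t *\<^sub>R f t) (F z - F (-1))"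
  proof (rule has_bochner_integral_FTC_Icc)
    show "(F has_vector_derivative f t) (at t within {-1..z})" for t
      using F has_real_derivative_iff_has_vector_derivative has_vector_derivative_at_within by blast
  qed (use c z in \<open>auto intro: continuous_on_subset\<close>)
  then have I: "(LINT t|lborel. indicator {-1..z} t *\<^sub>R f t) = F z - F (-1)"
    by (rule has_bochner_integral_integral_eq)
  note [measurable] = borel_measurable_continuous_onI[OF c]
  have "(LINT t|ivl. indicator {..z} t * f t) = (LINT t|density lborel (%t. ennreal (indicator {-1<..<0} t)). indicator {..z} t * f t)"
    by (simp add: ennreal_indicator)
  also have "\<dots> = (LINT t|lborel. indicator {-1<..<0} t *\<^sub>R (indicator {..z} t * f t))"
    by (rule integral_density) auto
  also have "\<dots> = (LINT t|lborel. indicator {-1..z} t *\<^sub>R f t)"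
  proof (rule integral_cong_AE)
    show "AE t in lborel. indicator {-1<..<0} t *\<^sub>R (indicator {..z} t * f t) = indicator {-1..z} t *\<^sub>R f t"
      using AE_lborel_singleton[of "-1::real"] AE_lborel_singleton[of "0::real"]
      by eventually_elim (use z in \<open>auto simp: indicator_def\<close>)
  qed auto
  finally show ?thesis unfolding I .
qed

lemma ivl_FTC_0:
  fixes f :: "real => real"
  assumes "!!z. DERIV F z :> f z" "continuous_on UNIV f"
  shows "(LINT z|ivl. f z) = F 0 - F (-1)"
proof -
  have "(LINT z|ivl. f z) = (LINT z|ivl. indicator {..0} z * f z)"
    by (rule integral_cong_AE) (use AE_ivl borel_measurable_continuous_onI[OF assms(2)] in \<open>auto elim: eventually_mono\<close>)
  then show ?thesis using ivl_FTC[OF assms, of 0] by simp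
qed

text \<open>The bound is required inside the strip only, which admits weights such as z + 1.\<close>

definition vweight :: "real => (real => real) => bool" where
  "vweight C a \<longleftrightarrow> a \<in> borel_measurable borel & (\<forall>z. -1 < z --> z < 0 --> \<bar>a z\<bar> <= C)"

lemma vweight_nonneg: "vweight C a ==> 0 <= C"
  unfolding vweight_def using abs_ge_zero[of "a (-1/2)"] by (auto dest!: spec[of _ "-1/2"])

lemma ivl_Cauchy_Schwarz:
  fixes F :: "real => 'b::euclidean_space"
  assumes a: "vweight C a" and F: "sqint ivl F"
  shows "integrable ivl (%z. a z *\<^sub>R F z)" "norm (LINT z|ivl. a z *\<^sub>R F z) <= C * l2 ivl F"
proof -
  have one: "sqint ivl (%_. 1 :: real)" by (simp add: sqint_def)
  have "AE z in ivl. norm (a z) <= C * norm (1::real)"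
    using AE_ivl by (rule eventually_mono) (use a in \<open>simp add: vweight_def\<close>)
  from sqint_bound[OF one _ this] have s: "sqint ivl a" "l2 ivl a <= C"
    using a vweight_nonneg[OF a] by (auto simp: vweight_def l2_def measure_def emeasure_ivl)
  note p = sqint_pairing[OF s(1) F bounded_bilinear_scaleR, of 1]
  show "integrable ivl (%z. a z *\<^sub>R F z)" using p(1) by simp
  have "norm (LINT z|ivl. a z *\<^sub>R F z) <= l2 ivl a * l2 ivl F" using p(2) by simp
  also have "\<dots> <= C * l2 ivl F" using s(2) by (rule mult_right_mono) simp
  finally show "norm (LINT z|ivl. a z *\<^sub>R F z) <= C * l2 ivl F" .
qed

subsection \<open>Vertical modes\<close>

text \<open>The squares are the eigenvalues of minus the second derivative on (-1, 0) with Neumann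
  condition at the bottom and Dirichlet condition at the surface; \<open>cmode\<close> is the
  eigenfunction with value 1 at the bottom.\<close>

definition freq :: "nat => real" where "freq j = (real j + 1/2) * pi"

definition cmode :: "nat => real => real" where "cmode j z = cos (freq j * (z + 1))"

text \<open>The primitive of \<open>cmode\<close> that vanishes at the bottom.\<close>

definition smode :: "nat => real => real" where "smode j z = sin (freq j * (z + 1)) / freq j"

lemma freq_gt: "1 < freq j"
proof -
  have "1 < pi / 2" using pi_gt3 by simp
  also have "\<dots> <= freq j" by (simp add: freq_def field_simps)
  finally show ?thesis .
qed

lemma freq_pos [simp]: "0 < freq j" "freq j \<noteq> 0" "0 <= freq j" "\<bar>freq j\<bar> = freq j"
  using freq_gt[of j] by auto

lemma cos_freq [simp]: "cos (freq j) = 0"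
  by (simp add: freq_def distrib_right cos_add)

lemma sin_freq [simp]: "(sin (freq j))\<^sup>2 = 1" "sin (freq j) * sin (freq j) = 1" "\<bar>sin (freq j)\<bar> = 1"
proof -
  show *: "(sin (freq j))\<^sup>2 = 1" using sin_cos_squared_add[of "freq j"] by simp
  then show "sin (freq j) * sin (freq j) = 1" by (simp add: power2_eq_square)
  show "\<bar>sin (freq j)\<bar> = 1" using * by (auto simp: power2_eq_1_iff)
qed

lemma DERIV_modes:
  "DERIV (smode j) z :> cmode j z" "DERIV (cmode j) z :> - ((freq j)\<^sup>2 * smode j z)"
  unfolding smode_def[abs_def] cmode_def[abs_def] by (auto intro!: derivative_eq_intros simp: power2_eq_square)

lemma modes_cont: "continuous_on A (cmode j)" "continuous_on A (smode j)"
  unfolding smode_def[abs_def] cmode_def[abs_def] by (intro continuous_intros; simp)+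

lemma modes_boundary [simp]: "cmode j 0 = 0" "cmode j (-1) = 1" "smode j (-1) = 0" "smode j 0 = sin (freq j) / freq j"
  by (simp_all add: cmode_def smode_def)

lemma modes_bound: "\<bar>cmode j z\<bar> <= 1" "\<bar>smode j z\<bar> <= 1 / freq j"
  by (auto simp: cmode_def smode_def abs_divide less_imp_le intro!: divide_right_mono)

text \<open>Green's formula on the depth interval. At the surface \<open>cmode\<close> vanishes and
  its slope is -r sin r, r = \<open>freq j\<close>; at the bottom it is 1 with slope 0. All mode
  integrals below are instances of it.\<close>

lemma mode_Green:
  assumes d: "!!z. DERIV f z :> f' z" "!!z. DERIV f' z :> f'' z" and c: "continuous_on UNIV f''"
  shows "(LINT z|ivl. (f'' z + (freq j)\<^sup>2 * f z) * cmode j z) = freq j * sin (freq j) * f 0 - f' (-1)"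
proof -
  have fc: "continuous_on UNIV f" using d(1) by (intro DERIV_continuous_on) blast
  have "DERIV (%z. f' z * cmode j z - f z * - ((freq j)\<^sup>2 * smode j z)) z :> (f'' z + (freq j)\<^sup>2 * f z) * cmode j z" for z
    by (rule derivative_eq_intros d DERIV_modes refl)+ (simp add: algebra_simps)
  from ivl_FTC_0[OF this] show ?thesis
    by (simp add: continuous_intros c fc modes_cont power2_eq_square algebra_simps)
qed

lemma cmode_integrals:
  "(LINT z|ivl. cmode j z) = sin (freq j) / freq j"
  "i \<noteq> j ==> (LINT z|ivl. cmode i z * cmode j z) = 0"
  "(LINT z|ivl. cmode j z * cmode j z) = 1 / 2"
proof -
  \<comment> \<open>Green's formula for the constant function 1.\<close>
  have "(LINT z|ivl. (freq j)\<^sup>2 * cmode j z) = freq j * sin (freq j)"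
    using mode_Green[of "%_. 1" "%_. 0" "%_. 0" j] by simp
  then show "(LINT z|ivl. cmode j z) = sin (freq j) / freq j" by (simp add: power2_eq_square field_simps)
  have "(LINT z|ivl. (- ((freq i)\<^sup>2 * cmode i z) + (freq j)\<^sup>2 * cmode i z) * cmode j z) = 0"
  proof (subst mode_Green)
    show "DERIV (%z. - ((freq i)\<^sup>2 * smode i z)) z :> - ((freq i)\<^sup>2 * cmode i z)" for z by (rule DERIV_minus DERIV_cmult DERIV_modes)+
  qed (auto intro!: DERIV_modes continuous_intros modes_cont)
  then have "((freq j)\<^sup>2 - (freq i)\<^sup>2) * (LINT z|ivl. cmode i z * cmode j z) = 0"
    by (simp add: left_diff_distrib[symmetric] mult.assoc flip: integral_mult_right_zero)
  moreover assume "i \<noteq> j"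
  then have "freq i \<noteq> freq j" by (simp add: freq_def)
  then have "(freq i)\<^sup>2 \<noteq> (freq j)\<^sup>2" using freq_pos(1)[of i] freq_pos(1)[of j] by (metis less_imp_le power2_eq_imp_eq)
  ultimately show "(LINT z|ivl. cmode i z * cmode j z) = 0" by simp
next
  \<comment> \<open>The resonant choice f = (z + 1) \<open>smode j\<close> / 2 solves f'' + r^2 f =
    \<open>cmode j\<close>, so Green's formula evaluates the square integral.\<close>
  have "(LINT z|ivl. (cmode j z - (freq j)\<^sup>2 * ((z + 1) * smode j z / 2) + (freq j)\<^sup>2 * ((z + 1) * smode j z / 2)) * cmode j z)
      = freq j * sin (freq j) * ((0 + 1) * smode j 0 / 2) - (smode j (-1) + (-1 + 1) * cmode j (-1)) / 2"
  proof (rule mode_Green)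
    show "DERIV (%z. (z + 1) * smode j z / 2) z :> (smode j z + (z + 1) * cmode j z) / 2" for z
      by (rule derivative_eq_intros DERIV_modes refl)+ (simp_all add: field_simps)
    show "DERIV (%z. (smode j z + (z + 1) * cmode j z) / 2) z :> cmode j z - (freq j)\<^sup>2 * ((z + 1) * smode j z / 2)" for z
      by (rule derivative_eq_intros DERIV_modes refl)+ (simp_all add: field_simps)
  qed (intro continuous_intros modes_cont; simp)
  then show "(LINT z|ivl. cmode j z * cmode j z) = 1 / 2" by simp
qed

text \<open>The partial sums of the expansion \<open>1 = \<Sigma>\<^sub>j (2 sin r\<^sub>j / r\<^sub>j) cos (r\<^sub>j (z + 1))\<close>, \<open>r\<^sub>j = freq j\<close>.\<close>

definition msum :: "nat => real => real" where
  "msum N z = (\<Sum>j<N. 2 * sin (freq j) / freq j * cmode j z)"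

lemma msum_cont: "continuous_on A (msum N)"
  unfolding msum_def[abs_def] by (intro continuous_intros modes_cont)

text \<open>The odd part of the series of inverse squares: the terms are grouped in pairs, and the
  even ones form a quarter of the whole series.\<close>

lemma sums_freq: "(%j. 2 / (freq j)\<^sup>2) sums 1"
proof -
  have b: "(%n. 1 / (real n + 1)\<^sup>2) sums (pi\<^sup>2 / 6)" using inverse_squares_sums by (simp add: add.commute)
  from sums_group[OF this, of 2] have "(%n. \<Sum>k = n * 2..<n * 2 + 2. 1 / (real k + 1)\<^sup>2) sums (pi\<^sup>2 / 6)" by simp
  then have "(%n. 1 / (2 * real n + 1)\<^sup>2 + 1 / (2 * real n + 2)\<^sup>2) sums (pi\<^sup>2 / 6)"
    by (simp add: numeral_2_eq_2 algebra_simps)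
  moreover have "(2 * real n + 2)\<^sup>2 = 4 * (real n + 1)\<^sup>2" for n by (simp add: power2_eq_square algebra_simps)
  ultimately have "(%n. 1 / (2 * real n + 1)\<^sup>2 + 1 / 4 * (1 / (real n + 1)\<^sup>2)) sums (pi\<^sup>2 / 6)" by simp
  from sums_diff[OF this sums_mult[OF b, of "1/4"]] have "(%n. 1 / (2 * real n + 1)\<^sup>2) sums (pi\<^sup>2 / 8)" by simp
  from sums_mult[OF this, of "8 / pi\<^sup>2"] show ?thesis
    by (simp add: freq_def power2_eq_square field_simps)
qed

text \<open>With \<open>sums_freq\<close> this is Parseval's identity for the single function 1,
  which takes the place of completeness of the modes.\<close>

lemma msum_defect:
  "(LINT z|ivl. (1 - msum N z) * (1 - msum N z)) = 1 - (\<Sum>j<N. 2 / (freq j)\<^sup>2)"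
proof (induction N)
  case 0
  then show ?case by (simp add: msum_def measure_def emeasure_ivl)
next
  case (Suc N)
  let ?c = "2 * sin (freq N) / freq N"
  have i: "integrable ivl (%z. cmode i z * cmode N z)" "integrable ivl (cmode N)" for i
    by (intro integrable_ivl continuous_intros modes_cont)+
  have "(LINT z|ivl. (1 - msum N z) * cmode N z)
      = (LINT z|ivl. cmode N z - (\<Sum>j<N. 2 * sin (freq j) / freq j * (cmode j z * cmode N z)))"
    by (simp add: msum_def left_diff_distrib sum_distrib_right mult.assoc)
  also have "\<dots> = sin (freq N) / freq N" using i by (simp add: cmode_integrals)
  finally have e: "(LINT z|ivl. (1 - msum N z) * cmode N z) = sin (freq N) / freq N" .
  have "(LINT z|ivl. (1 - msum (Suc N) z) * (1 - msum (Suc N) z)) = (LINT z|ivl. (1 - msum N z) * (1 - msum N z)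
      - 2 * (?c * ((1 - msum N z) * cmode N z)) + ?c\<^sup>2 * (cmode N z * cmode N z))"
    by (rule Bochner_Integration.integral_cong) (simp_all add: msum_def algebra_simps power2_eq_square)
  also have "\<dots> = 1 - (\<Sum>j<N. 2 / (freq j)\<^sup>2) - 2 * (?c * (sin (freq N) / freq N)) + ?c\<^sup>2 * (1 / 2)"
    unfolding Suc[symmetric] e[symmetric] cmode_integrals(3)[of N, symmetric]
    by (simp add: integrable_ivl continuous_intros msum_cont modes_cont)
  finally have *: "(LINT z|ivl. (1 - msum (Suc N) z) * (1 - msum (Suc N) z)) = \<dots>" .
  have c: "?c * (sin (freq N) / freq N) = 2 / (freq N)\<^sup>2" "?c\<^sup>2 = 4 / (freq N)\<^sup>2"
    by (simp_all add: power_divide power_mult_distrib power2_eq_square[of "freq N"])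
  show ?case unfolding * c by simp
qed

lemma msum_sqint: "sqint ivl (%z. 1 - msum N z)"
  unfolding sqint_def power2_norm_eq_inner inner_real_def
  by (intro conjI integrable_ivl continuous_intros msum_cont) (simp add: borel_measurable_continuous_onI msum_cont continuous_intros)

lemma msum_tendsto: "(%N. l2 ivl (%z. 1 - msum N z)) \<longlonglongrightarrow> 0"
proof -
  have "(%N. 1 - (\<Sum>j<N. 2 / (freq j)\<^sup>2)) \<longlonglongrightarrow> 1 - 1"
    by (intro tendsto_intros sums_freq[unfolded sums_def])
  from tendsto_real_sqrt[OF this] show ?thesis
    by (simp add: l2_def power2_eq_square msum_defect)
qed

text \<open>The function is the primitive of 1 - \<open>msum N\<close> from the bottom, so L2
  convergence of the latter gives uniform convergence here.\<close>

lemma vweight_smode_sum: "vweight (l2 ivl (%z. 1 - msum N z)) (%z. z + 1 - (\<Sum>j<N. 2 * sin (freq j) / freq j * smode j z))"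
  unfolding vweight_def
proof (intro conjI allI impI)
  let ?R = "%z. z + 1 - (\<Sum>j<N. 2 * sin (freq j) / freq j * smode j z)"
  show "?R \<in> borel_measurable borel" by (intro borel_measurable_continuous_onI continuous_intros modes_cont)
  fix z :: real assume z: "-1 < z" "z < 0"
  have d: "DERIV ?R t :> 1 - msum N t" for t
    unfolding msum_def by (rule derivative_eq_intros DERIV_modes refl)+ (simp add: mult_ac)
  have "vweight 1 (indicator {..z})" by (auto simp: vweight_def indicator_def)
  from ivl_Cauchy_Schwarz(2)[OF this msum_sqint[of N]] show "\<bar>?R z\<bar> <= l2 ivl (%z. 1 - msum N z)"
    using ivl_FTC[OF d, of z] z by (simp add: continuous_intros msum_cont)
qed

text \<open>
  Expanding \<open>1 - cosh (k (z + 1)) / cosh k\<close>, whose average is \<open>1 - tanh k / k\<close>, in the modes gives a partial fraction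
  decomposition of the latter.
\<close>

lemma tanh_sums:
  assumes k: "0 < k"
  shows "(%j. 2 * k\<^sup>2 / ((freq j)\<^sup>2 * (k\<^sup>2 + (freq j)\<^sup>2))) sums (1 - tanh k / k)"
proof -
  define q where "q z = 1 - cosh (k * (z + 1)) / cosh k" for z
  have ch: "cosh k \<noteq> 0" by simp
  have qc: "continuous_on A q" for A unfolding q_def[abs_def] by (intro continuous_intros ch ballI)
  have q1: "DERIV q z :> - k * sinh (k * (z + 1)) / cosh k" for z
    unfolding q_def[abs_def] by (auto intro!: derivative_eq_intros)
  have "DERIV (%z. - k * sinh (k * (z + 1)) / cosh k) z :> k\<^sup>2 * q z - k\<^sup>2" for z
    by (auto intro!: derivative_eq_intros simp: q_def power2_eq_square field_simps)
  \<comment> \<open>q vanishes at the surface and q' at the bottom, so there are no boundary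
    terms.\<close>
  from mode_Green[OF q1 this] have "(LINT z|ivl. (k\<^sup>2 * q z - k\<^sup>2 + (freq j)\<^sup>2 * q z) * cmode j z) = 0" for j
    by (simp add: continuous_intros qc) (simp add: q_def)
  then have "(LINT z|ivl. (k\<^sup>2 + (freq j)\<^sup>2) * (q z * cmode j z) - k\<^sup>2 * cmode j z) = 0" for j
    by (simp add: algebra_simps)
  then have "(k\<^sup>2 + (freq j)\<^sup>2) * (LINT z|ivl. q z * cmode j z) = k\<^sup>2 * (sin (freq j) / freq j)" for j
    by (simp add: integrable_ivl continuous_intros qc modes_cont cmode_integrals)
  moreover have pos: "0 < k\<^sup>2 + (freq j)\<^sup>2" for j using k by (intro add_pos_pos) auto
  ultimately have qm: "(LINT z|ivl. q z * cmode j z) = k\<^sup>2 * (sin (freq j) / freq j) / (k\<^sup>2 + (freq j)\<^sup>2)" for j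
    using pos[of j] by (simp add: eq_divide_eq mult_ac)
  have "(LINT z|ivl. q z) = (0 - sinh (k * (0 + 1)) / (k * cosh k)) - (-1 - sinh (k * (-1 + 1)) / (k * cosh k))"
    by (rule ivl_FTC_0[OF _ qc]) (use k in \<open>auto intro!: derivative_eq_intros simp: q_def field_simps\<close>)
  then have q0: "(LINT z|ivl. q z) = 1 - tanh k / k" by (simp add: tanh_def divide_simps)
  have "vweight 1 q" unfolding vweight_def
  proof (intro conjI allI impI)
    show "q \<in> borel_measurable borel" by (rule borel_measurable_continuous_onI[OF qc])
    fix z :: real assume z: "-1 < z" "z < 0"
    have "k * (z + 1) <= k" using z k by simp
    then have "cosh (k * (z + 1)) <= cosh k" using z k by (subst cosh_real_nonneg_le_iff) auto
    then show "\<bar>q z\<bar> <= 1" using cosh_real_pos[of "k * (z + 1)"] cosh_real_pos[of k] by (simp add: q_def abs_if)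
  qed
  \<comment> \<open>Since q is bounded by 1, replacing 1 by \<open>msum N\<close> under the average
    of q costs at most the L2 defect; this is the convergence of the series.\<close>
  note cs = ivl_Cauchy_Schwarz(2)[OF this msum_sqint]
  have "(LINT z|ivl. q z *\<^sub>R (1 - msum N z)) = (LINT z|ivl. q z - (\<Sum>j<N. 2 * sin (freq j) / freq j * (q z * cmode j z)))" for N
    by (simp add: msum_def right_diff_distrib sum_distrib_left mult_ac)
  also have "\<dots> N = (1 - tanh k / k) - (\<Sum>j<N. 2 * k\<^sup>2 / ((freq j)\<^sup>2 * (k\<^sup>2 + (freq j)\<^sup>2)))" for N
    by (simp add: integrable_ivl continuous_intros qc modes_cont q0 qm) (simp add: power2_eq_square mult_ac sin_freq)
  finally have "\<bar>(\<Sum>j<N. 2 * k\<^sup>2 / ((freq j)\<^sup>2 * (k\<^sup>2 + (freq j)\<^sup>2))) - (1 - tanh k / k)\<bar> <= l2 ivl (%z. 1 - msum N z)" for N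
    using cs[of N] by (simp add: abs_minus_commute)
  then show ?thesis unfolding sums_def
    by (intro Lim_transform_bound[OF _ msum_tendsto] LIM_zero_cancel[of _ "1 - tanh k / k"] Lim_null_comparison[OF _ msum_tendsto])
      (auto intro: always_eventually)
qed

section \<open>The symbol F1 and its expansion\<close>

text \<open>With k = \<surd>\<mu> |\<xi>|. The quotient on the right is the symbol that maps
  \<Delta>\<psi> to the depth integral of \<phi> - \<psi> when \<epsilon> = 0, and the summands are
  the contributions of the modes.\<close>

lemma F1_symbol_sums:
  fixes \<xi> :: "'a::euclidean_space"
  assumes "0 < \<mu>" "\<xi> \<noteq> 0"
  shows "(%j. 2 * \<mu> / ((freq j)\<^sup>2 * (\<mu> * (norm \<xi>)\<^sup>2 + (freq j)\<^sup>2))) sums ((1 - F1_symbol \<mu> \<xi>) / (norm \<xi>)\<^sup>2)"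
proof -
  have "0 < sqrt \<mu> * norm \<xi>" "0 < norm \<xi>" using assms by simp_all
  from sums_divide[OF tanh_sums[OF this(1)], of "(norm \<xi>)\<^sup>2"] this(2) assms show ?thesis
    by (simp add: F1_symbol_def power_mult_distrib mult_ac)
qed

text \<open>Every summand of the expansion is nonnegative and at most \<mu> times the one in
  \<open>sums_freq\<close>.\<close>

lemma F1_symbol_defect:
  assumes \<mu>: "0 < \<mu>"
  shows "0 <= (1 - F1_symbol \<mu> \<xi>) / (norm \<xi>)\<^sup>2" "(1 - F1_symbol \<mu> \<xi>) / (norm \<xi>)\<^sup>2 <= \<mu>"
proof -
  have "0 <= (1 - F1_symbol \<mu> \<xi>) / (norm \<xi>)\<^sup>2 & (1 - F1_symbol \<mu> \<xi>) / (norm \<xi>)\<^sup>2 <= \<mu>"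
  proof (cases "\<xi> = 0")
    case False
    note s = F1_symbol_sums[OF \<mu> False]
    have "0 <= (1 - F1_symbol \<mu> \<xi>) / (norm \<xi>)\<^sup>2" by (rule sums_le[OF _ sums_zero s]) (use \<mu> in simp)
    moreover have "(1 - F1_symbol \<mu> \<xi>) / (norm \<xi>)\<^sup>2 <= \<mu> * 1"
    proof (rule sums_le[OF _ s sums_mult[OF sums_freq]])
      fix j
      have "1 <= (freq j)\<^sup>2" using freq_gt[of j] by (simp add: one_le_power)
      then have "1 <= \<mu> * (norm \<xi>)\<^sup>2 + (freq j)\<^sup>2" using \<mu> by (simp add: add_increasing)
      then have "2 * \<mu> / ((freq j)\<^sup>2 * (\<mu> * (norm \<xi>)\<^sup>2 + (freq j)\<^sup>2)) <= 2 * \<mu> / ((freq j)\<^sup>2 * 1)"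
        using \<mu> by (intro divide_left_mono mult_left_mono mult_pos_pos) auto
      then show "2 * \<mu> / ((freq j)\<^sup>2 * (\<mu> * (norm \<xi>)\<^sup>2 + (freq j)\<^sup>2)) <= \<mu> * (2 / (freq j)\<^sup>2)" by (simp add: mult.commute)
    qed
    ultimately show ?thesis by simp
  \<comment> \<open>At \<xi> = 0 the quotient is 0 by the convention for division by zero.\<close>
  qed (use \<mu> in simp)
  then show "0 <= (1 - F1_symbol \<mu> \<xi>) / (norm \<xi>)\<^sup>2" "(1 - F1_symbol \<mu> \<xi>) / (norm \<xi>)\<^sup>2 <= \<mu>" by blast+
qed

lemma F1_symbol_even: "F1_symbol \<mu> (- \<xi>) = F1_symbol \<mu> \<xi>"
  by (simp add: F1_symbol_def)

lemma F1_symbol_measurable [measurable]: "F1_symbol \<mu> \<in> borel_measurable (borel :: 'a::euclidean_space measure)"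
proof -
  have [measurable]: "(tanh :: real => real) \<in> borel_measurable borel"
    by (intro borel_measurable_continuous_onI continuous_intros) auto
  show ?thesis unfolding F1_symbol_def[abs_def] by measurable
qed

lemma AE_smeas_fst:
  assumes "AE x in lborel. P (x :: 'a::euclidean_space)"
  shows "AE p in smeas. P (fst p)"
proof -
  from assms obtain S where S: "{x. \<not> P x} \<subseteq> S" "S \<in> null_sets lborel"
    unfolding eventually_ae_filter by auto
  have "emeasure smeas (S \<times> UNIV) = emeasure lborel S * emeasure ivl UNIV"
    unfolding smeas_pair using S(2) by (intro ivl.emeasure_pair_measure_Times) auto
  then have "S \<times> UNIV \<in> null_sets smeas"
    unfolding smeas_pair using S(2) by (intro null_setsI) (auto simp: smeas_pair)
  then show ?thesis using S(1) by (intro AE_I'[of "S \<times> UNIV"]) auto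
qed

lemma sqint_lift:
  fixes f :: "'a::euclidean_space => 'b::euclidean_space"
  assumes f: "sqint lborel f"
  shows "sqint smeas (%p. f (fst p))" "l2 smeas (%p. f (fst p)) <= l2 lborel f"
proof -
  have [measurable]: "f \<in> borel_measurable borel" using f by (simp add: sqint_def)
  have m: "(%p. ennreal ((norm (f (fst p)))\<^sup>2)) \<in> borel_measurable (smeas :: ('a \<times> real) measure)" by measurable
  have "(\<integral>\<^sup>+p. ennreal ((norm (f (fst p)))\<^sup>2) \<partial>smeas) = (\<integral>\<^sup>+x. \<integral>\<^sup>+z. ennreal ((norm (f x))\<^sup>2) \<partial>ivl \<partial>lborel)"
    using ivl.nn_integral_fst[of "%p. ennreal ((norm (f (fst p)))\<^sup>2)" "lborel :: 'a measure"] m unfolding smeas_pair by simp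
  also have "\<dots> = (\<integral>\<^sup>+x. ennreal ((norm (f x))\<^sup>2) \<partial>lborel)" by (simp add: emeasure_ivl)
  also have "\<dots> = ennreal ((l2 lborel f)\<^sup>2)" by (rule nn_sq_l2[OF f])
  finally have e: "(\<integral>\<^sup>+p. ennreal ((norm (f (fst p)))\<^sup>2) \<partial>smeas) = ennreal ((l2 lborel f)\<^sup>2)" .
  have fm: "(%p. f (fst p)) \<in> borel_measurable smeas" by measurable
  show "sqint smeas (%p. f (fst p))" "l2 smeas (%p. f (fst p)) <= l2 lborel f"
    using sqint_l2_leI[OF fm eq_refl[OF e]] by auto
qed

lemma test_fun_slice:
  assumes t: "test_fun v (g :: 'a::euclidean_space \<times> real => 'a \<times> real)"
  shows "test_fun (%x. v (x, z)) (%x. fst (g (x, z)))" "DERIV (%z. v (x, z)) z :> snd (g (x, z))"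
proof -
  have d: "(v has_derivative (%h. h \<bullet> g p)) (at p)" for p using t unfolding test_fun_def gderiv_def by blast
  have c: "continuous_on UNIV g" by (rule test_fun_cont(2)[OF t])
  obtain R where R: "0 < R" "!!x. R < norm x ==> v x = 0 & g x = 0" using test_fun_support[OF t] by blast
  show "test_fun (%x. v (x, z)) (%x. fst (g (x, z)))"
  proof (rule test_funI[where R = R])
    fix x :: 'a
    have "((%x. (x, z)) has_derivative (%h. (h, 0))) (at x)" by (auto intro!: derivative_eq_intros)
    from has_derivative_compose[OF this d[of "(x, z)"]] show "GDERIV (%x. v (x, z)) x :> fst (g (x, z))"
      unfolding gderiv_def by (rule has_derivative_eq_rhs) (auto simp: inner_prod_def)
  next
    show "continuous_on UNIV (%x. fst (g (x, z)))"
      by (intro continuous_intros continuous_on_compose2[OF c]) auto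
    show "v (x, z) = 0" if "R < norm x" for x :: 'a using R(2)[of "(x, z)"] that norm_fst_le[of x z] by auto
  qed
  have "((%z. (x, z)) has_derivative (%h. (0, h))) (at z)" by (auto intro!: derivative_eq_intros)
  from has_derivative_compose[OF this d[of "(x, z)"]] show "DERIV (%z. v (x, z)) z :> snd (g (x, z))"
    unfolding has_field_derivative_def by (rule has_derivative_eq_rhs) (auto simp: inner_prod_def)
qed

section \<open>Cutoffs in depth\<close>

text \<open>A continuously differentiable step from 0 at t = 0 to 1 at t = 1, built from squares of
  positive parts.\<close>

definition Sc :: "real => real" where "Sc t = 1 - (max 0 (1 - (max 0 t)\<^sup>2))\<^sup>2"

definition dSc :: "real => real" where "dSc t = 2 * max 0 (1 - (max 0 t)\<^sup>2) * (2 * max 0 t)"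

lemma DERIV_Sc: "DERIV Sc t :> dSc t"
proof -
  have "DERIV (%t. 1 - (max 0 t)\<^sup>2) t :> - (2 * max 0 t)"
    using DERIV_diff[OF DERIV_const DERIV_max_sq[of t], of 1] by simp
  from DERIV_chain2[OF DERIV_max_sq this]
  have "DERIV (%t. (max 0 (1 - (max 0 t)\<^sup>2))\<^sup>2) t :> 2 * max 0 (1 - (max 0 t)\<^sup>2) * (- (2 * max 0 t))" .
  from DERIV_diff[OF DERIV_const this, of 1] show ?thesis unfolding Sc_def[abs_def] dSc_def by simp
qed

lemma Sc_facts:
  "0 <= Sc t" "Sc t <= 1" "t <= 0 ==> Sc t = 0" "1 <= t ==> Sc t = 1" "t <= 0 ==> dSc t = 0" "1 <= t ==> dSc t = 0"
  "0 <= dSc t" "dSc t <= 4"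
proof -
  have m: "0 <= max 0 (1 - (max 0 t)\<^sup>2)" "max 0 (1 - (max 0 t)\<^sup>2) <= 1" by auto
  have "(max 0 (1 - (max 0 t)\<^sup>2))\<^sup>2 <= 1" using m by (intro power_le_one)
  then show "0 <= Sc t" "Sc t <= 1" by (auto simp: Sc_def)
  show "t <= 0 ==> Sc t = 0" "t <= 0 ==> dSc t = 0" by (auto simp: Sc_def dSc_def)
  have big: "max 0 (1 - (max 0 t)\<^sup>2) = 0" if "1 <= t" using one_le_power[OF that, of 2] that by simp
  then show "1 <= t ==> Sc t = 1" "1 <= t ==> dSc t = 0" by (auto simp: Sc_def dSc_def)
  show "0 <= dSc t" unfolding dSc_def using m by (intro mult_nonneg_nonneg) auto
  show "dSc t <= 4"
  proof (cases "1 <= t")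
    case True
    then show ?thesis using big by (simp add: dSc_def)
  next
    case False
    then have "2 * max 0 (1 - (max 0 t)\<^sup>2) * (2 * max 0 t) <= 2 * 1 * (2 * 1)" using m by (intro mult_mono) auto
    then show ?thesis by (simp add: dSc_def)
  qed
qed

lemma Sc_cont: "continuous_on A Sc" "continuous_on A dSc"
  unfolding Sc_def[abs_def] dSc_def[abs_def] by (intro continuous_intros)+

text \<open>The first factor is 1 on the strip and vanishes below -3/2, which gives compact support
  in z while the bottom stays free. The second vanishes within 1 / (n + 1) of the surface and is 1
  from depth 2 / (n + 1) on.\<close>

definition tht :: "nat => real => real" where
  "tht n z = Sc (2 * z + 3) * Sc (- real (Suc n) * z - 1)"

definition dtht :: "nat => real => real" where
  "dtht n z = 2 * dSc (2 * z + 3) * Sc (- real (Suc n) * z - 1) - real (Suc n) * dSc (- real (Suc n) * z - 1) * Sc (2 * z + 3)"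

lemma DERIV_tht: "DERIV (tht n) z :> dtht n z"
proof -
  have 1: "DERIV (%z. Sc (2 * z + 3)) z :> dSc (2 * z + 3) * 2"
    by (rule DERIV_chain2[OF DERIV_Sc]) (auto intro!: derivative_eq_intros)
  have 2: "DERIV (%z. Sc (- real (Suc n) * z - 1)) z :> dSc (- real (Suc n) * z - 1) * (- real (Suc n))"
    by (rule DERIV_chain2[OF DERIV_Sc]) (auto intro!: derivative_eq_intros)
  from DERIV_mult[OF 1 2] show ?thesis unfolding tht_def[abs_def] dtht_def by (simp add: algebra_simps)
qed

lemma tht_cont: "continuous_on A (tht n)" "continuous_on A (dtht n)"
  unfolding tht_def[abs_def] dtht_def[abs_def]
  by (intro continuous_intros continuous_on_compose2[OF Sc_cont(1)[of UNIV]] continuous_on_compose2[OF Sc_cont(2)[of UNIV]]; simp)+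

lemma tht_bounds: "0 <= tht n z" "tht n z <= 1"
  unfolding tht_def by (auto intro!: mult_nonneg_nonneg mult_le_one Sc_facts)

lemma tht_zero: "z <= - 3/2 ==> tht n z = 0" "- 1 / real (Suc n) <= z ==> tht n z = 0"
proof -
  show "z <= - 3/2 ==> tht n z = 0" by (simp add: tht_def Sc_facts)
  assume "- 1 / real (Suc n) <= z"
  then have "- real (Suc n) * z - 1 <= 0" by (simp add: field_simps)
  then show "tht n z = 0" unfolding tht_def by (simp add: Sc_facts del: of_nat_Suc)
qed

text \<open>The derivative is of size n, but only where |z| is at most 2 / (n + 1). The form 8 / |z|
  is what a function vanishing linearly at the surface can compensate.\<close>

lemma dtht_bound:
  assumes "-1 < z" "z < 0"
  shows "\<bar>dtht n z\<bar> <= 8 * \<bar>inverse z\<bar>"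
proof -
  have b: "Sc (2 * z + 3) = 1" "dSc (2 * z + 3) = 0" using assms by (auto intro: Sc_facts)
  let ?t = "- real (Suc n) * z - 1"
  have eq: "\<bar>dtht n z\<bar> = real (Suc n) * dSc ?t" unfolding dtht_def b using Sc_facts(7)[of ?t] by (simp add: abs_mult)
  show ?thesis
  proof (cases "1 <= ?t")
    case True
    then have "dSc ?t = 0" by (rule Sc_facts)
    then show ?thesis unfolding eq by simp
  next
    case False
    then have "real (Suc n) * \<bar>z\<bar> <= 2" using assms by (simp add: abs_if del: of_nat_Suc)
    then have le: "real (Suc n) <= 2 * \<bar>inverse z\<bar>" using assms by (simp add: field_simps abs_inverse del: of_nat_Suc)
    have "real (Suc n) * dSc ?t <= (2 * \<bar>inverse z\<bar>) * 4"
      using le Sc_facts(7,8)[of ?t] by (intro mult_mono) auto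
    then show ?thesis unfolding eq by simp
  qed
qed

lemma tht_tendsto:
  assumes "-1 < z" "z < 0"
  shows "(%n. tht n z) \<longlonglongrightarrow> 1" "(%n. dtht n z) \<longlonglongrightarrow> 0"
proof -
  obtain n0 :: nat where n0: "2 / \<bar>z\<bar> <= real n0" using real_arch_simple by blast
  have big: "1 <= - real (Suc n) * z - 1" if "n0 <= n" for n
  proof -
    have "2 / \<bar>z\<bar> <= real (Suc n)" using n0 that by simp
    then show ?thesis using assms by (simp add: field_simps abs_if del: of_nat_Suc)
  qed
  have b: "Sc (2 * z + 3) = 1" "dSc (2 * z + 3) = 0" using assms by (auto intro: Sc_facts)
  show "(%n. tht n z) \<longlonglongrightarrow> 1"
    by (rule tendsto_eventually)
      (use big b in \<open>auto simp: tht_def Sc_facts eventually_sequentially simp del: of_nat_Suc intro!: exI[of _ n0]\<close>)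
  show "(%n. dtht n z) \<longlonglongrightarrow> 0"
    by (rule tendsto_eventually)
      (use big b in \<open>auto simp: dtht_def Sc_facts eventually_sequentially simp del: of_nat_Suc intro!: exI[of _ n0]\<close>)
qed

subsection \<open>Separated test functions\<close>

lemma strip_test_fun_tensor:
  fixes \<eta> :: "'a::euclidean_space => real"
  assumes t: "test_fun \<eta> k" and f: "!!z. DERIV f z :> f' z" "continuous_on UNIV f'"
    and d: "0 < d" "!!z. - d < z ==> f z = 0" "!!z. z <= - 3/2 ==> f z = 0"
  shows "strip_test_fun (%p. \<eta> (fst p) * f (snd p)) (%p. (f (snd p) *\<^sub>R k (fst p), \<eta> (fst p) * f' (snd p)))"
proof -
  obtain R where R: "!!x. R < norm x ==> \<eta> x = 0 & k x = 0" using test_fun_support[OF t] by blast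
  have c: "continuous_on UNIV f" using f(1) by (intro DERIV_continuous_on) blast
  have "test_fun (%p. \<eta> (fst p) * f (snd p)) (%p. (f (snd p) *\<^sub>R k (fst p), \<eta> (fst p) * f' (snd p)))"
  proof (rule test_funI[where R = "R + 2"])
    fix p :: "'a \<times> real"
    have 1: "((%p. \<eta> (fst p)) has_derivative (%h. fst h \<bullet> k (fst p))) (at p)"
      by (rule has_derivative_compose[of fst fst])
        (use t in \<open>auto simp: test_fun_def gderiv_def intro!: derivative_eq_intros\<close>)
    have 2: "((%p. f (snd p)) has_derivative (%h. f' (snd p) * snd h)) (at p)"
      by (rule has_derivative_compose[of snd snd])
        (use f(1) in \<open>auto simp: has_field_derivative_def intro!: derivative_eq_intros\<close>)
    from has_derivative_mult[OF 1 2] show "GDERIV (%p. \<eta> (fst p) * f (snd p)) p :> (f (snd p) *\<^sub>R k (fst p), \<eta> (fst p) * f' (snd p))"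
      unfolding gderiv_def by (rule has_derivative_eq_rhs) (auto simp: inner_prod_def algebra_simps)
    show "\<eta> (fst p) * f (snd p) = 0" if "R + 2 < norm p"
    proof (cases "R < norm (fst p)")
      case False
      have "norm p <= norm (fst p) + \<bar>snd p\<bar>" using norm_Pair_le[of "fst p" "snd p"] by simp
      with that False have "2 < \<bar>snd p\<bar>" by linarith
      then show ?thesis using d by (cases "snd p < 0") auto
    qed (simp add: R)
  next
    show "continuous_on UNIV (%p. (f (snd p) *\<^sub>R k (fst p), \<eta> (fst p) * f' (snd p)))"
      by (intro continuous_intros continuous_on_compose2[OF c] continuous_on_compose2[OF f(2)]
        continuous_on_compose2[OF test_fun_cont(1)[OF t]] continuous_on_compose2[OF test_fun_cont(2)[OF t]]) auto
  qed
  then show ?thesis using d by (intro strip_test_funI) auto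
qed

text \<open>Here e vanishes at the surface but not near it, so the tensor product is no test
  function. Multiplied by \<open>tht n\<close> it is one; since |e z| is at most B |z|, the term
  with \<open>dtht n\<close> stays bounded and dominated convergence gives the limit.\<close>

lemma efield_tensor:
  fixes \<eta> :: "'a::euclidean_space => real"
  assumes t: "test_fun \<eta> k" and e: "!!z. DERIV e z :> e' z" "continuous_on UNIV e'" "!!z. \<bar>e' z\<bar> <= B" "e 0 = 0" and \<mu>: "0 < \<mu>"
  shows "efield \<mu> (%p. scale_mu \<mu> (e (snd p) *\<^sub>R k (fst p), \<eta> (fst p) * e' (snd p)))"
proof -
  define f f' where "f n z = e z * tht n z" and "f' n z = e' z * tht n z + e z * dtht n z" for n z
  define g where "g n p = (f n (snd p) *\<^sub>R k (fst p), \<eta> (fst p) * f' n (snd p))" for n p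
  define G where "G p = (e (snd p) *\<^sub>R k (fst p), \<eta> (fst p) * e' (snd p))" for p
  have ec: "continuous_on UNIV e" using e(1) by (intro DERIV_continuous_on) blast
  have st: "strip_test_fun (%p. \<eta> (fst p) * f n (snd p)) (g n)" for n
    unfolding g_def[abs_def]
  proof (rule strip_test_fun_tensor[OF t, where d = "1 / real (Suc n)"])
    show "DERIV (f n) z :> f' n z" for z unfolding f_def[abs_def] f'_def
      by (rule DERIV_cong[OF DERIV_mult[OF e(1) DERIV_tht]]) simp
    show "continuous_on UNIV (f' n)" unfolding f'_def[abs_def] by (intro continuous_intros e ec tht_cont)
  qed (auto simp: f_def tht_zero simp del: of_nat_Suc)
  note [measurable] = test_fun_measurable[OF t] borel_measurable_continuous_onI[OF ec] borel_measurable_continuous_onI[OF e(2)]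
    test_fun_measurable(2)[OF strip_test_funD(1)[OF st]]
  have [measurable]: "G \<in> borel_measurable borel" unfolding G_def[abs_def] by measurable
  have B: "0 <= B" using e(3)[of 0] by simp
  \<comment> \<open>9 B is B from the derivative of e plus 8 B from
    \<open>dtht_bound\<close>.\<close>
  have bd: "\<bar>f n z\<bar> <= B" "\<bar>f' n z\<bar> <= 9 * B" if z: "-1 < z" "z < 0" for n z
  proof -
    have "norm (e z - e 0) <= B * norm (z - 0)"
      by (rule field_differentiable_bound[of UNIV e e']) (use e in \<open>auto intro: has_field_derivative_at_within\<close>)
    then have ez: "\<bar>e z\<bar> <= B * \<bar>z\<bar>" by (simp add: e(4))
    also have "\<dots> <= B * 1" using B z by (intro mult_left_mono) auto
    finally have "\<bar>e z\<bar> * tht n z <= B * 1" using tht_bounds[of n z] B by (intro mult_mono) auto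
    then show "\<bar>f n z\<bar> <= B" using tht_bounds[of n z] by (simp add: f_def abs_mult)
    have "\<bar>e z * dtht n z\<bar> <= (B * \<bar>z\<bar>) * (8 * \<bar>inverse z\<bar>)"
      unfolding abs_mult by (intro mult_mono ez dtht_bound z) (use B in auto)
    moreover have "\<bar>z\<bar> * \<bar>inverse z\<bar> = 1" using z by (simp flip: abs_mult)
    then have "(B * \<bar>z\<bar>) * (8 * \<bar>inverse z\<bar>) = 8 * B" by (simp add: mult_ac)
    moreover have "\<bar>e' z * tht n z\<bar> <= B * 1" unfolding abs_mult using tht_bounds[of n z] B by (intro mult_mono e) auto
    ultimately show "\<bar>f' n z\<bar> <= 9 * B" unfolding f'_def by linarith
  qed
  define w where "w p = \<bar>\<eta> (fst p)\<bar> + norm (k (fst p))" for p :: "'a \<times> real"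
  have "sqint lborel (%x. \<bar>\<eta> x\<bar>)" "sqint lborel (%x. norm (k x))" using test_fun_sqint[OF t] by (simp_all add: sqint_def)
  then have w: "sqint smeas w" unfolding w_def[abs_def] by (intro sqint_add sqint_lift)
  have dom: "norm (scale_mu \<mu> (g n p)) <= max 1 (sqrt \<mu>) * (9 * B) * norm (w p)" if p: "-1 < snd p" "snd p < 0" for n p
  proof -
    have "norm (g n p) <= \<bar>f n (snd p)\<bar> * norm (k (fst p)) + \<bar>\<eta> (fst p)\<bar> * \<bar>f' n (snd p)\<bar>"
      using norm_Pair_le[of "f n (snd p) *\<^sub>R k (fst p)" "\<eta> (fst p) * f' n (snd p)"] by (simp add: g_def abs_mult)
    also have "\<dots> <= (9 * B) * norm (k (fst p)) + \<bar>\<eta> (fst p)\<bar> * (9 * B)"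
      using bd[OF p, of n] B by (intro add_mono mult_mono) auto
    finally have "norm (g n p) <= 9 * B * norm (w p)" by (simp add: w_def algebra_simps)
    then have "max 1 (sqrt \<mu>) * norm (g n p) <= max 1 (sqrt \<mu>) * (9 * B * norm (w p))" by (intro mult_left_mono) auto
    with scale_mu_norm[OF \<mu>, of "g n p"] show ?thesis by (simp add: mult.assoc)
  qed
  have lim: "(%n. scale_mu \<mu> (g n p)) \<longlonglongrightarrow> scale_mu \<mu> (G p)" if p: "-1 < snd p" "snd p < 0" for p
  proof -
    have "(%n. g n p) \<longlonglongrightarrow> ((e (snd p) * 1) *\<^sub>R k (fst p), \<eta> (fst p) * (e' (snd p) * 1 + e (snd p) * 0))"
      unfolding g_def f_def f'_def by (intro tendsto_intros tht_tendsto p)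
    then show ?thesis unfolding G_def by (intro bounded_linear.tendsto[OF bounded_linear_scale_mu]) simp
  qed
  have D: "AE p in smeas. norm (scale_mu \<mu> (g n p)) <= max 1 (sqrt \<mu>) * (9 * B) * norm (w p)" for n
    by (rule AE_smeasI, rule dom) simp_all
  have L: "AE p in smeas. (%n. scale_mu \<mu> (g n p)) \<longlonglongrightarrow> scale_mu \<mu> (G p)" by (rule AE_smeasI, rule lim) simp_all
  have "sqint smeas (%p. scale_mu \<mu> (G p))" "(%n. l2 smeas (%p. scale_mu \<mu> (g n p) - scale_mu \<mu> (G p))) \<longlonglongrightarrow> 0"
    by (rule l2_dominated_convergence[OF _ _ w L D]; measurable)+
  from efield_limit[OF this(1) \<mu> st this(2)] show ?thesis unfolding G_def .
qed

subsection \<open>Uniform bounds for families of functions\<close>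

text \<open>
  The index set \<open>I\<close> consists of all data satisfying given bounds; the constant \<open>C\<close> is uniform on \<open>I\<close>, and
  \<open>w\<close> records powers of the small parameters.
\<close>

definition ucls :: "exponent => 'p::euclidean_space measure => 'p set => 'i set => nat => ('i => real) =>
    ('i => 'p => 'b::euclidean_space) => bool" where
  "ucls p N H I k w f \<longleftrightarrow> (\<exists>C\<ge>0. \<forall>i\<in>I. 0 <= w i & cls p N H k (C * w i) (f i))"

lemma ucls_E:
  assumes "ucls p N H I k w f"
  obtains C where "0 <= C" "!!i. i \<in> I ==> 0 <= w i" "!!i. i \<in> I ==> cls p N H k (C * w i) (f i)"
  using assms unfolding ucls_def by blast

lemma ucls_le: "ucls p N H I k w f ==> j <= k ==> ucls p N H I j w f"
  unfolding ucls_def by (meson cls_le)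

text \<open>Lets surplus powers of \<epsilon> and \<mu> be discarded.\<close>

lemma ucls_weight:
  assumes "ucls p N H I k w f" and c: "0 <= c" and le: "!!i. i \<in> I ==> w i <= c * w' i" and nn: "!!i. i \<in> I ==> 0 <= w' i"
  shows "ucls p N H I k w' f"
proof -
  from assms(1) obtain C where C: "0 <= C" "!!i. i \<in> I ==> cls p N H k (C * w i) (f i)" by (rule ucls_E) blast
  show ?thesis unfolding ucls_def
  proof (intro exI[of _ "C * c"] conjI ballI nn)
    fix i assume i: "i \<in> I"
    show "cls p N H k (C * c * w' i) (f i)"
      by (rule cls_mono[OF C(2)[OF i]]) (use mult_left_mono[OF le[OF i] C(1)] in \<open>simp add: mult.assoc\<close>)
  qed (use C c in auto)
qed

context shift_invariant
begin

lemma ucls_prod: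
  fixes f :: "'i => 'p => 'b::euclidean_space" and g :: "'i => 'p => 'c::euclidean_space"
    and B :: "'b => 'c => 'e::euclidean_space"
  assumes B: "bounded_bilinear B" and K: "!!a b. norm (B a b) <= norm a * norm b * K" "0 <= K"
    and f: "ucls Linf N H I k v f" and g: "ucls p N H I k w g"
  shows "ucls p N H I k (%i. v i * w i) (%i x. B (f i x) (g i x))"
proof -
  from f obtain A where A: "0 <= A" "!!i. i \<in> I ==> 0 <= v i" "!!i. i \<in> I ==> cls Linf N H k (A * v i) (f i)" by (rule ucls_E) blast
  from g obtain C where C: "0 <= C" "!!i. i \<in> I ==> 0 <= w i" "!!i. i \<in> I ==> cls p N H k (C * w i) (g i)" by (rule ucls_E) blast
  show ?thesis unfolding ucls_def
  proof (intro exI[of _ "2 ^ k * K * A * C"] conjI ballI)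
    fix i assume i: "i \<in> I"
    show "cls p N H k (2 ^ k * K * A * C * (v i * w i)) (%x. B (f i x) (g i x))"
      using cls_prod[OF B K A(3)[OF i] C(3)[OF i]] by (simp add: mult_ac)
    show "0 <= v i * w i" using A(2)[OF i] C(2)[OF i] by simp
  qed (use A C K in auto)
qed

lemma ucls_add:
  assumes "ucls p N H I k w f" "ucls p N H I k w g"
  shows "ucls p N H I k w (%i x. f i x + g i x)"
proof -
  from assms(1) obtain A where A: "0 <= A" "!!i. i \<in> I ==> 0 <= w i" "!!i. i \<in> I ==> cls p N H k (A * w i) (f i)" by (rule ucls_E) blast
  from assms(2) obtain C where C: "0 <= C" "!!i. i \<in> I ==> cls p N H k (C * w i) (g i)" by (rule ucls_E) blast
  show ?thesis unfolding ucls_def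
    by (intro exI[of _ "A + C"] conjI ballI) (use A C cls_add[OF A(3) C(2)] in \<open>auto simp: distrib_right\<close>)
qed

lemma ucls_linear:
  fixes L :: "'i => 'b::euclidean_space => 'c::euclidean_space"
  assumes f: "ucls p N H I k w f" and L: "!!i. i \<in> I ==> bounded_linear (L i)"
    and v: "!!i x. i \<in> I ==> norm (L i x) <= norm x * v i" "!!i. i \<in> I ==> 0 <= v i"
  shows "ucls p N H I k (%i. v i * w i) (%i x. L i (f i x))"
proof -
  from f obtain A where A: "0 <= A" "!!i. i \<in> I ==> 0 <= w i" "!!i. i \<in> I ==> cls p N H k (A * w i) (f i)" by (rule ucls_E) blast
  show ?thesis unfolding ucls_def
  proof (intro exI[of _ A] conjI ballI)
    fix i assume i: "i \<in> I"
    show "cls p N H k (A * (v i * w i)) (%x. L i (f i x))"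
      using cls_linear[OF L[OF i] v(1)[OF i] v(2)[OF i] A(3)[OF i]] by (simp add: mult_ac)
    show "0 <= v i * w i" using A(2)[OF i] v(2)[OF i] by simp
  qed (use A in auto)
qed

lemma ucls_scaleR:
  assumes "ucls p N H I k w f" "!!i. i \<in> I ==> \<bar>a i\<bar> <= v i"
  shows "ucls p N H I k (%i. v i * w i) (%i x. a i *\<^sub>R f i x)"
proof (rule ucls_linear[OF assms(1)])
  show "norm (a i *\<^sub>R x) <= norm x * v i" if "i \<in> I" for i x
    using mult_left_mono[OF assms(2)[OF that] norm_ge_zero[of x]] by (simp add: mult.commute)
  show "0 <= v i" if "i \<in> I" for i using assms(2)[OF that] by linarith
qed (rule bounded_linear_scaleR_right)

lemma ucls_minus: "ucls p N H I k w f ==> ucls p N H I k w (%i x. - f i x)"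
  using ucls_scaleR[of p I k w f "%_. - 1" "%_. 1"] by simp

lemma ucls_diff: "ucls p N H I k w f ==> ucls p N H I k w g ==> ucls p N H I k w (%i x. f i x - g i x)"
  using ucls_add[OF _ ucls_minus] by simp

lemma ucls_const:
  assumes "0 <= C" "!!i. i \<in> I ==> norm (c i) <= C * w i" "!!i. i \<in> I ==> 0 <= w i"
  shows "ucls Linf N H I k w (%i x. c i)"
  unfolding ucls_def by (intro exI[of _ C] conjI ballI assms cls_const)

lemma ucls_0: "(!!i. i \<in> I ==> 0 <= w i) ==> ucls p N H I k w (%i x. 0)"
  unfolding ucls_def by (intro exI[of _ 1] conjI ballI cls_0) auto

lemma ucls_sum:
  assumes "finite J" "!!i. i \<in> I ==> 0 <= w i" "!!j. j \<in> J ==> ucls p N H I k w (f j)"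
  shows "ucls p N H I k w (%i x. \<Sum>j\<in>J. f j i x)"
  using assms(1,3)
  by (induction J) (auto intro!: ucls_add ucls_0 assms(2))

lemma ucls_components:
  fixes f :: "'i => 'p => 'b::euclidean_space"
  assumes "!!i. i \<in> I ==> 0 <= w i" "!!b. b \<in> Basis ==> ucls p N H I k w (%i x. f i x \<bullet> b)"
  shows "ucls p N H I k w f"
proof -
  have "ucls p N H I k w (%i x. \<Sum>b\<in>Basis. (f i x \<bullet> b) *\<^sub>R b)"
  proof (rule ucls_sum[OF _ assms(1)])
    fix b :: 'b assume b: "b \<in> Basis"
    have "ucls p N H I k (%i. 1 * w i) (%i x. (f i x \<bullet> b) *\<^sub>R b)"
      by (rule ucls_linear[OF assms(2)[OF b]]) (use b in \<open>auto intro: bounded_linear_scaleR_left\<close>)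
    then show "ucls p N H I k w (%i x. (f i x \<bullet> b) *\<^sub>R b)" by simp
  qed auto
  then show ?thesis by (simp add: euclidean_representation)
qed

lemma ucls_cong:
  assumes "ucls p N H I k w f" "!!i. i \<in> I ==> AE x in N. f i x = g i x" "!!i. i \<in> I ==> g i \<in> borel_measurable borel"
  shows "ucls p N H I k w g"
  using assms(1) cls_cong[OF _ assms(2,3)] unfolding ucls_def by blast

lemma ucls_inverse:
  fixes f :: "'i => 'p => real"
  assumes f: "ucls Linf N H I k (%_. 1) f" and c: "0 < c" "!!i. i \<in> I ==> AE x in N. c <= f i x"
  shows "ucls Linf N H I k (%_. 1) (%i x. inverse (f i x))"
proof -
  from f obtain A where A: "!!i. i \<in> I ==> cls Linf N H k (A * 1) (f i)" by (rule ucls_E) blast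
  from cls_inverse_ex[OF c(1), of k A] obtain C where
    "!!f :: 'p => real. cls Linf N H k A f ==> AE x in N. c <= f x ==> cls Linf N H k C (%x. inverse (f x))" by blast
  then have "!!i. i \<in> I ==> cls Linf N H k C (%x. inverse (f i x))" using A c(2) by simp
  then show ?thesis unfolding ucls_def
    by (intro exI[of _ "max 0 C"] conjI ballI) (auto intro: cls_mono[of _ _ _ _ C])
qed

end

subsection \<open>Families on the whole space and Fourier multipliers\<close>

abbreviation uc :: "'i set => nat => ('i => real) => ('i => 'a::euclidean_space => 'b::euclidean_space) => bool" where
  "uc \<equiv> ucls L2 lborel UNIV"

abbreviation ucI :: "'i set => nat => ('i => real) => ('i => 'a::euclidean_space => 'b::euclidean_space) => bool" where
  "ucI \<equiv> ucls Linf lborel UNIV"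

lemma uc_sqint: "uc I k w f ==> i \<in> I ==> sqint lborel (f i)"
  by (erule ucls_E) (auto dest: cls_base)

lemma uc_measurable: "uc I k w f ==> i \<in> I ==> f i \<in> borel_measurable borel"
  using uc_sqint by (fastforce simp: sqint_def)

lemma uc_rft_bound:
  fixes f :: "'i => 'a::euclidean_space => real"
  assumes "uc I k w f"
  shows "\<exists>C\<ge>0. \<forall>i\<in>I. \<forall>U. rft (f i) U --> sqint lborel (wU k U) & l2 lborel (wU k U) <= C * w i"
proof -
  from assms obtain A where A: "0 <= A" "!!i. i \<in> I ==> 0 <= w i" "!!i. i \<in> I ==> cls L2 lborel UNIV k (A * w i) (f i)" by (rule ucls_E) blast
  show ?thesis
  proof (intro exI[of _ "real (DIM('a) + 1) ^ Suc k * sqrt ((2 * pi) ^ DIM('a)) * A"] conjI ballI allI impI)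
    fix i U assume "i \<in> I" "rft (f i) U"
    from rft_of_cls[OF A(3)[OF this(1)] this(2)]
    show "sqint lborel (wU k U)" "l2 lborel (wU k U) <= real (DIM('a) + 1) ^ Suc k * sqrt ((2 * pi) ^ DIM('a)) * A * w i"
      by (simp_all add: mult.assoc)
  qed (use A in auto)
qed

text \<open>The number j is the order of the multiplier, that is the derivatives it consumes; its
  size v goes into the weight.\<close>

lemma uc_multiplier:
  fixes f g :: "'i => 'a::euclidean_space => real"
  assumes f: "uc I (k + j) w f" and U: "!!i. i \<in> I ==> rft (f i) (U i)" and g: "!!i. i \<in> I ==> rft (g i) (V i)"
    and m: "!!i. i \<in> I ==> AE \<xi> in lborel. norm (V i \<xi>) <= v i * (wt j \<xi> * norm (U i \<xi>))" and v: "!!i. i \<in> I ==> 0 <= v i"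
  shows "uc I k (%i. v i * w i) g"
proof -
  from f have w: "!!i. i \<in> I ==> 0 <= w i" by (rule ucls_E)
  obtain C where C: "0 <= C" "!!i U. i \<in> I ==> rft (f i) U ==> sqint lborel (wU (k + j) U) & l2 lborel (wU (k + j) U) <= C * w i"
    using uc_rft_bound[OF f] by blast
  show ?thesis unfolding ucls_def
  proof (intro exI[of _ C] conjI ballI)
    fix i assume i: "i \<in> I"
    note s = C(2)[OF i U[OF i]]
    have [measurable]: "V i \<in> borel_measurable borel" by (rule rft_sqint(4)[OF g[OF i]])
    have le: "AE \<xi> in lborel. norm (wU k (V i) \<xi>) <= v i * norm (wU (k + j) (U i) \<xi>)"
      using m[OF i]
    proof eventually_elim
      case (elim \<xi>)
      have "wt k \<xi> * norm (V i \<xi>) <= wt k \<xi> * (v i * (wt j \<xi> * norm (U i \<xi>)))" using elim by (intro mult_left_mono) auto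
      then show ?case unfolding norm_wt_mult unfolding wt_add by (simp only: mult_ac)
    qed
    have b: "sqint lborel (wU k (V i))" "l2 lborel (wU k (V i)) <= v i * l2 lborel (wU (k + j) (U i))"
      using sqint_bound[OF conjunct1[OF s] _ le v[OF i]] by auto
    have "v i * l2 lborel (wU (k + j) (U i)) <= v i * (C * w i)" using s v[OF i] by (intro mult_left_mono) auto
    then have "l2 lborel (wU k (V i)) <= C * (v i * w i)" using b(2) by (simp add: mult_ac)
    then show "cls L2 lborel UNIV k (C * (v i * w i)) (g i)" by (rule cls_of_rft[OF g[OF i] b(1)])
    show "0 <= v i * w i" using v[OF i] w[OF i] by simp
  qed (rule C)
qed

text \<open>The embedding into bounded functions, at the cost of d derivatives through
  \<open>wU_integrable\<close>.\<close>

lemma ucI_of_uc: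
  fixes f :: "'i => 'a::euclidean_space => real"
  assumes f: "uc I (k + DIM('a)) w f"
  shows "ucI I k w f"
proof -
  from f have w: "!!i. i \<in> I ==> 0 <= w i" by (rule ucls_E)
  obtain C where C: "0 <= C" "!!i U. i \<in> I ==> rft (f i) U ==> sqint lborel (wU (k + DIM('a)) U) & l2 lborel (wU (k + DIM('a)) U) <= C * w i"
    using uc_rft_bound[OF f] by blast
  define c where "c = l2 lborel (%\<xi>::'a. inverse (wt (DIM('a)) \<xi>))"
  have c0: "0 <= c" by (simp add: c_def)
  show ?thesis unfolding ucls_def
  proof (intro exI[of _ "c * C"] conjI ballI w)
    fix i assume i: "i \<in> I"
    obtain U where U: "rft (f i) U" using rft_ex[OF uc_sqint[OF f i]] by blast
    note s = C(2)[OF i U]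
    note b = wU_integrable[OF conjunct1[OF s] rft_sqint(4)[OF U], folded c_def]
    have "(LINT \<xi>|lborel. norm (wU k U \<xi>)) <= c * (C * w i)"
      by (rule order_trans[OF b(2)]) (use s c0 in \<open>auto intro: mult_left_mono\<close>)
    then show "cls Linf lborel UNIV k (c * C * w i) (f i)"
      using cls_Linf_of_rft[OF U b(1)] by (simp add: mult.assoc)
  qed (use C c0 in auto)
qed

subsection \<open>Lifting to the strip and vertical averages\<close>

lemma norm_fst_snd_le: "norm (fst p) <= norm p" "norm (snd p) <= norm p" "\<bar>snd q\<bar> <= norm q"
  using norm_fst_le[of "fst p" "snd p"] norm_snd_le[of "snd p" "fst p"] norm_snd_le[of "snd q" "fst q"] by auto

lemma sqint_fst_snd:
  fixes F :: "'x => 'a::euclidean_space \<times> real"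
  assumes "sqint N F"
  shows "sqint N (%p. fst (F p))" "sqint N (%p. snd (F p))"
proof -
  have F: "F \<in> borel_measurable N" using assms by (simp add: sqint_def)
  have "(%p. fst (F p)) \<in> borel_measurable N" "(%p. snd (F p)) \<in> borel_measurable N"
    by (rule measurable_compose[OF F]; simp)+
  then show "sqint N (%p. fst (F p))" "sqint N (%p. snd (F p))"
    by (auto intro!: sqint_bound(1)[OF assms, of _ 1] AE_I2 simp: norm_fst_snd_le)
qed

lemma sdirE:
  assumes "h \<in> sdir"
  obtains y where "h = (y, 0)"
  using assms by (intro that[of "fst h"]) (auto simp: sdir_def prod_eq_iff)

lemma dq_lift:
  "dq (y, 0) (%p. a (snd p) *\<^sub>R f (fst p)) = (%p. a (snd p) *\<^sub>R dq y f (fst p))"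
  by (auto simp: dq_def fun_eq_iff norm_Pair algebra_simps)

lemma cls_lift:
  fixes f :: "'a::euclidean_space => 'b::euclidean_space"
  assumes a: "vweight C a"
  shows "cls p lborel UNIV k M f ==> cls p smeas sdir k (C * M) (%p. a (snd p) *\<^sub>R f (fst p))"
proof (induction k arbitrary: f)
  have base: "lpb p smeas (C * M) (%p. a (snd p) *\<^sub>R f (fst p))" if f: "lpb p lborel M f" for f :: "'a => 'b"
  proof -
    have [measurable]: "f \<in> borel_measurable borel" using lpbD(1)[OF f] by simp
    have [measurable]: "a \<in> borel_measurable borel" using a by (simp add: vweight_def)
    have "lpb p smeas M (%p. f (fst p))"
      using f sqint_lift[of f] AE_smeas_fst[of "%x. norm (f x) <= M"] by (cases p) auto
    then show ?thesis
      by (rule lpb_dominated) (use a vweight_nonneg[OF a] in \<open>auto simp: vweight_def intro!: AE_smeasI intro: mult_right_mono\<close>)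
  qed
  {
    case 0
    then show ?case using base by simp
  next
    case (Suc k)
    have "cls p smeas sdir k (C * M) (dq h (%p. a (snd p) *\<^sub>R f (fst p)))" if h: "h \<in> sdir" "h \<noteq> 0" for h
    proof -
      obtain y where y: "h = (y, 0)" using h(1) by (rule sdirE)
      then have "y \<noteq> 0" using h(2) by (auto simp: zero_prod_def)
      then show ?thesis unfolding y dq_lift using Suc by simp
    qed
    then show ?case using base Suc.prems by simp
  }
qed

definition vavg :: "(real => real) => ('a \<times> real => 'b) => 'a => 'b::euclidean_space" where
  "vavg a F x = (LINT z|ivl. a z *\<^sub>R F (x, z))"

lemma slice_measurable:
  fixes F :: "'a::euclidean_space \<times> real => 'b::euclidean_space"
  assumes "F \<in> borel_measurable borel"
  shows "(%z. F (x, z)) \<in> borel_measurable borel"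
  by (rule measurable_compose[OF _ assms]) (simp add: borel_prod[symmetric])

lemma vavg_measurable:
  fixes F :: "'a::euclidean_space \<times> real => 'b::euclidean_space"
  assumes [measurable]: "F \<in> borel_measurable borel" "a \<in> borel_measurable borel"
  shows "vavg a F \<in> borel_measurable borel"
proof -
  have "(%q. a (snd q) *\<^sub>R F q) \<in> borel_measurable borel" by measurable
  then have "(%q. a (snd q) *\<^sub>R F q) \<in> borel_measurable (borel \<Otimes>\<^sub>M ivl)"
    by (simp add: borel_prod[symmetric] cong: measurable_cong_sets sets_pair_measure_cong)
  then have "(%x. LINT z|ivl. a z *\<^sub>R F (x, z)) \<in> borel_measurable borel"
    by (intro ivl.borel_measurable_lebesgue_integral) (simp add: split_beta')
  then show ?thesis unfolding vavg_def[abs_def] .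
qed

lemma AE_slice_sqint:
  fixes F :: "'a::euclidean_space \<times> real => 'b::euclidean_space"
  assumes F: "sqint smeas F"
  shows "AE x in lborel. sqint ivl (%z. F (x, z))"
    "(\<integral>\<^sup>+x. \<integral>\<^sup>+z. ennreal ((norm (F (x, z)))\<^sup>2) \<partial>ivl \<partial>lborel) = ennreal ((l2 smeas F)\<^sup>2)"
proof -
  have Fm: "F \<in> borel_measurable borel" using F by (simp add: sqint_def)
  note [measurable] = Fm
  have m: "(%p. ennreal ((norm (F p))\<^sup>2)) \<in> borel_measurable (lborel \<Otimes>\<^sub>M ivl)"
    unfolding smeas_pair[symmetric] by measurable
  show e: "(\<integral>\<^sup>+x. \<integral>\<^sup>+z. ennreal ((norm (F (x, z)))\<^sup>2) \<partial>ivl \<partial>lborel) = ennreal ((l2 smeas F)\<^sup>2)"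
    using ivl.nn_integral_fst[OF m] nn_sq_l2[OF F] unfolding smeas_pair by simp
  have mm: "(%x. \<integral>\<^sup>+z. ennreal ((norm (F (x, z)))\<^sup>2) \<partial>ivl) \<in> borel_measurable lborel"
    using ivl.borel_measurable_nn_integral_fst[OF m] by simp
  have "AE x in lborel. (\<integral>\<^sup>+z. ennreal ((norm (F (x, z)))\<^sup>2) \<partial>ivl) \<noteq> \<infinity>"
    by (rule nn_integral_PInf_AE[OF mm]) (simp add: e)
  then show "AE x in lborel. sqint ivl (%z. F (x, z))"
    by eventually_elim (use slice_measurable[OF Fm] in \<open>auto simp: sqint_iff_nn top.not_eq_extremum\<close>)
qed

lemmas vavg_slice = ivl_Cauchy_Schwarz[where F = "%z. F (x, z)" for F x, folded vavg_def]

lemma sqint_vavg: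
  fixes F :: "'a::euclidean_space \<times> real => 'b::euclidean_space"
  assumes a: "vweight C a" and F: "sqint smeas F"
  shows "sqint lborel (vavg a F)" "l2 lborel (vavg a F) <= C * l2 smeas F"
proof -
  have m: "vavg a F \<in> borel_measurable lborel" using vavg_measurable[of F a] F a by (simp add: sqint_def vweight_def)
  have [measurable]: "F \<in> borel_measurable borel" using F by (simp add: sqint_def)
  have "(\<integral>\<^sup>+x. ennreal ((norm (vavg a F x))\<^sup>2) \<partial>lborel) <= (\<integral>\<^sup>+x. ennreal (C\<^sup>2) * (\<integral>\<^sup>+z. ennreal ((norm (F (x, z)))\<^sup>2) \<partial>ivl) \<partial>lborel)"
  proof (rule nn_integral_mono_AE)
    show "AE x in lborel. ennreal ((norm (vavg a F x))\<^sup>2) <= ennreal (C\<^sup>2) * (\<integral>\<^sup>+z. ennreal ((norm (F (x, z)))\<^sup>2) \<partial>ivl)"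
      using AE_slice_sqint(1)[OF F]
    proof eventually_elim
      case (elim x)
      have "(norm (vavg a F x))\<^sup>2 <= (C * l2 ivl (%z. F (x, z)))\<^sup>2"
        using vavg_slice(2)[OF a elim] by (intro power_mono) auto
      then show ?case unfolding nn_sq_l2[OF elim] by (simp add: ennreal_mult[symmetric] power_mult_distrib ennreal_leI)
    qed
  qed
  also have "\<dots> = ennreal (C\<^sup>2) * (\<integral>\<^sup>+x. (\<integral>\<^sup>+z. ennreal ((norm (F (x, z)))\<^sup>2) \<partial>ivl) \<partial>lborel)"
  proof (rule nn_integral_cmult)
    have "(%p. ennreal ((norm (F p))\<^sup>2)) \<in> borel_measurable (lborel \<Otimes>\<^sub>M ivl)" unfolding smeas_pair[symmetric] by measurable
    then show "(%x. \<integral>\<^sup>+z. ennreal ((norm (F (x, z)))\<^sup>2) \<partial>ivl) \<in> borel_measurable lborel"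
      using ivl.borel_measurable_nn_integral_fst by simp
  qed
  also have "\<dots> = ennreal ((C * l2 smeas F)\<^sup>2)"
    unfolding AE_slice_sqint(2)[OF F] by (simp add: ennreal_mult[symmetric] power_mult_distrib)
  finally show "sqint lborel (vavg a F)" "l2 lborel (vavg a F) <= C * l2 smeas F"
    using sqint_l2_leI[OF m] vweight_nonneg[OF a] by auto
qed

text \<open>Only almost everywhere, since the slices at both x and x + y have to be square
  integrable for the average to be additive.\<close>

lemma dq_vavg:
  fixes F :: "'a::euclidean_space \<times> real => 'b::euclidean_space"
  assumes a: "vweight C a" and F: "sqint smeas F"
  shows "AE x in lborel. vavg a (dq (y, 0) F) x = dq y (vavg a F) x"
  using AE_slice_sqint(1)[OF F] leb.AE_shift[OF AE_slice_sqint(1)[OF F], of y, simplified]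
proof eventually_elim
  case (elim x)
  have "vavg a (dq (y, 0) F) x = (LINT z|ivl. (a z *\<^sub>R F (x + y, z) - a z *\<^sub>R F (x, z)) /\<^sub>R norm y)"
    unfolding vavg_def dq_def
    by (intro Bochner_Integration.integral_cong refl) (simp add: norm_Pair algebra_simps)
  also have "\<dots> = (LINT z|ivl. a z *\<^sub>R F (x + y, z) - a z *\<^sub>R F (x, z)) /\<^sub>R norm y"
    by (rule integral_scaleR_right)
  also have "\<dots> = dq y (vavg a F) x"
    unfolding dq_def vavg_def using vavg_slice(1)[OF a elim(1)] vavg_slice(1)[OF a elim(2)] by simp
  finally show ?case .
qed

lemma cls_vavg:
  fixes F :: "'a::euclidean_space \<times> real => 'b::euclidean_space"
  assumes a: "vweight C a"
  shows "cls L2 smeas sdir k M F ==> cls L2 lborel UNIV k (C * M) (vavg a F)"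
proof (induction k arbitrary: F)
  have base: "sqint lborel (vavg a F) & l2 lborel (vavg a F) <= C * M" if "sqint smeas F" "l2 smeas F <= M" for F :: "'a \<times> real => 'b"
    using sqint_vavg[OF a that(1)] mult_left_mono[OF that(2) vweight_nonneg[OF a]] by auto
  {
    case 0
    then show ?case using base by simp
  next
    case (Suc k)
    have F: "sqint smeas F" "l2 smeas F <= M" using Suc.prems by auto
    have "cls L2 lborel UNIV k (C * M) (dq y (vavg a F))" if "y \<noteq> 0" for y
    proof (rule leb.cls_cong[OF _ dq_vavg[OF a F(1)]])
      have "(y, 0::real) \<in> sdir" "(y, 0::real) \<noteq> 0" using that by (auto simp: sdir_def zero_prod_def)
      then show "cls L2 lborel UNIV k (C * M) (vavg a (dq (y, 0) F))" using Suc by simp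
      show "dq y (vavg a F) \<in> borel_measurable borel" using base[OF F] by (intro dq_measurable) (simp add: sqint_def)
    qed
    then show ?case using base[OF F] by simp
  }
qed

lemma vavg_pairing:
  fixes F :: "'a::euclidean_space \<times> real => 'b::euclidean_space"
  assumes a: "vweight C a" and F: "sqint smeas F" and f: "sqint lborel f"
  shows "(LINT p|smeas. a (snd p) * (F p \<bullet> f (fst p))) = (LINT x|lborel. vavg a F x \<bullet> f x)"
    "integrable smeas (%p. a (snd p) * (F p \<bullet> f (fst p)))"
proof -
  have [measurable]: "F \<in> borel_measurable borel" "a \<in> borel_measurable borel" using F a by (simp_all add: sqint_def vweight_def)
  have "sqint smeas (%p. a (snd p) *\<^sub>R F p)"
    by (rule sqint_bound(1)[OF F, of _ C])
      (use a vweight_nonneg[OF a] in \<open>auto simp: vweight_def intro!: AE_smeasI intro: mult_right_mono\<close>)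
  from sqint_inner[OF this sqint_lift(1)[OF f]]
  show i: "integrable smeas (%p. a (snd p) * (F p \<bullet> f (fst p)))" by simp
  have "(LINT p|smeas. a (snd p) * (F p \<bullet> f (fst p))) = (LINT x|lborel. LINT z|ivl. a z * (F (x, z) \<bullet> f x))"
    using ivl_pair.integral_fst'[of "%p. a (snd p) * (F p \<bullet> f (fst p))"] i unfolding smeas_pair by simp
  also have "\<dots> = (LINT x|lborel. vavg a F x \<bullet> f x)"
  proof (rule integral_cong_AE)
    show "AE x in lborel. (LINT z|ivl. a z * (F (x, z) \<bullet> f x)) = vavg a F x \<bullet> f x"
      using AE_slice_sqint(1)[OF F]
    proof eventually_elim
      case (elim x)
      show ?case using integral_inner_left[of "f x" ivl "%z. a z *\<^sub>R F (x, z)"] vavg_slice(1)[OF a elim] by (simp add: vavg_def)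
    qed
    show "(%x. LINT z|ivl. a z * (F (x, z) \<bullet> f x)) \<in> borel_measurable lborel"
      using borel_measurable_integrable[OF ivl_pair.integrable_fst'[of "%p. a (snd p) * (F p \<bullet> f (fst p))"]] i unfolding smeas_pair by simp
  qed (use sqint_inner[OF sqint_vavg(1)[OF a F] f] in simp)
  finally show "(LINT p|smeas. a (snd p) * (F p \<bullet> f (fst p))) = (LINT x|lborel. vavg a F x \<bullet> f x)" .
qed

text \<open>
  Let \<open>Y = \<nabla>\<^sup>\<mu>u\<close> with \<open>u\<close> vanishing at the surface. If \<open>a\<close> is the primitive of \<open>b\<close> vanishing at the bottom, then
  \<open>-\<integral> a \<partial>\<^sub>zu dz = \<integral> b u dz\<close>, which has gradient \<open>\<integral> b \<nabla>u dz\<close>.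
\<close>

definition vprimitive :: "(real => real) => (real => real) => bool" where
  "vprimitive a b \<longleftrightarrow> (\<forall>z. DERIV a z :> b z) & continuous_on UNIV b & a (-1) = 0 & vweight 1 a & vweight 1 b"

lemma vprimitiveD: "vprimitive a b ==> vweight 1 a" "vprimitive a b ==> vweight 1 b"
  by (simp_all add: vprimitive_def)

lemma vprimitive_1: "vprimitive (%z. z + 1) (%_. 1)"
  by (auto simp: vprimitive_def vweight_def intro!: derivative_eq_intros)

lemma vprimitive_modes: "vprimitive (smode j) (cmode j)"
proof -
  have "\<bar>smode j z\<bar> <= 1" for z using modes_bound(2)[of j z] freq_gt[of j] by (auto elim!: order_trans)
  then show ?thesis
    by (auto simp: vprimitive_def vweight_def DERIV_modes modes_cont modes_bound borel_measurable_continuous_onI)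
qed

text \<open>No boundary terms arise: v is zero at the surface and a at the bottom.\<close>

lemma vavg_FTC:
  fixes v :: "'a::euclidean_space \<times> real => real"
  assumes ab: "vprimitive a b" and t: "strip_test_fun v g"
  shows "vavg a (%p. snd (g p)) x = - vavg b v x"
proof -
  note t' = strip_test_funD(1)[OF t]
  have ac: "continuous_on UNIV a" using ab by (intro DERIV_continuous_on) (auto simp: vprimitive_def)
  have bc: "continuous_on UNIV b" using ab by (simp add: vprimitive_def)
  have cz: "continuous_on UNIV (%z. v (x, z))" "continuous_on UNIV (%z. snd (g (x, z)))"
    by (intro continuous_intros continuous_on_compose2[OF test_fun_cont(1)[OF t']] continuous_on_compose2[OF test_fun_cont(2)[OF t']]; simp)+
  have "DERIV (%z. a z * v (x, z)) z :> a z * snd (g (x, z)) + b z * v (x, z)" for z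
    by (rule DERIV_cong[OF DERIV_mult[OF _ test_fun_slice(2)[OF t', of x z]]]) (use ab in \<open>auto simp: vprimitive_def\<close>)
  from ivl_FTC_0[OF this] have "(LINT z|ivl. a z * snd (g (x, z)) + b z * v (x, z)) = a 0 * v (x, 0) - a (-1) * v (x, -1)"
    by (simp add: continuous_intros ac bc cz)
  moreover have "v (x, 0) = 0" using strip_test_funD(2)[OF t] by auto
  ultimately show ?thesis
    using ab integrable_ivl[OF continuous_on_mult[OF ac cz(2)]] integrable_ivl[OF continuous_on_mult[OF bc cz(1)]]
    by (simp add: vavg_def vprimitive_def)
qed

text \<open>The scaled divergence of this field is \<mu> b D - \<mu> a' D = 0 because b = a', and
  its vertical component vanishes at the bottom with a. It both supplies fields to test an
  \<open>efield\<close> with and exchanges horizontal sources for vertical ones.\<close>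

lemma normal_field_weak_div:
  fixes W :: "'a::euclidean_space => 'a"
  assumes d: "has_weak_div W D" and s: "sqint lborel W" "sqint lborel D" and ab: "vprimitive a b" and \<mu>: "0 < \<mu>"
  shows "normal_field \<mu> (%p. ((sqrt \<mu> * b (snd p)) *\<^sub>R W (fst p), - (\<mu> * a (snd p) * D (fst p))))"
  unfolding normal_field_def
proof (intro conjI allI impI)
  note w = vprimitiveD[OF ab]
  have m: "a \<in> borel_measurable borel" "b \<in> borel_measurable borel" using w by (simp_all add: vweight_def)
  have [measurable]: "W \<in> borel_measurable borel" "D \<in> borel_measurable borel" using s by (simp_all add: sqint_def)
  note [measurable] = m
  have bd: "sqint smeas (%p. c (snd p) *\<^sub>R f (fst p))" if "vweight 1 c" "sqint lborel f" for c and f :: "'a => 'b::euclidean_space"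
    using cls_base(1)[OF cls_lift[OF that(1), of L2 0 "l2 lborel f" f]] that(2) by simp
  have "sqint smeas (%p. (b (snd p) *\<^sub>R W (fst p), 0::real))" "sqint smeas (%p. (0::'a, a (snd p) *\<^sub>R D (fst p)))"
    by (rule sqint_bound(1)[OF bd[OF w(2) s(1)], of _ 1] sqint_bound(1)[OF bd[OF w(1) s(2)], of _ 1]; simp add: norm_Pair)+
  from sqint_add(1)[OF sqint_scaleR(1)[OF this(1), of "sqrt \<mu>"] sqint_scaleR(1)[OF this(2), of "- \<mu>"]]
  show "sqint smeas (%p. ((sqrt \<mu> * b (snd p)) *\<^sub>R W (fst p), - (\<mu> * a (snd p) * D (fst p))))" by (simp add: mult.assoc)
  fix v and g :: "'a \<times> real => 'a \<times> real" assume t: "strip_test_fun v g"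
  note tt = strip_test_funD(1)[OF t]
  have vs: "sqint smeas v" "sqint smeas g" using test_fun_sqint[OF tt] by (auto intro: sqint_smeas)
  note g = sqint_fst_snd[OF vs(2)]
  note p1 = vavg_pairing[OF w(2) g(1) s(1)] and p2 = vavg_pairing[OF w(1) g(2) s(2)] and p3 = vavg_pairing[OF w(2) vs(1) s(2)]
  have "(LINT p|smeas. b (snd p) * (fst (g p) \<bullet> W (fst p))) = (LINT z|ivl. LINT x|lborel. b z * (fst (g (x, z)) \<bullet> W x))"
    unfolding smeas_pair using ivl_pair.integral_snd[of "%x z. b z * (fst (g (x, z)) \<bullet> W x)"] p1(2) by (simp add: smeas_pair split_beta')
  also have "\<dots> = (LINT z|ivl. LINT x|lborel. - (b z * (v (x, z) \<bullet> D x)))"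
  proof (rule Bochner_Integration.integral_cong[OF refl])
    fix z
    have "(LINT x|lborel. W x \<bullet> fst (g (x, z))) = - (LINT x|lborel. D x * v (x, z))"
      using d test_fun_slice(1)[OF tt, of z] unfolding has_weak_div_def by blast
    then have "(LINT x|lborel. fst (g (x, z)) \<bullet> W x) = - (LINT x|lborel. v (x, z) \<bullet> D x)"
      by (simp add: inner_commute[of "fst _"] mult.commute)
    then show "(LINT x|lborel. b z * (fst (g (x, z)) \<bullet> W x)) = (LINT x|lborel. - (b z * (v (x, z) \<bullet> D x)))" by simp
  qed
  also have "\<dots> = - (LINT p|smeas. b (snd p) * (v p \<bullet> D (fst p)))"
    unfolding smeas_pair using ivl_pair.integral_snd[of "%x z. b z * (v (x, z) \<bullet> D x)"] p3(2) by (simp add: smeas_pair split_beta')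
  also have "\<dots> = (LINT p|smeas. a (snd p) * (snd (g p) \<bullet> D (fst p)))"
    unfolding p3(1) p2(1) vavg_FTC[OF ab t] by simp
  finally have e: "(LINT p|smeas. b (snd p) * (fst (g p) \<bullet> W (fst p))) = (LINT p|smeas. a (snd p) * (snd (g p) \<bullet> D (fst p)))" .
  have "(LINT p|smeas. ((sqrt \<mu> * b (snd p)) *\<^sub>R W (fst p), - (\<mu> * a (snd p) * D (fst p))) \<bullet> scale_mu \<mu> (g p))
      = (LINT p|smeas. \<mu> * (b (snd p) * (fst (g p) \<bullet> W (fst p))) - \<mu> * (a (snd p) * (snd (g p) \<bullet> D (fst p))))"
    using \<mu> by (intro Bochner_Integration.integral_cong refl)
      (simp add: scale_mu_def inner_commute[of "W _"] mult_ac flip: real_sqrt_mult)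
  also have "\<dots> = 0" using p1(2) p2(2) e by simp
  finally show "(LINT p|smeas. ((sqrt \<mu> * b (snd p)) *\<^sub>R W (fst p), - (\<mu> * a (snd p) * D (fst p))) \<bullet> scale_mu \<mu> (g p)) = 0" .
qed

lemma has_weak_div_test:
  assumes t: "test_fun \<eta> k" and c: "norm c = 1"
  shows "has_weak_div (%x. \<eta> x *\<^sub>R c) (%x. c \<bullet> k x)" "sqint lborel (%x. \<eta> x *\<^sub>R c)" "sqint lborel (%x. c \<bullet> k x)"
proof -
  note [measurable] = test_fun_measurable[OF t]
  show s: "sqint lborel (%x. \<eta> x *\<^sub>R c)" "sqint lborel (%x. c \<bullet> k x)"
    by (rule sqint_bound(1)[OF test_fun_sqint(1)[OF t], of _ 1] sqint_bound(1)[OF test_fun_sqint(2)[OF t], of _ 1];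
      use c Cauchy_Schwarz_ineq2[of c] in simp)+
  show "has_weak_div (%x. \<eta> x *\<^sub>R c) (%x. c \<bullet> k x)" unfolding has_weak_div_def
    using ibp_dq[OF test_fun_sqint(1)[OF t] s(2) test_dq_tendsto[OF t c] c] by (auto intro!: sqint_in_L2loc s)
qed

text \<open>The relation between averages of u and of \<nabla>u, obtained without constructing u: Y
  is paired with the normal fields that \<open>normal_field_weak_div\<close> makes out of a test
  function times a coordinate vector.\<close>

lemma vavg_weak_grad:
  fixes Y :: "'a::euclidean_space \<times> real => 'a \<times> real"
  assumes Y: "efield \<mu> Y" and \<mu>: "0 < \<mu>" and ab: "vprimitive a b"
  shows "has_weak_grad (%x. - vavg a (%p. snd (Y p)) x) (%x. vavg b (%p. fst (Y p)) x /\<^sub>R sqrt \<mu>)"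
proof (rule has_weak_gradI)
  note Ys = sqint_fst_snd[OF efield_sqint[OF Y]]
  note w = vprimitiveD[OF ab]
  show "sqint lborel (%x. - vavg a (%p. snd (Y p)) x)" "sqint lborel (%x. vavg b (%p. fst (Y p)) x /\<^sub>R sqrt \<mu>)"
    by (intro sqint_minus sqint_scaleR sqint_vavg(1)[OF w(1)] sqint_vavg(1)[OF w(2)] Ys)+
  fix \<eta> and k :: "'a => 'a" and c :: 'a assume t: "test_fun \<eta> k" and c: "c \<in> Basis"
  then have "norm c = 1" by simp
  note d = has_weak_div_test[OF t this]
  note p = vavg_pairing[OF w(2) Ys(1) d(2)] vavg_pairing[OF w(1) Ys(2) d(3)]
  have "0 = (LINT p|smeas. ((sqrt \<mu> * b (snd p)) *\<^sub>R (\<eta> (fst p) *\<^sub>R c), - (\<mu> * a (snd p) * (c \<bullet> k (fst p)))) \<bullet> Y p)"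
    using efieldD[OF Y normal_field_weak_div[OF d ab \<mu>]] by simp
  also have "\<dots> = (LINT p|smeas. sqrt \<mu> * (b (snd p) * (fst (Y p) \<bullet> (\<eta> (fst p) *\<^sub>R c))) - \<mu> * (a (snd p) * (snd (Y p) \<bullet> (c \<bullet> k (fst p)))))"
    by (intro Bochner_Integration.integral_cong refl) (simp add: inner_prod_def inner_commute[of c] mult_ac)
  also have "\<dots> = sqrt \<mu> * (LINT x|lborel. vavg b (%p. fst (Y p)) x \<bullet> (\<eta> x *\<^sub>R c)) - \<mu> * (LINT x|lborel. vavg a (%p. snd (Y p)) x \<bullet> (c \<bullet> k x))"
    using p(2,4) by (simp add: p(1,3)[simplified])
  finally have "sqrt \<mu> * (LINT x|lborel. (vavg b (%p. fst (Y p)) x \<bullet> c) * \<eta> x) = sqrt \<mu> * (sqrt \<mu> * (LINT x|lborel. vavg a (%p. snd (Y p)) x * (k x \<bullet> c)))"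
    using \<mu> by (simp add: inner_commute[of c] mult.commute[of "\<eta> _"] flip: mult.assoc)
  then have "inverse (sqrt \<mu>) * (LINT x|lborel. (vavg b (%p. fst (Y p)) x \<bullet> c) * \<eta> x) = (LINT x|lborel. vavg a (%p. snd (Y p)) x * (k x \<bullet> c))"
    using \<mu> by (simp add: field_simps)
  then show "(LINT x|lborel. - vavg a (%p. snd (Y p)) x * (k x \<bullet> c)) = - (LINT x|lborel. ((vavg b (%p. fst (Y p)) x /\<^sub>R sqrt \<mu>) \<bullet> c) * \<eta> x)"
    by (simp add: mult.assoc)
qed

text \<open>The normal field is paired with the scaled gradient of \<eta>(x)
  \<open>cmode j\<close>(z), which is admissible by \<open>efield_tensor\<close> because the mode
  vanishes at the surface.\<close>

lemma normal_field_mode: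
  fixes X :: "'a::euclidean_space \<times> real => 'a \<times> real"
  assumes X: "normal_field \<mu> X" and \<mu>: "0 < \<mu>"
  shows "has_weak_div (%x. sqrt \<mu> *\<^sub>R vavg (cmode j) (%p. fst (X p)) x) (%x. - ((freq j)\<^sup>2 * vavg (smode j) (%p. snd (X p)) x))"
  unfolding has_weak_div_def
proof (intro conjI allI impI)
  note Xs = sqint_fst_snd[OF normal_fieldD(1)[OF X]]
  note w = vprimitiveD[OF vprimitive_modes[of j]]
  show "in_L2loc (%x. sqrt \<mu> *\<^sub>R vavg (cmode j) (%p. fst (X p)) x)"
    by (intro sqint_in_L2loc sqint_scaleR sqint_vavg(1)[OF w(2)] Xs)
  show "in_L2loc (%x. - ((freq j)\<^sup>2 * vavg (smode j) (%p. snd (X p)) x))"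
    using sqint_scaleR(1)[OF sqint_vavg(1)[OF w(1) Xs(2)], of "- ((freq j)\<^sup>2)"] by (simp add: sqint_in_L2loc)
  fix \<eta> and k :: "'a => 'a" assume t: "test_fun \<eta> k"
  note p = vavg_pairing[OF w(2) Xs(1) test_fun_sqint(2)[OF t]] vavg_pairing[OF w(1) Xs(2) test_fun_sqint(1)[OF t]]
  \<comment> \<open>The slope of \<open>cmode j\<close> is at most \<open>freq j\<close>; this is
    the constant B of \<open>efield_tensor\<close>.\<close>
  have bd: "\<bar>- ((freq j)\<^sup>2 * smode j z)\<bar> <= freq j" for z
    using mult_left_mono[OF modes_bound(2)[of j z], of "(freq j)\<^sup>2"] by (simp add: abs_mult power2_eq_square)
  have "efield \<mu> (%p. scale_mu \<mu> (cmode j (snd p) *\<^sub>R k (fst p), \<eta> (fst p) * - ((freq j)\<^sup>2 * smode j (snd p))))"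
    by (rule efield_tensor[OF t DERIV_modes(2) _ bd]) (intro continuous_intros modes_cont | simp add: \<mu>)+
  from efieldD[OF this X] have "0 = (LINT p|smeas. X p \<bullet> scale_mu \<mu> (cmode j (snd p) *\<^sub>R k (fst p), \<eta> (fst p) * - ((freq j)\<^sup>2 * smode j (snd p))))"
    by simp
  also have "\<dots> = (LINT p|smeas. sqrt \<mu> * (cmode j (snd p) * (fst (X p) \<bullet> k (fst p))) - (freq j)\<^sup>2 * (smode j (snd p) * (snd (X p) \<bullet> \<eta> (fst p))))"
    by (intro Bochner_Integration.integral_cong refl) (simp add: scale_mu_def inner_prod_def mult_ac)
  also have "\<dots> = sqrt \<mu> * (LINT x|lborel. vavg (cmode j) (%p. fst (X p)) x \<bullet> k x) - (freq j)\<^sup>2 * (LINT x|lborel. vavg (smode j) (%p. snd (X p)) x \<bullet> \<eta> x)"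
    using p(2,4) by (simp add: p(1,3)[simplified])
  finally show "(LINT x|lborel. (sqrt \<mu> *\<^sub>R vavg (cmode j) (%p. fst (X p)) x) \<bullet> k x) = - (LINT x|lborel. - ((freq j)\<^sup>2 * vavg (smode j) (%p. snd (X p)) x) * \<eta> x)"
    by (simp add: mult.assoc)
qed

subsection \<open>Families on the strip\<close>

abbreviation us :: "'i set => nat => ('i => real) => ('i => 'a::euclidean_space \<times> real => 'b::euclidean_space) => bool" where
  "us \<equiv> ucls L2 smeas sdir"

abbreviation usI :: "'i set => nat => ('i => real) => ('i => 'a::euclidean_space \<times> real => 'b::euclidean_space) => bool" where
  "usI \<equiv> ucls Linf smeas sdir"

lemma ucls_lift:
  assumes f: "ucls p lborel UNIV I k w f" and a: "vweight 1 a"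
  shows "ucls p smeas sdir I k w (%i p. a (snd p) *\<^sub>R f i (fst p))"
  using f cls_lift[OF a] unfolding ucls_def by fastforce

lemma uc_vavg:
  assumes F: "us I k w F" and a: "!!i. i \<in> I ==> vweight 1 (a i)"
  shows "uc I k w (%i. vavg (a i) (F i))"
  using F cls_vavg[OF a] unfolding ucls_def by fastforce

lemma us_elliptic:
  fixes Y :: "'i => 'a::euclidean_space \<times> real => 'a \<times> real"
  assumes c: "usI I k (%_. 1) c" and \<kappa>: "0 < \<kappa>" "!!i. i \<in> I ==> AE p in smeas. \<forall>X. \<kappa> * (norm X)\<^sup>2 <= pmat (c i p) X \<bullet> X"
    and Y: "!!i. i \<in> I ==> efield (\<mu> i) (Y i)" "!!i. i \<in> I ==> normal_field (\<mu> i) (%p. pmat (c i p) (Y i p) - F i p)" "!!i. i \<in> I ==> 0 < \<mu> i"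
    and F: "us I k w F"
  shows "us I k w Y"
proof -
  from c obtain A where A: "0 <= A" "!!i. i \<in> I ==> cls Linf smeas sdir k (A * 1) (c i)" by (rule ucls_E) blast
  from F obtain M where M: "0 <= M" "!!i. i \<in> I ==> 0 <= w i" "!!i. i \<in> I ==> cls L2 smeas sdir k (M * w i) (F i)" by (rule ucls_E) blast
  obtain C where C: "0 <= C" "!!\<mu> c (Y :: 'a \<times> real => 'a \<times> real) F M. 0 < \<mu> ==> cls Linf smeas sdir k A c ==>
      AE p in smeas. \<forall>X. \<kappa> * (norm X)\<^sup>2 <= pmat (c p) X \<bullet> X ==> efield \<mu> Y ==> normal_field \<mu> (%p. pmat (c p) (Y p) - F p) ==>
      cls L2 smeas sdir k M F ==> cls L2 smeas sdir k (C * M) Y"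
    using elliptic_regularity[OF A(1) \<kappa>(1), of k] by blast
  show ?thesis unfolding ucls_def
  proof (intro exI[of _ "C * M"] conjI ballI M(2))
    fix i assume i: "i \<in> I"
    have "cls L2 smeas sdir k (C * (M * w i)) (Y i)"
      by (rule C(2)[OF Y(3)[OF i] _ \<kappa>(2)[OF i] Y(1)[OF i] Y(2)[OF i] M(3)[OF i]]) (use A(2)[OF i] in simp)
    then show "cls L2 smeas sdir k (C * M * w i) (Y i)" by (simp add: mult.assoc)
  qed (use C M in auto)
qed

subsection \<open>Differential operators and multipliers on families\<close>

definition ft :: "('a::euclidean_space => real) => 'a => complex" where
  "ft u = (SOME U. rft u U)"

lemma rft_ft: "sqint lborel u ==> rft u (ft u)"
  unfolding ft_def by (rule someI_ex[OF rft_ex])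

lemma ft_eq: "rft u U ==> AE \<xi> in lborel. ft u \<xi> = U \<xi>"
  by (rule rft_unique[OF rft_ft]) (auto dest: rft_sqint)

text \<open>The Sobolev space of integer order k, for a single function, in terms of the weight
  \<open>wt k\<close>.\<close>

definition hs :: "nat => ('a::euclidean_space => real) => bool" where
  "hs k u \<longleftrightarrow> rft u (ft u) & sqint lborel (wU k (ft u))"

lemma hsD: "hs k u ==> rft u (ft u)" "hs k u ==> sqint lborel u" "hs k u ==> ft u \<in> borel_measurable borel"
  "hs k u ==> u \<in> borel_measurable borel"
  by (auto simp: hs_def dest: rft_sqint)

lemma hs_le: "hs k u ==> j <= k ==> hs j u"
  unfolding hs_def using sqint_wU_le(1) rft_sqint(4) by blast

lemma hs_uc:
  assumes "uc I k w f" "i \<in> I"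
  shows "hs k (f i)"
  using uc_rft_bound[OF assms(1)] rft_ft[OF uc_sqint[OF assms]] assms(2) unfolding hs_def by metis

lemma sqint_symbol:
  assumes u: "hs j u" and m: "m \<in> borel_measurable borel" "!!\<xi>. norm (m \<xi>) <= c * wt j \<xi>"
  shows "sqint lborel (%\<xi>. m \<xi> * ft u \<xi>)"
proof (rule sqint_bound(1)[of _ "wU j (ft u)" _ "\<bar>c\<bar>"])
  have [measurable]: "ft u \<in> borel_measurable borel" by (rule hsD(3)[OF u])
  show "(%\<xi>. m \<xi> * ft u \<xi>) \<in> borel_measurable lborel" using m(1) by simp
  show "AE \<xi> in lborel. norm (m \<xi> * ft u \<xi>) <= \<bar>c\<bar> * norm (wU j (ft u) \<xi>)"
  proof (rule AE_I2)
    fix \<xi> :: 'a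
    have "c * wt j \<xi> <= \<bar>c\<bar> * wt j \<xi>" by (intro mult_right_mono) auto
    then have "norm (m \<xi>) <= \<bar>c\<bar> * wt j \<xi>" using m(2)[of \<xi>] by linarith
    from mult_right_mono[OF this norm_ge_zero[of "ft u \<xi>"]]
    show "norm (m \<xi> * ft u \<xi>) <= \<bar>c\<bar> * norm (wU j (ft u) \<xi>)" by (simp add: norm_mult mult.assoc)
  qed
qed (use u in \<open>auto simp: hs_def\<close>)

lemma uc_mult_ex:
  fixes f :: "'i => 'a::euclidean_space => real"
  assumes f: "uc I (k + j) w f" and m: "!!i. i \<in> I ==> m i \<in> borel_measurable borel"
    "!!i \<xi>. i \<in> I ==> m i (- \<xi>) = cnj (m i \<xi>)" "!!i \<xi>. i \<in> I ==> norm (m i \<xi>) <= v i * wt j \<xi>" "!!i. i \<in> I ==> 0 <= v i"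
  obtains g where "uc I k (%i. v i * w i) g" "!!i. i \<in> I ==> rft (g i) (%\<xi>. m i \<xi> * ft (f i) \<xi>)"
proof -
  have "\<exists>g. rft g (%\<xi>. m i \<xi> * ft (f i) \<xi>)" if i: "i \<in> I" for i
  proof -
    have "hs j (f i)" by (rule hs_le[OF hs_uc[OF f i]]) simp
    then show ?thesis
      by (intro rft_mult_ex[OF hsD(1) sqint_symbol[where c = "v i"]]) (use m[OF i] in auto)
  qed
  then obtain g where g: "!!i. i \<in> I ==> rft (g i) (%\<xi>. m i \<xi> * ft (f i) \<xi>)" by metis
  have "uc I k (%i. v i * w i) g"
    by (rule uc_multiplier[OF f hsD(1)[OF hs_uc[OF f]] g _ m(4)])
      (auto simp: norm_mult mult.assoc[symmetric] intro!: mult_right_mono m(3))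
  with g show ?thesis by (rule that[rotated])
qed

lemma uc_fourier_mult:
  fixes f :: "'i => 'a::euclidean_space => real"
  assumes f: "uc I (k + j) w f" and F: "!!i. i \<in> I ==> F i \<in> borel_measurable borel"
    "!!i \<xi>. i \<in> I ==> F i (- \<xi>) = F i \<xi>" "!!i \<xi>. i \<in> I ==> \<bar>F i \<xi>\<bar> <= v i * wt j \<xi>" "!!i. i \<in> I ==> 0 <= v i"
  shows "uc I k (%i. v i * w i) (%i. fourier_mult (F i) (f i))"
    "!!i. i \<in> I ==> rft (fourier_mult (F i) (f i)) (%\<xi>. complex_of_real (F i \<xi>) * ft (f i) \<xi>)"
proof -
  show r: "rft (fourier_mult (F i) (f i)) (%\<xi>. complex_of_real (F i \<xi>) * ft (f i) \<xi>)" if i: "i \<in> I" for i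
  proof (rule fourier_mult_rft[where F = "F i", OF hsD(1)[OF hs_uc[OF f i]] F(2)[OF i]])
    have [measurable]: "F i \<in> borel_measurable borel" by (rule F(1)[OF i])
    show "sqint lborel (%\<xi>. complex_of_real (F i \<xi>) * ft (f i) \<xi>)"
      by (rule sqint_symbol[OF hs_le[OF hs_uc[OF f i]], where j = j and c = "v i"]) (use F(3)[OF i] in auto)
  qed
  show "uc I k (%i. v i * w i) (%i. fourier_mult (F i) (f i))"
    by (rule uc_multiplier[OF f hsD(1)[OF hs_uc[OF f]] r _ F(4)])
      (auto simp: norm_mult mult.assoc[symmetric] intro!: mult_right_mono F(3))
qed

lemma uc_inner:
  fixes f :: "'i => 'a::euclidean_space => 'b::euclidean_space"
  assumes f: "uc I k w f" and b: "b \<in> Basis"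
  shows "uc I k w (%i x. f i x \<bullet> b)"
proof -
  have "norm (x \<bullet> b) <= norm x * 1" for x :: 'b using Basis_le_norm[OF b, of x] by simp
  from leb.ucls_linear[OF f bounded_linear_inner_left this] show ?thesis by simp
qed

lemma iD_symbol:
  assumes "b \<in> Basis"
  shows "norm (\<i> * complex_of_real (\<xi> \<bullet> b)) <= 1 * wt 1 (\<xi> :: 'a::euclidean_space)"
  using Basis_le_norm[OF assms, of \<xi>] by (simp add: wt_def norm_mult)

lemma hs_iD_ex:
  assumes u: "hs 1 u" and b: "b \<in> Basis"
  shows "\<exists>v. rft v (iD b (ft u))"
proof (rule rft_iD_ex[OF hsD(1)[OF u]])
  have "sqint lborel (%\<xi>. (\<i> * complex_of_real (\<xi> \<bullet> b)) * ft u \<xi>)"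
    by (rule sqint_symbol[OF u _ iD_symbol[OF b]]) simp
  then show "sqint lborel (iD b (ft u))" by (simp add: iD_def[abs_def])
qed

lemma weak_grad_hs:
  assumes u: "hs 1 u"
  shows "has_weak_grad u (weak_grad u)" "b \<in> Basis ==> rft (%x. weak_grad u x \<bullet> b) (iD b (ft u))"
proof -
  have [measurable]: "ft u \<in> borel_measurable borel" by (rule hsD(3)[OF u])
  obtain v where v: "!!b. b \<in> Basis ==> rft (v b) (iD b (ft u))" using hs_iD_ex[OF u] by metis
  define W where "W x = (\<Sum>b\<in>Basis. v b x *\<^sub>R b)" for x
  have W: "W x \<bullet> b = v b x" if "b \<in> Basis" for b x unfolding W_def by (rule inner_sum_left_Basis[OF that])
  have g: "has_weak_grad u W" by (rule has_weak_grad_rft[OF hsD(1)[OF u]]) (use v W in simp)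
  show gg: "has_weak_grad u (weak_grad u)" by (rule weak_grad_eq(1)[OF g])
  show "rft (%x. weak_grad u x \<bullet> b) (iD b (ft u))" if b: "b \<in> Basis"
  proof (rule rft_cong[OF v[OF b]])
    show "AE x in lborel. v b x = weak_grad u x \<bullet> b"
      using weak_grad_eq(2)[OF g] by eventually_elim (simp add: W[OF b])
    have [measurable]: "weak_grad u \<in> borel_measurable borel" using gg by (simp add: has_weak_grad_def in_L2loc_def)
    show "(%x. weak_grad u x \<bullet> b) \<in> borel_measurable borel" by measurable
  qed auto
qed

lemma weak_div_hs:
  fixes W :: "'a::euclidean_space => 'a"
  assumes W: "!!b. b \<in> Basis ==> hs 1 (%x. W x \<bullet> b)"
  shows "has_weak_div W (weak_div W)" "rft (weak_div W) (%\<xi>. \<Sum>b\<in>Basis. iD b (ft (%x. W x \<bullet> b)) \<xi>)"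
proof -
  note r = hsD(1)[OF W]
  have "\<forall>b\<in>Basis. \<exists>v. rft v (iD b (ft (%x. W x \<bullet> b)))" using hs_iD_ex[OF W] by blast
  from bchoice[OF this] obtain v where v: "!!b. b \<in> Basis ==> rft (v b) (iD b (ft (%x. W x \<bullet> b)))" by blast
  have s: "rft (%x. \<Sum>b\<in>Basis. v b x) (%\<xi>. \<Sum>b\<in>Basis. iD b (ft (%x. W x \<bullet> b)) \<xi>)" using v by (intro rft_sum) auto
  have d: "has_weak_div W (%x. \<Sum>b\<in>Basis. v b x)" by (rule has_weak_div_rft[OF r v s])
  show dd: "has_weak_div W (weak_div W)" by (rule weak_div_eq(1)[OF d])
  show "rft (weak_div W) (%\<xi>. \<Sum>b\<in>Basis. iD b (ft (%x. W x \<bullet> b)) \<xi>)"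
  proof (rule rft_cong[OF s])
    show "AE x in lborel. (\<Sum>b\<in>Basis. v b x) = weak_div W x" using weak_div_eq(2)[OF d] by eventually_elim simp
    show "weak_div W \<in> borel_measurable borel" using dd by (simp add: has_weak_div_def in_L2loc_def)
  qed (use rft_sqint(4)[OF s] in auto)
qed

lemma uc_weak_grad:
  fixes f :: "'i => 'a::euclidean_space => real"
  assumes f: "uc I (k + 1) w f"
  shows "uc I k w (%i. weak_grad (f i))"
proof (rule leb.ucls_components)
  have h: "i \<in> I ==> hs 1 (f i)" for i by (rule hs_le[OF hs_uc[OF f]]) simp_all
  fix b :: 'a assume b: "b \<in> Basis"
  have "uc I k (%i. 1 * w i) (%i x. weak_grad (f i) x \<bullet> b)"
    by (rule uc_multiplier[OF f hsD(1)[OF h] weak_grad_hs(2)[OF h b]])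
      (use iD_symbol[OF b] in \<open>auto simp: norm_iD norm_mult mult.assoc[symmetric] intro!: mult_right_mono\<close>)
  then show "uc I k w (%i x. weak_grad (f i) x \<bullet> b)" by simp
qed (use f in \<open>rule ucls_E\<close>)

lemma uc_weak_div:
  fixes W :: "'i => 'a::euclidean_space => 'a"
  assumes W: "uc I (k + 1) w W"
  shows "uc I k w (%i. weak_div (W i))"
proof -
  note Wb = uc_inner[OF W]
  have h: "i \<in> I ==> b \<in> Basis ==> hs 1 (%x. W i x \<bullet> b)" for i b by (rule hs_le[OF hs_uc[OF Wb]]) simp_all
  have "\<exists>g. uc I k (%i. 1 * w i) g & (\<forall>i\<in>I. rft (g i) (iD b (ft (%x. W i x \<bullet> b))))" if b: "b \<in> Basis" for b
  proof -
    obtain g where "uc I k (%i. 1 * w i) g" "!!i. i \<in> I ==> rft (g i) (%\<xi>. \<i> * complex_of_real (\<xi> \<bullet> b) * ft (%x. W i x \<bullet> b) \<xi>)"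
      by (rule uc_mult_ex[OF Wb[OF b], of "%i \<xi>. \<i> * complex_of_real (\<xi> \<bullet> b)" "%_. 1"]) (use iD_symbol[OF b] in auto)
    then show ?thesis unfolding iD_def[abs_def] by blast
  qed
  then obtain g where g: "!!b. b \<in> Basis ==> uc I k w (g b)" "!!b i. b \<in> Basis ==> i \<in> I ==> rft (g b i) (iD b (ft (%x. W i x \<bullet> b)))"
    by simp metis
  have "uc I k w (%i x. \<Sum>b\<in>Basis. g b i x)"
    by (rule leb.ucls_sum) (use g W in \<open>auto elim: ucls_E\<close>)
  then show ?thesis
  proof (rule leb.ucls_cong)
    fix i assume i: "i \<in> I"
    have "rft (%x. \<Sum>b\<in>Basis. g b i x) (%\<xi>. \<Sum>b\<in>Basis. iD b (ft (%x. W i x \<bullet> b)) \<xi>)" using g(2) i by (intro rft_sum) auto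
    from rft_inj[OF this weak_div_hs(2)[OF h[OF i]]] show "AE x in lborel. (\<Sum>b\<in>Basis. g b i x) = weak_div (W i) x" by simp
    show "weak_div (W i) \<in> borel_measurable borel" using rft_sqint(3)[OF weak_div_hs(2)[OF h[OF i]]] .
  qed
qed

lemma ucI_of_uc_vec:
  fixes f :: "'i => 'a::euclidean_space => 'b::euclidean_space"
  assumes f: "uc I (k + DIM('a)) w f"
  shows "ucI I k w f"
  by (rule leb.ucls_components) (use f uc_inner[OF f] in \<open>auto intro: ucI_of_uc elim: ucls_E\<close>)

text \<open>Of the 2 + d derivatives of c, d make its transform integrable and 2 are the weight
  asked for by \<open>deriv_product_rft\<close>.\<close>

lemma weak_grad_prod_hs:
  fixes c w :: "'a::euclidean_space => real"
  assumes c: "hs (2 + DIM('a)) c" and w: "hs 1 w" and cw: "hs 1 (%x. c x * w x)"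
  shows "AE x in lborel. weak_grad (%x. c x * w x) x = c x *\<^sub>R weak_grad w x + w x *\<^sub>R weak_grad c x"
proof -
  have c1: "hs 1 c" by (rule hs_le[OF c]) simp
  have ci: "integrable lborel (wU 2 (ft c))" by (rule wU_integrable(1)) (use c hsD(3)[OF c] in \<open>auto simp: hs_def\<close>)
  have "AE x in lborel. \<forall>b\<in>Basis. weak_grad (%x. c x * w x) x \<bullet> b = c x * (weak_grad w x \<bullet> b) + (weak_grad c x \<bullet> b) * w x"
    by (intro AE_finite_allI finite_Basis deriv_product_rft[OF _ hsD(1)[OF c1] weak_grad_hs(2)[OF c1] ci
        hsD(1)[OF w] weak_grad_hs(2)[OF w] hsD(1)[OF cw] weak_grad_hs(2)[OF cw]])
  then show ?thesis
    by eventually_elim (auto intro!: euclidean_eqI[where 'a = 'a] simp: inner_add_left)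
qed

lemma has_weak_div_cong:
  fixes W :: "'a::euclidean_space => 'a"
  assumes d: "has_weak_div W D" and s: "sqint lborel W'" "sqint lborel D'"
    and ae: "AE x in lborel. W x = W' x & D x = D' x"
  shows "has_weak_div W' D'"
  unfolding has_weak_div_def
proof (intro conjI allI impI sqint_in_L2loc s)
  fix \<eta> g assume t: "test_fun \<eta> (g :: 'a => 'a)"
  note ts = test_fun_sqint[OF t]
  have [measurable]: "W \<in> borel_measurable borel" "D \<in> borel_measurable borel" "W' \<in> borel_measurable borel" "D' \<in> borel_measurable borel"
    using d s by (simp_all add: has_weak_div_def in_L2loc_def sqint_def)
  note [measurable] = test_fun_measurable[OF t]
  have "(LINT x|lborel. W' x \<bullet> g x) = (LINT x|lborel. W x \<bullet> g x)" "(LINT x|lborel. D' x * \<eta> x) = (LINT x|lborel. D x * \<eta> x)"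
    by (rule integral_cong_AE; use ae in \<open>auto elim: eventually_mono\<close>)+
  then show "(LINT x|lborel. W' x \<bullet> g x) = - (LINT x|lborel. D' x * \<eta> x)" using d t unfolding has_weak_div_def by simp
qed

text \<open>
  Testing with \<open>\<eta>(x) cos (r\<^sub>j (z + 1))\<close> turns the flat problem, written with the normal field \<open>Y + (\<surd>\<mu> G, 0) - F\<close>,
  into a Helmholtz equation for \<open>\<integral> u cos (r\<^sub>j (z + 1)) dz\<close>, where \<open>Y = \<nabla>\<^sup>\<mu>u\<close>
  and \<open>r\<^sub>j = freq j\<close>.
\<close>

lemma mode_fourier:
  fixes Y :: "'a::euclidean_space \<times> real => 'a \<times> real"
  defines "y \<equiv> %j x. - vavg (smode j) (%p. snd (Y p)) x"
    and "A \<equiv> %j. vavg (cmode j) (%p. fst (Y p))"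
  assumes Y: "efield \<mu> Y" and \<mu>: "0 < \<mu>" and F: "sqint smeas F"
    and N: "normal_field \<mu> (%p. Y p + (sqrt \<mu> *\<^sub>R G (fst p), 0) - F p)"
    and H: "H = vavg (cmode j) (%p. fst (F p))" and g: "g = vavg (%z. freq j * smode j z) (%p. snd (F p))"
    and hs: "hs 1 (y j)" "!!b. b \<in> Basis ==> hs 1 (%x. A j x \<bullet> b)" "!!b. b \<in> Basis ==> hs 1 (%x. G x \<bullet> b)" "!!b. b \<in> Basis ==> hs 1 (%x. H x \<bullet> b)"
  shows "AE \<xi> in lborel. complex_of_real (\<mu> * (norm \<xi>)\<^sup>2 + (freq j)\<^sup>2) * ft (y j) \<xi> =
    complex_of_real (\<mu> * sin (freq j) / freq j) * ft (weak_div G) \<xi>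
    - (complex_of_real (sqrt \<mu>) * (\<Sum>b\<in>Basis. iD b (ft (%x. H x \<bullet> b)) \<xi>) + complex_of_real (freq j) * ft g \<xi>)"
proof -
  note w = vprimitiveD[OF vprimitive_modes[of j]]
  note Ys = sqint_fst_snd[OF efield_sqint[OF Y]] and Fs = sqint_fst_snd[OF F]
  let ?l = "freq j"
  \<comment> \<open>The field \<surd>\<mu> G does not depend on z, so its mode average is G times
    \<surd>\<mu> times the integral of \<open>cmode j\<close>.\<close>
  define c where "c = sqrt \<mu> * sin (freq j) / freq j"
  have gx: "g x = ?l * vavg (smode j) (%p. snd (F p)) x" for x unfolding g vavg_def by (simp add: mult.assoc)
  have Gs: "sqint lborel G" by (rule sqint_from_components) (use hs(3) hsD(2) in blast)
  have As: "sqint lborel (A j)" "sqint lborel H" "sqint lborel (y j)" "sqint lborel g"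
    using sqint_vavg(1)[OF w(2) Ys(1)] sqint_vavg(1)[OF w(2) Fs(1)] sqint_minus(1)[OF sqint_vavg(1)[OF w(1) Ys(2)]]
      sqint_scaleR(1)[OF sqint_vavg(1)[OF w(1) Fs(2)], of "freq j"] by (simp_all add: A_def H y_def gx[abs_def])
  define W where "W x = sqrt \<mu> *\<^sub>R (A j x + c *\<^sub>R G x - H x)" for x
  define D where "D x = ?l\<^sup>2 * y j x + ?l * g x" for x
  have ae: "AE x in lborel. sqrt \<mu> *\<^sub>R vavg (cmode j) (%p. fst (Y p + (sqrt \<mu> *\<^sub>R G (fst p), 0) - F p)) x = W x
      & - (?l\<^sup>2 * vavg (smode j) (%p. snd (Y p + (sqrt \<mu> *\<^sub>R G (fst p), 0) - F p)) x) = D x"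
    using AE_slice_sqint(1)[OF Ys(1)] AE_slice_sqint(1)[OF Ys(2)] AE_slice_sqint(1)[OF Fs(1)] AE_slice_sqint(1)[OF Fs(2)]
  proof eventually_elim
    case (elim x)
    note i = vavg_slice(1)[OF w(2) elim(1)] vavg_slice(1)[OF w(1) elim(2)] vavg_slice(1)[OF w(2) elim(3)] vavg_slice(1)[OF w(1) elim(4)]
    have "integrable ivl (%z. cmode j z *\<^sub>R (sqrt \<mu> *\<^sub>R G x))" by (intro integrable_scaleR_left integrable_ivl modes_cont)
    moreover have "(LINT z|ivl. cmode j z *\<^sub>R (sqrt \<mu> *\<^sub>R G x)) = c *\<^sub>R G x"
      by (subst integral_scaleR_left) (simp_all add: integrable_ivl modes_cont cmode_integrals c_def)
    ultimately show ?case using i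
      by (simp add: W_def D_def A_def y_def H gx vavg_def scaleR_add_right scaleR_diff_right right_diff_distrib power2_eq_square)
  qed
  have "sqint lborel W" "sqint lborel D" unfolding W_def[abs_def] D_def[abs_def]
    using sqint_scaleR(1)[OF As(3), of "?l\<^sup>2"] sqint_scaleR(1)[OF As(4), of ?l]
    by (auto intro!: sqint_scaleR sqint_add sqint_diff As Gs)
  note d = has_weak_div_cong[OF normal_field_mode[OF N \<mu>, of j] this ae]
  \<comment> \<open>This second relation, A = \<surd>\<mu> \<nabla>y, closes the system: it
    eliminates A from the divergence equation d.\<close>
  have "has_weak_grad (y j) (%x. A j x /\<^sub>R sqrt \<mu>)" unfolding y_def A_def by (rule vavg_weak_grad[OF Y \<mu> vprimitive_modes])
  note gA = weak_grad_eq(2)[OF this]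
  have A: "rft (%x. A j x \<bullet> b) (%\<xi>. complex_of_real (sqrt \<mu>) * iD b (ft (y j)) \<xi>)" if b: "b \<in> Basis" for b
  proof (rule rft_cong[OF rft_cmult[OF weak_grad_hs(2)[OF hs(1) b], of "sqrt \<mu>"]])
    show "AE x in lborel. sqrt \<mu> * (weak_grad (y j) x \<bullet> b) = A j x \<bullet> b" using gA by eventually_elim (use \<mu> in simp)
  qed (use hsD(3)[OF hs(1)] hsD(4)[OF hs(2)[OF b]] in simp_all)
  define V where "V b \<xi> = complex_of_real (sqrt \<mu>) * (ft (%x. A j x \<bullet> b) \<xi> + complex_of_real c * ft (%x. G x \<bullet> b) \<xi> - ft (%x. H x \<bullet> b) \<xi>)" for b \<xi>
  note ftb = hsD(1)[OF hs(2)] hsD(1)[OF hs(3)] hsD(1)[OF hs(4)]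
  have V: "rft (%x. W x \<bullet> b) (V b)" if b: "b \<in> Basis" for b
    using rft_cmult[OF rft_diff[OF rft_add[OF ftb(1)[OF b] rft_cmult[OF ftb(2)[OF b], of c]] ftb(3)[OF b]], of "sqrt \<mu>"]
    by (simp add: W_def V_def[abs_def] inner_add_left inner_diff_left)
  have iDV: "iD b (V b) \<xi> = complex_of_real (sqrt \<mu>) * (iD b (ft (%x. A j x \<bullet> b)) \<xi>
      + complex_of_real c * iD b (ft (%x. G x \<bullet> b)) \<xi> - iD b (ft (%x. H x \<bullet> b)) \<xi>)" for b \<xi>
    by (simp add: iD_def V_def algebra_simps)
  have "\<forall>b\<in>Basis. \<exists>v. rft v (iD b (V b))"
  proof
    fix b :: 'a assume b: "b \<in> Basis"
    obtain a1 a2 a3 where "rft a1 (iD b (ft (%x. A j x \<bullet> b)))" "rft a2 (iD b (ft (%x. G x \<bullet> b)))" "rft a3 (iD b (ft (%x. H x \<bullet> b)))"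
      using hs_iD_ex[OF hs(2)[OF b] b] hs_iD_ex[OF hs(3)[OF b] b] hs_iD_ex[OF hs(4)[OF b] b] by blast
    from rft_cmult[OF rft_diff[OF rft_add[OF this(1) rft_cmult[OF this(2), of c]] this(3)], of "sqrt \<mu>"]
    show "\<exists>v. rft v (iD b (V b))" unfolding iDV[abs_def] by blast
  qed
  from bchoice[OF this] obtain v where "\<forall>b\<in>Basis. rft (v b) (iD b (V b))" ..
  then have v: "!!b. b \<in> Basis ==> rft (v b) (iD b (V b))" by blast
  note Ds = rft_sum[OF finite_Basis v]
  have "rft D (%\<xi>. complex_of_real (?l\<^sup>2) * ft (y j) \<xi> + complex_of_real ?l * ft g \<xi>)"
    unfolding D_def[abs_def] by (intro rft_add rft_cmult rft_ft As)
  from rft_unique[OF Ds this has_weak_div_unique[OF has_weak_div_rft[OF V v Ds] d]]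
  have "AE \<xi> in lborel. (\<Sum>b\<in>Basis. iD b (V b) \<xi>) = complex_of_real (?l\<^sup>2) * ft (y j) \<xi> + complex_of_real ?l * ft g \<xi>" .
  moreover have "AE \<xi> in lborel. \<forall>b\<in>Basis. ft (%x. A j x \<bullet> b) \<xi> = complex_of_real (sqrt \<mu>) * iD b (ft (y j)) \<xi>"
    using ft_eq[OF A] by (simp add: AE_finite_all)
  moreover have "AE \<xi> in lborel. ft (weak_div G) \<xi> = (\<Sum>b\<in>Basis. iD b (ft (%x. G x \<bullet> b)) \<xi>)"
    by (rule ft_eq[OF weak_div_hs(2)]) (rule hs(3))
  ultimately show ?thesis
  proof eventually_elim
    case (elim \<xi>)
    \<comment> \<open>The divergence of \<nabla>y becomes multiplication by -|\<xi>|^2.\<close>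
    have "(\<Sum>b\<in>Basis. complex_of_real (\<xi> \<bullet> b) * complex_of_real (\<xi> \<bullet> b)) = complex_of_real ((norm \<xi>)\<^sup>2)"
      unfolding power2_norm_eq_inner euclidean_inner[of \<xi> \<xi>] by simp
    moreover have "(\<Sum>b\<in>Basis. iD b (ft (%x. A j x \<bullet> b)) \<xi>) = (\<Sum>b\<in>Basis. - (complex_of_real (sqrt \<mu>) * ft (y j) \<xi>) *
        (complex_of_real (\<xi> \<bullet> b) * complex_of_real (\<xi> \<bullet> b)))"
      using elim(2) by (intro sum.cong) (simp_all add: iD_def algebra_simps)
    ultimately have "(\<Sum>b\<in>Basis. iD b (ft (%x. A j x \<bullet> b)) \<xi>) = - complex_of_real (sqrt \<mu> * (norm \<xi>)\<^sup>2) * ft (y j) \<xi>"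
      by (simp only: sum_distrib_left[symmetric]) (simp add: mult_ac)
    with elim(1) have "complex_of_real (?l\<^sup>2) * ft (y j) \<xi> + complex_of_real ?l * ft g \<xi> = complex_of_real (sqrt \<mu>) *
        (- complex_of_real (sqrt \<mu> * (norm \<xi>)\<^sup>2) * ft (y j) \<xi> + complex_of_real c * ft (weak_div G) \<xi> - (\<Sum>b\<in>Basis. iD b (ft (%x. H x \<bullet> b)) \<xi>))"
      unfolding iDV elim(3) by (simp add: sum.distrib sum_subtractf flip: sum_distrib_left)
    moreover have "complex_of_real (sqrt \<mu>) * (complex_of_real (sqrt \<mu>) * z) = complex_of_real \<mu> * z"
      "complex_of_real (\<mu> * sin (freq j) / freq j) = complex_of_real (sqrt \<mu>) * complex_of_real c" for z
      using \<mu> by (simp_all add: c_def flip: of_real_mult mult.assoc)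
    ultimately show ?case by (simp add: algebra_simps)
  qed
qed

context shift_invariant
begin

lemma ucls_Pair:
  assumes f: "ucls p N H I k w f" and g: "ucls p N H I k w g"
  shows "ucls p N H I k w (%i x. (f i x, g i x))"
proof -
  have "ucls p N H I k (%i. 1 * w i) (%i x. (f i x, 0))" "ucls p N H I k (%i. 1 * w i) (%i x. (0, g i x))"
    by (intro ucls_linear[OF f] ucls_linear[OF g] bounded_linear_Pair bounded_linear_ident bounded_linear_zero;
        simp add: norm_Pair)+
  from ucls_add[OF this] show ?thesis by simp
qed

text \<open>For a fixed step the difference quotient is continuous in L2, so bounds of every order
  survive L2 limits. This is needed for the infinite sum over the modes.\<close>

lemma cls_limit:
  assumes "!!n::nat. cls L2 N H k M (f n)" "sqint N g" "(%n. l2 N (%x. f n x - g x)) \<longlonglongrightarrow> 0"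
  shows "cls L2 N H k M g"
  using assms
proof (induction k arbitrary: f g)
  have base: "l2 N g <= M" if "!!n::nat. sqint N (f n) & l2 N (f n) <= M" "sqint N g" "(%n. l2 N (%x. f n x - g x)) \<longlonglongrightarrow> 0" for f g
    using l2_tendsto[of N f g, OF _ that(2,3)] that(1) by (intro LIMSEQ_le_const2) auto
  {
    case 0
    then show ?case using base[of f g] by simp
  next
    case (Suc k)
    have f: "sqint N (f n) & l2 N (f n) <= M" for n using Suc.prems(1)[of n] by simp
    have "cls L2 N H k M (dq h g)" if h: "h \<in> H" "h \<noteq> 0" for h
    proof (rule Suc.IH)
      show "cls L2 N H k M (dq h (f n))" for n using Suc.prems(1)[of n] h by simp
      have dqs: "sqint N (dq h u)" "l2 N (dq h u) <= 2 / norm h * l2 N u" if u: "sqint N u" for u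
        unfolding dq_def[abs_def] using sqint_scaleR[OF sqint_diff(1)[OF sqint_N_shift(1)[OF u h(1)] u], of "inverse (norm h)"]
          mult_left_mono[OF sqint_diff(2)[OF sqint_N_shift(1)[OF u h(1)] u], of "inverse (norm h)"] sqint_N_shift(2)[OF u h(1)]
        by (auto simp: divide_inverse algebra_simps)
      show "sqint N (dq h g)" by (rule dqs Suc.prems)+
      have "norm (l2 N (%x. dq h (f n) x - dq h g x)) <= 2 / norm h * l2 N (%x. f n x - g x)" for n
        unfolding dq_diff[symmetric] using dqs(2)[OF sqint_diff(1), of "f n" g] f Suc.prems(2) by simp
      then show "(%n. l2 N (%x. dq h (f n) x - dq h g x)) \<longlonglongrightarrow> 0"
        by (intro Lim_null_comparison[OF always_eventually tendsto_mult_right_zero[OF Suc.prems(3)]]) blast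
    qed
    then show ?case using base[OF f Suc.prems(2,3)] Suc.prems(2) by simp
  }
qed

end

lemma LBINT_ivl:
  fixes f :: "real => 'b::euclidean_space"
  assumes [measurable]: "f \<in> borel_measurable borel"
  shows "(LINT z:{-1<..<0}|lborel. f z) = (LINT z|ivl. f z)"
proof -
  have "ivl = density lborel (%z. ennreal (indicator {-1<..<0::real} z))"
    by (intro arg_cong2[where f = density] refl ext) (simp split: split_indicator)
  then show ?thesis by (simp add: integral_density set_lebesgue_integral_def)
qed

text \<open>With X = (y, x), completing the square gives h (P X \<bullet> X) = |h y - x a|^2 + x^2;
  the last entry of P is exactly what makes this work. Then h y is recovered from h y - x a and x a,
  where squaring the sum of norms yields 2 + 2 C^2. In 2 C, the 2 comes from adding the bounds for y
  and x and the C from division by h.\<close>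

lemma pmat_coercive:
  fixes a :: "'a::euclidean_space"
  assumes h: "0 < h0" "h0 <= h" "h <= C" "norm a <= C"
  shows "min 1 (h0\<^sup>2 / (2 + 2 * C\<^sup>2)) / (2 * C) * (norm X)\<^sup>2 <= pmat (h, a, (1 + (norm a)\<^sup>2) / h) X \<bullet> X"
proof -
  define y x Q where "y = fst X" and "x = snd X" and "Q = (norm (h *\<^sub>R y - x *\<^sub>R a))\<^sup>2 + x\<^sup>2"
  have pos: "0 < h" "0 < C" using h by auto
  have "pmat (h, a, (1 + (norm a)\<^sup>2) / h) X \<bullet> X = h * (y \<bullet> y) - 2 * x * (a \<bullet> y) + (1 + (norm a)\<^sup>2) / h * (x * x)"
    by (simp add: pmat_def inner_prod_def x_def y_def inner_diff_left algebra_simps)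
  also have "\<dots> = (h\<^sup>2 * (y \<bullet> y) - 2 * h * x * (a \<bullet> y) + (1 + (a \<bullet> a)) * x\<^sup>2) / h"
    unfolding power2_norm_eq_inner using pos by (simp add: field_simps power2_eq_square)
  also have "\<dots> = Q / h"
    unfolding Q_def power2_norm_eq_inner by (simp add: inner_diff_left inner_diff_right inner_commute[of y a] algebra_simps power2_eq_square)
  finally have eq: "pmat (h, a, (1 + (norm a)\<^sup>2) / h) X \<bullet> X = Q / h" .
  define r where "r = 2 + 2 * C\<^sup>2"
  have r: "2 <= r" by (simp add: r_def)
  have "h * norm y <= norm (h *\<^sub>R y - x *\<^sub>R a) + norm (x *\<^sub>R a)"
    using norm_triangle_sub[of "h *\<^sub>R y" "x *\<^sub>R a"] pos by simp
  also have "norm (x *\<^sub>R a) <= \<bar>x\<bar> * C" using h(4) by (simp add: mult_left_mono)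
  finally have "(h * norm y)\<^sup>2 <= (norm (h *\<^sub>R y - x *\<^sub>R a) + \<bar>x\<bar> * C)\<^sup>2" using pos by (intro power_mono) auto
  also have "\<dots> <= 2 * (norm (h *\<^sub>R y - x *\<^sub>R a))\<^sup>2 + 2 * (\<bar>x\<bar> * C)\<^sup>2" using sum_squares_bound[of "norm (h *\<^sub>R y - x *\<^sub>R a)" "\<bar>x\<bar> * C"]
    by (simp add: power2_sum)
  also have "\<dots> <= r * Q" by (simp add: r_def Q_def algebra_simps power_mult_distrib)
  finally have "h\<^sup>2 * (norm y)\<^sup>2 <= r * Q" by (simp add: power_mult_distrib)
  moreover have "h0\<^sup>2 * (norm y)\<^sup>2 <= h\<^sup>2 * (norm y)\<^sup>2" using h by (intro mult_right_mono power_mono) auto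
  ultimately have "h0\<^sup>2 / r * (norm y)\<^sup>2 <= Q" using r by (simp add: field_simps)
  moreover have "x\<^sup>2 <= Q" by (simp add: Q_def)
  moreover have "min 1 (h0\<^sup>2 / r) * (norm y)\<^sup>2 <= h0\<^sup>2 / r * (norm y)\<^sup>2" "min 1 (h0\<^sup>2 / r) * x\<^sup>2 <= 1 * x\<^sup>2"
    by (intro mult_right_mono; simp)+
  ultimately have "min 1 (h0\<^sup>2 / r) * (norm X)\<^sup>2 <= 2 * Q"
    unfolding norm_prod_def x_def[symmetric] y_def[symmetric] by (simp add: distrib_left)
  then have "min 1 (h0\<^sup>2 / r) / (2 * C) * (norm X)\<^sup>2 <= Q / C" using pos by (simp add: field_simps)
  also have "\<dots> <= Q / h" using h pos by (intro divide_left_mono) (auto simp: Q_def)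
  finally show ?thesis unfolding eq r_def .
qed

subsection \<open>The velocity potential\<close>

text \<open>The index set I stands for all data under common bounds. Regularity is counted backwards
  from the m derivatives of the remainders: d for a sup bound on D and two for the gradient and
  divergence in D make k; the data have d more for sup bounds on coefficients and one more for a
  differentiation.\<close>

locale shallow =
  fixes I :: "'i set" and \<epsilon> \<mu> :: "'i => real" and \<mu>_max h_min :: real and m k :: nat
    and \<zeta> \<psi> :: "'i => 'a::euclidean_space => real" and \<phi> :: "'i => 'a \<times> real => real"
    and \<Phi> :: "'i => 'a \<times> real => 'a \<times> real" and D :: "'i => 'a => real"
  assumes eps: "!!i. i \<in> I ==> 0 <= \<epsilon> i" "!!i. i \<in> I ==> \<epsilon> i <= 1"
    and mu: "!!i. i \<in> I ==> 0 < \<mu> i" "!!i. i \<in> I ==> \<mu> i <= \<mu>_max"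
    and mumax: "0 < \<mu>_max"
    and hmin: "0 < h_min" "!!i. i \<in> I ==> AE x in lborel. h_min <= water_height (\<epsilon> i) (\<zeta> i) x"
    and k: "k = m + DIM('a) + 2"
    and Z: "uc I (k + DIM('a) + 1) (%_. 1) \<zeta>"
    and G: "uc I (k + DIM('a) + 1) (%_. 1) (%i. weak_grad (\<psi> i))"
    and sol: "!!i. i \<in> I ==> potential_solution (\<epsilon> i) (\<mu> i) (\<zeta> i) (\<psi> i) (\<phi> i) (\<Phi> i)"
    and D: "!!i. i \<in> I ==> has_weak_div (%X. water_height (\<epsilon> i) (\<zeta> i) X *\<^sub>R V_bar (\<epsilon> i) (\<zeta> i) (\<Phi> i) X) (D i)"
begin

abbreviation "gr i \<equiv> weak_grad (\<psi> i)"
abbreviation "dz i \<equiv> weak_grad (\<zeta> i)"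
abbreviation "L i \<equiv> weak_div (gr i)"
abbreviation "E i \<equiv> weak_div (%x. \<zeta> i x *\<^sub>R gr i x)"
abbreviation "h i \<equiv> water_height (\<epsilon> i) (\<zeta> i)"

text \<open>The coefficients \<open>(h, a, r)\<close> of the matrix \<open>P\<close>, the scaled gradient \<open>Y\<close> of \<open>\<phi> - \<psi>\<close>, and the right-hand side it solves for.\<close>

definition cf :: "'i => 'a \<times> real => real \<times> 'a \<times> real" where
  "cf i p = (h i (fst p), (sqrt (\<mu> i) * \<epsilon> i * (snd p + 1)) *\<^sub>R dz i (fst p),
     (1 + (norm ((sqrt (\<mu> i) * \<epsilon> i * (snd p + 1)) *\<^sub>R dz i (fst p)))\<^sup>2) / h i (fst p))"

definition Y :: "'i => 'a \<times> real => 'a \<times> real" where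
  "Y i p = scale_mu (\<mu> i) (\<Phi> i p - (gr i (fst p), 0))"

definition rhs :: "'i => 'a => real" where
  "rhs i x = E i x - dz i x \<bullet> gr i x"

lemma eps_mu: "i \<in> I ==> 0 <= \<epsilon> i * \<mu> i" "i \<in> I ==> 0 <= \<mu> i"
  using eps(1) mu(1) by (simp_all add: less_imp_le)

lemma ZI: "ucI I (k + 1) (%_. 1) \<zeta>"
  by (rule ucI_of_uc[OF ucls_le[OF Z]]) simp

lemma Z_grad: "uc I (k + DIM('a)) (%_. 1) (%i. dz i)" "ucI I k (%_. 1) (%i. dz i)"
proof -
  show "uc I (k + DIM('a)) (%_. 1) (%i. dz i)" by (rule uc_weak_grad[OF ucls_le[OF Z]]) simp
  then show "ucI I k (%_. 1) (%i. dz i)" by (rule ucI_of_uc_vec)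
qed

lemma ZG: "uc I (k + 1) (%_. 1) (%i x. \<zeta> i x *\<^sub>R gr i x)"
  using leb.ucls_prod[OF bounded_bilinear_scaleR, of 1, OF _ _ ZI ucls_le[OF G]] by simp

lemma LE: "uc I (k + DIM('a)) (%_. 1) L" "uc I k (%_. 1) E"
  by (rule uc_weak_div[OF ucls_le[OF G]] uc_weak_div[OF ZG]; simp)+

lemma dzgr: "uc I k (%_. 1) (%i x. dz i x \<bullet> gr i x)"
proof -
  have "uc I k (%_. 1 * 1) (%i x. dz i x \<bullet> gr i x)"
    by (rule leb.ucls_prod[OF bounded_bilinear_inner _ _ Z_grad(2) ucls_le[OF G], of 1]) (auto simp: Cauchy_Schwarz_ineq2)
  then show ?thesis by simp
qed

lemma rhs_uc: "uc I k (%_. 1) rhs"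
  unfolding rhs_def[abs_def] by (intro leb.ucls_diff LE dzgr)

lemma hI: "ucI I k (%_. 1) h" "ucI I k (%_. 1) (%i x. inverse (h i x))"
proof -
  have "ucI I k (%i. 1 * 1) (%i x. \<epsilon> i *\<^sub>R \<zeta> i x)"
    by (rule leb.ucls_scaleR[OF ucls_le[OF ZI]]) (use eps in auto)
  then have "ucI I k (%_. 1) (%i x. 1 + \<epsilon> i *\<^sub>R \<zeta> i x)"
    by (intro leb.ucls_add leb.ucls_const[of 1]) auto
  then show hh: "ucI I k (%_. 1) h" by (simp add: water_height_def[abs_def])
  show "ucI I k (%_. 1) (%i x. inverse (h i x))" by (rule leb.ucls_inverse[OF hh hmin])
qed

lemma measurables [measurable]:
  assumes i: "i \<in> I"
  shows "\<zeta> i \<in> borel_measurable borel" "dz i \<in> borel_measurable borel" "gr i \<in> borel_measurable borel"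
    "h i \<in> borel_measurable borel" "\<Phi> i \<in> borel_measurable borel"
proof -
  show [measurable]: "\<zeta> i \<in> borel_measurable borel" "dz i \<in> borel_measurable borel" "gr i \<in> borel_measurable borel"
    using uc_measurable[OF Z i] uc_measurable[OF Z_grad(1) i] uc_measurable[OF G i] by auto
  show "h i \<in> borel_measurable borel" unfolding water_height_def[abs_def] by measurable
  have "(%p. \<Phi> i p - (gr i (fst p), 0)) \<in> borel_measurable borel"
    using sol[OF i] by (simp add: potential_solution_def H1_surf0_def)
  then have "(%p. (\<Phi> i p - (gr i (fst p), 0)) + (gr i (fst p), 0)) \<in> borel_measurable borel" by measurable
  then show "\<Phi> i \<in> borel_measurable borel" by simp
qed

text \<open>The triple (1, 0, 1) is the identity matrix, so the first bound says that P differs from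
  it by O(\<epsilon>). It is the source of the factor \<epsilon> in the remainder.\<close>

lemma cf_usI: "usI I k \<epsilon> (%i p. cf i p - (1, 0, 1))" "usI I k (%_. 1) cf"
proof -
  have lift: "usI I k w (%i p. (snd p + 1) ^ n *\<^sub>R f i (fst p))" if "ucI I k w f"
    for n w and f :: "'i => 'a => 'c::euclidean_space"
    by (rule ucls_lift[OF that, of "%z. (z + 1) ^ n"]) (auto simp: vweight_def power_abs power_le_one)
  have w: "usI I k \<epsilon> f" if "usI I k (%i. c * \<epsilon> i * 1) f" "0 <= c" for c and f :: "'i => 'a \<times> real => 'c::euclidean_space"
    by (rule ucls_weight[OF that]) (use eps in auto)
  have "usI I k (%i. 1 * \<epsilon> i * 1) (%i p. \<epsilon> i *\<^sub>R ((snd p + 1) ^ 0 *\<^sub>R \<zeta> i (fst p)))"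
    by (intro str.ucls_scaleR lift ucls_le[OF ZI]) (use eps in auto)
  from w[OF this] have c1: "usI I k \<epsilon> (%i p. \<epsilon> i * \<zeta> i (fst p))" by simp
  have "usI I k (%i. sqrt \<mu>_max * \<epsilon> i * 1) (%i p. (sqrt (\<mu> i) * \<epsilon> i) *\<^sub>R ((snd p + 1) ^ 1 *\<^sub>R dz i (fst p)))"
    by (intro str.ucls_scaleR lift Z_grad(2)) (use mu mumax eps eps_mu in \<open>auto simp: abs_mult intro!: mult_mono\<close>)
  from w[OF this] have c2: "usI I k \<epsilon> (%i p. (sqrt (\<mu> i) * \<epsilon> i * (snd p + 1)) *\<^sub>R dz i (fst p))"
    using mumax by simp
  have f0: "ucI I k (%_. 1 * 1) (%i x. \<zeta> i x * inverse (h i x))"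
    by (rule leb.ucls_prod[OF bounded_bilinear_mult _ _ ucls_le[OF ZI] hI(2), of 1]) (auto simp: abs_mult)
  have "ucI I k (%_. 1 * 1) (%i x. dz i x \<bullet> dz i x)"
    by (rule leb.ucls_prod[OF bounded_bilinear_inner _ _ Z_grad(2) Z_grad(2), of 1]) (auto simp: Cauchy_Schwarz_ineq2)
  then have f1: "ucI I k (%_. (1 * 1) * 1) (%i x. (dz i x \<bullet> dz i x) * inverse (h i x))"
    by (rule leb.ucls_prod[OF bounded_bilinear_mult _ _ _ hI(2), of 1, rotated 2]) (auto simp: abs_mult)
  have "usI I k (%i. 1 * \<epsilon> i * 1) (%i p. \<epsilon> i *\<^sub>R ((snd p + 1) ^ 0 *\<^sub>R (\<zeta> i (fst p) * inverse (h i (fst p)))))"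
    by (rule str.ucls_scaleR[OF lift]) (use f0 eps in auto)
  note d0 = w[OF this]
  have "usI I k (%i. \<mu>_max * \<epsilon> i * 1) (%i p. (\<mu> i * (\<epsilon> i)\<^sup>2) *\<^sub>R ((snd p + 1) ^ 2 *\<^sub>R ((dz i (fst p) \<bullet> dz i (fst p)) * inverse (h i (fst p)))))"
  proof (rule str.ucls_scaleR[OF lift])
    fix i assume i: "i \<in> I"
    have "\<mu> i * (\<epsilon> i * \<epsilon> i) <= \<mu>_max * (\<epsilon> i * 1)" using eps[OF i] mu[OF i] by (intro mult_mono) auto
    then show "\<bar>\<mu> i * (\<epsilon> i)\<^sup>2\<bar> <= \<mu>_max * \<epsilon> i" using eps_mu[OF i] by (simp add: abs_mult power2_eq_square)
  qed (use f1 in simp)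
  from w[OF this] have d1: "usI I k \<epsilon> (%i p. (\<mu> i * (\<epsilon> i)\<^sup>2) *\<^sub>R ((snd p + 1) ^ 2 *\<^sub>R ((dz i (fst p) \<bullet> dz i (fst p)) * inverse (h i (fst p)))))"
    using mumax by simp
  \<comment> \<open>The last entry minus 1 is (|a|^2 - \<epsilon> \<zeta>) / h; \<open>d1\<close> is
    the first part and \<open>d0\<close> the second.\<close>
  note d = str.ucls_diff[OF d1 d0, simplified]
  show *: "usI I k \<epsilon> (%i p. cf i p - (1, 0, 1))"
  proof (rule str.ucls_cong[OF str.ucls_Pair[OF c1 str.ucls_Pair[OF c2 d]]])
    fix i assume i: "i \<in> I"
    note [measurable] = measurables[OF i]
    show "(%p. cf i p - (1, 0, 1)) \<in> borel_measurable borel" unfolding cf_def[abs_def] by measurable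
    show "AE p in smeas. (\<epsilon> i * \<zeta> i (fst p), (sqrt (\<mu> i) * \<epsilon> i * (snd p + 1)) *\<^sub>R dz i (fst p),
        \<mu> i * (\<epsilon> i)\<^sup>2 * ((snd p + 1)\<^sup>2 * (dz i (fst p) \<bullet> dz i (fst p) * inverse (h i (fst p)))) -
        \<epsilon> i * (\<zeta> i (fst p) * inverse (h i (fst p)))) = cf i p - (1, 0, 1)"
      using AE_smeas_fst[OF hmin(2)[OF i]]
    proof eventually_elim
      case (elim p)
      have "0 < h i (fst p)" using elim hmin(1) by simp
      moreover have "0 <= \<mu> i" using eps_mu(2)[OF i] .
      ultimately show ?case
        by (simp add: cf_def power_mult_distrib power2_norm_eq_inner[symmetric] divide_simps)
          (simp add: water_height_def algebra_simps power2_eq_square)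
    qed
  qed
  have "usI I k (%_. 1) (%i p. cf i p - (1, 0, 1))" by (rule ucls_weight[OF *, of 1]) (use eps in auto)
  moreover have "usI I k (%_. 1) (%i p. (1, 0, 1) :: real \<times> 'a \<times> real)" by (rule str.ucls_const[of "norm (1, 0 :: 'a, 1)"]) auto
  ultimately have "usI I k (%_. 1) (%i p. (cf i p - (1, 0, 1)) + (1, 0, 1))" by (rule str.ucls_add)
  then show "usI I k (%_. 1) cf" by simp
qed

lemma cf_coercive:
  obtains \<kappa> where "0 < \<kappa>" "!!i. i \<in> I ==> AE p in smeas. \<forall>X. \<kappa> * (norm X)\<^sup>2 <= pmat (cf i p) X \<bullet> X"
proof -
  obtain C where C: "0 <= C" "!!i. i \<in> I ==> cls Linf smeas sdir k (C * 1) (cf i)" using cf_usI(2) by (rule ucls_E) blast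
  show ?thesis
  proof (rule that)
    \<comment> \<open>C + 1 in place of C, since the bound C may be 0 when there are no
      data.\<close>
    show "0 < min 1 (h_min\<^sup>2 / (2 + 2 * (C + 1)\<^sup>2)) / (2 * (C + 1))" using hmin(1) C(1) by (simp add: add_pos_nonneg)
    fix i assume i: "i \<in> I"
    have "AE p in smeas. norm (cf i p) <= C" using cls_lpb[OF C(2)[OF i]] by simp
    with AE_smeas_fst[OF hmin(2)[OF i]]
    show "AE p in smeas. \<forall>X. min 1 (h_min\<^sup>2 / (2 + 2 * (C + 1)\<^sup>2)) / (2 * (C + 1)) * (norm X)\<^sup>2 <= pmat (cf i p) X \<bullet> X"
    proof eventually_elim
      case (elim p)
      have "\<bar>fst (cf i p)\<bar> <= norm (cf i p)" "norm (fst (snd (cf i p))) <= norm (cf i p)"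
        using norm_fst_le[of "fst (cf i p)" "snd (cf i p)"] norm_snd_le[of "snd (cf i p)" "fst (cf i p)"]
          norm_fst_le[of "fst (snd (cf i p))" "snd (snd (cf i p))"] by simp_all
      with elim show ?case unfolding cf_def by (intro allI pmat_coercive hmin(1)) auto
    qed
  qed
qed

end

lemma F1_symbol_bounds:
  assumes "0 < \<mu>"
  shows "\<bar>F1_symbol \<mu> \<xi>\<bar> <= 1" "\<bar>1 - F1_symbol \<mu> \<xi>\<bar> <= \<mu> * wt 2 \<xi>"
proof -
  show "\<bar>F1_symbol \<mu> \<xi>\<bar> <= 1"
  proof (cases "\<xi> = 0")
    case False
    then have k: "0 < sqrt \<mu> * norm \<xi>" using assms by simp
    then have "0 <= F1_symbol \<mu> \<xi>" using False by (simp add: F1_symbol_def)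
    then show ?thesis using F1_symbol_defect(1)[OF assms, of \<xi>] False by (simp add: zero_le_divide_iff)
  qed (simp add: F1_symbol_def)
  show "\<bar>1 - F1_symbol \<mu> \<xi>\<bar> <= \<mu> * wt 2 \<xi>"
  proof (cases "\<xi> = 0")
    case False
    then have "\<bar>1 - F1_symbol \<mu> \<xi>\<bar> <= \<mu> * (norm \<xi>)\<^sup>2"
      using F1_symbol_defect[OF assms, of \<xi>] False by (simp add: divide_le_eq zero_le_divide_iff)
    also have "\<dots> <= \<mu> * wt 2 \<xi>" using assms norm_pow_le_wt[of \<xi> 2] by (intro mult_left_mono) auto
    finally show ?thesis .
  qed (use assms in \<open>simp add: F1_symbol_def\<close>)
qed

lemma fourier_mult_vec_inner:
  "b \<in> Basis ==> fourier_mult_vec F W x \<bullet> b = fourier_mult F (%y. W y \<bullet> b) x"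
  unfolding fourier_mult_vec_def by (rule inner_sum_left_Basis)

context shallow
begin

lemma Y_efield:
  assumes i: "i \<in> I"
  shows "efield (\<mu> i) (Y i)"
proof -
  note [measurable] = measurables[OF i]
  define W where "W p = \<Phi> i p - (gr i (fst p), 0)" for p
  have [measurable]: "W \<in> borel_measurable borel" unfolding W_def by measurable
  obtain v g where t: "!!n::nat. strip_test_fun (v n) (g n)"
    and l: "(%n. \<integral>\<^sup>+p\<in>strip. ennreal ((norm (W p - g n p))\<^sup>2) \<partial>lborel) \<longlonglongrightarrow> 0"
    using sol[OF i] unfolding potential_solution_def H1_surf0_def W_def by blast
  have g: "sqint smeas (g n)" for n by (rule sqint_smeas[OF test_fun_sqint(2)[OF strip_test_funD(1)[OF t]]])
  have [measurable]: "g n \<in> borel_measurable borel" for n using g[of n] by (simp add: sqint_def)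
  have l': "(%n. \<integral>\<^sup>+p. ennreal ((norm (W p - g n p))\<^sup>2) \<partial>smeas) \<longlonglongrightarrow> 0"
    using l by (simp add: nn_integral_smeas)
  then have "\<forall>\<^sub>F n in sequentially. (\<integral>\<^sup>+p. ennreal ((norm (W p - g n p))\<^sup>2) \<partial>smeas) < 1" by (rule order_tendstoD) simp
  \<comment> \<open>\<open>H1_surf0\<close> does not state that the gradient is square integrable;
    it follows from one test gradient at finite distance.\<close>
  then obtain n where "(\<integral>\<^sup>+p. ennreal ((norm (W p - g n p))\<^sup>2) \<partial>smeas) < 1" by (auto simp: eventually_sequentially)
  then have "sqint smeas (%p. W p - g n p)"
    unfolding sqint_iff_nn by (auto intro: less_trans[of _ 1])
  from sqint_add(1)[OF this g[of n]] have W: "sqint smeas W" by simp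
  have s: "sqint smeas (%p. W p - g n p)" for n by (rule sqint_diff(1)[OF W g])
  have l2: "(%n. l2 smeas (%p. W p - g n p)) \<longlonglongrightarrow> 0" using l' nn_l2_tendsto_iff[of smeas "%n p. W p - g n p", OF s] by simp
  show ?thesis
  proof (rule efield_limit[OF _ mu(1)[OF i] t])
    show "sqint smeas (Y i)" unfolding Y_def[abs_def] using sqint_scale_mu(1)[OF W mu(1)[OF i]] by (simp add: W_def)
    have "l2 smeas (%p. scale_mu (\<mu> i) (g n p) - Y i p) = l2 smeas (%p. scale_mu (\<mu> i) (W p - g n p))" for n
      unfolding Y_def W_def[symmetric] scale_mu_lin(1) by (rule l2_diff_commute)
    then have le: "norm (l2 smeas (%p. scale_mu (\<mu> i) (g n p) - Y i p)) <= max 1 (sqrt (\<mu> i)) * l2 smeas (%p. W p - g n p)" for n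
      using sqint_scale_mu(2)[OF s mu(1)[OF i], of n] by simp
    show "(%n. l2 smeas (%p. scale_mu (\<mu> i) (g n p) - Y i p)) \<longlonglongrightarrow> 0"
      by (rule Lim_null_comparison[OF always_eventually tendsto_mult_right_zero[OF l2]]) (use le in blast)
  qed
qed

lemma cf_P: "P_matrix (\<epsilon> i) (\<mu> i) (\<zeta> i) p X = pmat (cf i p) X" if "i \<in> I"
  using eps_mu(2)[OF that]
  by (simp add: P_matrix_def pmat_def cf_def Let_def power_mult_distrib mult_ac)

lemma uc_hs: "uc I n w f ==> 1 <= n ==> i \<in> I ==> hs 1 (f i)"
  by (rule hs_le[OF hs_uc])

section \<open>Reduction to the flat problem\<close>

text \<open>The forcing left when P is replaced by the identity: the part of the source with the
  factor \<epsilon>, and -(P - 1) Y.\<close>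

definition F2 :: "'i => 'a \<times> real => 'a \<times> real" where
  "F2 i p = (0, - (\<mu> i * (snd p + 1) * (\<epsilon> i * rhs i (fst p)))) - pmat (cf i p - (1, 0, 1)) (Y i p)"

text \<open>The weak formulation says that P applied to Y + \<surd>\<mu> \<nabla>\<psi> is a normal
  field. Subtracting \<epsilon> times the normal field built from \<zeta> \<nabla>\<psi> turns its
  horizontal component h \<surd>\<mu> \<nabla>\<psi> into the flat one, and the rest is collected in
  \<open>F2\<close>.\<close>

lemma Y_flat:
  assumes i: "i \<in> I"
  shows "normal_field (\<mu> i) (%p. Y i p + (sqrt (\<mu> i) *\<^sub>R gr i (fst p), 0) - F2 i p)"
proof -
  note [measurable] = measurables[OF i]
  interpret pmat: bounded_bilinear pmat by (rule bounded_bilinear_pmat)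
  define X where "X p = pmat (cf i p) (Y i p + (sqrt (\<mu> i) *\<^sub>R gr i (fst p), 0))" for p
  note sq = uc_sqint[OF G i] uc_sqint[OF ZG i] uc_sqint[OF LE(2) i]
  have "sqint smeas (%p. (gr i (fst p), 0::real))"
    by (rule sqint_bound(1)[OF sqint_lift(1)[OF sq(1)], of _ 1]) (auto simp: norm_Pair)
  from sqint_add(1)[OF efield_sqint[OF Y_efield[OF i]] sqint_scaleR(1)[OF this, of "sqrt (\<mu> i)"]]
  have s: "sqint smeas (%p. Y i p + (sqrt (\<mu> i) *\<^sub>R gr i (fst p), 0))" by simp
  obtain C where C: "0 <= C" "!!i. i \<in> I ==> cls Linf smeas sdir k (C * 1) (cf i)" using cf_usI(2) by (rule ucls_E) blast
  have Xs: "sqint smeas X" unfolding X_def[abs_def]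
    by (rule sqint_pmat[OF _ C(1) s]) (use cls_le[OF C(2)[OF i], of 0] in simp)
  have Xe: "X p = P_matrix (\<epsilon> i) (\<mu> i) (\<zeta> i) p (scale_mu (\<mu> i) (\<Phi> i p))" for p
    by (simp add: X_def cf_P[OF i] Y_def scale_mu_def scaleR_diff_right)
  have "(LINT p|smeas. X p \<bullet> scale_mu (\<mu> i) (g p)) = 0" if t: "strip_test_fun v g" for v and g :: "'a \<times> real => 'a \<times> real"
  proof -
    have "(%p. X p \<bullet> scale_mu (\<mu> i) (g p)) \<in> borel_measurable borel"
      using borel_measurable_integrable[OF sqint_inner[OF Xs sqint_test_field[OF t mu(1)[OF i]]]] by simp
    from integral_smeas[OF this] show ?thesis using sol[OF i] t unfolding Xe potential_solution_def by simp
  qed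
  then have "normal_field (\<mu> i) X" using Xs by (auto simp: normal_field_def)
  moreover have "normal_field (\<mu> i) (%p. ((sqrt (\<mu> i) * 1) *\<^sub>R (\<zeta> i (fst p) *\<^sub>R gr i (fst p)), - (\<mu> i * (snd p + 1) * E i (fst p))))"
    by (rule normal_field_weak_div[OF weak_div_hs(1) sq(2,3) vprimitive_1 mu(1)[OF i], OF uc_hs[OF uc_inner[OF ZG] _ i]]) auto
  note normal_field_lin[OF calculation this mu(1)[OF i], of 1 "- \<epsilon> i"]
  moreover have ss: "sqrt (\<mu> i) * (sqrt (\<mu> i) * x) = \<mu> i * x" for x using eps_mu(2)[OF i] by (simp flip: mult.assoc)
  have "1 *\<^sub>R X p + (- \<epsilon> i) *\<^sub>R ((sqrt (\<mu> i) * 1) *\<^sub>R (\<zeta> i (fst p) *\<^sub>R gr i (fst p)), - (\<mu> i * (snd p + 1) * E i (fst p)))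
      = Y i p + (sqrt (\<mu> i) *\<^sub>R gr i (fst p), 0) - F2 i p" for p
    by (simp add: X_def F2_def pmat_def cf_def rhs_def water_height_def prod_eq_iff algebra_simps inner_add_right ss)
  ultimately show ?thesis by simp
qed

text \<open>The remaining \<surd>\<mu> \<nabla>\<psi> is exchanged for the vertical source \<mu> (z
  + 1) \<Delta>\<psi>. This is the step that raises the order of the right-hand side from
  \<surd>\<mu> to \<mu>.\<close>

lemma Y_normal:
  assumes i: "i \<in> I"
  shows "normal_field (\<mu> i) (%p. pmat (cf i p) (Y i p) - (0, - (\<mu> i * (snd p + 1) * (L i (fst p) + \<epsilon> i * rhs i (fst p)))))"
proof -
  have "normal_field (\<mu> i) (%p. ((sqrt (\<mu> i) * 1) *\<^sub>R gr i (fst p), - (\<mu> i * (snd p + 1) * L i (fst p))))"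
    by (rule normal_field_weak_div[OF weak_div_hs(1) uc_sqint[OF G i] uc_sqint[OF LE(1) i] vprimitive_1 mu(1)[OF i], OF uc_hs[OF uc_inner[OF G] _ i]]) auto
  from normal_field_lin[OF Y_flat[OF i] this mu(1)[OF i], of 1 "-1"] show ?thesis
    by (rule back_subst[of "normal_field (\<mu> i)"])
      (auto simp: fun_eq_iff F2_def pmat_def prod_eq_iff algebra_simps)
qed

lemma source_us:
  assumes "uc I k w q"
  shows "us I k (%i. \<mu> i * w i) (%i p. (0::'a, - (\<mu> i * (snd p + 1) * q i (fst p))))"
proof (rule str.ucls_Pair)
  have "us I k w (%i p. (snd p + 1) *\<^sub>R q i (fst p))" by (rule ucls_lift[OF assms]) (auto simp: vweight_def)
  then have "us I k (%i. \<mu> i * w i) (%i p. (- \<mu> i) *\<^sub>R ((snd p + 1) *\<^sub>R q i (fst p)))"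
    by (rule str.ucls_scaleR) (use eps_mu in auto)
  then show *: "us I k (%i. \<mu> i * w i) (%i p. - (\<mu> i * (snd p + 1) * q i (fst p)))" by (simp add: mult.assoc)
  show "us I k (%i. \<mu> i * w i) (%i p. 0 :: 'a)" by (rule str.ucls_0) (use * in \<open>rule ucls_E\<close>)
qed

lemma eps_rhs: "uc I k \<epsilon> (%i x. \<epsilon> i * rhs i x)" "uc I k (%_. 1) (%i x. L i x + \<epsilon> i * rhs i x)"
proof -
  have "uc I k (%i. \<epsilon> i * 1) (%i x. \<epsilon> i *\<^sub>R rhs i x)" by (rule leb.ucls_scaleR[OF rhs_uc]) (use eps in auto)
  then show e: "uc I k \<epsilon> (%i x. \<epsilon> i * rhs i x)" by simp
  show "uc I k (%_. 1) (%i x. L i x + \<epsilon> i * rhs i x)"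
    by (intro leb.ucls_add ucls_le[OF LE(1)] ucls_weight[OF e, of 1]) (use eps in auto)
qed

lemma Y_us: "us I k \<mu> Y"
proof -
  obtain \<kappa> where \<kappa>: "0 < \<kappa>" "!!i. i \<in> I ==> AE p in smeas. \<forall>X. \<kappa> * (norm X)\<^sup>2 <= pmat (cf i p) X \<bullet> X"
    by (rule cf_coercive) blast
  from source_us[OF eps_rhs(2)] show ?thesis
    by (intro us_elliptic[OF cf_usI(2) \<kappa> Y_efield Y_normal mu(1)]) auto
qed

text \<open>The matrix difference is O(\<epsilon>) and acts on Y = O(\<mu>).\<close>

lemma F2_us: "us I k (%i. \<epsilon> i * \<mu> i) F2"
proof -
  have "us I k (%i. \<epsilon> i * \<mu> i) (%i p. pmat (cf i p - (1, 0, 1)) (Y i p))"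
    by (rule str.ucls_prod[OF bounded_bilinear_pmat pmat_norm _ cf_usI(1) Y_us]) simp
  with source_us[OF eps_rhs(1)] show ?thesis
    unfolding F2_def[abs_def] by (intro str.ucls_diff) (simp_all add: mult.commute)
qed

lemma us_fst_snd:
  fixes V :: "'j => 'a \<times> real => 'a \<times> real"
  assumes V: "us J n w V"
  shows "us J n w (%i p. fst (V i p))" "us J n w (%i p. snd (V i p))"
  using str.ucls_linear[OF V bounded_linear_fst, of "%_. 1"] str.ucls_linear[OF V bounded_linear_snd, of "%_. 1"]
  by (simp_all add: norm_fst_snd_le)

section \<open>The depth integral of the potential\<close>

text \<open>By partial integration with the primitive z + 1 this is the integral over the depth of
  u, where Y is the scaled gradient of u = \<phi> - \<psi>.\<close>

definition wb :: "'i => 'a => real" where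
  "wb i x = - vavg (%z. z + 1) (%p. snd (Y i p)) x"

lemma uc_wb: "uc I k \<mu> wb"
  unfolding wb_def[abs_def] using vprimitiveD(1)[OF vprimitive_1] by (intro leb.ucls_minus uc_vavg us_fst_snd Y_us)

text \<open>The coefficients of \<open>\<integral> u dz\<close> in the vertical modes, for \<open>Y = \<nabla>\<^sup>\<mu>u\<close>, and their parts due to \<open>F2\<close>.\<close>

definition yc :: "'i => nat => 'a => real" where
  "yc i j x = - vavg (smode j) (%p. snd (Y i p)) x"

text \<open>The mode equation is divided by \<mu> |\<xi>|^2 + r^2, r = \<open>freq j\<close>, and
  multiplied by the coefficient 2 sin r / r of the expansion of 1. The forcing then contributes 2 /
  r^2 times \<epsilon> \<mu>, summable in j, and the rest is the summand of
  \<open>F1_symbol_sums\<close>.\<close>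

lemma mode_remainder:
  obtains u where "uc (I \<times> UNIV) k (%(i, j). 2 / (freq j)\<^sup>2 * (\<epsilon> i * \<mu> i)) (%(i, j). u i j)"
    "!!i j. i \<in> I ==> AE \<xi> in lborel. ft (u i j) \<xi> = complex_of_real (2 * sin (freq j) / freq j) * ft (yc i j) \<xi>
      - complex_of_real (2 * \<mu> i / ((freq j)\<^sup>2 * (\<mu> i * (norm \<xi>)\<^sup>2 + (freq j)\<^sup>2))) * ft (L i) \<xi>"
proof -
  \<comment> \<open>The mode number joins the index set, so that one constant serves all
    modes.\<close>
  let ?J = "I \<times> (UNIV :: nat set)"
  define w where "w q = \<epsilon> (fst q) * \<mu> (fst q)" for q :: "'i \<times> nat"
  define Hf where "Hf q = vavg (cmode (snd q)) (%p. fst (F2 (fst q) p))" for q :: "'i \<times> nat"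
  \<comment> \<open>The factor \<open>freq\<close> is put into the weight, where it turns
    \<open>smode\<close> into a sine bounded by 1.\<close>
  define gf where "gf q = vavg (%z. freq (snd q) * smode (snd q) z) (%p. snd (F2 (fst q) p))" for q :: "'i \<times> nat"
  have reindex: "us ?J k (%q. v (fst q)) (%q. V (fst q))" if "us I k v V" for v and V :: "'i => 'a \<times> real => 'a \<times> real"
    using that by (auto simp: ucls_def)
  note F = us_fst_snd[OF reindex[OF F2_us, folded w_def]] and Yr = us_fst_snd[OF reindex[OF Y_us]]
  note vw = vprimitiveD[OF vprimitive_modes]
  have "vweight 1 (%z. freq j * smode j z)" for j
    using vprimitive_modes[of j] by (auto simp: vweight_def vprimitive_def smode_def)
  then have Hg: "uc ?J k w Hf" "uc ?J k w gf" unfolding Hf_def[abs_def] gf_def[abs_def] by (intro uc_vavg F vw)+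
  define d where "d q \<xi> = \<mu> (fst q) * (norm \<xi>)\<^sup>2 + (freq (snd q))\<^sup>2" for q :: "'i \<times> nat" and \<xi> :: 'a
  define c where "c q = 2 * sin (freq (snd q)) / freq (snd q)" for q :: "'i \<times> nat"
  define v where "v q = 2 / (freq (snd q))\<^sup>2" for q :: "'i \<times> nat"
  \<comment> \<open>The last bound is the inequality between arithmetic and geometric means; it lets
    the denominator absorb the factor \<surd>\<mu> |\<xi>| of the horizontal forcing.\<close>
  have d: "0 < d q \<xi>" "freq (snd q) <= d q \<xi>" "freq (snd q) * (sqrt (\<mu> (fst q)) * norm \<xi>) <= d q \<xi>" if "q \<in> ?J" for q \<xi>
  proof -
    have m: "0 <= \<mu> (fst q) * (norm \<xi>)\<^sup>2" "(sqrt (\<mu> (fst q)) * norm \<xi>)\<^sup>2 = \<mu> (fst q) * (norm \<xi>)\<^sup>2"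
      using that eps_mu(2) by (auto simp: power_mult_distrib)
    have "freq (snd q) * 1 <= (freq (snd q))\<^sup>2" unfolding power2_eq_square
      using freq_gt[of "snd q"] by (intro mult_left_mono) auto
    with m(1) show "freq (snd q) <= d q \<xi>" by (simp add: d_def)
    with freq_gt[of "snd q"] show "0 < d q \<xi>" by linarith
    show "freq (snd q) * (sqrt (\<mu> (fst q)) * norm \<xi>) <= d q \<xi>"
      using sum_squares_bound[of "freq (snd q)" "sqrt (\<mu> (fst q)) * norm \<xi>"] m zero_le_power2[of "freq (snd q)"]
      unfolding d_def by linarith
  qed
  have v0: "0 <= v q" and ca: "\<bar>c q\<bar> = 2 / freq (snd q)" for q by (simp_all add: v_def c_def abs_mult abs_divide)
  \<comment> \<open>\<open>M1\<close> and \<open>M2\<close> are the symbols through which the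
    horizontal and the vertical forcing enter; both have size 2 / r^2.\<close>
  define M1 where "M1 b q \<xi> = - complex_of_real (c q * sqrt (\<mu> (fst q)) / d q \<xi>) * (\<i> * complex_of_real (\<xi> \<bullet> b))" for b :: 'a and q \<xi>
  define M2 where "M2 q \<xi> = - complex_of_real (c q * freq (snd q) / d q \<xi>)" for q and \<xi> :: 'a
  have b1: "norm (M1 b q \<xi>) <= v q * wt 0 \<xi>"
    if q: "q \<in> ?J" and b: "b \<in> Basis" for q \<xi> and b :: 'a
  proof -
    have "freq (snd q) * (sqrt (\<mu> (fst q)) * \<bar>\<xi> \<bullet> b\<bar>) <= freq (snd q) * (sqrt (\<mu> (fst q)) * norm \<xi>)"
      using Basis_le_norm[OF b, of \<xi>] q eps_mu(2) by (intro mult_left_mono) auto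
    also have "\<dots> <= d q \<xi>" by (rule d(3)[OF q])
    finally show ?thesis using d(1)[OF q, of \<xi>] q eps_mu(2)
      by (auto simp: M1_def norm_mult norm_divide abs_mult ca v_def wt_def field_simps power2_eq_square)
  qed
  have b2: "norm (M2 q \<xi>) <= v q * wt 0 \<xi>" if q: "q \<in> ?J" for q \<xi>
  proof -
    have "(freq (snd q))\<^sup>2 <= d q \<xi>" using q eps_mu(2) by (auto simp: d_def)
    then show ?thesis using d(1)[OF q, of \<xi>] by (simp add: M2_def norm_divide norm_mult ca v_def wt_def field_simps power2_eq_square)
  qed
  have [measurable]: "d q \<in> borel_measurable borel" for q unfolding d_def[abs_def] by measurable
  have M: "M1 b q \<in> borel_measurable borel" "M2 q \<in> borel_measurable borel" "M1 b q (- \<xi>) = cnj (M1 b q \<xi>)" "M2 q (- \<xi>) = cnj (M2 q \<xi>)" for b q \<xi>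
    unfolding M1_def[abs_def] M2_def[abs_def] by (measurable, measurable) (simp_all add: d_def)
  have "\<exists>t. uc ?J k (%q. v q * w q) t & (\<forall>q\<in>?J. rft (t q) (%\<xi>. M1 b q \<xi> * ft (%x. Hf q x \<bullet> b) \<xi>))" if b: "b \<in> Basis" for b
  proof -
    have "uc ?J (k + 0) w (%q x. Hf q x \<bullet> b)" using uc_inner[OF Hg(1) b] by simp
    then obtain t where "uc ?J k (%q. v q * w q) t" "!!q. q \<in> ?J ==> rft (t q) (%\<xi>. M1 b q \<xi> * ft (%x. Hf q x \<bullet> b) \<xi>)"
      by (rule uc_mult_ex[where m = "M1 b" and v = v, OF _ M(1,3) b1[OF _ b] v0]) (assumption, rule that)
    then show ?thesis by (intro exI[of _ t] conjI ballI)
  qed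
  then have "\<forall>b\<in>Basis. \<exists>t. uc ?J k (%q. v q * w q) t & (\<forall>q\<in>?J. rft (t q) (%\<xi>. M1 b q \<xi> * ft (%x. Hf q x \<bullet> b) \<xi>))" ..
  from bchoice[OF this] obtain t where
    "\<forall>b\<in>Basis. uc ?J k (%q. v q * w q) (t b) & (\<forall>q\<in>?J. rft (t b q) (%\<xi>. M1 b q \<xi> * ft (%x. Hf q x \<bullet> b) \<xi>))" ..
  note t = this[rule_format, THEN conjunct1] this[rule_format, THEN conjunct2, rule_format]
  have "uc ?J (k + 0) w gf" using Hg(2) by simp
  then obtain s where s: "uc ?J k (%q. v q * w q) s" "!!q. q \<in> ?J ==> rft (s q) (%\<xi>. M2 q \<xi> * ft (gf q) \<xi>)"
    by (rule uc_mult_ex[where m = M2 and v = v, OF _ M(2,4) b2 v0]) (assumption, rule that)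
  define u where "u q x = (\<Sum>b\<in>Basis. t b q x) + s q x" for q x
  have wnn: "0 <= v q * w q" if "q \<in> ?J" for q using v0[of q] that eps_mu by (auto simp: w_def)
  have u: "uc ?J k (%q. v q * w q) u" unfolding u_def[abs_def]
    by (intro leb.ucls_add leb.ucls_sum t(1) s(1) wnn finite_Basis)
  show ?thesis
  proof (rule that[of "%i j. u (i, j)"])
    show "uc ?J k (%(i, j). 2 / (freq j)\<^sup>2 * (\<epsilon> i * \<mu> i)) (%(i, j). u (i, j))"
      using u by (simp add: v_def w_def split_beta')
    fix i and j :: nat assume i: "i \<in> I"
    let ?q = "(i, j)"
    have q: "?q \<in> ?J" using i by simp
    have k1: "1 <= k" using k by simp
    have "rft (u ?q) (%\<xi>. (\<Sum>b\<in>Basis. M1 b ?q \<xi> * ft (%x. Hf ?q x \<bullet> b) \<xi>) + M2 ?q \<xi> * ft (gf ?q) \<xi>)"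
      unfolding u_def[abs_def] by (intro rft_add rft_sum finite_Basis t(2) s(2) q)
    note ft_eq[OF this]
    moreover have "AE \<xi> in lborel. complex_of_real (\<mu> i * (norm \<xi>)\<^sup>2 + (freq j)\<^sup>2) * ft (%x. - vavg (smode j) (%p. snd (Y i p)) x) \<xi> =
      complex_of_real (\<mu> i * sin (freq j) / freq j) * ft (L i) \<xi>
      - (complex_of_real (sqrt (\<mu> i)) * (\<Sum>b\<in>Basis. iD b (ft (%x. Hf ?q x \<bullet> b)) \<xi>) + complex_of_real (freq j) * ft (gf ?q) \<xi>)"
    proof (rule mode_fourier[OF Y_efield[OF i] mu(1)[OF i] _ Y_flat[OF i]])
      show "sqint smeas (F2 i)" using F2_us by (rule ucls_E) (use i cls_base(1) in blast)
      show "Hf ?q = vavg (cmode j) (%p. fst (F2 i p))" "gf ?q = vavg (%z. freq j * smode j z) (%p. snd (F2 i p))"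
        by (simp_all add: Hf_def gf_def)
      show "hs 1 (%x. - vavg (smode j) (%p. snd (Y i p)) x)"
        by (rule uc_hs[OF leb.ucls_minus[OF uc_vavg[OF us_fst_snd(2)[OF Y_us] vw(1)]] k1 i])
      fix b :: 'a assume b: "b \<in> Basis"
      show "hs 1 (%x. vavg (cmode j) (%p. fst (Y i p)) x \<bullet> b)"
        by (rule uc_hs[OF uc_inner[OF uc_vavg[OF us_fst_snd(1)[OF Y_us] vw(2)] b] k1 i])
      show "hs 1 (%x. gr i x \<bullet> b)" by (rule uc_hs[OF uc_inner[OF G b] _ i]) simp
      show "hs 1 (%x. Hf ?q x \<bullet> b)" by (rule hs_le[OF hs_uc[OF uc_inner[OF Hg(1) b] q] k1])
    qed
    ultimately show "AE \<xi> in lborel. ft (u ?q) \<xi> = complex_of_real (2 * sin (freq j) / freq j) * ft (yc i j) \<xi>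
      - complex_of_real (2 * \<mu> i / ((freq j)\<^sup>2 * (\<mu> i * (norm \<xi>)\<^sup>2 + (freq j)\<^sup>2))) * ft (L i) \<xi>"
    proof eventually_elim
      case (elim \<xi>)
      have eq: "- (c' * r / e) * S - (c' * l / e) * G = c' * ((a * L' - (r * S + l * G)) / e) - (c' * a / e) * L'"
        if "e \<noteq> 0" for c' r e S l G a L' :: complex
        using that by (simp add: field_simps)
      have d0: "complex_of_real (d ?q \<xi>) \<noteq> 0" using d(1)[OF q, of \<xi>] by simp
      have y: "ft (yc i j) \<xi> = (complex_of_real (\<mu> i * sin (freq j) / freq j) * ft (L i) \<xi>
          - (complex_of_real (sqrt (\<mu> i)) * (\<Sum>b\<in>Basis. iD b (ft (%x. Hf ?q x \<bullet> b)) \<xi>) + complex_of_real (freq j) * ft (gf ?q) \<xi>)) / complex_of_real (d ?q \<xi>)"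
        using elim(2) d0 by (simp add: eq_divide_eq mult.commute yc_def[abs_def] d_def)
      have "c ?q * (\<mu> i * sin (freq j) / freq j) = 2 * \<mu> i / (freq j)\<^sup>2"
        by (simp add: c_def power2_eq_square[of "freq j"])
      then have kk: "complex_of_real (2 * \<mu> i / ((freq j)\<^sup>2 * d ?q \<xi>)) = complex_of_real (c ?q) * complex_of_real (\<mu> i * sin (freq j) / freq j) / complex_of_real (d ?q \<xi>)"
        by (simp flip: of_real_mult of_real_divide)
      let ?S = "\<Sum>b\<in>Basis. iD b (ft (%x. Hf ?q x \<bullet> b)) \<xi>"
      have "ft (u ?q) \<xi> = - (complex_of_real (c ?q) * complex_of_real (sqrt (\<mu> i)) / complex_of_real (d ?q \<xi>)) * ?S
          - (complex_of_real (c ?q) * complex_of_real (freq j) / complex_of_real (d ?q \<xi>)) * ft (gf ?q) \<xi>"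
        unfolding elim(1) by (simp add: M1_def M2_def iD_def sum_distrib_left sum_negf mult.assoc)
      from trans[OF this eq[OF d0, where L' = "ft (L i) \<xi>" and a = "complex_of_real (\<mu> i * sin (freq j) / freq j)"]] show ?case unfolding y[symmetric] kk[symmetric] by (simp add: c_def d_def)
    qed
  qed
qed

text \<open>Summation of \<open>mode_remainder\<close> over j. The weights z + 1 are uniform limits
  of sums of \<open>smode\<close>, so the coefficients add up to \<open>wb\<close>; the symbols add
  up to the F1 quotient; and the remainders stay below C times the sum of 2 / r^2, which is
  1.\<close>

lemma wb_flat:
  obtains u where "uc I k (%i. \<epsilon> i * \<mu> i) u"
    "!!i. i \<in> I ==> AE \<xi> in lborel. ft (wb i) \<xi> = complex_of_real ((1 - F1_symbol (\<mu> i) \<xi>) / (norm \<xi>)\<^sup>2) * ft (L i) \<xi> + ft (u i) \<xi>"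
proof -
  obtain u where u: "uc (I \<times> UNIV) k (%(i, j). 2 / (freq j)\<^sup>2 * (\<epsilon> i * \<mu> i)) (%(i, j). u i j)"
    "!!i j. i \<in> I ==> AE \<xi> in lborel. ft (u i j) \<xi> = complex_of_real (2 * sin (freq j) / freq j) * ft (yc i j) \<xi>
      - complex_of_real (2 * \<mu> i / ((freq j)\<^sup>2 * (\<mu> i * (norm \<xi>)\<^sup>2 + (freq j)\<^sup>2))) * ft (L i) \<xi>"
    by (rule mode_remainder) (rule that)
  from u(1) obtain C where C: "0 <= C" and "\<forall>q\<in>I \<times> UNIV. cls L2 lborel UNIV k (C * (case q of (i, j) => 2 / (freq j)\<^sup>2 * (\<epsilon> i * \<mu> i))) (case q of (i, j) => u i j)"
    unfolding ucls_def by blast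
  then have Cu: "cls L2 lborel UNIV k (C * (2 / (freq j)\<^sup>2 * (\<epsilon> i * \<mu> i))) (u i j)" if "i \<in> I" for i j using that by auto
  define m where "m i \<xi> = (1 - F1_symbol (\<mu> i) \<xi>) / (norm \<xi>)\<^sup>2" for i and \<xi> :: 'a
  have mb: "0 <= m i \<xi>" "m i \<xi> <= \<mu> i" if "i \<in> I" for i \<xi> using F1_symbol_defect[OF mu(1)[OF that], of \<xi>] by (simp_all add: m_def)
  have me: "m i (- \<xi>) = m i \<xi>" for i \<xi> by (simp add: m_def F1_symbol_even)
  have mm[measurable]: "m i \<in> borel_measurable borel" for i unfolding m_def[abs_def] by measurable
  have "uc I (k + 0) (%_. 1) L" by (rule ucls_le[OF LE(1)]) simp
  note w0 = uc_fourier_mult(2)[OF this, of m \<mu>, OF mm]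
  have w0: "rft (fourier_mult (m i) (L i)) (%\<xi>. complex_of_real (m i \<xi>) * ft (L i) \<xi>)" if i: "i \<in> I" for i
    by (rule w0[OF _ _ _ i]) (use mb me eps_mu in \<open>auto simp: wt_def abs_of_nonneg\<close>)
  define U where "U i x = wb i x - fourier_mult (m i) (L i) x" for i x
  have U: "rft (U i) (%\<xi>. ft (wb i) \<xi> - complex_of_real (m i \<xi>) * ft (L i) \<xi>)" if i: "i \<in> I" for i
    unfolding U_def[abs_def] by (rule rft_diff[OF rft_ft[OF uc_sqint[OF uc_wb i]] w0[OF i]])
  have "cls L2 lborel UNIV k (C * (\<epsilon> i * \<mu> i)) (U i)" if i: "i \<in> I" for i
  proof (rule leb.cls_limit)
    define S where "S N x = (\<Sum>j<N. u i j x)" for N x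
    have cs: "cls L2 lborel UNIV k (C * (\<epsilon> i * \<mu> i) * (\<Sum>j<N. 2 / (freq j)\<^sup>2)) (S N)" for N
    proof (induction N)
      case (Suc N)
      from leb.cls_add[OF this Cu[OF i, of N]] show ?case by (simp add: S_def[abs_def] algebra_simps)
    qed (simp add: S_def[abs_def] leb.cls_0)
    have le: "(\<Sum>j<N. 2 / (freq j)\<^sup>2) <= 1" for N
      using sum_le_suminf[OF sums_summable[OF sums_freq], of "{..<N}"] sums_unique[OF sums_freq] by simp
    show "cls L2 lborel UNIV k (C * (\<epsilon> i * \<mu> i)) (S N)" for N
      by (rule cls_mono[OF cs mult_left_le[OF le]]) (use C eps_mu(1)[OF i] in simp)
    show "sqint lborel (U i)" by (rule rft_sqint(1)[OF U[OF i]])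
    have us: "sqint lborel (u i j)" for j by (rule cls_base(1)[OF Cu[OF i]])
    \<comment> \<open>The error of replacing z + 1 by its finite mode sum, an average of Y with a
      uniformly small weight.\<close>
    define r where "r N = vavg (%z. z + 1 - (\<Sum>j<N. 2 * sin (freq j) / freq j * smode j z)) (%p. snd (Y i p))" for N
    define c where "c j = 2 * sin (freq j) / freq j" for j
    define mj where "mj j \<xi> = 2 * \<mu> i / ((freq j)\<^sup>2 * (\<mu> i * (norm \<xi>)\<^sup>2 + (freq j)\<^sup>2))" for j and \<xi> :: 'a
    note Ys = sqint_fst_snd(2)[OF efield_sqint[OF Y_efield[OF i]]]
    note vw = vprimitiveD(1)[OF vprimitive_modes] vprimitiveD(1)[OF vprimitive_1]
    have ys: "sqint lborel (yc i j)" "sqint lborel (wb i)" for j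
      using sqint_minus(1)[OF sqint_vavg(1)[OF vw(1) Ys]] uc_sqint[OF uc_wb i] by (simp_all add: yc_def[abs_def])
    have rs: "sqint lborel (r N)" "l2 lborel (r N) <= l2 ivl (%z. 1 - msum N z) * l2 smeas (%p. snd (Y i p))" for N
      unfolding r_def by (rule sqint_vavg[OF vweight_smode_sum Ys])+
    have re: "AE x in lborel. r N x = (\<Sum>j<N. c j * yc i j x) - wb i x" for N
      using AE_slice_sqint(1)[OF Ys]
    proof eventually_elim
      case (elim x)
      note i = vavg_slice(1)[OF vw(1) elim] vavg_slice(1)[OF vw(2) elim]
      have "r N x = (LINT z|ivl. (z + 1) *\<^sub>R snd (Y i (x, z)) - (\<Sum>j<N. c j *\<^sub>R (smode j z *\<^sub>R snd (Y i (x, z)))))"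
        unfolding r_def vavg_def c_def
        by (intro Bochner_Integration.integral_cong refl) (simp add: left_diff_distrib sum_distrib_right mult.assoc)
      also have "\<dots> = vavg (%z. z + 1) (%p. snd (Y i p)) x - (\<Sum>j<N. c j * vavg (smode j) (%p. snd (Y i p)) x)"
        using i by (simp add: vavg_def)
      finally show ?case by (simp add: wb_def yc_def sum_negf)
    qed
    \<comment> \<open>The other part of the error: its transform is that of \<Delta>\<psi> times the
      tail of the series for the F1 quotient, which tends to 0 by dominated convergence.\<close>
    define V where "V N x = S N x - U i x - ((\<Sum>j<N. c j * yc i j x) - wb i x)" for N x
    have V0: "rft (V N) (%\<xi>. (\<Sum>j<N. ft (u i j) \<xi>) - (ft (wb i) \<xi> - complex_of_real (m i \<xi>) * ft (L i) \<xi>)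
        - ((\<Sum>j<N. complex_of_real (c j) * ft (yc i j) \<xi>) - ft (wb i) \<xi>))" for N
      unfolding V_def[abs_def] S_def by (intro rft_diff rft_sum rft_cmult rft_ft us U i ys finite_lessThan)
    define D where "D N \<xi> = complex_of_real (m i \<xi> - (\<Sum>j<N. mj j \<xi>)) * ft (L i) \<xi>" for N \<xi>
    have li: "sqint lborel (ft (L i))" by (rule rft_sqint(2)[OF rft_ft[OF uc_sqint[OF LE(1) i]]])
    have [measurable]: "ft (L i) \<in> borel_measurable borel" "mj j \<in> borel_measurable borel" for j
      using li unfolding mj_def[abs_def] by (simp_all add: sqint_def)
    have Dm[measurable]: "D N \<in> borel_measurable borel" for N unfolding D_def[abs_def] by measurable
    have VD: "AE \<xi> in lborel. (\<Sum>j<N. ft (u i j) \<xi>) - (ft (wb i) \<xi> - complex_of_real (m i \<xi>) * ft (L i) \<xi>)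
        - ((\<Sum>j<N. complex_of_real (c j) * ft (yc i j) \<xi>) - ft (wb i) \<xi>) = D N \<xi>" for N
    proof -
      have "AE \<xi> in lborel. \<forall>j. ft (u i j) \<xi> = complex_of_real (c j) * ft (yc i j) \<xi> - complex_of_real (mj j \<xi>) * ft (L i) \<xi>"
        using u(2)[OF i] unfolding c_def mj_def AE_all_countable by blast
      then show ?thesis
        by eventually_elim (simp add: D_def sum_subtractf left_diff_distrib sum_distrib_right)
    qed
    have V: "rft (V N) (D N)" for N by (rule rft_cong[OF V0 _ rft_sqint(3)[OF V0] VD]) auto
    have s: "(%j. mj j \<xi>) sums m i \<xi>" if "\<xi> \<noteq> 0" for \<xi>
      using F1_symbol_sums[OF mu(1)[OF i] that] by (simp add: mj_def m_def)
    have nz: "AE \<xi> in lborel. \<xi> \<noteq> (0 :: 'a)" by (rule AE_lborel_singleton)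
    have "(%N. l2 lborel (%\<xi>. D N \<xi> - 0)) \<longlonglongrightarrow> 0"
    proof (rule l2_dominated_convergence(3)[OF _ _ li, where C = "\<mu> i"])
      show "AE \<xi> in lborel. (%N. D N \<xi>) \<longlonglongrightarrow> 0" using nz
      proof eventually_elim
        case (elim \<xi>)
        have "(%N. D N \<xi>) \<longlonglongrightarrow> complex_of_real (m i \<xi> - m i \<xi>) * ft (L i) \<xi>"
          unfolding D_def by (intro tendsto_intros s[OF elim, unfolded sums_def])
        then show ?case by simp
      qed
      show "AE \<xi> in lborel. norm (D N \<xi>) <= \<mu> i * norm (ft (L i) \<xi>)" for N using nz
      proof eventually_elim
        case (elim \<xi>)
        have "0 <= mj j \<xi>" for j using mu(1)[OF i] by (simp add: mj_def)
        then have "(\<Sum>j<N. mj j \<xi>) <= m i \<xi>" "0 <= (\<Sum>j<N. mj j \<xi>)"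
          using sum_le_suminf[OF sums_summable[OF s[OF elim]], of "{..<N}"] sums_unique[OF s[OF elim]] by (auto intro: sum_nonneg)
        with mb[OF i, of \<xi>] have "\<bar>m i \<xi> - (\<Sum>j<N. mj j \<xi>)\<bar> <= \<mu> i" by linarith
        then show ?case by (simp add: D_def norm_mult mult_right_mono del: of_real_diff)
      qed
    qed auto
    from tendsto_add[OF this tendsto_mult_left_zero[OF msum_tendsto, of "l2 smeas (%p. snd (Y i p))"]]
    have lim: "(%N. l2 lborel (D N) + l2 ivl (%z. 1 - msum N z) * l2 smeas (%p. snd (Y i p))) \<longlonglongrightarrow> 0" by simp
    have "l2 lborel (%x. S N x - U i x) <= l2 lborel (D N) + l2 ivl (%z. 1 - msum N z) * l2 smeas (%p. snd (Y i p))" for N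
    proof -
      have "l2 lborel (%x. S N x - U i x) = l2 lborel (%x. V N x + r N x)"
      proof (rule l2_cong_AE)
        show "(%x. S N x - U i x) \<in> borel_measurable lborel" "(%x. V N x + r N x) \<in> borel_measurable lborel"
          using sqint_diff(1)[OF cls_base(1)[OF cs] rft_sqint(1)[OF U[OF i]]] sqint_add(1)[OF rft_sqint(1)[OF V] rs(1)] by (simp_all add: sqint_def)
        show "AE x in lborel. S N x - U i x = V N x + r N x" using re[of N] by eventually_elim (simp add: V_def)
      qed
      also have "\<dots> <= l2 lborel (V N) + l2 lborel (r N)" by (rule sqint_add(2)[OF rft_sqint(1)[OF V] rs(1)])
      finally show ?thesis using l2_le_rft[OF V, of N] rs(2)[of N] by linarith
    qed
    then show "(%N. l2 lborel (%x. S N x - U i x)) \<longlonglongrightarrow> 0"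
      by (intro Lim_null_comparison[OF always_eventually lim]) simp
  qed
  then have "uc I k (%i. \<epsilon> i * \<mu> i) U" unfolding ucls_def using C eps_mu(1) by (intro exI[of _ C]) auto
  then show ?thesis
  proof (rule that)
    fix i assume i: "i \<in> I"
    show "AE \<xi> in lborel. ft (wb i) \<xi> = complex_of_real ((1 - F1_symbol (\<mu> i) \<xi>) / (norm \<xi>)\<^sup>2) * ft (L i) \<xi> + ft (U i) \<xi>"
      using ft_eq[OF U[OF i]] by eventually_elim (simp add: m_def)
  qed
qed

end

text \<open>The residual of the second equation, in which \<open>D\<close> is \<open>-\<G>\<psi> / \<mu>\<close>.\<close>

definition residual2 :: "real => real => ('a::euclidean_space => real) => ('a => real) => ('a => real) => 'a => real" where
  "residual2 \<epsilon> \<mu> \<zeta> \<psi> D x = \<epsilon> / 2 * ((norm (fourier_mult_vec (F1_symbol \<mu>) (weak_grad \<psi>) x))\<^sup>2 - (norm (weak_grad \<psi> x))\<^sup>2)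
    + \<epsilon> * \<mu> * ((\<epsilon> * (weak_grad \<zeta> x \<bullet> weak_grad \<psi> x) - D x)\<^sup>2 / (2 * (1 + \<epsilon>\<^sup>2 * \<mu> * (norm (weak_grad \<zeta> x))\<^sup>2)))"

section \<open>The residuals of the two equations\<close>

context shallow
begin

lemma wb_uc: "uc I k \<mu> wb" "uc I k \<mu> (%i x. \<zeta> i x * wb i x)"
proof -
  show w: "uc I k \<mu> wb" by (rule uc_wb)
  have "uc I k (%i. 1 * \<mu> i) (%i x. \<zeta> i x * wb i x)"
    by (rule leb.ucls_prod[OF bounded_bilinear_mult _ _ ucls_le[OF ZI] w, of 1]) (auto simp: abs_mult)
  then show "uc I k \<mu> (%i x. \<zeta> i x * wb i x)" by simp
qed

lemma k1: "k = Suc (m + DIM('a)) + 1" "1 <= k"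
  by (simp_all add: k)

text \<open>\<open>h V = h\<nabla>\<psi> + \<nabla>(h w)\<close> for \<open>w = \<integral> (\<phi> - \<psi>) dz\<close>, see \<^term>\<open>wb\<close>.\<close>

definition V :: "'i => 'a => 'a" where
  "V i x = (gr i x + \<epsilon> i *\<^sub>R (\<zeta> i x *\<^sub>R gr i x)) + (weak_grad (wb i) x + \<epsilon> i *\<^sub>R weak_grad (%y. \<zeta> i y * wb i y) x)"

text \<open>Writing the potential through Y, the horizontal component averages to \<nabla>w by
  \<open>vavg_weak_grad\<close> and the weighted vertical one to -w. This gives h \<nabla>w +
  \<epsilon> w \<nabla>\<zeta>, which the product rule for \<zeta> w recombines.\<close>

lemma hV:
  assumes i: "i \<in> I"
  shows "AE x in lborel. h i x *\<^sub>R V_bar (\<epsilon> i) (\<zeta> i) (\<Phi> i) x = V i x"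
proof -
  note [measurable] = measurables[OF i]
  have Y: "sqint smeas (Y i)" by (rule efield_sqint[OF Y_efield[OF i]])
  have hz: "hs (2 + DIM('a)) (\<zeta> i)" by (rule hs_le[OF hs_uc[OF Z i]]) (simp add: k)
  show ?thesis
    using hmin(2)[OF i] AE_slice_sqint(1)[OF sqint_fst_snd(1)[OF Y]] AE_slice_sqint(1)[OF sqint_fst_snd(2)[OF Y]]
      weak_grad_eq(2)[OF vavg_weak_grad[OF Y_efield[OF i] mu(1)[OF i] vprimitive_1], folded wb_def]
      weak_grad_prod_hs[OF hz uc_hs[OF wb_uc(1) k1(2) i] uc_hs[OF wb_uc(2) k1(2) i]]
  proof eventually_elim
    case (elim x)
    have h: "h i x \<noteq> 0" using elim(1) hmin(1) by simp
    have s: "sqrt (\<mu> i) \<noteq> 0" using mu(1)[OF i] by simp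
    note i1 = vavg_slice(1)[OF vprimitiveD(2)[OF vprimitive_1] elim(2), simplified]
    note i2 = vavg_slice(1)[OF vprimitiveD(1)[OF vprimitive_1] elim(3), simplified]
    have [measurable]: "(%z. \<Phi> i (x, z)) \<in> borel_measurable borel" by (rule slice_measurable) measurable
    have "h i x *\<^sub>R V_bar (\<epsilon> i) (\<zeta> i) (\<Phi> i) x =
        (LINT z:{-1<..<0}|lborel. h i x *\<^sub>R fst (\<Phi> i (x, z)) - (\<epsilon> i * (z + 1) * snd (\<Phi> i (x, z))) *\<^sub>R dz i x)"
      using h by (simp add: V_bar_def)
    also have "\<dots> = (LINT z|ivl. h i x *\<^sub>R fst (\<Phi> i (x, z)) - (\<epsilon> i * (z + 1) * snd (\<Phi> i (x, z))) *\<^sub>R dz i x)"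
      by (rule LBINT_ivl) measurable
    also have "\<dots> = (LINT z|ivl. h i x *\<^sub>R gr i x + (h i x / sqrt (\<mu> i)) *\<^sub>R fst (Y i (x, z)) - (\<epsilon> i * ((z + 1) * snd (Y i (x, z)))) *\<^sub>R dz i x)"
      using s by (intro Bochner_Integration.integral_cong refl) (simp add: Y_def scale_mu_def algebra_simps)
    also have "\<dots> = h i x *\<^sub>R gr i x + (h i x / sqrt (\<mu> i)) *\<^sub>R (LINT z|ivl. fst (Y i (x, z))) - (\<epsilon> i * (LINT z|ivl. (z + 1) * snd (Y i (x, z)))) *\<^sub>R dz i x"
      using i1 i2 by (simp add: emeasure_ivl measure_def)
    also have "(LINT z|ivl. (z + 1) * snd (Y i (x, z))) = - wb i x" by (simp add: wb_def vavg_def)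
    also have "(h i x / sqrt (\<mu> i)) *\<^sub>R (LINT z|ivl. fst (Y i (x, z))) = h i x *\<^sub>R weak_grad (wb i) x"
      unfolding elim(4) by (simp add: vavg_def divide_inverse)
    finally show ?case unfolding V_def elim(5) by (simp add: water_height_def algebra_simps)
  qed
qed

lemma uc_one: "uc I n \<mu> f ==> uc I n (%_. 1) f"
  by (rule ucls_weight[of _ _ _ _ _ _ _ \<mu>_max]) (use mu mumax in auto)

lemma V_uc: "uc I (Suc (m + DIM('a))) (%_. 1) V"
proof -
  have e: "uc I n (%_. 1) (%i x. \<epsilon> i *\<^sub>R f i x)" if "uc I n (%_. 1) f" for n and f :: "'i => 'a => 'a"
    using leb.ucls_scaleR[OF that, of \<epsilon> "%_. 1"] eps by simp
  have g: "uc I (Suc (m + DIM('a))) (%_. 1) (%i. weak_grad (f i))" if "uc I k \<mu> f" for f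
    by (rule uc_weak_grad[OF uc_one]) (use that k in simp)
  show ?thesis unfolding V_def[abs_def]
    by (intro leb.ucls_add e g wb_uc ucls_le[OF G] ucls_le[OF ZG]) (simp_all add: k)
qed

lemma V_ft:
  assumes i: "i \<in> I" and b: "b \<in> Basis"
  shows "AE \<xi> in lborel. ft (%x. V i x \<bullet> b) \<xi> = ft (%x. gr i x \<bullet> b) \<xi> + \<epsilon> i * ft (%x. (\<zeta> i x *\<^sub>R gr i x) \<bullet> b) \<xi>
    + \<i> * (\<xi> \<bullet> b) * (ft (wb i) \<xi> + \<epsilon> i * ft (%x. \<zeta> i x * wb i x) \<xi>)"
proof -
  have "rft (%x. (gr i x \<bullet> b + \<epsilon> i * ((\<zeta> i x *\<^sub>R gr i x) \<bullet> b)) + (weak_grad (wb i) x \<bullet> b + \<epsilon> i * (weak_grad (%x. \<zeta> i x * wb i x) x \<bullet> b)))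
    (%\<xi>. (ft (%x. gr i x \<bullet> b) \<xi> + \<epsilon> i * ft (%x. (\<zeta> i x *\<^sub>R gr i x) \<bullet> b) \<xi>) + (iD b (ft (wb i)) \<xi> + \<epsilon> i * iD b (ft (%x. \<zeta> i x * wb i x)) \<xi>))"
    by (intro rft_add rft_cmult rft_ft uc_sqint[OF uc_inner[OF G b] i] uc_sqint[OF uc_inner[OF ZG b] i]
      weak_grad_hs(2) uc_hs[OF wb_uc(1) k1(2) i] uc_hs[OF wb_uc(2) k1(2) i] b)
  then have "rft (%x. V i x \<bullet> b) (%\<xi>. (ft (%x. gr i x \<bullet> b) \<xi> + \<epsilon> i * ft (%x. (\<zeta> i x *\<^sub>R gr i x) \<bullet> b) \<xi>)
      + (iD b (ft (wb i)) \<xi> + \<epsilon> i * iD b (ft (%x. \<zeta> i x * wb i x)) \<xi>))"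
    by (simp add: V_def inner_add_left mult.assoc)
  from ft_eq[OF this] show ?thesis by eventually_elim (simp add: iD_def algebra_simps)
qed

text \<open>\<open>D\<close> is given as a divergence of an expression in \<open>V_bar\<close>;
  replacing it almost everywhere by \<open>V\<close> makes regularity and transform accessible. The
  d derivatives above m are kept for the sup bound on the square in \<open>r2\<close>.\<close>

lemma D_facts:
  shows "uc I (m + DIM('a)) (%_. 1) D"
    "!!i. i \<in> I ==> AE \<xi> in lborel. ft (D i) \<xi> = (\<Sum>b\<in>Basis. iD b (ft (%x. V i x \<bullet> b)) \<xi>)"
proof -
  have h: "hs 1 (%x. V i x \<bullet> b)" if "i \<in> I" "b \<in> Basis" for i b by (rule uc_hs[OF uc_inner[OF V_uc]]) (use that in auto)
  have D': "has_weak_div (V i) (D i)" if i: "i \<in> I" for i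
  proof -
    have "(LINT x|lborel. V i x \<bullet> g x) = (LINT x|lborel. (h i x *\<^sub>R V_bar (\<epsilon> i) (\<zeta> i) (\<Phi> i) x) \<bullet> g x)"
      if t: "test_fun \<eta> g" for \<eta> g
    proof (rule integral_cong_AE)
      have [measurable]: "g \<in> borel_measurable borel" "V i \<in> borel_measurable borel"
        using test_fun_measurable[OF t] uc_measurable[OF V_uc i] by auto
      have [measurable]: "(%x. h i x *\<^sub>R V_bar (\<epsilon> i) (\<zeta> i) (\<Phi> i) x) \<in> borel_measurable borel"
        using D[OF i] by (simp add: has_weak_div_def in_L2loc_def)
      show "(%x. V i x \<bullet> g x) \<in> borel_measurable lborel" "(%x. (h i x *\<^sub>R V_bar (\<epsilon> i) (\<zeta> i) (\<Phi> i) x) \<bullet> g x) \<in> borel_measurable lborel"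
        by measurable
      show "AE x in lborel. V i x \<bullet> g x = (h i x *\<^sub>R V_bar (\<epsilon> i) (\<zeta> i) (\<Phi> i) x) \<bullet> g x"
        using hV[OF i] by eventually_elim simp
    qed
    then show ?thesis
      using D[OF i] sqint_in_L2loc[OF uc_sqint[OF V_uc i]] unfolding has_weak_div_def by metis
  qed
  have e: "AE x in lborel. weak_div (V i) x = D i x" if i: "i \<in> I" for i
    by (rule has_weak_div_unique[OF weak_div_hs(1)[OF h[OF i]] D'[OF i]])
  have m: "D i \<in> borel_measurable borel" if "i \<in> I" for i using D'[OF that] by (simp add: has_weak_div_def in_L2loc_def)
  show "uc I (m + DIM('a)) (%_. 1) D"
    by (rule leb.ucls_cong[OF uc_weak_div e m]) (use V_uc in auto)
  show "AE \<xi> in lborel. ft (D i) \<xi> = (\<Sum>b\<in>Basis. iD b (ft (%x. V i x \<bullet> b)) \<xi>)" if i: "i \<in> I" for i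
  proof (rule ft_eq)
    have r: "rft (weak_div (V i)) (%\<xi>. \<Sum>b\<in>Basis. iD b (ft (%x. V i x \<bullet> b)) \<xi>)" by (rule weak_div_hs(2)[OF h[OF i]])
    show "rft (D i) (%\<xi>. \<Sum>b\<in>Basis. iD b (ft (%x. V i x \<bullet> b)) \<xi>)"
      by (rule rft_cong[OF r e[OF i] m[OF i]]) (use rft_sqint(4)[OF r] in auto)
  qed
qed


abbreviation "F1 i \<equiv> F1_symbol (\<mu> i)"
abbreviation "fm i \<equiv> fourier_mult_vec (F1 i) (gr i)"

lemma fourier_mult_F1:
  fixes f :: "'i => 'a => real"
  assumes "uc I n w f"
  shows "uc I n w (%i. fourier_mult (F1 i) (f i))"
    "i \<in> I ==> rft (fourier_mult (F1 i) (f i)) (%\<xi>. complex_of_real (F1 i \<xi>) * ft (f i) \<xi>)"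
proof -
  have f: "uc I (n + 0) w f" using assms by simp
  have c: "i \<in> I ==> \<bar>F1 i \<xi>\<bar> <= 1 * wt 0 \<xi>" for i and \<xi> :: 'a using F1_symbol_bounds(1)[OF mu(1)] by (simp add: wt_def)
  note u = uc_fourier_mult[OF f F1_symbol_measurable F1_symbol_even c]
  show "uc I n w (%i. fourier_mult (F1 i) (f i))" using u(1) by simp
  show "i \<in> I ==> rft (fourier_mult (F1 i) (f i)) (%\<xi>. complex_of_real (F1 i \<xi>) * ft (f i) \<xi>)" by (rule u(2)) auto
qed

text \<open>The second bound spends two derivatives on the symbol 1 - F1, of size \<mu> (1 +
  |\<xi>|)^2.\<close>

lemma fm_uc: "uc I k (%_. 1) fm" "uc I k \<mu> (%i x. gr i x - fm i x)"
proof -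
  note g = uc_inner[OF G]
  show "uc I k (%_. 1) fm"
    by (rule leb.ucls_components) (use fourier_mult_F1(1)[OF g, THEN ucls_le, of _ k] in \<open>simp_all add: fourier_mult_vec_inner\<close>)
  show "uc I k \<mu> (%i x. gr i x - fm i x)"
  proof (rule leb.ucls_components)
    fix b :: 'a assume b: "b \<in> Basis"
    have g2: "uc I (k + 2) (%_. 1) (%i x. gr i x \<bullet> b)" by (rule ucls_le[OF g[OF b]]) (use k DIM_positive[where 'a = 'a] in auto)
    have "uc I k (%i. \<mu> i * 1) (%i x. gr i x \<bullet> b - fourier_mult (F1 i) (%x. gr i x \<bullet> b) x)"
    proof (rule uc_multiplier[OF g2 rft_ft])
      fix i assume i: "i \<in> I"
      show "sqint lborel (%x. gr i x \<bullet> b)" by (rule uc_sqint[OF g2 i])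
      then show "rft (%x. gr i x \<bullet> b - fourier_mult (F1 i) (%x. gr i x \<bullet> b) x) (%\<xi>. ft (%x. gr i x \<bullet> b) \<xi> - F1 i \<xi> * ft (%x. gr i x \<bullet> b) \<xi>)"
        by (intro rft_diff rft_ft fourier_mult_F1(2)[OF g2 i])
      show "AE \<xi> in lborel. norm (ft (%x. gr i x \<bullet> b) \<xi> - F1 i \<xi> * ft (%x. gr i x \<bullet> b) \<xi>) <= \<mu> i * (wt 2 \<xi> * norm (ft (%x. gr i x \<bullet> b) \<xi>))"
      proof (rule AE_I2)
        fix \<xi> :: 'a
        have "ft (%x. gr i x \<bullet> b) \<xi> - F1 i \<xi> * ft (%x. gr i x \<bullet> b) \<xi> = complex_of_real (1 - F1 i \<xi>) * ft (%x. gr i x \<bullet> b) \<xi>"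
          by (simp add: algebra_simps)
        then show "norm (ft (%x. gr i x \<bullet> b) \<xi> - F1 i \<xi> * ft (%x. gr i x \<bullet> b) \<xi>) <= \<mu> i * (wt 2 \<xi> * norm (ft (%x. gr i x \<bullet> b) \<xi>))"
          using mult_right_mono[OF F1_symbol_bounds(2)[OF mu(1)[OF i], of \<xi>] norm_ge_zero[of "ft (%x. gr i x \<bullet> b) \<xi>"]]
          by (simp only: norm_mult norm_of_real mult.assoc)
      qed
    qed (use eps_mu in auto)
    then show "uc I k \<mu> (%i x. (gr i x - fm i x) \<bullet> b)" by (simp add: inner_diff_left fourier_mult_vec_inner[OF b])
  qed (use eps_mu in auto)
qed

text \<open>The difference of squares factors into a bounded sum and a difference of order \<mu>;
  the fraction already carries \<epsilon> \<mu>, and its denominator is at least 2.\<close>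

lemma r2: "uc I m (%i. \<epsilon> i * \<mu> i) (%i. residual2 (\<epsilon> i) (\<mu> i) (\<zeta> i) (\<psi> i) (D i))"
proof -
  have f: "ucI I m (%_. 1) fm" "ucI I m (%_. 1) (%i. gr i)"
    by (rule ucI_of_uc_vec, rule ucls_le[OF fm_uc(1)] ucls_le[OF G], simp add: k)+
  have "uc I m (%i. 1 * \<mu> i) (%i x. (fm i x + gr i x) \<bullet> (gr i x - fm i x))"
    by (rule leb.ucls_prod[OF bounded_bilinear_inner _ _ leb.ucls_add[OF f] ucls_le[OF fm_uc(2)], of 1])
      (auto simp: Cauchy_Schwarz_ineq2 k)
  then have "uc I m (%i. \<epsilon> i * (1 * \<mu> i)) (%i x. (- \<epsilon> i / 2) *\<^sub>R ((fm i x + gr i x) \<bullet> (gr i x - fm i x)))"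
    by (rule leb.ucls_scaleR) (use eps in auto)
  moreover have "(- a / 2) *\<^sub>R ((y + z) \<bullet> (z - y)) = a / 2 * ((norm y)\<^sup>2 - (norm z)\<^sup>2)" for a and y z :: 'a
    by (simp add: power2_norm_eq_inner inner_diff_right inner_add_left inner_commute[of z y] field_simps)
  ultimately have 1: "uc I m (%i. \<epsilon> i * \<mu> i) (%i x. \<epsilon> i / 2 * ((norm (fm i x))\<^sup>2 - (norm (gr i x))\<^sup>2))" by (simp only: mult_1_left)
  have "uc I (m + DIM('a)) (%i. 1 * 1) (%i x. \<epsilon> i *\<^sub>R (dz i x \<bullet> gr i x))"
    by (rule leb.ucls_scaleR[OF ucls_le[OF dzgr]]) (use eps k in auto)
  then have q: "uc I (m + DIM('a)) (%_. 1) (%i x. \<epsilon> i * (dz i x \<bullet> gr i x) - D i x)"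
    by (intro leb.ucls_diff D_facts(1)) simp
  have q2: "uc I m (%_. 1 * 1) (%i x. (\<epsilon> i * (dz i x \<bullet> gr i x) - D i x) * (\<epsilon> i * (dz i x \<bullet> gr i x) - D i x))"
    by (rule leb.ucls_prod[OF bounded_bilinear_mult _ _ ucI_of_uc[OF q] ucls_le[OF q], of 1]) (auto simp: abs_mult)
  have "ucI I k (%_. 1 * 1) (%i x. dz i x \<bullet> dz i x)"
    by (rule leb.ucls_prod[OF bounded_bilinear_inner _ _ Z_grad(2) Z_grad(2), of 1]) (auto simp: Cauchy_Schwarz_ineq2)
  then have "ucI I k (%i. (2 * \<mu>_max) * (1 * 1)) (%i x. (2 * (\<epsilon> i)\<^sup>2 * \<mu> i) *\<^sub>R (dz i x \<bullet> dz i x))"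
  proof (rule leb.ucls_scaleR)
    fix i assume i: "i \<in> I"
    have "(\<epsilon> i)\<^sup>2 * \<mu> i <= 1 * \<mu>_max" using eps[OF i] mu[OF i] by (intro mult_mono) (auto simp: power_le_one)
    then show "\<bar>2 * (\<epsilon> i)\<^sup>2 * \<mu> i\<bar> <= 2 * \<mu>_max" using eps_mu[OF i] by (simp add: abs_mult)
  qed
  from ucls_le[OF ucls_weight[OF this, of "2 * \<mu>_max" "%_. 1"], of m]
  have "ucI I m (%_. 1) (%i x. (2 * (\<epsilon> i)\<^sup>2 * \<mu> i) *\<^sub>R (dz i x \<bullet> dz i x))" using mumax k by simp
  then have "ucI I m (%_. 1) (%i x. 2 + (2 * (\<epsilon> i)\<^sup>2 * \<mu> i) *\<^sub>R (dz i x \<bullet> dz i x))"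
    by (intro leb.ucls_add leb.ucls_const[of 2]) auto
  then have "ucI I m (%_. 1) (%i x. inverse (2 + (2 * (\<epsilon> i)\<^sup>2 * \<mu> i) *\<^sub>R (dz i x \<bullet> dz i x)))"
    by (rule leb.ucls_inverse[of _ _ _ 2]) (use eps_mu in auto)
  then have "uc I m (%_. 1 * (1 * 1)) (%i x. inverse (2 + (2 * (\<epsilon> i)\<^sup>2 * \<mu> i) *\<^sub>R (dz i x \<bullet> dz i x)) *
      ((\<epsilon> i * (dz i x \<bullet> gr i x) - D i x) * (\<epsilon> i * (dz i x \<bullet> gr i x) - D i x)))"
    by (rule leb.ucls_prod[OF bounded_bilinear_mult _ _ _ q2, of 1, rotated 2]) (auto simp: abs_mult)
  then have "uc I m (%i. (\<epsilon> i * \<mu> i) * (1 * (1 * 1))) (%i x. (\<epsilon> i * \<mu> i) *\<^sub>R (inverse (2 + (2 * (\<epsilon> i)\<^sup>2 * \<mu> i) *\<^sub>R (dz i x \<bullet> dz i x)) *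
      ((\<epsilon> i * (dz i x \<bullet> gr i x) - D i x) * (\<epsilon> i * (dz i x \<bullet> gr i x) - D i x))))"
    by (rule leb.ucls_scaleR) (use eps_mu(1) in auto)
  moreover have "(a * b) *\<^sub>R (inverse (2 + (2 * a\<^sup>2 * b) *\<^sub>R (z \<bullet> z)) * (q * q)) = a * b * (q\<^sup>2 / (2 * (1 + a\<^sup>2 * b * (norm z)\<^sup>2)))"
    for a b q :: real and z :: 'a
    by (simp add: power2_norm_eq_inner power2_eq_square[of q] divide_inverse distrib_left mult_ac)
  ultimately show ?thesis unfolding residual2_def[abs_def] by (intro leb.ucls_add[OF 1]) (simp only: mult_1_left mult_1_right)
qed

end

context shallow
begin

text \<open>In Fourier terms D is L + \<epsilon> div(\<zeta> \<nabla>\<psi>) - |\<xi>|^2 (w +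
  \<epsilon> \<zeta> w). By \<open>wb_flat\<close>, L - |\<xi>|^2 w = F1 L - |\<xi>|^2 u with u =
  O(\<epsilon> \<mu>), so the leading terms cancel exactly. The \<epsilon> terms differ by -(1 - F1)
  div(\<zeta> \<nabla>\<psi>) - F1 div(\<zeta> (1 - F1) \<nabla>\<psi>) and |\<xi>|^2 (\<zeta> w),
  each O(\<mu>).\<close>

lemma r1:
  "\<exists>r. uc I m (%i. \<epsilon> i * \<mu> i) r & (\<forall>i\<in>I. AE x in lborel. model_N1 (\<epsilon> i) (\<mu> i) (\<zeta> i) (\<psi> i) x - D i x = r i x)"
proof -
  obtain u where u: "uc I k (%i. \<epsilon> i * \<mu> i) u"
    "!!i. i \<in> I ==> AE \<xi> in lborel. ft (wb i) \<xi> = complex_of_real ((1 - F1 i \<xi>) / (norm \<xi>)\<^sup>2) * ft (L i) \<xi> + ft (u i) \<xi>"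
    by (rule wb_flat) blast
  define z where "z b i x = (\<zeta> i x *\<^sub>R gr i x) \<bullet> b" for b i x
  define y where "y b i x = \<zeta> i x * ((gr i x - fm i x) \<bullet> b)" for b i x
  have z: "uc I (m + 3) (%_. 1) (z b)" if "b \<in> Basis" for b
    unfolding z_def by (rule ucls_le[OF uc_inner[OF ZG that]]) (use k DIM_positive[where 'a = 'a] in auto)
  have y: "uc I (m + 1) \<mu> (y b)" if "b \<in> Basis" for b
  proof -
    have "uc I k (%i. 1 * \<mu> i) (y b)" unfolding y_def
      by (rule leb.ucls_prod[OF bounded_bilinear_mult _ _ ucls_le[OF ZI] uc_inner[OF fm_uc(2) that], of 1]) (auto simp: abs_mult)
    then have "uc I k \<mu> (y b)" by simp
    then show ?thesis by (rule ucls_le) (simp add: k)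
  qed
  have n2: "norm (complex_of_real ((norm \<xi>)\<^sup>2)) <= 1 * wt 2 \<xi>" for \<xi> :: 'a using norm_pow_le_wt[of \<xi> 2] by (simp add: norm_power)
  have k2: "m + 2 <= k" by (simp add: k)
  \<comment> \<open>The four families are the terms of the remainder: \<open>g1\<close> from u,
    \<open>g2\<close> from \<zeta> w, and below \<open>g3\<close> from the outer factor 1 - F1 and
    \<open>g4\<close> from the inner one.\<close>
  obtain g1 where g1: "uc I m (%i. 1 * (\<epsilon> i * \<mu> i)) g1" "!!i. i \<in> I ==> rft (g1 i) (%\<xi>. complex_of_real ((norm \<xi>)\<^sup>2) * ft (u i) \<xi>)"
    by (rule uc_mult_ex[OF ucls_le[OF u(1) k2], of "%_ \<xi>. complex_of_real ((norm \<xi>)\<^sup>2)" "%_. 1"]) (use n2 in auto)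
  obtain g2 where g2: "uc I m (%i. 1 * \<mu> i) g2" "!!i. i \<in> I ==> rft (g2 i) (%\<xi>. complex_of_real ((norm \<xi>)\<^sup>2) * ft (%x. \<zeta> i x * wb i x) \<xi>)"
    by (rule uc_mult_ex[OF ucls_le[OF wb_uc(2) k2], of "%_ \<xi>. complex_of_real ((norm \<xi>)\<^sup>2)" "%_. 1"]) (use n2 in auto)
  have "\<exists>g. uc I m \<mu> g & (\<forall>i\<in>I. rft (g i) (%\<xi>. - (\<i> * (\<xi> \<bullet> b)) * complex_of_real (1 - F1 i \<xi>) * ft (z b i) \<xi>))" if b: "b \<in> Basis" for b
  proof -
    obtain g where "uc I m (%i. \<mu> i * 1) g" "!!i. i \<in> I ==> rft (g i) (%\<xi>. (- (\<i> * (\<xi> \<bullet> b)) * complex_of_real (1 - F1 i \<xi>)) * ft (z b i) \<xi>)"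
    proof (rule uc_mult_ex[OF z[OF b]])
      fix i and \<xi> :: 'a assume i: "i \<in> I"
      have "norm (\<i> * complex_of_real (\<xi> \<bullet> b)) * \<bar>1 - F1 i \<xi>\<bar> <= (1 * wt 1 \<xi>) * (\<mu> i * wt 2 \<xi>)"
        using iD_symbol[OF b] F1_symbol_bounds(2)[OF mu(1)[OF i]] by (intro mult_mono) auto
      also have "\<dots> = \<mu> i * wt 3 \<xi>" by (simp add: wt_def power_numeral_reduce)
      finally show "norm (- (\<i> * complex_of_real (\<xi> \<bullet> b)) * complex_of_real (1 - F1 i \<xi>)) <= \<mu> i * wt 3 \<xi>"
        by (simp only: norm_mult[of "- _"] norm_minus_cancel norm_of_real)
    qed (use eps_mu in \<open>auto simp: F1_symbol_even\<close>)
    then show ?thesis by auto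
  qed
  from bchoice[OF ballI, OF this] obtain g3 where
    "\<forall>b\<in>Basis. uc I m \<mu> (g3 b) & (\<forall>i\<in>I. rft (g3 b i) (%\<xi>. - (\<i> * (\<xi> \<bullet> b)) * complex_of_real (1 - F1 i \<xi>) * ft (z b i) \<xi>))" ..
  note g3 = this[rule_format, THEN conjunct1] this[rule_format, THEN conjunct2, rule_format]
  have "\<exists>g. uc I m \<mu> g & (\<forall>i\<in>I. rft (g i) (%\<xi>. - (\<i> * (\<xi> \<bullet> b)) * F1 i \<xi> * ft (y b i) \<xi>))" if b: "b \<in> Basis" for b
  proof -
    obtain g where "uc I m (%i. 1 * \<mu> i) g" "!!i. i \<in> I ==> rft (g i) (%\<xi>. (- (\<i> * (\<xi> \<bullet> b)) * F1 i \<xi>) * ft (y b i) \<xi>)"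
    proof (rule uc_mult_ex[OF y[OF b]])
      fix i and \<xi> :: 'a assume i: "i \<in> I"
      have "norm (\<i> * complex_of_real (\<xi> \<bullet> b)) * \<bar>F1 i \<xi>\<bar> <= (1 * wt 1 \<xi>) * 1"
        using iD_symbol[OF b] F1_symbol_bounds(1)[OF mu(1)[OF i]] by (intro mult_mono) auto
      then show "norm (- (\<i> * complex_of_real (\<xi> \<bullet> b)) * complex_of_real (F1 i \<xi>)) <= 1 * wt 1 \<xi>"
        by (simp add: norm_mult)
    qed (auto simp: F1_symbol_even)
    then show ?thesis by auto
  qed
  from bchoice[OF ballI, OF this] obtain g4 where
    "\<forall>b\<in>Basis. uc I m \<mu> (g4 b) & (\<forall>i\<in>I. rft (g4 b i) (%\<xi>. - (\<i> * (\<xi> \<bullet> b)) * F1 i \<xi> * ft (y b i) \<xi>))" ..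
  note g4 = this[rule_format, THEN conjunct1] this[rule_format, THEN conjunct2, rule_format]
  define r where "r i x = g1 i x + \<epsilon> i * (g2 i x + (\<Sum>b\<in>Basis. g3 b i x + g4 b i x))" for i x
  have "uc I m \<mu> (%i x. g2 i x + (\<Sum>b\<in>Basis. g3 b i x + g4 b i x))"
    using g2(1) g3(1) g4(1) eps_mu(2) by (intro leb.ucls_add leb.ucls_sum) auto
  from leb.ucls_scaleR[OF this, of \<epsilon> \<epsilon>] g1(1) have r_uc: "uc I m (%i. \<epsilon> i * \<mu> i) r"
    unfolding r_def[abs_def] using eps by (intro leb.ucls_add) auto
  show ?thesis
  proof (intro exI[of _ r] conjI r_uc ballI)
    fix i assume i: "i \<in> I"
    let ?E = "weak_div (%x. \<zeta> i x *\<^sub>R fm i x)"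
    have r: "rft (r i) (%\<xi>. complex_of_real ((norm \<xi>)\<^sup>2) * ft (u i) \<xi> + \<epsilon> i * (complex_of_real ((norm \<xi>)\<^sup>2) * ft (%x. \<zeta> i x * wb i x) \<xi>
        + (\<Sum>b\<in>Basis. - (\<i> * (\<xi> \<bullet> b)) * complex_of_real (1 - F1 i \<xi>) * ft (z b i) \<xi> + - (\<i> * (\<xi> \<bullet> b)) * F1 i \<xi> * ft (y b i) \<xi>)))"
      unfolding r_def[abs_def] using g1(2) g2(2) g3(2) g4(2) i by (intro rft_add rft_cmult rft_sum) auto
    have "uc I k (%_. 1 * 1) (%i x. \<zeta> i x *\<^sub>R fm i x)"
      by (rule leb.ucls_prod[OF bounded_bilinear_scaleR _ _ ucls_le[OF ZI] fm_uc(1), of 1]) auto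
    then have zf: "uc I (m + 1 + 1) (%_. 1) (%i x. \<zeta> i x *\<^sub>R fm i x)" using k2 by (simp add: ucls_le)
    note zb = uc_inner[OF zf]
    have l: "rft (L i) (%\<xi>. \<Sum>b\<in>Basis. iD b (ft (%x. gr i x \<bullet> b)) \<xi>)" "rft ?E (%\<xi>. \<Sum>b\<in>Basis. iD b (ft (%x. (\<zeta> i x *\<^sub>R fm i x) \<bullet> b)) \<xi>)"
      by (rule weak_div_hs(2)[OF uc_hs[OF uc_inner[OF G] _ i]] weak_div_hs(2)[OF uc_hs[OF zb _ i]]; simp)+
    have N: "rft (%x. model_N1 (\<epsilon> i) (\<mu> i) (\<zeta> i) (\<psi> i) x - D i x)
        (%\<xi>. (complex_of_real (F1 i \<xi>) * ft (L i) \<xi> + \<epsilon> i * (complex_of_real (F1 i \<xi>) * ft ?E \<xi>)) - ft (D i) \<xi>)"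
      unfolding model_N1_def weak_laplacian_def
      by (intro rft_diff rft_add rft_cmult fourier_mult_F1(2)[OF LE(1) i] fourier_mult_F1(2)[OF uc_weak_div[OF zf] i] rft_ft uc_sqint[OF D_facts(1) i])
    have yb: "AE \<xi> in lborel. \<forall>b\<in>Basis. ft (y b i) \<xi> = ft (z b i) \<xi> - ft (%x. (\<zeta> i x *\<^sub>R fm i x) \<bullet> b) \<xi>"
    proof (intro AE_finite_allI finite_Basis ft_eq)
      fix b :: 'a assume b: "b \<in> Basis"
      have "rft (%x. z b i x - (\<zeta> i x *\<^sub>R fm i x) \<bullet> b) (%\<xi>. ft (z b i) \<xi> - ft (%x. (\<zeta> i x *\<^sub>R fm i x) \<bullet> b) \<xi>)"
        by (intro rft_diff rft_ft uc_sqint[OF z[OF b] i] uc_sqint[OF zb[OF b] i])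
      then show "rft (y b i) (%\<xi>. ft (z b i) \<xi> - ft (%x. (\<zeta> i x *\<^sub>R fm i x) \<bullet> b) \<xi>)"
        by (simp add: y_def[abs_def] z_def inner_diff_left right_diff_distrib)
    qed
    have Vb: "AE \<xi> in lborel. \<forall>b\<in>Basis. ft (%x. V i x \<bullet> b) \<xi> = ft (%x. gr i x \<bullet> b) \<xi> + \<epsilon> i * ft (z b i) \<xi>
        + \<i> * (\<xi> \<bullet> b) * (ft (wb i) \<xi> + \<epsilon> i * ft (%x. \<zeta> i x * wb i x) \<xi>)"
      unfolding z_def[abs_def] by (intro AE_finite_allI finite_Basis V_ft i)
    \<comment> \<open>Multiplying the F1 quotient back by |\<xi>|^2 requires \<xi> to be
      nonzero.\<close>
    have nz: "AE \<xi> in lborel. \<xi> \<noteq> (0::'a)" by (rule AE_I[of _ _ "{0}"]) auto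
    show "AE x in lborel. model_N1 (\<epsilon> i) (\<mu> i) (\<zeta> i) (\<psi> i) x - D i x = r i x"
    proof (rule rft_inj[OF N r])
      show "AE \<xi> in lborel. (complex_of_real (F1 i \<xi>) * ft (L i) \<xi> + \<epsilon> i * (complex_of_real (F1 i \<xi>) * ft ?E \<xi>)) - ft (D i) \<xi>
        = complex_of_real ((norm \<xi>)\<^sup>2) * ft (u i) \<xi> + \<epsilon> i * (complex_of_real ((norm \<xi>)\<^sup>2) * ft (%x. \<zeta> i x * wb i x) \<xi>
        + (\<Sum>b\<in>Basis. - (\<i> * (\<xi> \<bullet> b)) * complex_of_real (1 - F1 i \<xi>) * ft (z b i) \<xi> + - (\<i> * (\<xi> \<bullet> b)) * F1 i \<xi> * ft (y b i) \<xi>))"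
        using ft_eq[OF l(1)] ft_eq[OF l(2)] D_facts(2)[OF i] u(2)[OF i] yb Vb nz
      proof eventually_elim
        case (elim \<xi>)
        define F where "F = complex_of_real (F1 i \<xi>)"
        define q where "q b = \<i> * complex_of_real (\<xi> \<bullet> b)" for b
        define n where "n = complex_of_real ((norm \<xi>)\<^sup>2)"
        define W where "W = ft (wb i) \<xi> + \<epsilon> i * ft (%x. \<zeta> i x * wb i x) \<xi>"
        have qq: "(\<Sum>b\<in>Basis. q b * q b) = - n"
        proof -
          have "(norm \<xi>)\<^sup>2 = (\<Sum>b\<in>Basis. (\<xi> \<bullet> b) * (\<xi> \<bullet> b))" by (simp add: power2_norm_eq_inner euclidean_inner[of \<xi> \<xi>])
          then show ?thesis by (simp add: q_def n_def sum_negf mult_ac flip: of_real_mult)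
        qed
        have n: "n \<noteq> 0" using elim(7) by (simp add: n_def)
        define lz where "lz = (\<Sum>b\<in>Basis. q b * ft (z b i) \<xi>)"
        define lk where "lk = (\<Sum>b\<in>Basis. q b * ft (%x. (\<zeta> i x *\<^sub>R fm i x) \<bullet> b) \<xi>)"
        have Ek: "ft ?E \<xi> = lk" using elim(2) by (simp add: lk_def iD_def q_def)
        have "ft (D i) \<xi> = (\<Sum>b\<in>Basis. q b * (ft (%x. gr i x \<bullet> b) \<xi> + \<epsilon> i * ft (z b i) \<xi> + q b * W))"
          unfolding elim(3) by (intro sum.cong refl) (simp add: iD_def q_def W_def elim(6))
        also have "\<dots> = (\<Sum>b\<in>Basis. q b * ft (%x. gr i x \<bullet> b) \<xi>) + \<epsilon> i * lz + (\<Sum>b\<in>Basis. q b * q b) * W"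
          by (simp add: lz_def sum.distrib sum_distrib_left sum_distrib_right algebra_simps)
        also have "(\<Sum>b\<in>Basis. q b * ft (%x. gr i x \<bullet> b) \<xi>) = ft (L i) \<xi>" using elim(1) by (simp add: iD_def q_def)
        finally have Dx: "ft (D i) \<xi> = ft (L i) \<xi> + \<epsilon> i * lz - n * W" by (simp add: qq)
        have S: "(\<Sum>b\<in>Basis. - (\<i> * (\<xi> \<bullet> b)) * complex_of_real (1 - F1 i \<xi>) * ft (z b i) \<xi> + - (\<i> * (\<xi> \<bullet> b)) * F1 i \<xi> * ft (y b i) \<xi>) = F * lk - lz"
        proof -
          have "(\<Sum>b\<in>Basis. - (\<i> * (\<xi> \<bullet> b)) * complex_of_real (1 - F1 i \<xi>) * ft (z b i) \<xi> + - (\<i> * (\<xi> \<bullet> b)) * F1 i \<xi> * ft (y b i) \<xi>)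
            = (\<Sum>b\<in>Basis. F * (q b * ft (%x. (\<zeta> i x *\<^sub>R fm i x) \<bullet> b) \<xi>) - q b * ft (z b i) \<xi>)"
            by (intro sum.cong refl) (simp add: elim(5) F_def q_def algebra_simps)
          then show ?thesis by (simp add: lk_def lz_def sum_subtractf sum_distrib_left)
        qed
        have "n * ft (wb i) \<xi> = (1 - F) * ft (L i) \<xi> + n * ft (u i) \<xi>"
          unfolding elim(4) using n by (simp add: F_def n_def field_simps)
        then show ?case unfolding S Dx Ek n_def[symmetric] by (simp add: W_def F_def algebra_simps)
      qed
    qed
  qed
qed

end

subsection \<open>Sobolev norms and difference quotients\<close>

lemma Lambda_symbol_measurable [measurable]: "Lambda_symbol s \<in> borel_measurable (borel :: 'a::euclidean_space measure)"
  unfolding Lambda_symbol_def[abs_def] by measurable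

text \<open>The upper bound rounds s up and the lower bound rounds it down. The factor 2^n comes
  from (1 + |\<xi>|)^2 being at most 4 (1 + |\<xi>|^2).\<close>

lemma Lambda_symbol_bounds:
  fixes \<xi> :: "'a::euclidean_space"
  shows "0 <= s ==> s <= real m ==> \<bar>Lambda_symbol s \<xi>\<bar> <= wt m \<xi>" "real n <= s ==> wt n \<xi> <= 2 ^ n * Lambda_symbol s \<xi>"
proof -
  assume s: "0 <= s" "s <= real m"
  have "(1 + (norm \<xi>)\<^sup>2) powr (s / 2) <= ((1 + norm \<xi>)\<^sup>2) powr (s / 2)"
    using s by (intro powr_mono2) (auto simp: power2_eq_square algebra_simps)
  also have "(1 + norm \<xi>)\<^sup>2 = (1 + norm \<xi>) powr 2" by (simp add: add_pos_nonneg)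
  also have "\<dots> powr (s / 2) = (1 + norm \<xi>) powr s" unfolding powr_powr by simp
  also have "\<dots> <= (1 + norm \<xi>) powr m" using s by (intro powr_mono) auto
  also have "\<dots> = wt m \<xi>" by (simp add: wt_def powr_realpow add_pos_nonneg)
  finally show "\<bar>Lambda_symbol s \<xi>\<bar> <= wt m \<xi>" by (simp add: Lambda_symbol_def)
next
  assume s: "real n <= s"
  have p: "0 < 1 + (norm \<xi>)\<^sup>2" by (simp add: add_pos_nonneg)
  have "2 * norm \<xi> <= 1 + (norm \<xi>)\<^sup>2" using sum_squares_bound[of 1 "norm \<xi>"] by simp
  then have "2 * norm \<xi> <= 3 + 3 * (norm \<xi>)\<^sup>2" using zero_le_power2[of "norm \<xi>"] by linarith
  then have "(1 + norm \<xi>)\<^sup>2 <= 4 * (1 + (norm \<xi>)\<^sup>2)" by (simp add: power2_sum)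
  then have "1 + norm \<xi> <= sqrt (4 * (1 + (norm \<xi>)\<^sup>2))" by (rule real_le_rsqrt)
  also have "\<dots> = 2 * (1 + (norm \<xi>)\<^sup>2) powr (1 / 2)" using p by (simp only: real_sqrt_mult real_sqrt_four powr_half_sqrt[OF less_imp_le[OF p]])
  finally have "wt n \<xi> <= (2 * (1 + (norm \<xi>)\<^sup>2) powr (1 / 2)) ^ n" unfolding wt_def by (intro power_mono) auto
  also have "\<dots> = 2 ^ n * (1 + (norm \<xi>)\<^sup>2) powr (n / 2)" using p by (simp add: power_mult_distrib powr_powr flip: powr_realpow)
  also have "\<dots> <= 2 ^ n * (1 + (norm \<xi>)\<^sup>2) powr (s / 2)" using s by (intro mult_left_mono powr_mono) auto
  finally show "wt n \<xi> <= 2 ^ n * Lambda_symbol s \<xi>" by (simp add: Lambda_symbol_def)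
qed

lemma sobolev_rft:
  assumes "f \<in> sobolev s"
  shows "rft f (ft f)" "rft (fourier_mult (Lambda_symbol s) f) (%\<xi>. complex_of_real (Lambda_symbol s \<xi>) * ft f \<xi>)"
proof -
  obtain U where U: "rft f U" "sqint lborel (%\<xi>. complex_of_real (Lambda_symbol s \<xi>) * U \<xi>)"
    using assms by (auto simp: sobolev_def rft_def in_L2_sqint)
  show f: "rft f (ft f)" by (rule rft_ft[OF rft_sqint(1)[OF U(1)]])
  note [measurable] = rft_sqint(4)[OF f]
  have "sqint lborel (%\<xi>. complex_of_real (Lambda_symbol s \<xi>) * ft f \<xi>)"
    by (rule sqint_cong_AE[OF U(2)]) (use ft_eq[OF U(1)] in \<open>auto elim!: eventually_mono\<close>)
  then show "rft (fourier_mult (Lambda_symbol s) f) (%\<xi>. complex_of_real (Lambda_symbol s \<xi>) * ft f \<xi>)"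
    by (rule fourier_mult_rft[OF f, rotated]) (simp add: Lambda_symbol_def)
qed

lemma cls_of_sobolev:
  fixes f :: "'a::euclidean_space => real"
  assumes f: "f \<in> sobolev s" and n: "real n <= s"
  shows "cls L2 lborel UNIV n (2 ^ n * (sqrt ((2 * pi) ^ DIM('a)) * sobolev_norm s f)) f"
proof (rule cls_of_rft[OF sobolev_rft(1)[OF f]])
  let ?V = "%\<xi>. complex_of_real (Lambda_symbol s \<xi>) * ft f \<xi>"
  note [measurable] = rft_sqint(4)[OF sobolev_rft(1)[OF f]]
  have le: "norm (wU n (ft f) \<xi>) <= 2 ^ n * norm (?V \<xi>)" for \<xi>
    using mult_right_mono[OF Lambda_symbol_bounds(2)[OF n, of \<xi>] norm_ge_zero[of "ft f \<xi>"]]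
    by (simp add: norm_mult mult.assoc Lambda_symbol_def)
  have "sqint lborel (wU n (ft f)) & l2 lborel (wU n (ft f)) <= 2 ^ n * l2 lborel ?V"
    using sqint_bound[OF rft_sqint(2)[OF sobolev_rft(2)[OF f]], of "wU n (ft f)" "2 ^ n"] le by simp
  then show "sqint lborel (wU n (ft f))" "l2 lborel (wU n (ft f)) <= 2 ^ n * (sqrt ((2 * pi) ^ DIM('a)) * sobolev_norm s f)"
    unfolding sobolev_norm_def L2_norm_l2 rft_l2[OF sobolev_rft(2)[OF f], symmetric] by auto
qed

lemma sobolev_of_cls:
  fixes f :: "'a::euclidean_space => real"
  assumes f: "cls L2 lborel UNIV m M f" and s: "0 <= s" "s <= real m"
  shows "f \<in> sobolev s" "sobolev_norm s f <= real (DIM('a) + 1) ^ Suc m * sqrt ((2 * pi) ^ DIM('a)) * M"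
proof -
  let ?V = "%\<xi>. complex_of_real (Lambda_symbol s \<xi>) * ft f \<xi>"
  have r: "rft f (ft f)" by (rule rft_ft[OF cls_base(1)[OF f]])
  note [measurable] = rft_sqint(4)[OF r]
  note w = rft_of_cls[OF f r]
  have le: "norm (?V \<xi>) <= 1 * norm (wU m (ft f) \<xi>)" for \<xi>
    using mult_right_mono[OF Lambda_symbol_bounds(1)[OF s, of \<xi>] norm_ge_zero[of "ft f \<xi>"]] by (simp add: norm_mult)
  have V: "sqint lborel ?V" "l2 lborel ?V <= l2 lborel (wU m (ft f))"
    using sqint_bound[OF w(1), of ?V 1] le by simp_all
  show fs: "f \<in> sobolev s" using V(1) r by (auto simp: sobolev_def rft_def in_L2_sqint)
  show "sobolev_norm s f <= real (DIM('a) + 1) ^ Suc m * sqrt ((2 * pi) ^ DIM('a)) * M"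
    unfolding sobolev_norm_def L2_norm_l2 using l2_le_rft[OF sobolev_rft(2)[OF fs]] V(2) w(2) by linarith
qed

lemma sobolev_dot_grad:
  fixes \<psi> :: "'a::euclidean_space => real"
  assumes "\<psi> \<in> sobolev_dot (s + 1)" and b: "b \<in> Basis"
  shows "(%x. weak_grad \<psi> x \<bullet> b) \<in> sobolev s"
proof -
  obtain G where G: "has_weak_grad \<psi> G" "(%x. G x \<bullet> b) \<in> sobolev s" using assms by (auto simp: sobolev_dot_def)
  have [measurable]: "weak_grad \<psi> \<in> borel_measurable borel"
    using weak_grad_eq(1)[OF G(1)] by (simp add: has_weak_grad_def in_L2loc_def)
  obtain U where U: "rft (%x. G x \<bullet> b) U" "in_L2 (%\<xi>. complex_of_real (Lambda_symbol s \<xi>) * U \<xi>)"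
    using G(2) by (auto simp: sobolev_def rft_def)
  have "AE x in lborel. G x \<bullet> b = weak_grad \<psi> x \<bullet> b" using weak_grad_eq(2)[OF G(1)] by eventually_elim simp
  then have "rft (%x. weak_grad \<psi> x \<bullet> b) U" by (rule rft_cong[OF U(1)]) (use rft_sqint(4)[OF U(1)] in auto)
  then show ?thesis using U(2) by (auto simp: sobolev_def rft_def)
qed

lemma sobolev_norm_inner:
  fixes W :: "'a::euclidean_space => 'a"
  assumes W: "!!b. b \<in> Basis ==> (%x. W x \<bullet> b) \<in> sobolev s" and b: "b \<in> Basis"
  shows "sobolev_norm s (%x. W x \<bullet> b) <= sobolev_vec_norm s W"
proof -
  let ?V = "fourier_mult_vec (Lambda_symbol s) W"
  have c: "(%x. ?V x \<bullet> b) = fourier_mult (Lambda_symbol s) (%x. W x \<bullet> b)" if "b \<in> Basis" for b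
    using fourier_mult_vec_inner[OF that] by auto
  have "sqint lborel ?V"
    by (rule sqint_from_components) (use rft_sqint(1)[OF sobolev_rft(2)[OF W]] c in simp)
  from sqint_bound(2)[OF this, of "%x. ?V x \<bullet> b" 1] have "l2 lborel (%x. ?V x \<bullet> b) <= l2 lborel ?V"
    using sqint_component[OF \<open>sqint lborel ?V\<close> b] Basis_le_norm[OF b] by (auto simp: sqint_def)
  then show ?thesis unfolding c[OF b] by (simp add: sobolev_norm_def sobolev_vec_norm_def L2_norm_l2)
qed

text \<open>Extracts the factor \<epsilon> \<mu> from a remainder. If it is 0, the bound forces f to
  vanish almost everywhere, and R = 0 serves.\<close>

lemma cls_quotient:
  fixes f :: "'a::euclidean_space => real"
  assumes f: "cls L2 lborel UNIV m (B * w) f" and w: "0 <= w" and B: "0 <= B"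
  obtains R where "cls L2 lborel UNIV m B R" "AE x in lborel. f x = w * R x"
proof (cases "w = 0")
  case True
  then have "l2 lborel f = 0" using cls_base(2)[OF f] l2_nonneg[of lborel f] by simp
  from l2_eq_0_AE[OF cls_base(1)[OF f] this] show ?thesis
    by (intro that[of "%x. 0"] leb.cls_0 B) (simp add: True)
next
  case False
  have "\<bar>1 / w\<bar> * (B * w) = B" using False w by simp
  with leb.cls_scaleR[OF f, of "1 / w"] show ?thesis
    by (intro that[of "%x. (1 / w) *\<^sub>R f x"]) (use False in auto)
qed

subsection \<open>Consistency\<close>

text \<open>One datum is a solution at a fixed time together with a potential and a divergence,
  bundled so that all of them can form the index set of the locale \<open>shallow\<close>.\<close>

datatype 'a datum = Datum (d_eps: real) (d_mu: real) (d_h: real) (d_zeta: "'a => real") (d_psi: "'a => real")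
  (d_phi: "'a \<times> real => real") (d_Phi: "'a \<times> real => 'a \<times> real") (d_D: "'a => real")

definition data :: "real => real => real => 'a::euclidean_space datum set" where
  "data \<mu>_max \<sigma> K = {i. (d_eps i, d_mu i) \<in> shallow_water \<mu>_max & 0 < d_h i & 1 / d_h i <= K &
     (AE X in lborel. d_h i <= water_height (d_eps i) (d_zeta i) X) & d_zeta i \<in> sobolev \<sigma> & sobolev_norm \<sigma> (d_zeta i) <= K &
     d_psi i \<in> sobolev_dot (\<sigma> + 1) & sobolev_vec_norm \<sigma> (weak_grad (d_psi i)) <= K &
     potential_solution (d_eps i) (d_mu i) (d_zeta i) (d_psi i) (d_phi i) (d_Phi i) &
     has_weak_div (%X. water_height (d_eps i) (d_zeta i) X *\<^sub>R V_bar (d_eps i) (d_zeta i) (d_Phi i) X) (d_D i)}"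

text \<open>For fixed K the set of data is one index set, so the family estimates give a constant
  that depends on K but not on the individual datum.\<close>

lemma uniform_remainder:
  assumes mm: "0 < \<mu>_max" and s: "0 <= s" and \<sigma>: "s + real (2 * DIM('a::euclidean_space) + 4) <= \<sigma>"
  shows "\<forall>K. \<exists>B. \<forall>i \<in> data \<mu>_max \<sigma> K. \<exists>R1 R2 :: 'a => real.
    R1 \<in> sobolev s & sobolev_norm s R1 <= B & R2 \<in> sobolev s & sobolev_norm s R2 <= B &
    (AE X in lborel. model_N1 (d_eps i) (d_mu i) (d_zeta i) (d_psi i) X - d_D i X = d_eps i * d_mu i * R1 X) &
    (AE X in lborel. residual2 (d_eps i) (d_mu i) (d_zeta i) (d_psi i) (d_D i) X = d_eps i * d_mu i * R2 X)"
proof (rule allI)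
  fix K :: real
  define m where "m = nat \<lceil>s\<rceil>"
  have m: "s <= real m" "real m <= s + 1" using s by (auto simp: m_def)
  let ?k = "m + DIM('a) + 2"
  \<comment> \<open>The data must have k + d + 1 = m + 2 d + 3 derivatives, and m is at most s +
    1.\<close>
  have n: "real (?k + DIM('a) + 1) <= \<sigma>" using m \<sigma> by simp
  define c where "c = 2 ^ (?k + DIM('a) + 1) * sqrt ((2 * pi) ^ DIM('a))"
  have c: "0 <= c" by (simp add: c_def)
  have uc: "uc (data \<mu>_max \<sigma> K) (?k + DIM('a) + 1) (%_. 1) f"
    if f: "!!i. i \<in> data \<mu>_max \<sigma> K ==> f i \<in> sobolev \<sigma> & sobolev_norm \<sigma> (f i) <= K" for f :: "'a datum => 'a => real"
    unfolding ucls_def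
  proof (intro exI[of _ "c * \<bar>K\<bar>"] conjI ballI)
    fix i :: "'a datum" assume i: "i \<in> data \<mu>_max \<sigma> K"
    have "c * sobolev_norm \<sigma> (f i) <= c * \<bar>K\<bar> * 1" using f[OF i] c by (auto intro!: mult_left_mono)
    then show "cls L2 lborel UNIV (?k + DIM('a) + 1) (c * \<bar>K\<bar> * 1) (f i)"
      by (intro cls_mono[OF cls_of_sobolev[OF conjunct1[OF f[OF i]] n]]) (simp only: c_def mult.assoc)
  qed (use c in auto)
  \<comment> \<open>1 / (|K| + 1) is a positive lower bound for the depth, common to all
    data.\<close>
  interpret shallow "data \<mu>_max \<sigma> K :: 'a datum set" d_eps d_mu \<mu>_max "1 / (\<bar>K\<bar> + 1)" m ?k d_zeta d_psi d_phi d_Phi d_D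
  proof
    show "uc (data \<mu>_max \<sigma> K :: 'a datum set) (?k + DIM('a) + 1) (%_. 1) d_zeta" by (rule uc) (auto simp: data_def)
    show "uc (data \<mu>_max \<sigma> K :: 'a datum set) (?k + DIM('a) + 1) (%_. 1) (%i. weak_grad (d_psi i))"
    proof (rule leb.ucls_components, simp, rule uc)
      fix b :: 'a and i :: "'a datum" assume b: "b \<in> Basis" and i: "i \<in> data \<mu>_max \<sigma> K"
      then have p: "d_psi i \<in> sobolev_dot (\<sigma> + 1)" "sobolev_vec_norm \<sigma> (weak_grad (d_psi i)) <= K" by (auto simp: data_def)
      show "(%x. weak_grad (d_psi i) x \<bullet> b) \<in> sobolev \<sigma> & sobolev_norm \<sigma> (%x. weak_grad (d_psi i) x \<bullet> b) <= K"
        using sobolev_dot_grad[OF p(1) b] sobolev_norm_inner[OF sobolev_dot_grad[OF p(1)] b] p(2) by auto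
    qed
    fix i :: "'a datum" assume i: "i \<in> data \<mu>_max \<sigma> K"
    then have "0 < d_h i" "1 / d_h i <= \<bar>K\<bar> + 1" by (auto simp: data_def)
    then have "1 / (\<bar>K\<bar> + 1) <= d_h i" by (simp add: field_simps)
    then show "AE x in lborel. 1 / (\<bar>K\<bar> + 1) <= water_height (d_eps i) (d_zeta i) x"
      using i by (auto simp: data_def elim!: eventually_mono)
  qed (use mm in \<open>auto simp: data_def shallow_water_def\<close>)
  from r1 obtain r where r: "uc (data \<mu>_max \<sigma> K :: 'a datum set) m (%i. d_eps i * d_mu i) r"
    "\<forall>i \<in> data \<mu>_max \<sigma> K. AE x in lborel. model_N1 (d_eps i) (d_mu i) (d_zeta i) (d_psi i) x - d_D i x = r i x"
    by blast
  obtain B1 where B1: "0 <= B1" "!!i. i \<in> data \<mu>_max \<sigma> K ==> cls L2 lborel UNIV m (B1 * (d_eps i * d_mu i)) (r i)"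
    using r(1) by (rule ucls_E) blast
  from r2 obtain B2 where B2: "0 <= B2" "!!i :: 'a datum. i \<in> data \<mu>_max \<sigma> K ==>
      cls L2 lborel UNIV m (B2 * (d_eps i * d_mu i)) (residual2 (d_eps i) (d_mu i) (d_zeta i) (d_psi i) (d_D i))"
    by (rule ucls_E) blast
  let ?C = "real (DIM('a) + 1) ^ Suc m * sqrt ((2 * pi) ^ DIM('a))"
  show "\<exists>B. \<forall>i \<in> data \<mu>_max \<sigma> K. \<exists>R1 R2 :: 'a => real.
    R1 \<in> sobolev s & sobolev_norm s R1 <= B & R2 \<in> sobolev s & sobolev_norm s R2 <= B &
    (AE X in lborel. model_N1 (d_eps i) (d_mu i) (d_zeta i) (d_psi i) X - d_D i X = d_eps i * d_mu i * R1 X) &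
    (AE X in lborel. residual2 (d_eps i) (d_mu i) (d_zeta i) (d_psi i) (d_D i) X = d_eps i * d_mu i * R2 X)"
  proof (intro exI[of _ "?C * max B1 B2"] ballI)
    fix i :: "'a datum" assume i: "i \<in> data \<mu>_max \<sigma> K"
    then have em: "0 <= d_eps i * d_mu i" by (auto simp: data_def shallow_water_def)
    obtain R1 where R1: "cls L2 lborel UNIV m B1 R1" "AE X in lborel. r i X = d_eps i * d_mu i * R1 X"
      by (rule cls_quotient[OF B1(2)[OF i] em B1(1)])
    obtain R2 where R2: "cls L2 lborel UNIV m B2 R2"
      "AE X in lborel. residual2 (d_eps i) (d_mu i) (d_zeta i) (d_psi i) (d_D i) X = d_eps i * d_mu i * R2 X"
      by (rule cls_quotient[OF B2(2)[OF i] em B2(1)])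
    have S: "R1 \<in> sobolev s" "sobolev_norm s R1 <= ?C * max B1 B2" "R2 \<in> sobolev s" "sobolev_norm s R2 <= ?C * max B1 B2"
      using sobolev_of_cls[OF cls_mono[OF R1(1), of "max B1 B2"] s m(1)] sobolev_of_cls[OF cls_mono[OF R2(1), of "max B1 B2"] s m(1)] by auto
    have "AE X in lborel. model_N1 (d_eps i) (d_mu i) (d_zeta i) (d_psi i) X - d_D i X = d_eps i * d_mu i * R1 X"
      using r(2)[rule_format, OF i] R1(2) by eventually_elim simp
    with S R2(2) show "\<exists>R1 R2. R1 \<in> sobolev s & sobolev_norm s R1 <= ?C * max B1 B2 & R2 \<in> sobolev s & sobolev_norm s R2 <= ?C * max B1 B2 &
      (AE X in lborel. model_N1 (d_eps i) (d_mu i) (d_zeta i) (d_psi i) X - d_D i X = d_eps i * d_mu i * R1 X) &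
      (AE X in lborel. residual2 (d_eps i) (d_mu i) (d_zeta i) (d_psi i) (d_D i) X = d_eps i * d_mu i * R2 X)"
      by blast
  qed
qed

lemma consistency:
  fixes A :: "(real \<times> real) set"
  assumes mm: "0 < \<mu>_max" and t0: "t0 <= 2" and A: "A \<subseteq> shallow_water \<mu>_max"
  shows "ww_consistent t0 \<mu>_max A 1 1
    (model_N1 :: real => real => ('a::euclidean_space => real) => ('a => real) => 'a => real) model_N2"
  unfolding ww_consistent_def
\<comment> \<open>The estimate is made at each time separately, so the value T = 1 is an arbitrary
  choice.\<close>
proof (intro exI[of _ "2 * DIM('a) + 4"] exI[of _ "1 :: real"] conjI allI impI)
  fix s :: real assume s: "0 <= s"
  let ?\<sigma> = "s + real (2 * DIM('a) + 4)"
  \<comment> \<open>With these choices M dominates 1 / h and the norm of \<zeta>, so that the sum of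
    absolute values of M and V is an admissible K.\<close>
  let ?C0 = "%x y z. 1 + \<bar>x\<bar>" and ?C1 = "%x y. 1 + \<bar>x\<bar> + \<bar>y\<bar>"
  from choice[OF uniform_remainder[where 'a = 'a, OF mm s order_refl]]
  obtain B where B: "!!K i. i \<in> data \<mu>_max ?\<sigma> K ==> \<exists>R1 R2 :: 'a => real.
    R1 \<in> sobolev s & sobolev_norm s R1 <= B K & R2 \<in> sobolev s & sobolev_norm s R2 <= B K &
    (AE X in lborel. model_N1 (d_eps i) (d_mu i) (d_zeta i) (d_psi i) X - d_D i X = d_eps i * d_mu i * R1 X) &
    (AE X in lborel. residual2 (d_eps i) (d_mu i) (d_zeta i) (d_psi i) (d_D i) X = d_eps i * d_mu i * R2 X)"
    by blast
  \<comment> \<open>The bound of \<open>uniform_remainder\<close> as a function of the arguments of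
    N, made positive.\<close>
  let ?C2 = "%x y. 1 + \<bar>B (\<bar>x\<bar> + \<bar>y\<bar>)\<bar>"
  have main: "\<exists>R1 R2. \<forall>t\<in>time_interval 1 \<epsilon>.
      (AE X in lborel. \<zeta>' t X + model_N1 \<epsilon> \<mu> (\<zeta> t) (\<psi> t) X = \<mu> ^ 1 * \<epsilon> ^ 1 * R1 t X) &
      (AE X in lborel. \<psi>' t X + model_N2 \<epsilon> \<mu> (\<zeta> t) (\<psi> t) X = \<mu> ^ 1 * \<epsilon> ^ 1 * R2 t X) &
      R1 t \<in> sobolev s & R2 t \<in> sobolev s &
      sobolev_norm s (R1 t) <= N_const ?C0 ?C1 ?C2 t0 h \<mu>_max ?\<sigma> (\<zeta> t) (\<psi> t) &
      sobolev_norm s (R2 t) <= N_const ?C0 ?C1 ?C2 t0 h \<mu>_max ?\<sigma> (\<zeta> t) (\<psi> t)"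
    if em: "(\<epsilon>, \<mu>) \<in> A" and \<zeta>: "cont_sobolev ?\<sigma> (time_interval 1 \<epsilon>) \<zeta>" and \<psi>: "cont_sobolev_dot (?\<sigma> + 1) (time_interval 1 \<epsilon>) \<psi>"
      and h: "non_cavitation h (time_interval 1 \<epsilon>) \<epsilon> \<zeta>" and ww: "water_waves \<epsilon> \<mu> (time_interval 1 \<epsilon>) \<zeta> \<psi> \<zeta>' \<psi>'"
    for \<epsilon> \<mu> h and \<zeta> \<psi> \<zeta>' \<psi>' :: "real => 'a => real"
  proof -
    define P where "P t R1 R2 \<longleftrightarrow>
      (AE X in lborel. \<zeta>' t X + model_N1 \<epsilon> \<mu> (\<zeta> t) (\<psi> t) X = \<mu> ^ 1 * \<epsilon> ^ 1 * R1 X) &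
      (AE X in lborel. \<psi>' t X + model_N2 \<epsilon> \<mu> (\<zeta> t) (\<psi> t) X = \<mu> ^ 1 * \<epsilon> ^ 1 * R2 X) &
      R1 \<in> sobolev s & R2 \<in> sobolev s &
      sobolev_norm s R1 <= N_const ?C0 ?C1 ?C2 t0 h \<mu>_max ?\<sigma> (\<zeta> t) (\<psi> t) &
      sobolev_norm s R2 <= N_const ?C0 ?C1 ?C2 t0 h \<mu>_max ?\<sigma> (\<zeta> t) (\<psi> t)" for t R1 R2
    have "\<exists>R1 R2. P t R1 R2" if t: "t \<in> time_interval 1 \<epsilon>" for t
    proof -
      obtain G where G: "is_DN \<epsilon> \<mu> (\<zeta> t) (\<psi> t) G" "AE X in lborel. \<zeta>' t X - 1 / \<mu> * G X = 0"
        "AE X in lborel. \<psi>' t X + \<zeta> t X + \<epsilon> / 2 * (norm (weak_grad (\<psi> t) X))\<^sup>2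
          - \<epsilon> / \<mu> * ((G X + \<epsilon> * \<mu> * (weak_grad (\<zeta> t) X \<bullet> weak_grad (\<psi> t) X))\<^sup>2
              / (2 * (1 + \<epsilon>\<^sup>2 * \<mu> * (norm (weak_grad (\<zeta> t) X))\<^sup>2))) = 0"
        using ww t unfolding water_waves_def by blast
      obtain \<phi> \<Phi> D where D: "potential_solution \<epsilon> \<mu> (\<zeta> t) (\<psi> t) \<phi> \<Phi>"
        "has_weak_div (%X. water_height \<epsilon> (\<zeta> t) X *\<^sub>R V_bar \<epsilon> (\<zeta> t) \<Phi> X) D" "G = (%X. - \<mu> * D X)"
        using G(1) unfolding is_DN_def by blast
      let ?i = "Datum \<epsilon> \<mu> h (\<zeta> t) (\<psi> t) \<phi> \<Phi> D"
      define M where "M = M_const ?C0 ?C1 t0 h \<mu>_max ?\<sigma> (\<zeta> t)"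
      define V where "V = sobolev_vec_norm ?\<sigma> (weak_grad (\<psi> t))"
      have mu: "0 < \<mu>" and sw: "(\<epsilon>, \<mu>) \<in> shallow_water \<mu>_max" using em A by (auto simp: shallow_water_def)
      \<comment> \<open>The order of the data is at least 6 while t0 + 1 is at most 3, so M contains
        the full norm of \<zeta>.\<close>
      have "max (t0 + 1) ?\<sigma> = ?\<sigma>" using t0 s by simp
      then have M: "M = 1 + \<bar>1 + \<bar>1 / h\<bar>\<bar> + \<bar>sobolev_norm ?\<sigma> (\<zeta> t)\<bar>" by (simp add: M_def M_const_def M0_const_def)
      have "0 < h" "AE X in lborel. h <= water_height \<epsilon> (\<zeta> t) X" using h t by (auto simp: non_cavitation_def)
      moreover have "\<zeta> t \<in> sobolev ?\<sigma>" "\<psi> t \<in> sobolev_dot (?\<sigma> + 1)"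
        using \<zeta> \<psi> t by (auto simp: cont_sobolev_def cont_sobolev_dot_def)
      moreover have "1 / h <= \<bar>M\<bar> + \<bar>V\<bar>" "sobolev_norm ?\<sigma> (\<zeta> t) <= \<bar>M\<bar> + \<bar>V\<bar>" "V <= \<bar>M\<bar> + \<bar>V\<bar>"
        unfolding M by linarith+
      ultimately have "?i \<in> data \<mu>_max ?\<sigma> (\<bar>M\<bar> + \<bar>V\<bar>)" using sw D(1,2) by (auto simp: data_def V_def)
      from B[OF this] obtain R1 R2 :: "'a => real" where R:
        "R1 \<in> sobolev s" "sobolev_norm s R1 <= B (\<bar>M\<bar> + \<bar>V\<bar>)" "R2 \<in> sobolev s" "sobolev_norm s R2 <= B (\<bar>M\<bar> + \<bar>V\<bar>)"
        "AE X in lborel. model_N1 \<epsilon> \<mu> (\<zeta> t) (\<psi> t) X - D X = \<epsilon> * \<mu> * R1 X"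
        "AE X in lborel. residual2 \<epsilon> \<mu> (\<zeta> t) (\<psi> t) D X = \<epsilon> * \<mu> * R2 X" by auto
      have N: "B (\<bar>M\<bar> + \<bar>V\<bar>) <= N_const ?C0 ?C1 ?C2 t0 h \<mu>_max ?\<sigma> (\<zeta> t) (\<psi> t)"
        unfolding N_const_def M_def[symmetric] V_def[symmetric] by linarith
      have E1: "AE X in lborel. \<zeta>' t X + model_N1 \<epsilon> \<mu> (\<zeta> t) (\<psi> t) X = \<mu> ^ 1 * \<epsilon> ^ 1 * R1 X"
        using G(2) R(5)
      proof eventually_elim
        case (elim X)
        have "\<zeta>' t X = - D X" using elim(1) mu by (simp add: D(3))
        with elim(2) show ?case by (simp add: mult_ac)
      qed
      have E2: "AE X in lborel. \<psi>' t X + model_N2 \<epsilon> \<mu> (\<zeta> t) (\<psi> t) X = \<mu> ^ 1 * \<epsilon> ^ 1 * R2 X"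
        using G(3) R(6)
      proof eventually_elim
        case (elim X)
        let ?d = "weak_grad (\<zeta> t) X \<bullet> weak_grad (\<psi> t) X" and ?n = "2 * (1 + \<epsilon>\<^sup>2 * \<mu> * (norm (weak_grad (\<zeta> t) X))\<^sup>2)"
        have "\<epsilon> / \<mu> * ((- \<mu> * D X + \<epsilon> * \<mu> * ?d)\<^sup>2 / ?n) = \<epsilon> / \<mu> * (\<mu>\<^sup>2 * (\<epsilon> * ?d - D X)\<^sup>2 / ?n)"
          by (simp add: power2_eq_square algebra_simps)
        also have "\<dots> = \<epsilon> * \<mu> * ((\<epsilon> * ?d - D X)\<^sup>2 / ?n)" using mu by (simp add: power2_eq_square)
        finally show ?case using elim unfolding D(3) residual2_def model_N2_def by (simp add: algebra_simps)
      qed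
      show ?thesis
        using E1 E2 R(1,3) order_trans[OF R(2) N] order_trans[OF R(4) N] unfolding P_def by blast
    qed
    then have "\<exists>R1 R2. \<forall>t\<in>time_interval 1 \<epsilon>. P t (R1 t) (R2 t)" by metis
    then show ?thesis unfolding P_def .
  qed
  show "\<exists>C0 C1 C2. (\<forall>x y z. C0 x y z > 0) & (\<forall>x y. C1 x y > 0) & (\<forall>x y. C2 x y > 0) &
        (\<forall>(\<epsilon>, \<mu>)\<in>A. \<forall>h_min \<zeta> \<psi> \<zeta>' \<psi>'.
           cont_sobolev ?\<sigma> (time_interval 1 \<epsilon>) \<zeta> & cont_sobolev_dot (?\<sigma> + 1) (time_interval 1 \<epsilon>) \<psi> &
           non_cavitation h_min (time_interval 1 \<epsilon>) \<epsilon> \<zeta> & water_waves \<epsilon> \<mu> (time_interval 1 \<epsilon>) \<zeta> \<psi> \<zeta>' \<psi>' -->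
           (\<exists>R1 R2. \<forall>t\<in>time_interval 1 \<epsilon>.
              (AE X in lborel. \<zeta>' t X + (model_N1 \<epsilon> \<mu> (\<zeta> t) (\<psi> t) X :: real) = \<mu> ^ 1 * \<epsilon> ^ 1 * R1 t X) &
              (AE X in lborel. \<psi>' t X + model_N2 \<epsilon> \<mu> (\<zeta> t) (\<psi> t) X = \<mu> ^ 1 * \<epsilon> ^ 1 * R2 t (X :: 'a)) &
              R1 t \<in> sobolev s & R2 t \<in> sobolev s &
              sobolev_norm s (R1 t) <= N_const C0 C1 C2 t0 h_min \<mu>_max ?\<sigma> (\<zeta> t) (\<psi> t) &
              sobolev_norm s (R2 t) <= N_const C0 C1 C2 t0 h_min \<mu>_max ?\<sigma> (\<zeta> t) (\<psi> t)))"
    by (intro exI[of _ ?C0] exI[of _ ?C1] exI[of _ ?C2] conjI) (use main in \<open>auto simp: add_pos_nonneg split_beta\<close>)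
qed simp

theorem proposition1p15:
  fixes \<mu>_max t0 :: real and A :: "(real \<times> real) set"
  assumes "CARD('d::finite) = 1 \<or> CARD('d) = 2"
    and "\<mu>_max > 0"
    and "real CARD('d) / 2 < t0" and "t0 \<le> 2"
    and "A \<subseteq> shallow_water \<mu>_max"
  shows "ww_consistent t0 \<mu>_max A 1 1
           (model_N1 :: real \<Rightarrow> real \<Rightarrow> (real ^ 'd \<Rightarrow> real) \<Rightarrow> (real ^ 'd \<Rightarrow> real) \<Rightarrow> real ^ 'd \<Rightarrow> real)
           model_N2"
  using assms(2,4,5) by (rule consistency)

end
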